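(* Corresponding to any impulse control $(\mu,\nu,\{\omega^r\}_{r\in[0,h]})$ there exists an impulse solution $(x,v)$ associated with it, and it is unique.
   Context: **Standing assumptions.** $N,M\in\mathbb N$, $N\ge1$, $N\ge M$, $h>0$, $T:=Nh$. $\mathcal K\subseteq\mathbb R^m$ is a closed cone, $\check x_0\in\mathbb R^n$; $f,g_1,\dots,g_m:\mathbb R\times(\mathbb R^n)^{M+1}\to\mathbb R^n$ are bounded and of class $C^1$; $\xi_0\in C([-Mh,0],\mathbb R^n)$. **Notation.** $]a,b[$, $[a,b[$, $]a,b]$ denote open/half-open intervals. $\{z(t-kh)\}_k:=(z(t),z(t-h),\dots,z(t-Mh))$ and $\{z_{l-k}\}_k:=(z_l,z_{l-1},\dots,z_{l-M})$. For $w\in\mathbb R^m$, $\|w\|:=\sum_{j=1}^m|w^j|$. $z^-(t),z^+(t)$ are the left and right limits of $z$ at $t$. $C^*([0,T],\mathbb R^m)$ is the set of finite regular $\mathbb R^m$-valued Borel measures on $[0,T]$; $C^\oplus([0,T])$ the set of finite regular nonnegative Borel measures; $C^*_{\mathcal K}([0,T])$ the set of $\mu\in C^*([0,T],\mathbb R^m)$ with range contained in $\mathcal K$. $|\mu|:=\sum_{j=1}^m(\mu^j_++\mu^j_-)$ (Jordan decompositions of components); $\mu^c$ is the continuous (atomless) component of $\mu$. $\mu_i\rightharpoonup^*\mu$ means $\int_{[0,T]}\psi\,d\mu_i^j\to\int_{[0,T]}\psi\,d\mu^j$ for all $\psi\in C([0,T],\mathbb R)$ and each component $j$. For $\mu\in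 C^*_{\mathcal K}([0,T])$, $$\mathcal V_c(\mu):=\{\nu\in C^\oplus([0,T]):\ \nu^c=|\mu^c|,\ \exists(\mu_i)\subset C^*_{\mathcal K}([0,T])\text{ with }(\mu_i,|\mu_i|)\rightharpoonup^*(\mu,\nu)\}.$$ **Impulse control.** An impulse control $(\mu,\nu,\{\omega^r\}_{r\in[0,h]})$ consists of $\mu\in C^*_{\mathcal K}([0,T])$, $\nu\in\mathcal V_c(\mu)$ and essentially bounded measurable functions $\omega^r=(\omega^r_1,\dots,\omega^r_N):[0,1]\to\mathcal K^N$, $r\in[0,h]$, such that (with the convention $\omega^h_0\equiv0$, $\omega^0_{N+1}\equiv0$): (1) for each $r\in[0,h]$, $\sum_{l=1}^N\|\omega^r_l(s)\|=\sum_{l=1}^N\int_0^1\|\omega^r_l(s')\|ds'$ for a.e. $s\in[0,1]$; (2) $\int_0^1\|\omega^r_l(s)\|ds=\nu(\{r+(l-1)h\})$ and $\int_0^1\omega^r_l(s)ds=\mu(\{r+(l-1)h\})$ for $r\in]0,h[$, $l=1,\dots,N$; (3) $\int_0^1[\|\omega^h_l(s)\|+\|\omega^0_{l+1}(s)\|]ds=\nu(\{lh\})$ and $\int_0^1[\omega^h_l(s)+\omega^0_{l+1}(s)]ds=\mu(\{lh\})$ for $l=0,\dots,N$. **Impulse solution.** $(x,v)\in BV([-Mh,T],\mathbb R^n)\times BV([0,T],\mathbb R)$ is an impulse solution associated with the impulse control if $x=\xi_0$ on $[-Mh,0[$, $(x,v)(0)=(\check x_0,0)$, $(x,v)((l-1)h)=(\zeta^0_l,\theta^0_l)(1)$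 for $l=2,\dots,N+1$ (for $l=N+1$ using $\omega_{N+1}^0\equiv0$, i.e. $(x,v)(T)=(\zeta_N^h,\theta_N^h)(1)$), and for $l=1,\dots,N$, $t\in](l-1)h,lh[$: $$x(t)=\zeta_l^0(1)+\int_{(l-1)h}^tf(t',\{x(t'-kh)\}_k)dt'+\sum_{j=1}^m\int_{[(l-1)h,t]}g_j(t',\{x(t'-kh)\}_k)\,d(\mu^c)^j(t')+\sum_{r\in]0,t-(l-1)h]}\big(\zeta_l^r(1)-x^-(r+(l-1)h)\big),$$ $$v(t)=\theta_l^0(1)+\int_{[(l-1)h,t]}d\nu^c(t')+\sum_{r\in]0,t-(l-1)h]}\big(\theta_l^r(1)-v^-(r+(l-1)h)\big).$$ Here for $r\in[0,h]$, $\zeta_l^r:[0,1]\to\mathbb R^n$ solves $\frac{d\zeta_l^r}{ds}(s)=\sum_{j=1}^mg_j(r+(l-1)h,\{\zeta^r_{l-k}(s)\}_k)(\omega_l^r)^j(s)$ a.e., with $\zeta_l^r(0)=x^-(r+(l-1)h)$ if $r\in]0,h]$, $\zeta_l^0(0)=\zeta_{l-1}^h(1)$; and $\theta_l^r(s)=\theta_l^r(0)+\int_0^s\|\omega_l^r(s')\|ds'$, with $\theta_l^r(0)=v^-(r+(l-1)h)$ if $r\in]0,h]$, $\theta_l^0(0)=\theta_{l-1}^h(1)$. By convention $\theta^r_0\equiv0$; $\zeta_0^r(s)=\xi_0(r-h)$ if $s\in[0,1[$ or $r\in[0,h[$, and $\zeta_0^h(1)=\check x_0$; $\zeta^r_{-a}\equiv\xi_0(r-(a+1)h)$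 for $a=1,\dots,M-1$.
   Formalization: The requirement x in BV([-Mh,T]) is imposed only when ξ_0 has bounded variation; for a merely continuous ξ_0 of unbounded variation, where no such x exists, x is required to be BV on [0,T] only. *)

theory Defs
  imports "HOL-Analysis.Analysis"
begin

definition norm1 :: "real ^ 'm \<Rightarrow> real" where
  "norm1 w = (\<Sum>j\<in>UNIV. \<bar>w $ j\<bar>)"

definition C1_map :: "('a::real_normed_vector \<Rightarrow> 'b::real_normed_vector) \<Rightarrow> bool" where
  "C1_map f \<longleftrightarrow> (\<exists>f'. (\<forall>z. (f has_derivative blinfun_apply (f' z)) (at z)) \<and> continuous_on UNIV f')"

definition bounded_variation_on :: "real set \<Rightarrow> (real \<Rightarrow> 'a::real_normed_vector) \<Rightarrow> bool" where
  "bounded_variation_on S z \<longleftrightarrow>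
     (\<exists>C. \<forall>p n. (\<forall>i\<le>n. p i \<in> S) \<and> (\<forall>i<n. p i \<le> p (Suc i)) \<longrightarrow>
        (\<Sum>i<(n::nat). norm (z (p (Suc i)) - z (p i))) \<le> C)"

definition abs_continuous_on :: "real set \<Rightarrow> (real \<Rightarrow> 'a::real_normed_vector) \<Rightarrow> bool" where
  "abs_continuous_on S z \<longleftrightarrow>
     (\<forall>\<epsilon>>0. \<exists>\<delta>>0. \<forall>a b n.
        (\<forall>i<n. a i \<le> b i \<and> {a i..b i} \<subseteq> S) \<and>
        (\<forall>i<n. \<forall>k<n. i \<noteq> k \<longrightarrow> {a i<..<b i} \<inter> {a k<..<b k} = {}) \<and>
        (\<Sum>i<(n::nat). b i - a i) < \<delta>
        \<longrightarrow> (\<Sum>i<n. norm (z (b i) - z (a i))) < \<epsilon>)"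

definition left_lim :: "(real \<Rightarrow> 'a::t2_space) \<Rightarrow> real \<Rightarrow> 'a" where
  "left_lim z t = Lim (at_left t) z"

abbreviation borel_on :: "real \<Rightarrow> real measure" where
  "borel_on T \<equiv> restrict_space borel {0..T}"

text \<open>Nonnegative measures use the library type; signed and vector-valued ones are countably
  additive set functions, whose values off the Borel subsets of \<open>[0,T]\<close> are irrelevant.
  Finiteness of the latter is built into the codomain, and every finite Borel measure on the
  compact interval \<open>[0,T]\<close> is regular, so regularity need not be imposed separately.\<close>

definition pos_measures :: "real \<Rightarrow> real measure set" where
  "pos_measures T = {\<nu>. sets \<nu> = sets (borel_on T) \<and> finite_measure \<nu>}"

definition vec_measures :: "real \<Rightarrow> (real set \<Rightarrow> real ^ 'm) set" where
  "vec_measures T = {\<mu>. \<forall>A. range A \<subseteq> sets (borel_on T) \<and> disjoint_family A \<longrightarrow>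
      (\<lambda>i::nat. \<mu> (A i)) sums \<mu> (\<Union>i. A i)}"

definition cone_measures :: "real \<Rightarrow> (real ^ 'm) set \<Rightarrow> (real set \<Rightarrow> real ^ 'm) set" where
  "cone_measures T K = {\<mu> \<in> vec_measures T. \<forall>B \<in> sets (borel_on T). \<mu> B \<in> K}"

definition is_jordan_decomp ::
    "real \<Rightarrow> (real set \<Rightarrow> real) \<Rightarrow> real measure \<Rightarrow> real measure \<Rightarrow> bool" where
  "is_jordan_decomp T \<sigma> p q \<longleftrightarrow>
     p \<in> pos_measures T \<and> q \<in> pos_measures T \<and>
     (\<forall>B \<in> sets (borel_on T). \<sigma> B = measure p B - measure q B) \<and>
     (\<exists>P \<in> sets (borel_on T). emeasure q P = 0 \<and> emeasure p ({0..T} - P) = 0)"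

definition jordan_pos :: "real \<Rightarrow> (real set \<Rightarrow> real) \<Rightarrow> real measure" where
  "jordan_pos T \<sigma> = (THE p. \<exists>q. is_jordan_decomp T \<sigma> p q)"

definition jordan_neg :: "real \<Rightarrow> (real set \<Rightarrow> real) \<Rightarrow> real measure" where
  "jordan_neg T \<sigma> = (THE q. \<exists>p. is_jordan_decomp T \<sigma> p q)"

definition component :: "(real set \<Rightarrow> real ^ 'm) \<Rightarrow> 'm \<Rightarrow> real set \<Rightarrow> real" where
  "component \<mu> j = (\<lambda>B. \<mu> B $ j)"

definition variation_measure :: "real \<Rightarrow> (real set \<Rightarrow> real ^ 'm) \<Rightarrow> real measure" where
  "variation_measure T \<mu> = measure_of {0..T} (sets (borel_on T))
     (\<lambda>B. \<Sum>j\<in>UNIV. emeasure (jordan_pos T (component \<mu> j)) B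
                   + emeasure (jordan_neg T (component \<mu> j)) B)"

definition signed_integral ::
    "real \<Rightarrow> (real set \<Rightarrow> real) \<Rightarrow> real set \<Rightarrow> (real \<Rightarrow> 'a::{banach, second_countable_topology}) \<Rightarrow> 'a" where
  "signed_integral T \<sigma> S \<psi> =
     (LINT t:S|jordan_pos T \<sigma>. \<psi> t) - (LINT t:S|jordan_neg T \<sigma>. \<psi> t)"

text \<open>The atomless component is the restriction to the complement of the (countable) set of atoms.\<close>

definition vec_cont_part :: "(real set \<Rightarrow> real ^ 'm) \<Rightarrow> real set \<Rightarrow> real ^ 'm" where
  "vec_cont_part \<mu> = (\<lambda>B. \<mu> (B - {t. \<mu> {t} \<noteq> 0}))"

definition pos_cont_part :: "real measure \<Rightarrow> real measure" where
  "pos_cont_part \<nu> = density \<nu> (indicator {t. emeasure \<nu> {t} = 0})"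

definition weak_star_vec ::
    "real \<Rightarrow> (nat \<Rightarrow> real set \<Rightarrow> real ^ 'm) \<Rightarrow> (real set \<Rightarrow> real ^ 'm) \<Rightarrow> bool" where
  "weak_star_vec T \<mu>s \<mu> \<longleftrightarrow>
     (\<forall>\<psi>::real \<Rightarrow> real. continuous_on {0..T} \<psi> \<longrightarrow>
        (\<forall>j. (\<lambda>i. signed_integral T (component (\<mu>s i) j) {0..T} \<psi>)
               \<longlonglongrightarrow> signed_integral T (component \<mu> j) {0..T} \<psi>))"

definition weak_star_pos :: "real \<Rightarrow> (nat \<Rightarrow> real measure) \<Rightarrow> real measure \<Rightarrow> bool" where
  "weak_star_pos T \<nu>s \<nu> \<longleftrightarrow>
     (\<forall>\<psi>::real \<Rightarrow> real. continuous_on {0..T} \<psi> \<longrightarrow>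
        (\<lambda>i. LINT t:{0..T}|\<nu>s i. \<psi> t) \<longlonglongrightarrow> (LINT t:{0..T}|\<nu>. \<psi> t))"

definition Vc :: "real \<Rightarrow> (real ^ 'm) set \<Rightarrow> (real set \<Rightarrow> real ^ 'm) \<Rightarrow> real measure set" where
  "Vc T K \<mu> = {\<nu> \<in> pos_measures T.
      pos_cont_part \<nu> = variation_measure T (vec_cont_part \<mu>) \<and>
      (\<exists>\<mu>s. (\<forall>i. \<mu>s i \<in> cone_measures T K) \<and>
             weak_star_vec T \<mu>s \<mu> \<and>
             weak_star_pos T (\<lambda>i. variation_measure T (\<mu>s i)) \<nu>)}"

text \<open>\<open>\<omega> r l s\<close> stands for \<open>\<omega>\<^sup>r\<^sub>l(s)\<close>. Block indices \<open>l\<close> are integers because the delayed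
  arcs \<open>\<zeta>\<^sup>r\<^bsub>l-k\<^esub>\<close> below reach nonpositive indices.\<close>

definition impulse_control ::
    "nat \<Rightarrow> real \<Rightarrow> (real ^ 'm) set \<Rightarrow> (real set \<Rightarrow> real ^ 'm) \<Rightarrow> real measure \<Rightarrow>
     (real \<Rightarrow> int \<Rightarrow> real \<Rightarrow> real ^ 'm) \<Rightarrow> bool" where
  "impulse_control N h K \<mu> \<nu> \<omega> \<longleftrightarrow>
     \<mu> \<in> cone_measures (real N * h) K \<and>
     \<nu> \<in> Vc (real N * h) K \<mu> \<and>
     (\<forall>r\<in>{0..h}. \<forall>l\<in>{1..int N}.
        \<omega> r l \<in> borel_measurable (lebesgue_on {0..1}) \<and>
        (\<exists>C. AE s in lebesgue_on {0..1}. norm (\<omega> r l s) \<le> C) \<and>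
        (\<forall>s\<in>{0..1}. \<omega> r l s \<in> K)) \<and>
     (\<forall>s\<in>{0..1}. \<omega> h 0 s = 0 \<and> \<omega> 0 (int N + 1) s = 0) \<and>
     (\<forall>r\<in>{0..h}. AE s in lebesgue_on {0..1}.
        (\<Sum>l\<in>{1..int N}. norm1 (\<omega> r l s))
          = (\<Sum>l\<in>{1..int N}. LINT s'|lebesgue_on {0..1}. norm1 (\<omega> r l s'))) \<and>
     (\<forall>r\<in>{0<..<h}. \<forall>l\<in>{1..int N}.
        (LINT s|lebesgue_on {0..1}. norm1 (\<omega> r l s)) = measure \<nu> {r + of_int (l - 1) * h} \<and>
        (LINT s|lebesgue_on {0..1}. \<omega> r l s) = \<mu> {r + of_int (l - 1) * h}) \<and>
     (\<forall>l\<in>{0..int N}.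
        (LINT s|lebesgue_on {0..1}. norm1 (\<omega> h l s) + norm1 (\<omega> 0 (l + 1) s))
          = measure \<nu> {of_int l * h} \<and>
        (LINT s|lebesgue_on {0..1}. \<omega> h l s + \<omega> 0 (l + 1) s) = \<mu> {of_int l * h})"

text \<open>The space of \<open>(M+1)\<close>-tuples in \<open>\<real>\<^sup>n\<close> is \<^typ>\<open>(real ^ 'n) ^ 'k\<close>, where a bijection \<open>\<kappa>\<close> from
  \<^typ>\<open>'k\<close> to \<open>{0..M}\<close> names the slots: slot \<open>i\<close> carries the delay \<open>\<kappa> i * h\<close>.\<close>

definition delay_tuple :: "('k::finite \<Rightarrow> nat) \<Rightarrow> real \<Rightarrow> (real \<Rightarrow> real ^ 'n) \<Rightarrow> real \<Rightarrow> (real ^ 'n) ^ 'k" where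
  "delay_tuple \<kappa> h z t = (\<chi> i. z (t - real (\<kappa> i) * h))"

definition block_tuple :: "('k::finite \<Rightarrow> nat) \<Rightarrow> (int \<Rightarrow> real ^ 'n) \<Rightarrow> int \<Rightarrow> (real ^ 'n) ^ 'k" where
  "block_tuple \<kappa> z l = (\<chi> i. z (l - int (\<kappa> i)))"

text \<open>The fast-time arcs \<open>\<zeta> r l\<close>, \<open>\<theta> r l\<close> attached to \<open>(x,v)\<close>. The differential equation is meant in
  the Caratheodory sense: absolutely continuous functions satisfying it almost everywhere.\<close>

definition attached_arcs ::
    "nat \<Rightarrow> nat \<Rightarrow> real \<Rightarrow> ('k::finite \<Rightarrow> nat) \<Rightarrow>
     ('m::finite \<Rightarrow> real \<times> ((real ^ 'n) ^ 'k) \<Rightarrow> real ^ 'n) \<Rightarrow>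
     (real \<Rightarrow> real ^ 'n) \<Rightarrow> real ^ 'n \<Rightarrow>
     (real \<Rightarrow> int \<Rightarrow> real \<Rightarrow> real ^ 'm) \<Rightarrow>
     (real \<Rightarrow> real ^ 'n) \<Rightarrow> (real \<Rightarrow> real) \<Rightarrow>
     (real \<Rightarrow> int \<Rightarrow> real \<Rightarrow> real ^ 'n) \<Rightarrow> (real \<Rightarrow> int \<Rightarrow> real \<Rightarrow> real) \<Rightarrow> bool" where
  "attached_arcs N M h \<kappa> g \<xi>0 x0 \<omega> x v \<zeta> \<theta> \<longleftrightarrow>
     (\<forall>r\<in>{0..h}. \<forall>s\<in>{0..1}.
        \<theta> r 0 s = 0 \<and>
        \<zeta> r 0 s = (if r = h \<and> s = 1 then x0 else \<xi>0 (r - h)) \<and>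
        (\<forall>a::nat. 1 \<le> a \<and> a < M \<longrightarrow> \<zeta> r (- int a) s = \<xi>0 (r - (real a + 1) * h))) \<and>
     (\<forall>l\<in>{1..int N}. \<forall>r\<in>{0..h}.
        abs_continuous_on {0..1} (\<zeta> r l) \<and>
        (AE s in lebesgue_on {0..1}.
           (\<zeta> r l has_vector_derivative
              (\<Sum>j\<in>UNIV. (\<omega> r l s $ j) *\<^sub>R
                  g j (r + of_int (l - 1) * h, block_tuple \<kappa> (\<lambda>i. \<zeta> r i s) l)))
           (at s within {0..1})) \<and>
        \<zeta> r l 0 = (if r = 0 then \<zeta> h (l - 1) 1 else left_lim x (r + of_int (l - 1) * h)) \<and>
        (\<forall>s\<in>{0..1}. \<theta> r l s = \<theta> r l 0 + (LINT s'|lebesgue_on {0..s}. norm1 (\<omega> r l s'))) \<and>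
        \<theta> r l 0 = (if r = 0 then \<theta> h (l - 1) 1 else left_lim v (r + of_int (l - 1) * h)))"

text \<open>If the history \<open>\<xi>0\<close> is of bounded variation, the first two conditions amount to
  \<open>x \<in> BV([-Mh,T])\<close>. For a merely continuous history of unbounded variation no function extending it
  is in that space, and bounded variation is then asked only on \<open>[0,T]\<close>. In both cases the integrands
  below are bounded and Borel, so all the integrals exist.\<close>

definition impulse_solution ::
    "nat \<Rightarrow> nat \<Rightarrow> real \<Rightarrow> ('k::finite \<Rightarrow> nat) \<Rightarrow>
     (real \<times> ((real ^ 'n) ^ 'k) \<Rightarrow> real ^ 'n) \<Rightarrow>
     ('m::finite \<Rightarrow> real \<times> ((real ^ 'n) ^ 'k) \<Rightarrow> real ^ 'n) \<Rightarrow>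
     (real \<Rightarrow> real ^ 'n) \<Rightarrow> real ^ 'n \<Rightarrow>
     (real set \<Rightarrow> real ^ 'm) \<Rightarrow> real measure \<Rightarrow> (real \<Rightarrow> int \<Rightarrow> real \<Rightarrow> real ^ 'm) \<Rightarrow>
     (real \<Rightarrow> real ^ 'n) \<Rightarrow> (real \<Rightarrow> real) \<Rightarrow> bool" where
  "impulse_solution N M h \<kappa> f g \<xi>0 x0 \<mu> \<nu> \<omega> x v \<longleftrightarrow>
     bounded_variation_on {0..real N * h} x \<and>
     (bounded_variation_on {- (real M * h)..0} \<xi>0 \<longrightarrow>
        bounded_variation_on {- (real M * h)..real N * h} x) \<and>
     bounded_variation_on {0..real N * h} v \<and>
     (\<forall>t\<in>{- (real M * h)..<0}. x t = \<xi>0 t) \<and>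
     x 0 = x0 \<and> v 0 = 0 \<and>
     (\<exists>\<zeta> \<theta>. attached_arcs N M h \<kappa> g \<xi>0 x0 \<omega> x v \<zeta> \<theta> \<and>
        (\<forall>l\<in>{2..int N}. x (of_int (l - 1) * h) = \<zeta> 0 l 1 \<and> v (of_int (l - 1) * h) = \<theta> 0 l 1) \<and>
        x (real N * h) = \<zeta> h (int N) 1 \<and> v (real N * h) = \<theta> h (int N) 1 \<and>
        (\<forall>l\<in>{1..int N}. \<forall>t\<in>{of_int (l - 1) * h<..<of_int l * h}.
           (\<lambda>r. \<zeta> r l 1 - left_lim x (r + of_int (l - 1) * h))
              summable_on {0<..t - of_int (l - 1) * h} \<and>
           x t = \<zeta> 0 l 1
             + (LINT t'|lebesgue_on {of_int (l - 1) * h..t}. f (t', delay_tuple \<kappa> h x t'))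
             + (\<Sum>j\<in>UNIV. signed_integral (real N * h) (component (vec_cont_part \<mu>) j)
                            {of_int (l - 1) * h..t} (\<lambda>t'. g j (t', delay_tuple \<kappa> h x t')))
             + (\<Sum>\<^sub>\<infinity>r\<in>{0<..t - of_int (l - 1) * h}.
                  \<zeta> r l 1 - left_lim x (r + of_int (l - 1) * h)) \<and>
           (\<lambda>r. \<theta> r l 1 - left_lim v (r + of_int (l - 1) * h))
              summable_on {0<..t - of_int (l - 1) * h} \<and>
           v t = \<theta> 0 l 1
             + measure (pos_cont_part \<nu>) {of_int (l - 1) * h..t}
             + (\<Sum>\<^sub>\<infinity>r\<in>{0<..t - of_int (l - 1) * h}.
                  \<theta> r l 1 - left_lim v (r + of_int (l - 1) * h))))"

end

theory Submission
  imports Defs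
begin

text \<open>
  Why the theorem is true. On a single delay block \<open>[(l-1)h, lh]\<close> the values \<open>x(t - kh)\<close> with
  \<open>k \<ge> 1\<close> and the fast arcs with lower block index are already known, so the block carries an
  undelayed equation. A jump at \<open>t\<close> is the displacement of the fast differential equation over
  \<open>[0,1]\<close> started at the left limit \<open>x\<^sup>-(t)\<close>; it is therefore a function of \<open>x\<^sup>-(t)\<close>. This suggests
  to take the left-continuous version \<open>Y = x\<^sup>-\<close> as the unknown. Apart from the countably many atoms,
  which the atomless measures do not see, \<open>x\<close> and \<open>Y\<close> agree, and the block equation becomes
  \<open>Y(t) = c + \<Sum>\<^sub>i \<integral>\<^bsub>[a,t)\<^esub> H\<^sub>i(s, Y(s)) d\<rho>\<^sub>i(s)\<close> for finitely many finite measures \<open>\<rho>\<^sub>i\<close>: Lebesgue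
  measure, the positive and negative parts of the atomless components of \<open>\<mu>\<close>, and one discrete
  measure carrying the jumps.

  The half-open interval makes this a Volterra equation even when the \<open>\<rho>\<^sub>i\<close> have atoms: the part
  of \<open>[a,t)\<close> whose distance to \<open>t\<close>, measured by the total mass, is at most \<open>d\<close> has mass at most \<open>d\<close>
  (\<open>mass_near_end_le\<close>). Hence the sup norm weighted by \<open>exp (k * mass [a,t))\<close> contracts for large
  \<open>k\<close> (\<open>exponential_weight\<close>), which yields existence by Picard iteration (\<open>volterra_exists\<close>) and
  a Gronwall estimate with a constant that depends on the measures and on the Lipschitz constant
  only (\<open>volterra_stable\<close>).

  The same result for Lebesgue measure on \<open>[0,1]\<close> solves the fast equation. Passing between its
  integral form and the Caratheodory form of the definition needs Lebesgue's differentiation theorem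
  for bounded functions (\<open>indefinite_integral_derivative_ae\<close>, from the Vitali covering theorem) and
  the fundamental theorem for absolutely continuous functions
  (\<open>abs_continuous_fundamental_theorem\<close>, from Cousin's partition lemma). The control condition that
  \<open>\<Sum>\<^sub>l \<parallel>\<omega>\<^sup>r\<^sub>l(s)\<parallel>\<close> is constant in \<open>s\<close> bounds the fast controls uniformly in \<open>r\<close>, so all fast flows
  share one stability constant and the jump at \<open>t\<close> is Lipschitz in \<open>x\<^sup>-(t)\<close> with a constant
  proportional to \<open>\<nu>{t}\<close>, which is summable.

  That the integrals against \<open>\<mu>\<^sup>c\<close> are integrals against finite atomless measures rests on the Jordan
  decomposition: \<open>jordan_pos\<close> and \<open>jordan_neg\<close> are definite descriptions, so existence and
  uniqueness of the decomposition have to be established (\<open>is_jordan_decomp_jordan\<close>).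

  Induction over the blocks then glues the solutions (\<open>state_solved_Suc\<close>, \<open>state_solution_unique\<close>).
  The component \<open>v\<close> solves equations of the same kind with constant integrands, and the
  fast arcs \<open>\<theta>\<close> are explicit.\<close>

section \<open>Indefinite integrals and absolutely continuous functions\<close>

lemma set_integrable_bounded_lebesgue:
  fixes \<phi> :: "real \<Rightarrow> 'b::euclidean_space"
  assumes [measurable]: "\<phi> \<in> borel_measurable lebesgue" and "\<And>x. norm (\<phi> x) \<le> B"
    and "S \<in> lmeasurable"
  shows "set_integrable lebesgue S \<phi>"
  unfolding set_integrable_def
  using assms by (intro integrableI_bounded_set_indicator[where B=B]) (auto simp: fmeasurable_def)

text \<open>The core of Lebesgue's differentiation theorem for a bounded density. The intervals with large
  average lie in an open set barely larger than \<open>{\<phi> < \<alpha>}\<close>. By Vitali a disjoint family of them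
  covers the exceptional set; on their union \<open>U\<close> the integral of \<open>\<phi>\<close> exceeds \<open>\<beta> |U|\<close>, yet it is at
  most \<open>\<alpha> |U|\<close> up to a small error. So \<open>|U|\<close> is small. Intervals with \<open>x\<close> in any position are
  admitted, so that both one-sided derivatives are covered at once.\<close>

lemma averages_above_negligible:
  fixes \<phi> :: "real \<Rightarrow> real"
  assumes [measurable]: "\<phi> \<in> borel_measurable lebesgue"
    and bd: "\<And>x. 0 \<le> \<phi> x" "\<And>x. \<phi> x \<le> B" and ab: "0 \<le> \<alpha>" "\<alpha> < \<beta>"
  shows "negligible {x\<in>{p<..<q}. \<phi> x < \<alpha> \<and>
     (\<forall>d>0. \<exists>u w. u \<le> x \<and> x \<le> w \<and> u < w \<and> w - u < d \<and> \<beta> * (w - u) < (LINT t:{u..w}|lebesgue. \<phi> t))}"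
    (is "negligible ?E")
proof (cases "p < q")
  case False
  then show ?thesis by simp
next
  case True
  define A where "A = {x\<in>{p<..<q}. \<phi> x < \<alpha>}"
  have B0: "0 \<le> B" using bd[of 0] by linarith
  have A_meas[measurable]: "A \<in> sets lebesgue"
  proof -
    have "{x\<in>space lebesgue. \<phi> x < \<alpha>} \<in> sets lebesgue" by measurable
    then have "{x. \<phi> x < \<alpha>} \<inter> {p<..<q} \<in> sets lebesgue" by auto
    moreover have "A = {x. \<phi> x < \<alpha>} \<inter> {p<..<q}" by (auto simp: A_def)
    ultimately show ?thesis by simp
  qed
  define \<Phi> where "\<Phi> = density lebesgue (\<lambda>x. ennreal (\<phi> x))"
  have \<Phi>_eq: "emeasure \<Phi> S = ennreal (LINT t:S|lebesgue. \<phi> t)" if "S \<in> lmeasurable" for S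
  proof -
    have [measurable]: "S \<in> sets lebesgue" using that by auto
    have "emeasure \<Phi> S = (\<integral>\<^sup>+x\<in>S. ennreal (\<phi> x) \<partial>lebesgue)"
      unfolding \<Phi>_def by (rule emeasure_density) auto
    also have "\<dots> = (\<integral>\<^sup>+x. ennreal (indicator S x *\<^sub>R \<phi> x) \<partial>lebesgue)"
      by (intro nn_integral_cong) (auto simp: indicator_def)
    also have "\<dots> = ennreal (LINT t:S|lebesgue. \<phi> t)"
      unfolding set_lebesgue_integral_def
      using set_integrable_bounded_lebesgue[of \<phi> B S] bd that
      by (intro nn_integral_eq_integral) (auto simp: set_integrable_def)
    finally show ?thesis .
  qed
  show ?thesis
    unfolding negligible_outer_le
  proof (intro allI impI)
    fix e :: real assume "e > 0"
    \<comment> \<open>\<open>\<eta>\<close> is chosen so that \<open>B \<eta> \<le> (\<beta> - \<alpha>) e\<close>, the error that the final estimate tolerates.\<close>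
    define \<eta> where "\<eta> = e * (\<beta> - \<alpha>) / (B + 1)"
    have "\<eta> > 0" using \<open>e > 0\<close> ab B0 by (simp add: \<eta>_def)
    obtain G0 where G0: "open G0" "A \<subseteq> G0" "(G0 - A) \<in> lmeasurable" "emeasure lebesgue (G0 - A) < ennreal \<eta>"
      using sets_lebesgue_outer_open[OF A_meas \<open>\<eta> > 0\<close>] by blast
    define G where "G = G0 \<inter> {p<..<q}"
    have G: "open G" "A \<subseteq> G" "G \<subseteq> {p<..<q}" using G0 by (auto simp: G_def A_def)
    define K where "K = {(u::real,w). u < w \<and> {u..w} \<subseteq> G \<and> \<beta> * (w - u) < (LINT t:{u..w}|lebesgue. \<phi> t)}"
    have cb: "cball ((fst i + snd i) / 2) ((snd i - fst i) / 2) = {fst i..snd i}" for i :: "real \<times> real"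
      by (auto simp: cball_eq_atLeastAtMost field_simps)
    obtain C where C: "countable C" "C \<subseteq> K"
      "pairwise (\<lambda>i j. disjnt {fst i..snd i} {fst j..snd j}) C"
      "negligible (?E - (\<Union>i\<in>C. {fst i..snd i}))"
    proof (rule Vitali_covering_theorem_cballs[of K "\<lambda>i. (snd i - fst i)/2" ?E "\<lambda>i. (fst i + snd i)/2"])
      show "0 < (snd i - fst i) / 2" if "i \<in> K" for i using that by (auto simp: K_def)
    next
      fix x d :: real assume x: "x \<in> ?E" and d: "0 < d"
      then have "x \<in> G" using G by (auto simp: A_def)
      then obtain r where r: "r > 0" "ball x r \<subseteq> G" using G by (meson open_contains_ball)
      obtain u w where uw: "u \<le> x" "x \<le> w" "u < w" "w - u < min r d" "\<beta> * (w - u) < (LINT t:{u..w}|lebesgue. \<phi> t)"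
        using x r d by (auto dest!: spec[of _ "min r d"])
      have "{u..w} \<subseteq> ball x r" using uw by (auto simp: dist_real_def)
      then have "(u,w) \<in> K" using uw r by (auto simp: K_def)
      then show "\<exists>i. i \<in> K \<and> x \<in> cball ((fst i + snd i) / 2) ((snd i - fst i) / 2) \<and> (snd i - fst i) / 2 < d"
        unfolding cb using uw by (intro exI[of _ "(u,w)"]) auto
    qed (use that in \<open>simp add: cb\<close>)
    define U where "U = (\<Union>i\<in>C. {fst i..snd i})"
    have U_sub: "U \<subseteq> G" using C(2) unfolding U_def K_def by force
    have U_meas[measurable]: "U \<in> sets lebesgue" unfolding U_def using C(1) by (intro sets.countable_UN') auto
    have U_lm: "U \<in> lmeasurable"
    proof (rule bounded_set_imp_lmeasurable)
      show "bounded U" using U_sub G by (intro bounded_subset[OF bounded_closed_interval[of p q]]) auto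
    qed simp
    have dis: "disjoint_family_on (\<lambda>i. {fst i..snd i}) C"
      using C(3) by (auto simp: disjoint_family_on_def pairwise_def disjnt_def)
    \<comment> \<open>Compare Lebesgue measure and the measure with density \<open>\<phi>\<close> on each interval and sum over the disjoint family.\<close>
    have "ennreal \<beta> * emeasure lebesgue U = (\<integral>\<^sup>+i. ennreal \<beta> * emeasure lebesgue {fst i..snd i} \<partial>count_space C)"
      unfolding U_def using C(1) dis by (subst emeasure_UN_countable) (auto simp: nn_integral_cmult)
    also have "\<dots> \<le> (\<integral>\<^sup>+i. emeasure \<Phi> {fst i..snd i} \<partial>count_space C)"
    proof (intro nn_integral_mono)
      fix i assume "i \<in> space (count_space C)"
      then have i: "fst i < snd i" "\<beta> * (snd i - fst i) < (LINT t:{fst i..snd i}|lebesgue. \<phi> t)" using C(2) by (auto simp: K_def)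
      have "ennreal \<beta> * emeasure lebesgue {fst i..snd i} = ennreal (\<beta> * (snd i - fst i))"
        using i ab by (simp add: ennreal_mult)
      also have "\<dots> \<le> emeasure \<Phi> {fst i..snd i}" using i by (subst \<Phi>_eq) (auto intro!: ennreal_leI)
      finally show "ennreal \<beta> * emeasure lebesgue {fst i..snd i} \<le> emeasure \<Phi> {fst i..snd i}" .
    qed
    also have "\<dots> = emeasure \<Phi> U"
      unfolding U_def using C(1) dis by (subst emeasure_UN_countable) (auto simp: \<Phi>_def)
    finally have 1: "ennreal \<beta> * emeasure lebesgue U \<le> emeasure \<Phi> U" .
    have "emeasure \<Phi> U = (\<integral>\<^sup>+x\<in>U. ennreal (\<phi> x) \<partial>lebesgue)"
      unfolding \<Phi>_def by (rule emeasure_density) auto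
    also have "\<dots> \<le> (\<integral>\<^sup>+x. ennreal \<alpha> * indicator U x + ennreal B * indicator (G0 - A) x \<partial>lebesgue)"
      proof (intro nn_integral_mono)
      fix x
      show "ennreal (\<phi> x) * indicator U x \<le> ennreal \<alpha> * indicator U x + ennreal B * indicator (G0 - A) x"
      proof (cases "x \<in> U \<and> x \<notin> A")
        case True
        then have "x \<in> G0" using U_sub by (auto simp: G_def)
        moreover have "ennreal (\<phi> x) \<le> ennreal \<alpha> + ennreal B"
          using add_increasing[OF zero_le ennreal_leI[OF bd(2)]] .
        ultimately show ?thesis using True by auto
      next
        case False
        then show ?thesis by (auto simp: indicator_def A_def intro!: ennreal_leI)
      qed
    qed
    also have "\<dots> = ennreal \<alpha> * emeasure lebesgue U + ennreal B * emeasure lebesgue (G0 - A)"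
      using G0 by (subst nn_integral_add) (auto simp: nn_integral_cmult_indicator fmeasurable_def)
    also have "\<dots> \<le> ennreal \<alpha> * emeasure lebesgue U + ennreal B * ennreal \<eta>"
      using G0(4) by (intro add_left_mono mult_left_mono) auto
    finally have 2: "ennreal \<beta> * emeasure lebesgue U \<le> ennreal \<alpha> * emeasure lebesgue U + ennreal B * ennreal \<eta>"
      using 1 by order
    have eU: "emeasure lebesgue U = ennreal (measure lebesgue U)"
      using U_lm by (simp add: emeasure_eq_measure2)
    have "\<beta> * measure lebesgue U \<le> \<alpha> * measure lebesgue U + B * \<eta>"
      using 2 ab B0 \<open>\<eta> > 0\<close> unfolding eU
      by (simp flip: ennreal_mult ennreal_plus)
    then have "(\<beta> - \<alpha>) * measure lebesgue U \<le> B * \<eta>" by (simp add: algebra_simps)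
    also have "\<dots> \<le> (\<beta> - \<alpha>) * e"
      using B0 ab \<open>e > 0\<close> by (simp add: \<eta>_def field_simps)
    finally have "measure lebesgue U \<le> e" using ab by simp
    moreover have neg: "negligible (?E - U)" using C(4) by (simp add: U_def)
    then have "measure lebesgue (U \<union> (?E - U)) = measure lebesgue U"
      using U_meas by (intro measure_Un_null_set) (simp_all add: negligible_iff_null_sets)
    moreover have "U \<union> (?E - U) \<in> lmeasurable"
      using U_lm neg by (intro fmeasurable.Un) (simp_all add: negligible_iff_measure)
    ultimately show "\<exists>T. ?E \<subseteq> T \<and> T \<in> lmeasurable \<and> measure lebesgue T \<le> e"
      by (intro exI[of _ "U \<union> (?E - U)"] conjI) (simp_all only: Un_Diff_cancel Un_upper2)
  qed
qed

lemma set_integral_split_lebesgue: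
  fixes \<phi> :: "real \<Rightarrow> 'b::euclidean_space"
  assumes "\<phi> \<in> borel_measurable lebesgue" and "\<And>x. norm (\<phi> x) \<le> B" and "p \<le> u" "u \<le> w"
  shows "(LINT t:{p..w}|lebesgue. \<phi> t) = (LINT t:{p..u}|lebesgue. \<phi> t) + (LINT t:{u..w}|lebesgue. \<phi> t)"
proof -
  have "(LINT t:{p..w}|lebesgue. \<phi> t) = (LINT t:{p..u} \<union> {u<..w}|lebesgue. \<phi> t)"
    using assms by (intro arg_cong[where f="\<lambda>S. set_lebesgue_integral lebesgue S \<phi>"]) auto
  also have "\<dots> = (LINT t:{p..u}|lebesgue. \<phi> t) + (LINT t:{u<..w}|lebesgue. \<phi> t)"
  proof (intro set_integral_Un set_integrable_bounded_lebesgue[where B=B] assms)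
    show "{u<..w} \<in> lmeasurable"
      by (rule bounded_set_imp_lmeasurable, rule bounded_subset[OF bounded_closed_interval[of u w]]) auto
  qed auto
  also have "(LINT t:{u<..w}|lebesgue. \<phi> t) = (LINT t:{u..w}|lebesgue. \<phi> t)"
    unfolding set_lebesgue_integral_def
  proof (rule integral_cong_AE)
    show "AE x in lebesgue. indicator {u<..w} x *\<^sub>R \<phi> x = indicator {u..w} x *\<^sub>R \<phi> x"
      by (rule AE_I'[of "{u}"]) (auto simp: indicator_def)
  qed (use assms(1) in \<open>auto intro!: borel_measurable_scaleR borel_measurable_indicator\<close>)
  finally show ?thesis .
qed

text \<open>Off the exceptional sets belonging to rational \<open>\<alpha> < \<beta>\<close>, short averages of the nonnegative functions
  \<open>\<phi> + B\<close> and \<open>B - \<phi>\<close> near \<open>x\<close> exceed their values at \<open>x\<close> by at most \<open>e\<close>; together this is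
  differentiability.\<close>

lemma indefinite_integral_derivative_ae_real:
  fixes \<phi> :: "real \<Rightarrow> real"
  assumes meas[measurable]: "\<phi> \<in> borel_measurable lebesgue" and bd: "\<And>x. norm (\<phi> x) \<le> B"
  shows "negligible {x\<in>{p<..<q}. \<not> ((\<lambda>t. LINT u:{p..t}|lebesgue. \<phi> u) has_real_derivative \<phi> x) (at x)}"
proof -
  define bad where "bad \<psi> \<alpha> \<beta> = {x\<in>{p<..<q}. \<psi> x < \<alpha> \<and>
     (\<forall>d>0. \<exists>u w. u \<le> x \<and> x \<le> w \<and> u < w \<and> w - u < d \<and> \<beta> * (w - u) < (LINT t:{u..w}|lebesgue. \<psi> t))}"
    for \<psi> :: "real \<Rightarrow> real" and \<alpha> \<beta>
  define Q where "Q = {(\<alpha>,\<beta>). \<alpha> \<in> \<rat> \<and> \<beta> \<in> \<rat> \<and> 0 \<le> \<alpha> \<and> \<alpha> < (\<beta>::real)}"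
  have Q: "countable Q"
    by (rule countable_subset[of _ "\<rat> \<times> \<rat>"]) (auto simp: Q_def countable_rat)
  let ?up = "\<lambda>x. \<phi> x + B" and ?dn = "\<lambda>x. B - \<phi> x"
  have bnd: "0 \<le> \<phi> x + B" "\<phi> x \<le> B" "0 \<le> B - \<phi> x" "B - \<phi> x \<le> 2 * B" for x
    using bd[of x] by auto
  have [simp]: "negligible (bad ?up \<alpha> \<beta>)" if "(\<alpha>,\<beta>) \<in> Q" for \<alpha> \<beta>
    unfolding bad_def using that
    by (intro averages_above_negligible[where B="2*B"]) (auto simp: Q_def bnd)
  have [simp]: "negligible (bad ?dn \<alpha> \<beta>)" if "(\<alpha>,\<beta>) \<in> Q" for \<alpha> \<beta>
    unfolding bad_def using that
    by (intro averages_above_negligible[where B="2*B"]) (auto simp: Q_def bnd)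
  define N where "N = (\<Union>(\<alpha>,\<beta>)\<in>Q. bad ?up \<alpha> \<beta> \<union> bad ?dn \<alpha> \<beta>)"
  have N: "negligible N"
    unfolding N_def using Q by (intro negligible_countable_Union) auto
  have deriv: "((\<lambda>t. LINT u:{p..t}|lebesgue. \<phi> u) has_real_derivative \<phi> x) (at x)"
    if x: "x \<in> {p<..<q}" "x \<notin> N" for x
    unfolding has_field_derivative_def has_derivative_at_alt
  proof (intro conjI allI impI bounded_linear_mult_right)
    fix e :: real assume e: "e > 0"
    have av: "\<exists>d>0. \<forall>u w. u \<le> x \<and> x \<le> w \<and> u < w \<and> w - u < d \<longrightarrow> (LINT t:{u..w}|lebesgue. \<psi> t) \<le> (\<psi> x + e) * (w - u)"
      if \<psi>: "\<psi> = ?up \<or> \<psi> = ?dn" for \<psi>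
    proof -
      have "0 \<le> \<psi> x" using \<psi> bnd by auto
      obtain \<alpha> where \<alpha>: "\<alpha> \<in> \<rat>" "\<psi> x < \<alpha>" "\<alpha> < \<psi> x + e" using Rats_dense_in_real[of "\<psi> x" "\<psi> x + e"] e by auto
      obtain \<beta> where \<beta>: "\<beta> \<in> \<rat>" "\<alpha> < \<beta>" "\<beta> < \<psi> x + e" using Rats_dense_in_real[of \<alpha> "\<psi> x + e"] \<alpha> by auto
      have "(\<alpha>,\<beta>) \<in> Q" using \<alpha> \<beta> \<open>0 \<le> \<psi> x\<close> by (auto simp: Q_def)
      then have "x \<notin> bad \<psi> \<alpha> \<beta>" using x \<psi> by (auto simp: N_def)
      then obtain d where d: "d > 0" "\<And>u w. u \<le> x \<Longrightarrow> x \<le> w \<Longrightarrow> u < w \<Longrightarrow> w - u < d \<Longrightarrow> (LINT t:{u..w}|lebesgue. \<psi> t) \<le> \<beta> * (w - u)"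
        using x \<alpha> unfolding bad_def by force
      show ?thesis
      proof (intro exI[of _ d] conjI allI impI d(1))
        fix u w assume uw: "u \<le> x \<and> x \<le> w \<and> u < w \<and> w - u < d"
        then have "(LINT t:{u..w}|lebesgue. \<psi> t) \<le> \<beta> * (w - u)" using d by blast
        also have "\<dots> \<le> (\<psi> x + e) * (w - u)" using uw \<beta> by (intro mult_right_mono) auto
        finally show "(LINT t:{u..w}|lebesgue. \<psi> t) \<le> (\<psi> x + e) * (w - u)" .
      qed
    qed
    obtain d1 where d1: "d1 > 0" "\<And>u w. u \<le> x \<Longrightarrow> x \<le> w \<Longrightarrow> u < w \<Longrightarrow> w - u < d1 \<Longrightarrow> (LINT t:{u..w}|lebesgue. ?up t) \<le> (?up x + e) * (w - u)"
      using av[of ?up] by blast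
    obtain d2 where d2: "d2 > 0" "\<And>u w. u \<le> x \<Longrightarrow> x \<le> w \<Longrightarrow> u < w \<Longrightarrow> w - u < d2 \<Longrightarrow> (LINT t:{u..w}|lebesgue. ?dn t) \<le> (?dn x + e) * (w - u)"
      using av[of ?dn] by blast
    have key: "\<bar>(LINT t:{u..w}|lebesgue. \<phi> t) - \<phi> x * (w - u)\<bar> \<le> e * (w - u)"
      if uw: "u \<le> x" "x \<le> w" "u < w" "w - u < min d1 d2" for u w
    proof -
      have i: "set_integrable lebesgue {u..w} \<phi>"
        using bd by (intro set_integrable_bounded_lebesgue) auto
      have c: "set_integrable lebesgue {u..w} (\<lambda>x. B)"
        by (intro set_integrable_bounded_lebesgue[where B="\<bar>B\<bar>"]) auto
      have "(LINT t:{u..w}|lebesgue. ?up t) = (LINT t:{u..w}|lebesgue. \<phi> t) + B * (w - u)"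
        using i c uw by (subst set_integral_add) (auto simp: set_lebesgue_integral_def)
      moreover have "(LINT t:{u..w}|lebesgue. ?dn t) = B * (w - u) - (LINT t:{u..w}|lebesgue. \<phi> t)"
        using i c uw by (subst set_integral_diff) (auto simp: set_lebesgue_integral_def)
      ultimately show ?thesis using d1(2)[of u w] d2(2)[of u w] uw by (auto simp: algebra_simps abs_le_iff)
    qed
    have x0: "p < x" using x by auto
    let ?d = "min (min d1 d2) (x - p)"
    show "\<exists>d>0. \<forall>y. norm (y - x) < d \<longrightarrow>
         norm ((LINT u:{p..y}|lebesgue. \<phi> u) - (LINT u:{p..x}|lebesgue. \<phi> u) - \<phi> x * (y - x)) \<le> e * norm (y - x)"
    proof (intro exI[of _ ?d] conjI allI impI)
      show "?d > 0" using d1 d2 x0 by auto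
      fix y assume y: "norm (y - x) < ?d"
      then have "p < y" by (auto simp: abs_if split: if_splits)
      consider "x < y" | "y < x" | "x = y" by linarith
      then show "norm ((LINT u:{p..y}|lebesgue. \<phi> u) - (LINT u:{p..x}|lebesgue. \<phi> u) - \<phi> x * (y - x)) \<le> e * norm (y - x)"
      proof cases
        case 1
        then show ?thesis using key[of x y] y x0 set_integral_split_lebesgue[of \<phi> B p x y] bd by auto
      next
        case 2
        then show ?thesis using key[of y x] y \<open>p < y\<close> set_integral_split_lebesgue[of \<phi> B p y x] bd
          by (auto simp: abs_le_iff algebra_simps)
      qed simp
    qed
  qed
  show ?thesis
    by (rule negligible_subset[OF N]) (use deriv in blast)
qed

lemma indefinite_integral_derivative_ae:
  fixes \<phi> :: "real \<Rightarrow> 'b::euclidean_space"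
  assumes meas: "\<phi> \<in> borel_measurable (lebesgue_on {0..1})" and bd: "\<And>x. x \<in> {0..1} \<Longrightarrow> norm (\<phi> x) \<le> B"
  shows "AE s in lebesgue_on {0..1}. ((\<lambda>t. LINT u|lebesgue_on {0..t}. \<phi> u) has_vector_derivative \<phi> s) (at s within {0..1})"
proof -
  define \<psi> where "\<psi> x = (if x \<in> {0..1} then \<phi> x else 0)" for x
  have [measurable]: "\<psi> \<in> borel_measurable lebesgue"
    using meas unfolding \<psi>_def by (subst (asm) borel_measurable_if[symmetric]) auto
  have "0 \<le> B" using bd[of 0] order_trans[OF norm_ge_zero[of "\<phi> 0"]] by simp
  then have B: "norm (\<psi> x) \<le> B" for x using bd by (auto simp: \<psi>_def)
  have Bi: "norm (\<psi> x \<bullet> i) \<le> B" if "i \<in> Basis" for x i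
    using Basis_le_norm[OF that, of "\<psi> x"] B[of x] by auto
  define N where "N i = {x\<in>{0<..<1}. \<not> ((\<lambda>t. LINT u:{0..t}|lebesgue. \<psi> u \<bullet> i) has_real_derivative \<psi> x \<bullet> i) (at x)}" for i
  have N: "negligible (N i)" if "i \<in> Basis" for i
    unfolding N_def using Bi[OF that] by (intro indefinite_integral_derivative_ae_real[where B=B]) auto
  have "negligible (insert 0 (insert 1 (\<Union>i\<in>Basis. N i)))"
    using N by (auto intro: negligible_Union)
  then have "insert 0 (insert 1 (\<Union>i\<in>Basis. N i)) \<in> null_sets lebesgue" by (simp add: negligible_iff_null_sets)
  then have "AE s in lebesgue. s \<notin> insert 0 (insert 1 (\<Union>i\<in>Basis. N i))" by (rule AE_not_in)
  then have "AE s in lebesgue. s \<in> {0..1} \<longrightarrow> ((\<lambda>t. LINT u|lebesgue_on {0..t}. \<phi> u) has_vector_derivative \<phi> s) (at s within {0..1})"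
  proof (rule AE_mp, intro AE_I2 impI)
    fix s :: real assume "s \<notin> insert 0 (insert 1 (\<Union>i\<in>Basis. N i))" "s \<in> {0..1}"
    then have s: "s \<in> {0<..<1}" "\<And>i. i \<in> Basis \<Longrightarrow> ((\<lambda>t. LINT u:{0..t}|lebesgue. \<psi> u \<bullet> i) has_real_derivative \<psi> s \<bullet> i) (at s)"
      by (auto simp: N_def)
    have in_eq: "(LINT u:{0..t}|lebesgue. \<psi> u \<bullet> i) = (LINT u:{0..t}|lebesgue. \<psi> u) \<bullet> i" for t i
      using set_integrable_bounded_lebesgue[of \<psi> B "{0..t}"] B
      unfolding set_lebesgue_integral_def set_integrable_def
      by (subst integral_inner_left[symmetric]) auto
    have "((\<lambda>t. LINT u:{0..t}|lebesgue. \<psi> u) has_vector_derivative \<psi> s) (at s)"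
      unfolding has_vector_derivative_def
    proof (subst has_derivative_componentwise_within, intro ballI)
      fix i :: 'b assume i: "i \<in> Basis"
      show "((\<lambda>x. (LINT u:{0..x}|lebesgue. \<psi> u) \<bullet> i) has_derivative (\<lambda>x. x *\<^sub>R \<psi> s \<bullet> i)) (at s)"
        using s(2)[OF i] unfolding in_eq has_field_derivative_def inner_scaleR_left mult_commute_abs .
    qed
    then have "((\<lambda>t. LINT u:{0..t}|lebesgue. \<psi> u) has_vector_derivative \<psi> s) (at s within {0..1})"
      by (rule has_vector_derivative_at_within)
    moreover have "(LINT u:{0..t}|lebesgue. \<psi> u) = (LINT u|lebesgue_on {0..t}. \<phi> u)" if "t \<in> {0..1}" for t
    proof -
      have "(LINT u:{0..t}|lebesgue. \<psi> u) = (LINT u|lebesgue_on {0..t}. \<psi> u)"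
        unfolding set_lebesgue_integral_def by (subst integral_restrict_space) auto
      also have "\<dots> = (LINT u|lebesgue_on {0..t}. \<phi> u)"
        using that by (intro Bochner_Integration.integral_cong) (auto simp: \<psi>_def space_restrict_space)
      finally show ?thesis .
    qed
    moreover have "\<psi> s = \<phi> s" using s by (auto simp: \<psi>_def)
    ultimately show "((\<lambda>t. LINT u|lebesgue_on {0..t}. \<phi> u) has_vector_derivative \<phi> s) (at s within {0..1})"
      using s by (auto intro: has_vector_derivative_transform[rotated 2])
  qed
  then show ?thesis by (subst AE_restrict_space_iff) auto
qed

lemma Lipschitz_imp_abs_continuous_on:
  fixes z :: "real \<Rightarrow> 'b::real_normed_vector"
  assumes "\<And>s t. s \<in> S \<Longrightarrow> t \<in> S \<Longrightarrow> s \<le> t \<Longrightarrow> norm (z t - z s) \<le> B * (t - s)" and "0 \<le> B"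
  shows "abs_continuous_on S z"
  unfolding abs_continuous_on_def
proof (intro allI impI)
  fix e :: real assume "e > 0"
  show "\<exists>d>0. \<forall>a b n.
        (\<forall>i<n. a i \<le> b i \<and> {a i..b i} \<subseteq> S) \<and>
        (\<forall>i<n. \<forall>k<n. i \<noteq> k \<longrightarrow> {a i<..<b i} \<inter> {a k<..<b k} = {}) \<and>
        (\<Sum>i<(n::nat). b i - a i) < d
        \<longrightarrow> (\<Sum>i<n. norm (z (b i) - z (a i))) < e"
  proof (intro exI[of _ "e / (B + 1)"] conjI allI impI)
    show "e / (B+1) > 0" using \<open>e > 0\<close> assms by auto
    fix a b :: "nat \<Rightarrow> real" and n :: nat
    assume *: "(\<forall>i<n. a i \<le> b i \<and> {a i..b i} \<subseteq> S) \<and>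
        (\<forall>i<n. \<forall>k<n. i \<noteq> k \<longrightarrow> {a i<..<b i} \<inter> {a k<..<b k} = {}) \<and> (\<Sum>i<n. b i - a i) < e / (B + 1)"
    have le: "(\<Sum>i<n. norm (z (b i) - z (a i))) \<le> (\<Sum>i<n. B * (b i - a i))"
    proof (intro sum_mono)
      fix i assume "i \<in> {..<n}"
      then have "a i \<le> b i" "{a i..b i} \<subseteq> S" using * by auto
      then have "a i \<in> S" "b i \<in> S" by auto
      then show "norm (z (b i) - z (a i)) \<le> B * (b i - a i)" using assms(1) \<open>a i \<le> b i\<close> by auto
    qed
    also have "\<dots> = B * (\<Sum>i<n. b i - a i)" by (simp add: sum_distrib_left)
    also have "\<dots> \<le> B * (e / (B+1))" using * assms by (intro mult_left_mono) auto
    also have "\<dots> < e" using \<open>e > 0\<close> assms by (simp add: field_simps)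
    finally show "(\<Sum>i<n. norm (z (b i) - z (a i))) < e" .
  qed
qed

text \<open>Take a tagged partition into intervals so fine that an interval with tag outside the null set
  \<open>E\<close> contributes at most \<open>e\<close> times its length, while all intervals with tag in \<open>E\<close> lie in an open set
  of measure below the \<open>\<delta>\<close> of absolute continuity and contribute at most \<open>e\<close> together.\<close>

lemma abs_continuous_zero_derivative_const:
  fixes z :: "real \<Rightarrow> 'b::euclidean_space"
  assumes ac: "abs_continuous_on {a..b} z" and E: "negligible E" 
    and der: "\<And>s. s \<in> {a..b} - E \<Longrightarrow> (z has_vector_derivative 0) (at s within {a..b})"
    and ab: "a \<le> b"
  shows "z b = z a"
proof -
  have bound: "norm (z b - z a) \<le> e * (b - a) + e" if e: "e > 0" for e
  proof -
    obtain d where d: "d > 0" "\<And>u w n.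
        (\<forall>i<n. u i \<le> w i \<and> {u i..w i} \<subseteq> {a..b}) \<Longrightarrow>
        (\<forall>i<n. \<forall>k<n. i \<noteq> k \<longrightarrow> {u i<..<w i} \<inter> {u k<..<w k} = {}) \<Longrightarrow>
        (\<Sum>i<(n::nat). w i - u i) < d
        \<Longrightarrow> (\<Sum>i<n. norm (z (w i) - z (u i))) < e"
      using ac[unfolded abs_continuous_on_def, THEN spec, THEN mp, OF e] by (elim exE conjE) (rule that; blast)
    have "E \<in> sets lebesgue" using E by (simp add: negligible_iff_null_sets null_setsD2)
    then obtain G where G: "open G" "E \<subseteq> G" "G - E \<in> lmeasurable" "emeasure lebesgue (G - E) < ennreal d"
      using sets_lebesgue_outer_open[of E d] d by blast
    have Gs: "G \<in> sets lebesgue" using G by auto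
    have emG: "emeasure lebesgue G < ennreal d"
    proof -
      have "E \<in> null_sets lebesgue" using E by (simp add: negligible_iff_null_sets)
      then have "emeasure lebesgue (G - E) = emeasure lebesgue G" using Gs by (simp add: emeasure_Diff_null_set)
      then show ?thesis using G by simp
    qed
    have "\<exists>r>0. if s \<in> E then ball s r \<subseteq> G else \<forall>y\<in>{a..b}. norm (y - s) < r \<longrightarrow> norm (z y - z s) \<le> e * norm (y - s)"
      if "s \<in> {a..b}" for s
    proof (cases "s \<in> E")
      case True then show ?thesis using G by (auto simp: open_contains_ball)
    next
      case False
      then have "(z has_derivative (\<lambda>x. 0)) (at s within {a..b})" using der that by (force simp: has_vector_derivative_def)
      then show ?thesis using False e unfolding has_derivative_within_alt by auto
    qed
    then obtain r where r: "\<And>s. s \<in> {a..b} \<Longrightarrow> r s > 0"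
      "\<And>s. s \<in> {a..b} \<Longrightarrow> s \<in> E \<Longrightarrow> ball s (r s) \<subseteq> G"
      "\<And>s y. s \<in> {a..b} \<Longrightarrow> s \<notin> E \<Longrightarrow> y \<in> {a..b} \<Longrightarrow> norm (y - s) < r s \<Longrightarrow> norm (z y - z s) \<le> e * norm (y - s)"
      by metis
    define g where "g s = ball s (if s \<in> {a..b} then r s else 1)" for s
    have "gauge g" using r(1) by (auto simp: gauge_def g_def)
    then obtain p where p: "p tagged_division_of {a..b}" "g fine p" using fine_division_exists_real by blast
    have fin: "finite p" using p by auto
    have pt: "\<exists>u w. K = {u..w} \<and> u \<le> w \<and> a \<le> u \<and> w \<le> b \<and> u \<le> s \<and> s \<le> w \<and> K \<subseteq> ball s (r s) \<and> s \<in> {a..b}"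
      if sK: "(s,K) \<in> p" for s K
    proof -
      obtain u w where "K = cbox u w" using tagged_division_ofD(4)[OF p(1) sK] by auto
      moreover have "s \<in> K" "K \<subseteq> {a..b}" using tagged_division_ofD(2,3)[OF p(1) sK] by auto
      moreover have "K \<subseteq> g s" using p(2) sK by (auto simp: fine_def)
      moreover have "g s = ball s (r s)" using calculation by (auto simp: g_def)
      ultimately show ?thesis by (intro exI[of _ u] exI[of _ w]) (auto simp: subset_iff)
    qed
    have tel: "(\<Sum>(s,K)\<in>p. z (Sup K) - z (Inf K)) = z b - z a"
      using additive_tagged_division_1[OF ab, of p z] p by simp
    \<comment> \<open>The intervals of \<open>p1\<close> lie in \<open>G\<close>, those of \<open>p - p1\<close> have tags with vanishing derivative.\<close>
    define p1 where "p1 = {(s,K)\<in>p. s \<in> E}"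
    have p1: "p1 \<subseteq> p" "finite p1" using fin by (auto simp: p1_def intro: rev_finite_subset)
    have "norm (\<Sum>(s,K)\<in>p - p1. z (Sup K) - z (Inf K)) \<le> (\<Sum>(s,K)\<in>p - p1. e * (Sup K - Inf K))"
    proof (rule sum_norm_le, clarify)
      fix s K assume sK: "(s,K) \<in> p" "(s,K) \<notin> p1"
      then obtain u w where K: "K = {u..w}" "u \<le> w" "a \<le> u" "w \<le> b" "u \<le> s" "s \<le> w" "K \<subseteq> ball s (r s)" "s \<in> {a..b}"
        using pt by blast
      have "s \<notin> E" using sK by (auto simp: p1_def)
      have "u \<in> {u..w}" "w \<in> {u..w}" using K by auto
      then have "u \<in> ball s (r s)" "w \<in> ball s (r s)" using K by blast+
      then have "norm (z u - z s) \<le> e * norm (u - s)" "norm (z w - z s) \<le> e * norm (w - s)"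
        using r(3)[of s u] r(3)[of s w] K \<open>s \<notin> E\<close> by (auto simp: dist_real_def)
      then have "norm (z w - z u) \<le> e * (w - s) + e * (s - u)"
        using norm_triangle_ineq4[of "z w - z s" "z u - z s"] K by auto
      then show "norm (z (Sup K) - z (Inf K)) \<le> e * (Sup K - Inf K)" using K by (simp add: algebra_simps)
    qed
    also have "\<dots> \<le> (\<Sum>(s,K)\<in>p. e * (Sup K - Inf K))"
      using fin e by (intro sum_mono2) (auto dest!: pt)
    also have "\<dots> = e * (\<Sum>(s,K)\<in>p. Sup K - Inf K)" by (simp add: sum_distrib_left split_def)
    also have "\<dots> = e * (b - a)" using additive_tagged_division_1[OF ab p(1), of "\<lambda>x. x"] by simp
    finally have 1: "norm (\<Sum>(s,K)\<in>p - p1. z (Sup K) - z (Inf K)) \<le> e * (b - a)" .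
    \<comment> \<open>Absolute continuity speaks about finite sequences of intervals, hence the enumeration \<open>h\<close>.\<close>
    obtain n and h :: "nat \<Rightarrow> real \<times> real set" where h: "bij_betw h {..<n} p1" 
      using p1(2) by (metis ex_bij_betw_nat_finite atLeast0LessThan)
    define u where "u i = Inf (snd (h i))" for i
    define w where "w i = Sup (snd (h i))" for i
    have hp: "h i \<in> p1" if "i < n" for i using h that by (auto simp: bij_betw_def)
    have uw: "snd (h i) = {u i..w i} \<and> u i \<le> w i \<and> a \<le> u i \<and> w i \<le> b \<and> {u i..w i} \<subseteq> G" if i: "i < n" for i
    proof -
      obtain s K where sK: "h i = (s,K)" by force
      then have "(s,K) \<in> p" "s \<in> E" using hp[OF i] by (auto simp: p1_def)
      then obtain u' w' where K: "K = {u'..w'}" "u' \<le> w'" "a \<le> u'" "w' \<le> b" "u' \<le> s" "s \<le> w'" "K \<subseteq> ball s (r s)" "s \<in> {a..b}"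
        using pt by blast
      have "u i = u'" "w i = w'" using K sK by (auto simp: u_def w_def)
      moreover have "K \<subseteq> G" using K r(2)[of s] \<open>s \<in> E\<close> by blast
      ultimately show ?thesis using K sK by auto
    qed
    have dj: "{u i<..<w i} \<inter> {u k<..<w k} = {}" if "i < n" "k < n" "i \<noteq> k" for i k
    proof -
      have "h i \<noteq> h k" using h that by (auto simp: bij_betw_def inj_on_def)
      moreover have "h i \<in> p" "h k \<in> p" using hp that p1 by auto
      ultimately have "interior (snd (h i)) \<inter> interior (snd (h k)) = {}"
        using tagged_division_ofD(5)[OF p(1)] by (metis prod.collapse)
      then show ?thesis using uw[OF that(1)] uw[OF that(2)] by simp
    qed
    have "(\<Sum>i<n. w i - u i) < d"
    proof -
      have "(\<Sum>i<n. w i - u i) = (\<Sum>i<n. measure lebesgue {u i<..<w i})" using uw by (intro sum.cong) auto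
      also have "\<dots> = measure lebesgue (\<Union>i<n. {u i<..<w i})"
        using dj uw by (intro measure_UNION'[symmetric]) (auto simp: pairwise_def disjnt_def)
      also have "\<dots> \<le> measure lebesgue G"
      proof (rule measure_mono_fmeasurable)
        show "(\<Union>i<n. {u i<..<w i}) \<subseteq> G" using uw by (force simp: subset_iff)
        show "G \<in> lmeasurable" using emG Gs by (auto simp: fmeasurable_def intro: order.strict_trans)
      qed auto
      also have "\<dots> < d"
      proof -
        have "emeasure lebesgue G = ennreal (measure lebesgue G)"
          using emG by (intro emeasure_eq_ennreal_measure) auto
        then show ?thesis using emG by (simp add: ennreal_less_iff)
      qed
      finally show ?thesis .
    qed
    then have "(\<Sum>i<n. norm (z (w i) - z (u i))) < e"
      using uw dj by (intro d(2)) auto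
    moreover have "(\<Sum>(s,K)\<in>p1. norm (z (Sup K) - z (Inf K))) = (\<Sum>i<n. norm (z (w i) - z (u i)))"
      unfolding u_def w_def split_def by (rule sum.reindex_bij_betw[OF h, symmetric])
    ultimately have 2: "norm (\<Sum>(s,K)\<in>p1. z (Sup K) - z (Inf K)) \<le> e"
      using norm_sum[of "\<lambda>(s,K). z (Sup K) - z (Inf K)" p1] by (simp add: split_def)
    have "z b - z a = (\<Sum>(s,K)\<in>p - p1. z (Sup K) - z (Inf K)) + (\<Sum>(s,K)\<in>p1. z (Sup K) - z (Inf K))"
      unfolding tel[symmetric] using p1(1) fin by (rule sum.subset_diff)
    then show ?thesis using 1 2 norm_triangle_ineq[of "\<Sum>(s,K)\<in>p - p1. z (Sup K) - z (Inf K)" "\<Sum>(s,K)\<in>p1. z (Sup K) - z (Inf K)"] by simp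
  qed
  have small: "norm (z b - z a) \<le> e * (b - a + 1)" if "e > 0" for e using bound[OF that] by (simp add: algebra_simps)
  have "norm (z b - z a) \<le> 0"
  proof (rule field_le_epsilon)
    fix e :: real assume "e > 0"
    then show "norm (z b - z a) \<le> 0 + e" using small[of "e / (b - a + 1)"] ab by simp
  qed
  then show ?thesis by simp
qed

lemma abs_continuous_on_diff:
  assumes "abs_continuous_on S y" "abs_continuous_on S z"
  shows "abs_continuous_on S (\<lambda>t. y t - z t)"
  unfolding abs_continuous_on_def
proof (intro allI impI)
  fix e :: real assume "e > 0"
  then have e2: "e/2 > 0" by simp
  obtain d1 where d1: "d1 > 0" "\<forall>a b n. (\<forall>i<n. a i \<le> b i \<and> {a i..b i} \<subseteq> S) \<and>
        (\<forall>i<n. \<forall>k<n. i \<noteq> k \<longrightarrow> {a i<..<b i} \<inter> {a k<..<b k} = {}) \<and>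
        (\<Sum>i<(n::nat). b i - a i) < d1 \<longrightarrow> (\<Sum>i<n. norm (y (b i) - y (a i))) < e/2"
    using assms(1)[unfolded abs_continuous_on_def, THEN spec, THEN mp, OF e2] by (elim exE conjE) (rule that)
  obtain d2 where d2: "d2 > 0" "\<forall>a b n. (\<forall>i<n. a i \<le> b i \<and> {a i..b i} \<subseteq> S) \<and>
        (\<forall>i<n. \<forall>k<n. i \<noteq> k \<longrightarrow> {a i<..<b i} \<inter> {a k<..<b k} = {}) \<and>
        (\<Sum>i<(n::nat). b i - a i) < d2 \<longrightarrow> (\<Sum>i<n. norm (z (b i) - z (a i))) < e/2"
    using assms(2)[unfolded abs_continuous_on_def, THEN spec, THEN mp, OF e2] by (elim exE conjE) (rule that)
  show "\<exists>d>0. \<forall>a b n. (\<forall>i<n. a i \<le> b i \<and> {a i..b i} \<subseteq> S) \<and>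
        (\<forall>i<n. \<forall>k<n. i \<noteq> k \<longrightarrow> {a i<..<b i} \<inter> {a k<..<b k} = {}) \<and>
        (\<Sum>i<(n::nat). b i - a i) < d \<longrightarrow> (\<Sum>i<n. norm (y (b i) - z (b i) - (y (a i) - z (a i)))) < e"
  proof (intro exI[of _ "min d1 d2"] conjI allI impI)
    fix a b :: "nat \<Rightarrow> real" and n :: nat
    assume *: "(\<forall>i<n. a i \<le> b i \<and> {a i..b i} \<subseteq> S) \<and>
        (\<forall>i<n. \<forall>k<n. i \<noteq> k \<longrightarrow> {a i<..<b i} \<inter> {a k<..<b k} = {}) \<and> (\<Sum>i<n. b i - a i) < min d1 d2"
    have "(\<Sum>i<n. norm (y (b i) - z (b i) - (y (a i) - z (a i)))) \<le> (\<Sum>i<n. norm (y (b i) - y (a i)) + norm (z (b i) - z (a i)))"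
    proof (intro sum_mono)
      fix i
      have "y (b i) - z (b i) - (y (a i) - z (a i)) = (y (b i) - y (a i)) - (z (b i) - z (a i))" by simp
      then show "norm (y (b i) - z (b i) - (y (a i) - z (a i))) \<le> norm (y (b i) - y (a i)) + norm (z (b i) - z (a i))"
        by (metis norm_triangle_ineq4)
    qed
    also have "\<dots> < e/2 + e/2"
      unfolding sum.distrib
    proof (rule add_strict_mono)
      show "(\<Sum>i<n. norm (y (b i) - y (a i))) < e/2"
        by (rule d1(2)[THEN spec[of _ a], THEN spec[of _ b], THEN spec[of _ n], THEN mp]) (use * in simp)
      show "(\<Sum>i<n. norm (z (b i) - z (a i))) < e/2"
        by (rule d2(2)[THEN spec[of _ a], THEN spec[of _ b], THEN spec[of _ n], THEN mp]) (use * in simp)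
    qed
    finally show "(\<Sum>i<n. norm (y (b i) - z (b i) - (y (a i) - z (a i)))) < e" by simp
  next
    show "min d1 d2 > 0" using d1(1) d2(1) by simp
  qed
qed

lemma abs_continuous_on_subset:
  "abs_continuous_on S z \<Longrightarrow> S' \<subseteq> S \<Longrightarrow> abs_continuous_on S' z"
  unfolding abs_continuous_on_def
proof (intro allI impI)
  fix e :: real
  assume ac: "\<forall>\<epsilon>>0. \<exists>\<delta>>0. \<forall>a b n. (\<forall>i<n. a i \<le> b i \<and> {a i..b i} \<subseteq> S) \<and>
        (\<forall>i<n. \<forall>k<n. i \<noteq> k \<longrightarrow> {a i<..<b i} \<inter> {a k<..<b k} = {}) \<and>
        (\<Sum>i<(n::nat). b i - a i) < \<delta> \<longrightarrow> (\<Sum>i<n. norm (z (b i) - z (a i))) < \<epsilon>"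
    and S: "S' \<subseteq> S" and e: "e > 0"
  obtain d where d: "d > 0" "\<forall>a b n. (\<forall>i<n. a i \<le> b i \<and> {a i..b i} \<subseteq> S) \<and>
        (\<forall>i<n. \<forall>k<n. i \<noteq> k \<longrightarrow> {a i<..<b i} \<inter> {a k<..<b k} = {}) \<and>
        (\<Sum>i<(n::nat). b i - a i) < d \<longrightarrow> (\<Sum>i<n. norm (z (b i) - z (a i))) < e"
    using ac[THEN spec, THEN mp, OF e] by (elim exE conjE) (rule that)
  show "\<exists>d>0. \<forall>a b n. (\<forall>i<n. a i \<le> b i \<and> {a i..b i} \<subseteq> S') \<and>
        (\<forall>i<n. \<forall>k<n. i \<noteq> k \<longrightarrow> {a i<..<b i} \<inter> {a k<..<b k} = {}) \<and>
        (\<Sum>i<(n::nat). b i - a i) < d \<longrightarrow> (\<Sum>i<n. norm (z (b i) - z (a i))) < e"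
  proof (intro exI[of _ d] conjI allI impI d(1), elim conjE)
    fix a b :: "nat \<Rightarrow> real" and n :: nat
    assume *: "\<forall>i<n. a i \<le> b i \<and> {a i..b i} \<subseteq> S'"
      "\<forall>i<n. \<forall>k<n. i \<noteq> k \<longrightarrow> {a i<..<b i} \<inter> {a k<..<b k} = {}" "(\<Sum>i<n. b i - a i) < d"
    have "\<forall>i<n. a i \<le> b i \<and> {a i..b i} \<subseteq> S" using *(1) S by blast
    then show "(\<Sum>i<n. norm (z (b i) - z (a i))) < e"
      using *(2,3) by (intro d(2)[THEN spec[of _ a], THEN spec[of _ b], THEN spec[of _ n], THEN mp] conjI)
  qed
qed

lemma norm_indefinite_integral_increment:
  fixes \<phi> :: "real \<Rightarrow> 'b::euclidean_space"
  assumes meas: "\<phi> \<in> borel_measurable (lebesgue_on {0..1})" and bd: "\<And>x. x \<in> {0..1} \<Longrightarrow> norm (\<phi> x) \<le> B"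
    and st: "0 \<le> s" "s \<le> t" "t \<le> 1"
  shows "norm ((LINT u|lebesgue_on {0..t}. \<phi> u) - (LINT u|lebesgue_on {0..s}. \<phi> u)) \<le> B * (t - s)"
proof -
  define \<psi> where "\<psi> x = (if x \<in> {0..1} then \<phi> x else 0)" for x
  have [measurable]: "\<psi> \<in> borel_measurable lebesgue"
    using meas unfolding \<psi>_def by (subst (asm) borel_measurable_if[symmetric]) auto
  have "0 \<le> B" using bd[of 0] order_trans[OF norm_ge_zero[of "\<phi> 0"]] by simp
  then have B: "norm (\<psi> x) \<le> B" for x using bd by (auto simp: \<psi>_def)
  have eq: "(LINT u|lebesgue_on {0..t}. \<phi> u) = (LINT u:{0..t}|lebesgue. \<psi> u)" if "t \<in> {0..1}" for t
  proof -
    have "(LINT u:{0..t}|lebesgue. \<psi> u) = (LINT u|lebesgue_on {0..t}. \<psi> u)"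
      unfolding set_lebesgue_integral_def by (subst integral_restrict_space) auto
    also have "\<dots> = (LINT u|lebesgue_on {0..t}. \<phi> u)"
      using that by (intro Bochner_Integration.integral_cong) (auto simp: \<psi>_def space_restrict_space)
    finally show ?thesis ..
  qed
  have "norm (LINT u:{s..t}|lebesgue. \<psi> u) \<le> (LINT u:{s..t}|lebesgue. B)"
    unfolding set_lebesgue_integral_def
  proof (rule Bochner_Integration.integral_norm_bound_integral)
    show "integrable lebesgue (\<lambda>x. indicator {s..t} x *\<^sub>R \<psi> x)"
      using set_integrable_bounded_lebesgue[of \<psi> B "{s..t}"] B by (auto simp: set_integrable_def)
    show "integrable lebesgue (\<lambda>x. indicator {s..t} x *\<^sub>R B)"
      using set_integrable_bounded_lebesgue[of "\<lambda>_. B" "\<bar>B\<bar>" "{s..t}"] by (auto simp: set_integrable_def)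
  qed (use B in \<open>auto simp: indicator_def\<close>)
  also have "\<dots> = B * (t - s)" using st by (simp add: set_lebesgue_integral_def)
  finally show ?thesis
    using set_integral_split_lebesgue[of \<psi> B 0 s t] B st eq[of s] eq[of t] by simp
qed

text \<open>Subtracting the indefinite integral of \<open>\<phi>\<close>, which is Lipschitz and has the same derivative almost
  everywhere, reduces the claim to a vanishing derivative.\<close>

lemma abs_continuous_fundamental_theorem:
  fixes z :: "real \<Rightarrow> 'b::euclidean_space"
  assumes ac: "abs_continuous_on {0..1} z"
    and meas: "\<phi> \<in> borel_measurable (lebesgue_on {0..1})" and bd: "\<And>x. x \<in> {0..1} \<Longrightarrow> norm (\<phi> x) \<le> B"
    and der: "AE s in lebesgue_on {0..1}. (z has_vector_derivative \<phi> s) (at s within {0..1})"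
    and t: "t \<in> {0..1}"
  shows "z t = z 0 + (LINT u|lebesgue_on {0..t}. \<phi> u)"
proof -
  define F where "F t = (LINT u|lebesgue_on {0..t}. \<phi> u)" for t
  have "0 \<le> B" using bd[of 0] order_trans[OF norm_ge_zero[of "\<phi> 0"]] by simp
  then have F: "abs_continuous_on {0..1} F"
    unfolding F_def using norm_indefinite_integral_increment[OF meas bd]
    by (intro Lipschitz_imp_abs_continuous_on[where B=B]) auto
  have der0: "AE s in lebesgue_on {0..1}. (F has_vector_derivative \<phi> s) (at s within {0..1})"
    unfolding F_def by (rule indefinite_integral_derivative_ae[OF meas]) (rule bd)
  have "AE s in lebesgue_on {0..1}. ((\<lambda>t. z t - F t) has_vector_derivative 0) (at s within {0..1})"
    using der der0
    by eventually_elim (auto simp: F_def dest: has_vector_derivative_diff)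
  then obtain E where E: "E \<in> null_sets lebesgue" "{s\<in>{0..1}. \<not> ((\<lambda>t. z t - F t) has_vector_derivative 0) (at s within {0..1})} \<subseteq> E"
    by (subst (asm) AE_restrict_space_iff) (auto simp: eventually_ae_filter)
  have "z t - F t = z 0 - F 0"
  proof (rule abs_continuous_zero_derivative_const[of 0 t "\<lambda>t. z t - F t" E])
    show "abs_continuous_on {0..t} (\<lambda>t. z t - F t)"
      using abs_continuous_on_subset[OF abs_continuous_on_diff[OF ac F], of "{0..t}"] t by auto
    show "negligible E" using E by (simp add: negligible_iff_null_sets)
    show "((\<lambda>t. z t - F t) has_vector_derivative 0) (at s within {0..t})" if "s \<in> {0..t} - E" for s
    proof (rule has_vector_derivative_within_subset)
      show "((\<lambda>t. z t - F t) has_vector_derivative 0) (at s within {0..1})" using E that t by fastforce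
    qed (use t in auto)
  qed (use t in auto)
  moreover have "F 0 = 0"
  proof -
    have "F 0 = (LINT u:{0}|lebesgue. \<phi> u)"
      unfolding F_def set_lebesgue_integral_def by (subst integral_restrict_space) auto
    also have "\<dots> = 0" unfolding set_lebesgue_integral_def
    proof (rule integral_eq_zero_AE)
      show "AE x in lebesgue. indicator {0} x *\<^sub>R \<phi> x = 0"
        by (rule AE_I'[of "{0}"]) (auto simp: indicator_def)
    qed
    finally show ?thesis .
  qed
  ultimately show ?thesis by (simp add: F_def algebra_simps)
qed

section \<open>Jordan decomposition of signed set functions\<close>

text \<open>Real-valued countably additive set functions on a \<open>\<sigma>\<close>-algebra. Finiteness of all values is what
  makes them bounded, and boundedness is what makes the supremum in the Hahn decomposition finite.\<close>

locale signed_set_function = sigma_algebra \<Omega> \<A> for \<Omega> :: "'a set" and \<A> +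
  fixes \<sigma> :: "'a set \<Rightarrow> real"
  assumes sums: "\<And>A. range A \<subseteq> \<A> \<Longrightarrow> disjoint_family A \<Longrightarrow> (\<lambda>i::nat. \<sigma> (A i)) sums \<sigma> (\<Union>i. A i)"
begin

lemma empty_zero: "\<sigma> {} = 0"
proof -
  have "(\<lambda>i::nat. \<sigma> {}) sums \<sigma> (\<Union>i::nat. {})"
    by (rule sums) (auto simp: disjoint_family_on_def)
  then have "(\<lambda>i::nat. \<sigma> {}) \<longlonglongrightarrow> 0" using summable_LIMSEQ_zero sums_summable by blast
  then show ?thesis by (simp add: LIMSEQ_const_iff)
qed

lemma union_disjoint: "A \<in> \<A> \<Longrightarrow> B \<in> \<A> \<Longrightarrow> A \<inter> B = {} \<Longrightarrow> \<sigma> (A \<union> B) = \<sigma> A + \<sigma> B"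
proof -
  assume AB: "A \<in> \<A>" "B \<in> \<A>" "A \<inter> B = {}"
  have "(\<lambda>i. \<sigma> (binaryset A B i)) sums \<sigma> (\<Union>i. binaryset A B i)"
    using AB by (intro sums) (auto simp: range_binaryset_eq disjoint_family_on_def binaryset_def)
  moreover have "(\<lambda>i. \<sigma> (binaryset A B i)) sums (\<sigma> A + \<sigma> B)" using empty_zero by (rule binaryset_sums)
  ultimately show ?thesis by (simp add: sums_unique2 UN_binaryset_eq)
qed

lemma diff_subset: "A \<in> \<A> \<Longrightarrow> B \<in> \<A> \<Longrightarrow> B \<subseteq> A \<Longrightarrow> \<sigma> (A - B) = \<sigma> A - \<sigma> B"
  using union_disjoint[of "A - B" B] by (simp add: Un_absorb2 Diff Diff_disjoint Int_commute)

lemma split: "A \<in> \<A> \<Longrightarrow> B \<in> \<A> \<Longrightarrow> \<sigma> A = \<sigma> (A \<inter> B) + \<sigma> (A - B)"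
  using union_disjoint[of "A \<inter> B" "A - B"] by (auto simp: Int_Diff_Un)

text \<open>If values inside \<open>X\<close> are unbounded, then \<open>X\<close> splits into two parts of large absolute value, one of
  which is again of this kind. Discarding the other part repeatedly produces disjoint sets with
  values of modulus at least 1, against countable additivity.\<close>

lemma bounded: "\<exists>C. \<forall>B\<in>\<A>. \<bar>\<sigma> B\<bar> \<le> C"
proof (rule ccontr)
  \<comment> \<open>\<open>X\<close> is wild if the values on its subsets are unbounded.\<close>
  define wild where "wild X \<longleftrightarrow> X \<in> \<A> \<and> (\<forall>C. \<exists>B\<in>\<A>. B \<subseteq> X \<and> C < \<bar>\<sigma> B\<bar>)" for X
  assume "\<nexists>C. \<forall>B\<in>\<A>. \<bar>\<sigma> B\<bar> \<le> C"
  then have wild0: "wild \<Omega>" unfolding wild_def using sets_into_space by (meson not_le top)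
  have step: "\<exists>Y. wild Y \<and> Y \<subseteq> X \<and> 1 \<le> \<bar>\<sigma> (X - Y)\<bar>" if X: "wild X" for X
  proof -
    have XA: "X \<in> \<A>" using X by (simp add: wild_def)
    obtain B where B: "B \<in> \<A>" "B \<subseteq> X" "\<bar>\<sigma> X\<bar> + 1 < \<bar>\<sigma> B\<bar>" using X unfolding wild_def by blast
    have d: "\<sigma> (X - B) = \<sigma> X - \<sigma> B" using XA B diff_subset by blast
    have "wild B \<or> wild (X - B)"
    proof (rule ccontr)
      assume "\<not> (wild B \<or> wild (X - B))"
      then obtain c1 c2 where c: "\<And>D. D \<in> \<A> \<Longrightarrow> D \<subseteq> B \<Longrightarrow> \<bar>\<sigma> D\<bar> \<le> c1" "\<And>D. D \<in> \<A> \<Longrightarrow> D \<subseteq> X - B \<Longrightarrow> \<bar>\<sigma> D\<bar> \<le> c2"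
        using XA B unfolding wild_def by (metis Diff not_le)
      obtain D where D: "D \<in> \<A>" "D \<subseteq> X" "c1 + c2 < \<bar>\<sigma> D\<bar>" using X unfolding wild_def by blast
      have "\<sigma> D = \<sigma> (D \<inter> B) + \<sigma> (D - B)" using D B split by blast
      moreover have "\<bar>\<sigma> (D \<inter> B)\<bar> \<le> c1" "\<bar>\<sigma> (D - B)\<bar> \<le> c2" using D B by (intro c; auto)+
      ultimately show False using D by linarith
    qed
    then show ?thesis
    proof
      assume "wild B" then show ?thesis using B d by (intro exI[of _ B]) auto
    next
      assume w: "wild (X - B)"
      have "X - (X - B) = B" using B by auto
      then show ?thesis using w B by (intro exI[of _ "X - B"]) auto
    qed
  qed
  define nxt where "nxt X = (SOME Y. wild Y \<and> Y \<subseteq> X \<and> 1 \<le> \<bar>\<sigma> (X - Y)\<bar>)" for X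
  have nxt: "wild (nxt X) \<and> nxt X \<subseteq> X \<and> 1 \<le> \<bar>\<sigma> (X - nxt X)\<bar>" if "wild X" for X
    unfolding nxt_def using someI_ex[OF step[OF that]] .
  define X where "X n = (nxt ^^ n) \<Omega>" for n
  have wX: "wild (X n)" for n by (induction n) (use wild0 nxt in \<open>auto simp: X_def\<close>)
  have XS: "X (Suc n) = nxt (X n)" for n by (simp add: X_def)
  have "decseq X" using nxt[OF wX] by (intro decseq_SucI) (simp add: XS)
  define D where "D n = X n - X (Suc n)" for n
  have "disjoint_family D"
    unfolding disjoint_family_on_def
  proof (intro ballI impI)
    fix m n :: nat assume "m \<noteq> n"
    then consider "Suc m \<le> n" | "Suc n \<le> m" by linarith
    then show "D m \<inter> D n = {}"
      using decseqD[OF \<open>decseq X\<close>] by cases (fastforce simp: D_def)+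
  qed
  moreover have "range D \<subseteq> \<A>" using wX by (auto simp: D_def wild_def)
  ultimately have "(\<lambda>i. \<sigma> (D i)) \<longlonglongrightarrow> 0" using sums sums_summable summable_LIMSEQ_zero by blast
  then have "\<forall>\<^sub>F i in sequentially. \<bar>\<sigma> (D i)\<bar> < 1"
    by (auto simp: tendsto_iff dist_real_def dest: spec[of _ 1])
  then obtain i where "\<bar>\<sigma> (D i)\<bar> < 1" by (auto simp: eventually_sequentially)
  then show False using nxt[OF wX[of i]] by (simp add: D_def XS)
qed

lemma continuous_below:
  assumes A: "range A \<subseteq> \<A>" "incseq A"
  shows "(\<lambda>n. \<sigma> (A n)) \<longlonglongrightarrow> \<sigma> (\<Union>n. A n)"
proof -
  have r: "range (disjointed A) \<subseteq> \<A>" using A range_disjointed_sets by blast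
  have "(\<lambda>i. \<sigma> (disjointed A i)) sums \<sigma> (\<Union>n. A n)"
    using sums[OF r disjoint_family_disjointed] by (simp add: UN_disjointed_eq)
  then have "(\<lambda>n. \<Sum>i<Suc n. \<sigma> (disjointed A i)) \<longlonglongrightarrow> \<sigma> (\<Union>n. A n)"
    unfolding sums_def by (rule LIMSEQ_Suc)
  moreover have "(\<Sum>i<Suc n. \<sigma> (disjointed A i)) = \<sigma> (A n)" for n
  proof (induction n)
    case 0
    then show ?case by (simp add: disjointed_def)
  next
    case (Suc n)
    have "disjointed A (Suc n) = A (Suc n) - A n" using A(2) by (simp add: disjointed_mono)
    moreover have "\<sigma> (A (Suc n) - A n) = \<sigma> (A (Suc n)) - \<sigma> (A n)"
      using A by (intro diff_subset) (auto simp: incseq_SucD)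
    ultimately show ?case using Suc by simp
  qed
  ultimately show ?thesis by simp
qed

lemma continuous_above:
  assumes A: "range A \<subseteq> \<A>" "decseq A"
  shows "(\<lambda>n. \<sigma> (A n)) \<longlonglongrightarrow> \<sigma> (\<Inter>n. A n)"
proof -
  have "(\<lambda>n. \<sigma> (A 0 - A n)) \<longlonglongrightarrow> \<sigma> (\<Union>n. A 0 - A n)"
    using A by (intro continuous_below) (auto simp: incseq_def decseq_def)
  moreover have "(\<Union>n. A 0 - A n) = A 0 - (\<Inter>n. A n)" by auto
  moreover have "\<sigma> (A 0 - A n) = \<sigma> (A 0) - \<sigma> (A n)" for n
    using A by (intro diff_subset) (auto simp: decseq_def)
  moreover have "\<sigma> (A 0 - (\<Inter>n. A n)) = \<sigma> (A 0) - \<sigma> (\<Inter>n. A n)"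
    using A by (intro diff_subset) auto
  ultimately have "(\<lambda>n. \<sigma> (A 0) - \<sigma> (A n)) \<longlonglongrightarrow> \<sigma> (A 0) - \<sigma> (\<Inter>n. A n)" by simp
  from tendsto_diff[OF tendsto_const[of "\<sigma> (A 0)"] this] show ?thesis by simp
qed

text \<open>Since \<open>\<sigma>(A \<inter> B) \<ge> \<sigma>(A) + \<sigma>(B) - s\<close> for the supremum \<open>s\<close>, the limit inferior \<open>P\<close> of sets whose values
  tend to \<open>s\<close> geometrically has value \<open>s\<close>. A part of \<open>P\<close> with negative value could be removed and a
  disjoint set with positive value could be added, contradicting maximality.\<close>

lemma Hahn_decomposition:
  "\<exists>P\<in>\<A>. (\<forall>B\<in>\<A>. B \<subseteq> P \<longrightarrow> 0 \<le> \<sigma> B) \<and> (\<forall>B\<in>\<A>. B \<inter> P = {} \<longrightarrow> \<sigma> B \<le> 0)"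
proof -
  obtain C where C: "\<And>B. B \<in> \<A> \<Longrightarrow> \<bar>\<sigma> B\<bar> \<le> C" using bounded by blast
  define s where "s = Sup (\<sigma> ` \<A>)"
  have bdd: "bdd_above (\<sigma> ` \<A>)" using C by (intro bdd_aboveI[of _ C]) (auto simp: abs_le_iff)
  have s: "\<sigma> B \<le> s" if "B \<in> \<A>" for B unfolding s_def using bdd that by (intro cSup_upper) auto
  have "\<exists>B\<in>\<A>. s - (1/2)^n < \<sigma> B" for n :: nat
  proof -
    have "s - (1/2)^n < Sup (\<sigma> ` \<A>)" by (simp add: s_def)
    then show ?thesis using bdd empty_sets by (subst (asm) less_cSup_iff) auto
  qed
  then obtain p where p: "\<And>n. p n \<in> \<A>" "\<And>n. s - (1/2)^n < \<sigma> (p n)" by metis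
  \<comment> \<open>\<open>P\<close> will be the union over \<open>m\<close> of the intersections of all \<open>p n\<close> with \<open>n \<ge> m\<close>; the errors \<open>2\<^sup>-\<^sup>n\<close> add up to at most \<open>2 * 2\<^sup>-\<^sup>m\<close>.\<close>
  define I where "I m k = (\<Inter>n\<in>{m..m+k}. p n)" for m k :: nat
  have IA: "I m k \<in> \<A>" for m k unfolding I_def using p by (intro finite_INT) auto
  have I_low: "s - 2 * (1/2)^m + (1/2)^(m+k) \<le> \<sigma> (I m k)" for m k
  proof (induction k)
    case 0
    then show ?case using p(2)[of m] by (simp add: I_def)
  next
    case (Suc k)
    have e: "I m (Suc k) = I m k \<inter> p (Suc (m+k))" by (auto simp: I_def le_Suc_eq)
    have "\<sigma> (I m k \<union> p (Suc (m+k))) = \<sigma> (I m k - p (Suc (m+k))) + \<sigma> (p (Suc (m+k)))"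
      using union_disjoint[of "I m k - p (Suc (m+k))" "p (Suc (m+k))"] IA p by auto
    moreover have "\<sigma> (I m k) = \<sigma> (I m k \<inter> p (Suc (m+k))) + \<sigma> (I m k - p (Suc (m+k)))"
      using split IA p by blast
    moreover have "\<sigma> (I m k \<union> p (Suc (m+k))) \<le> s" using IA p by (intro s) auto
    ultimately show ?case using Suc p(2)[of "Suc (m+k)"] unfolding e by simp
  qed
  define J where "J m = (\<Inter>k. I m k)" for m
  have JA: "J m \<in> \<A>" for m unfolding J_def using IA by auto
  have J_low: "s - 2 * (1/2)^m \<le> \<sigma> (J m)" for m
  proof (rule LIMSEQ_le_const)
    show "(\<lambda>k. \<sigma> (I m k)) \<longlonglongrightarrow> \<sigma> (J m)" unfolding J_def
      using IA by (intro continuous_above) (auto simp: decseq_def I_def)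
    have "s - 2 * (1/2)^m \<le> \<sigma> (I m k)" for k
      using I_low[of m k] zero_le_power[of "1/2::real" "m+k"] by linarith
    then show "\<exists>N. \<forall>n\<ge>N. s - 2 * (1/2)^m \<le> \<sigma> (I m n)" by blast
  qed
  define P where "P = (\<Union>m. J m)"
  have PA: "P \<in> \<A>" unfolding P_def using JA by auto
  have "incseq J"
  proof (rule incseq_SucI, rule subsetI)
    fix m x assume "x \<in> J m"
    then have x: "\<And>n. n \<ge> m \<Longrightarrow> x \<in> p n" unfolding J_def I_def by (metis INT_D UNIV_I atLeastAtMost_iff le_iff_add le_refl)
    then show "x \<in> J (Suc m)" by (auto simp: J_def I_def)
  qed
  have "s \<le> \<sigma> P"
  proof (rule LIMSEQ_le)
    show "(\<lambda>m. \<sigma> (J m)) \<longlonglongrightarrow> \<sigma> P" unfolding P_def using JA \<open>incseq J\<close> by (intro continuous_below) auto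
    have "(\<lambda>m. s - 2 * (1/2)^m) \<longlonglongrightarrow> s - 2 * 0" by (intro tendsto_intros LIMSEQ_power_zero) auto
    then show "(\<lambda>m. s - 2 * (1/2)^m) \<longlonglongrightarrow> s" by simp
  qed (use J_low in auto)
  then have sP: "\<sigma> P = s" using s[OF PA] by simp
  show ?thesis
  proof (intro bexI[of _ P] conjI ballI impI PA)
    fix B assume "B \<in> \<A>" "B \<subseteq> P"
    then show "0 \<le> \<sigma> B" using diff_subset[of P B] s[of "P - B"] PA sP by auto
  next
    fix B assume "B \<in> \<A>" "B \<inter> P = {}"
    then show "\<sigma> B \<le> 0" using union_disjoint[of B P] s[of "B \<union> P"] PA sP by auto
  qed
qed

end

lemma vec_measuresD:
  "\<mu> \<in> vec_measures T \<Longrightarrow> range A \<subseteq> sets (borel_on T) \<Longrightarrow> disjoint_family A \<Longrightarrow>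
    (\<lambda>i::nat. \<mu> (A i)) sums \<mu> (\<Union>i. A i)"
  unfolding vec_measures_def by blast

lemma signed_set_function_component:
  assumes "\<mu> \<in> vec_measures T"
  shows "signed_set_function {0..T} (sets (borel_on T)) (component \<mu> j)"
proof -
  have "sigma_algebra (space (borel_on T)) (sets (borel_on T))" by (rule sets.sigma_algebra_axioms)
  moreover have "(\<lambda>i. component \<mu> j (A i)) sums component \<mu> j (\<Union>i. A i)"
    if "range A \<subseteq> sets (borel_on T)" "disjoint_family A" for A :: "nat \<Rightarrow> real set"
  proof -
    have "(\<lambda>i. \<mu> (A i)) sums \<mu> (\<Union>i. A i)" using assms that by (simp add: vec_measures_def)
    then show ?thesis unfolding component_def by (rule bounded_linear.sums[OF bounded_linear_vec_nth])
  qed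
  ultimately show ?thesis by (simp add: signed_set_function_def signed_set_function_axioms_def space_restrict_space)
qed

lemma ex_jordan_decomp:
  assumes "signed_set_function {0..T} (sets (borel_on T)) \<sigma>"
  shows "\<exists>p q. is_jordan_decomp T \<sigma> p q"
proof -
  interpret signed_set_function "{0..T}" "sets (borel_on T)" \<sigma> by fact
  obtain P where P: "P \<in> sets (borel_on T)" "\<And>B. B \<in> sets (borel_on T) \<Longrightarrow> B \<subseteq> P \<Longrightarrow> 0 \<le> \<sigma> B"
    "\<And>B. B \<in> sets (borel_on T) \<Longrightarrow> B \<inter> P = {} \<Longrightarrow> \<sigma> B \<le> 0"
    using Hahn_decomposition by (auto elim!: bexE)
  define p where "p = measure_of {0..T} (sets (borel_on T)) (\<lambda>B. ennreal (\<sigma> (B \<inter> P)))"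
  define q where "q = measure_of {0..T} (sets (borel_on T)) (\<lambda>B. ennreal (- \<sigma> (B - P)))"
  have sp: "sets p = sets (borel_on T)" "sets q = sets (borel_on T)" 
    using space_closed by (simp_all add: p_def q_def sigma_sets_eq)
  have spc: "space p = {0..T}" "space q = {0..T}" using space_closed by (simp_all add: p_def q_def space_measure_of)
  have ep: "emeasure p B = ennreal (\<sigma> (B \<inter> P))" if B: "B \<in> sets (borel_on T)" for B
    unfolding p_def
  proof (rule emeasure_measure_of_sigma[OF sigma_algebra_axioms _ _ B])
    show "countably_additive (sets (borel_on T)) (\<lambda>B. ennreal (\<sigma> (B \<inter> P)))"
    proof (rule countably_additiveI)
      fix A :: "nat \<Rightarrow> real set" assume A: "range A \<subseteq> sets (borel_on T)" "disjoint_family A"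
      have "(\<lambda>i. \<sigma> (A i \<inter> P)) sums \<sigma> (\<Union>i. A i \<inter> P)"
        using A P(1) by (intro sums) (auto simp: disjoint_family_on_def)
      moreover have "0 \<le> \<sigma> (A i \<inter> P)" for i using P(2)[of "A i \<inter> P"] A P(1) by auto
      ultimately have "(\<Sum>i. ennreal (\<sigma> (A i \<inter> P))) = ennreal (\<sigma> (\<Union>i. A i \<inter> P))"
        by (intro suminf_ennreal_eq)
      moreover have "(\<Union>i. A i \<inter> P) = (\<Union>i. A i) \<inter> P" by auto
      ultimately show "(\<Sum>i. ennreal (\<sigma> (A i \<inter> P))) = ennreal (\<sigma> ((\<Union>i. A i) \<inter> P))" by simp
    qed
  qed (simp add: positive_def empty_zero)
  have eq: "emeasure q B = ennreal (- \<sigma> (B - P))" if B: "B \<in> sets (borel_on T)" for B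
    unfolding q_def
  proof (rule emeasure_measure_of_sigma[OF sigma_algebra_axioms _ _ B])
    show "countably_additive (sets (borel_on T)) (\<lambda>B. ennreal (- \<sigma> (B - P)))"
    proof (rule countably_additiveI)
      fix A :: "nat \<Rightarrow> real set" assume A: "range A \<subseteq> sets (borel_on T)" "disjoint_family A"
      have "(\<lambda>i. \<sigma> (A i - P)) sums \<sigma> (\<Union>i. A i - P)"
        using A P(1) by (intro sums) (auto simp: disjoint_family_on_def)
      then have "(\<lambda>i. - \<sigma> (A i - P)) sums (- \<sigma> (\<Union>i. A i - P))" by (rule sums_minus)
      moreover have "0 \<le> - \<sigma> (A i - P)" for i using P(3)[of "A i - P"] A P(1) by auto
      ultimately have "(\<Sum>i. ennreal (- \<sigma> (A i - P))) = ennreal (- \<sigma> (\<Union>i. A i - P))"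
        by (intro suminf_ennreal_eq)
      moreover have "(\<Union>i. A i - P) = (\<Union>i. A i) - P" by auto
      ultimately show "(\<Sum>i. ennreal (- \<sigma> (A i - P))) = ennreal (- \<sigma> ((\<Union>i. A i) - P))" by simp
    qed
  qed (simp add: positive_def empty_zero)
  have "is_jordan_decomp T \<sigma> p q"
    unfolding is_jordan_decomp_def pos_measures_def
  proof (intro conjI CollectI ballI bexI[of _ P])
    show "finite_measure p" by (rule finite_measureI) (use top in \<open>simp add: spc ep\<close>)
    show "finite_measure q" by (rule finite_measureI) (use top in \<open>simp add: spc eq\<close>)
    fix B assume B: "B \<in> sets (borel_on T)"
    have "measure p B = \<sigma> (B \<inter> P)" using B P by (intro measure_eq_emeasure_eq_ennreal) (auto simp: ep)
    moreover have "0 \<le> - \<sigma> (B - P)" using P(3)[of "B - P"] P(1) B by auto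
    then have "measure q B = - \<sigma> (B - P)" using B by (intro measure_eq_emeasure_eq_ennreal) (auto simp: eq)
    ultimately show "\<sigma> B = measure p B - measure q B" using split[OF B P(1)] by simp
  next
    show "emeasure q P = 0" using P(1) by (simp add: eq empty_zero)
    have "({0..T} - P) \<inter> P = {}" by auto
    then show "emeasure p ({0..T} - P) = 0" using P(1) top by (subst ep) (auto simp: empty_zero)
  qed (use sp P in auto)
  then show ?thesis by blast
qed

text \<open>On the carrier \<open>P\<close> of \<open>p\<close> the set function equals \<open>p\<close>, hence is dominated by the positive part of
  any other decomposition.\<close>

lemma jordan_decomp_unique_le:
  assumes J: "is_jordan_decomp T \<sigma> p q" "is_jordan_decomp T \<sigma> p' q'" and B: "B \<in> sets (borel_on T)"
  shows "measure p B \<le> measure p' B"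
proof -
  interpret p: finite_measure p using J by (simp add: is_jordan_decomp_def pos_measures_def)
  interpret q: finite_measure q using J by (simp add: is_jordan_decomp_def pos_measures_def)
  interpret p': finite_measure p' using J by (simp add: is_jordan_decomp_def pos_measures_def)
  have s: "sets p = sets (borel_on T)" "sets q = sets (borel_on T)" "sets p' = sets (borel_on T)"
    using J by (auto simp: is_jordan_decomp_def pos_measures_def)
  obtain P where P: "P \<in> sets (borel_on T)" "emeasure q P = 0" "emeasure p ({0..T} - P) = 0"
    using J by (auto simp: is_jordan_decomp_def)
  have Bsub: "B \<subseteq> {0..T}" using sets.sets_into_space[OF B] by (simp add: space_restrict_space)
  have BP: "B \<inter> P \<in> sets (borel_on T)" "B - P \<in> sets (borel_on T)" using B P by auto
  have "emeasure p (B - P) = 0"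
  proof -
    have "{0..T} - P \<in> sets p" using P(1) s sets.compl_sets[of P "borel_on T"] by (simp add: space_restrict_space)
    moreover have "B - P \<subseteq> {0..T} - P" using Bsub by auto
    ultimately have "emeasure p (B - P) \<le> emeasure p ({0..T} - P)" by (intro emeasure_mono)
    then show ?thesis using P(3) by simp
  qed
  then have "measure p B = measure p (B \<inter> P)"
    using p.finite_measure_Diff'[of B P] B P s by (simp add: measure_def)
  also have "\<dots> = \<sigma> (B \<inter> P)"
  proof -
    have "emeasure q (B \<inter> P) = 0" using P(2) emeasure_mono[of "B \<inter> P" P q] P(1) s by auto
    then show ?thesis using J(1) BP by (auto simp: is_jordan_decomp_def measure_def)
  qed
  also have "\<dots> \<le> measure p' (B \<inter> P)" using J(2) BP by (simp add: is_jordan_decomp_def)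
  also have "\<dots> \<le> measure p' B" using B s by (intro p'.finite_measure_mono) auto
  finally show ?thesis .
qed

lemma jordan_decomp_unique:
  assumes J: "is_jordan_decomp T \<sigma> p q" "is_jordan_decomp T \<sigma> p' q'"
  shows "p = p'" "q = q'"
proof -
  have fin: "finite_measure p" "finite_measure q" "finite_measure p'" "finite_measure q'"
    and s: "sets p = sets (borel_on T)" "sets q = sets (borel_on T)" "sets p' = sets (borel_on T)" "sets q' = sets (borel_on T)"
    using J by (auto simp: is_jordan_decomp_def pos_measures_def)
  have e: "measure p B = measure p' B" if "B \<in> sets (borel_on T)" for B
    using jordan_decomp_unique_le[OF J that] jordan_decomp_unique_le[OF J(2,1) that] by simp
  have e2: "measure q B = measure q' B" if "B \<in> sets (borel_on T)" for B
    using e[OF that] J that unfolding is_jordan_decomp_def by (metis add_diff_cancel_left' diff_diff_eq2 diff_add_cancel)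
  show "p = p'" using e s fin by (intro measure_eqI) (auto simp: finite_measure.emeasure_eq_measure)
  show "q = q'" using e2 s fin by (intro measure_eqI) (auto simp: finite_measure.emeasure_eq_measure)
qed

lemma is_jordan_decomp_jordan:
  assumes "signed_set_function {0..T} (sets (borel_on T)) \<sigma>"
  shows "is_jordan_decomp T \<sigma> (jordan_pos T \<sigma>) (jordan_neg T \<sigma>)"
proof -
  obtain p q where pq: "is_jordan_decomp T \<sigma> p q" using ex_jordan_decomp[OF assms] by blast
  have "jordan_pos T \<sigma> = p" unfolding jordan_pos_def using pq jordan_decomp_unique by (intro the_equality) blast+
  moreover have "jordan_neg T \<sigma> = q" unfolding jordan_neg_def using pq jordan_decomp_unique by (intro the_equality) blast+
  ultimately show ?thesis using pq by simp
qed

text \<open>At an atom the two parts would have the same positive mass, but they live on disjoint sets.\<close>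

lemma jordan_no_atoms:
  assumes J: "is_jordan_decomp T \<sigma> p q" and 0: "\<And>t. t \<in> {0..T} \<Longrightarrow> \<sigma> {t} = 0" "\<sigma> {} = 0"
  shows "emeasure p {t} = 0" "emeasure q {t} = 0"
proof -
  have s: "sets p = sets (borel_on T)" "sets q = sets (borel_on T)" and fin: "finite_measure p" "finite_measure q"
    using J by (auto simp: is_jordan_decomp_def pos_measures_def)
  obtain P where P: "P \<in> sets (borel_on T)" "emeasure q P = 0" "emeasure p ({0..T} - P) = 0"
    using J by (auto simp: is_jordan_decomp_def)
  have "emeasure p {t} = 0 \<and> emeasure q {t} = 0"
  proof (cases "t \<in> {0..T}")
    case False
    then have "{t} \<notin> sets (borel_on T)" using sets.sets_into_space[of "{t}" "borel_on T"] by (auto simp: space_restrict_space)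
    then show ?thesis using s by (simp add: emeasure_notin_sets)
  next
    case True
    then have tm: "{t} \<in> sets (borel_on T)" by (auto simp: sets_restrict_space)
    have eqm: "measure p {t} = measure q {t}" using J tm 0(1)[OF True] by (auto simp: is_jordan_decomp_def)
    have "measure p {t} = 0 \<or> measure q {t} = 0"
    proof (cases "t \<in> P")
      case True
      then have "emeasure q {t} = 0" using P emeasure_mono[of "{t}" P q] s by auto
      then show ?thesis by (simp add: measure_def)
    next
      case False
      have "{0..T} - P \<in> sets p" using P(1) s sets.compl_sets[of P "borel_on T"] by (simp add: space_restrict_space)
      then have "emeasure p {t} = 0" using P emeasure_mono[of "{t}" "{0..T} - P" p] False True by auto
      then show ?thesis by (simp add: measure_def)
    qed
    then show ?thesis using eqm fin by (simp add: finite_measure.emeasure_eq_measure)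
  qed
  then show "emeasure p {t} = 0" "emeasure q {t} = 0" by auto
qed

text \<open>Infinitely many points with \<open>|\<mu>{t}| > 1/k\<close> would give a disjoint sequence whose values do not tend to 0.\<close>

lemma countable_atoms:
  fixes \<mu> :: "real set \<Rightarrow> real ^ 'm"
  assumes "\<mu> \<in> vec_measures T"
  shows "countable {t\<in>{0..T}. \<mu> {t} \<noteq> 0}"
proof -
  have fin: "finite {t\<in>{0..T}. norm (\<mu> {t}) > 1 / real (Suc k)}" (is "finite ?A") for k
  proof (rule ccontr)
    assume "infinite ?A"
    then obtain u :: "nat \<Rightarrow> real" where u: "inj u" "range u \<subseteq> ?A"
      using infinite_countable_subset by blast
    have "(\<lambda>i. \<mu> {u i}) sums \<mu> (\<Union>i. {u i})"
    proof -
      have "disjoint_family (\<lambda>i. {u i})" using u(1) by (auto simp: disjoint_family_on_def inj_def)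
      moreover have "range (\<lambda>i. {u i}) \<subseteq> sets (borel_on T)"
        using u(2) by (auto simp: sets_restrict_space_iff)
      ultimately show ?thesis using vec_measuresD[OF assms] by blast
    qed
    then have "(\<lambda>i. \<mu> {u i}) \<longlonglongrightarrow> 0" using sums_summable summable_LIMSEQ_zero by blast
    from LIMSEQ_D[OF this, of "1 / real (Suc k)"]
    obtain i where "norm (\<mu> {u i}) < 1 / real (Suc k)" by auto
    then show False using u(2) by (auto simp: subset_iff not_less dest!: spec[of _ "u i"])
  qed
  have "{t\<in>{0..T}. \<mu> {t} \<noteq> 0} \<subseteq> (\<Union>k. {t\<in>{0..T}. norm (\<mu> {t}) > 1 / real (Suc k)})"
  proof
    fix t assume t: "t \<in> {t\<in>{0..T}. \<mu> {t} \<noteq> 0}"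
    then obtain k where "1 / real (Suc k) < norm (\<mu> {t})" by (metis (mono_tags, lifting) mem_Collect_eq inverse_eq_divide reals_Archimedean zero_less_norm_iff)
    then show "t \<in> (\<Union>k. {t\<in>{0..T}. norm (\<mu> {t}) > 1 / real (Suc k)})" using t by blast
  qed
  then show ?thesis by (rule countable_subset) (use fin in \<open>auto intro: countable_finite\<close>)
qed

text \<open>The set of all \<open>t\<close> with \<open>\<mu>{t} \<noteq> 0\<close> need not be measurable, as values of \<open>\<mu>\<close> off the Borel subsets of
  \<open>[0,T]\<close> are arbitrary. Only its intersection with \<open>[0,T]\<close> matters, and that is countable.\<close>

lemma vec_cont_part_vec_measures:
  assumes "\<mu> \<in> vec_measures T"
  shows "vec_cont_part \<mu> \<in> vec_measures T"
  unfolding vec_measures_def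
proof (intro CollectI allI impI)
  fix A :: "nat \<Rightarrow> real set" assume A: "range A \<subseteq> sets (borel_on T) \<and> disjoint_family A"
  define D where "D = {t\<in>{0..T}. \<mu> {t} \<noteq> 0}"
  have Dm: "D \<in> sets (borel_on T)"
  proof -
    have "countable D" unfolding D_def by (rule countable_atoms[OF assms])
    then have "D \<in> sets borel" by (rule sets.countable[rotated]) simp
    moreover have "D \<subseteq> {0..T}" by (auto simp: D_def)
    ultimately show ?thesis by (auto simp: sets_restrict_space_iff)
  qed
  have e: "B - {t. \<mu> {t} \<noteq> 0} = B - D" if "B \<subseteq> {0..T}" for B using that by (auto simp: D_def)
  have sub: "A i \<subseteq> {0..T}" for i using A sets.sets_into_space[of "A i" "borel_on T"] by (auto simp: space_restrict_space)
  have "(\<lambda>i. \<mu> (A i - D)) sums \<mu> (\<Union>i. A i - D)"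
  proof -
    have "range (\<lambda>i. A i - D) \<subseteq> sets (borel_on T)" using A Dm by auto
    moreover have "disjoint_family (\<lambda>i. A i - D)" using A by (auto simp: disjoint_family_on_def)
    ultimately show ?thesis using vec_measuresD[OF assms] by blast
  qed
  moreover have "(\<Union>i. A i - D) = (\<Union>i. A i) - D" by auto
  ultimately show "(\<lambda>i. vec_cont_part \<mu> (A i)) sums vec_cont_part \<mu> (\<Union>i. A i)"
    unfolding vec_cont_part_def using e[OF sub] e[of "\<Union>i. A i"] sub by (simp add: UN_subset_iff)
qed

lemma jordan_cont_part:
  fixes \<mu> :: "real set \<Rightarrow> real ^ 'm"
  assumes "\<mu> \<in> vec_measures T" and "\<rho> = jordan_pos T (component (vec_cont_part \<mu>) j) \<or> \<rho> = jordan_neg T (component (vec_cont_part \<mu>) j)"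
  shows "finite_measure \<rho>" "sets \<rho> = sets (borel_on T)" "emeasure \<rho> {t} = 0"
proof -
  have J: "is_jordan_decomp T (component (vec_cont_part \<mu>) j) (jordan_pos T (component (vec_cont_part \<mu>) j)) (jordan_neg T (component (vec_cont_part \<mu>) j))"
    by (intro is_jordan_decomp_jordan signed_set_function_component vec_cont_part_vec_measures assms)
  have 0: "\<mu> {} = 0"
  proof -
    have "signed_set_function {0..T} (sets (borel_on T)) (component \<mu> j)" for j using assms by (intro signed_set_function_component)
    then have "component \<mu> j {} = 0" for j by (rule signed_set_function.empty_zero)
    then show ?thesis by (simp add: component_def vec_eq_iff)
  qed
  have "component (vec_cont_part \<mu>) j {s} = 0" for s
  proof -
    have "{s} - {t. \<mu> {t} \<noteq> 0} = (if \<mu> {s} = 0 then {s} else {})" by auto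
    then show ?thesis using 0 by (simp add: component_def vec_cont_part_def)
  qed
  then show "finite_measure \<rho>" "sets \<rho> = sets (borel_on T)" "emeasure \<rho> {t} = 0"
    using J assms(2) jordan_no_atoms[OF J] 0
    by (auto simp: is_jordan_decomp_def pos_measures_def component_def vec_cont_part_def)
qed

section \<open>Volterra equations driven by finitely many measures\<close>

text \<open>Each coordinate of \<open>Y\<close> is the difference of the nondecreasing functions \<open>Y\<^sub>i + m\<close> and \<open>m\<close>. This is
  the source of measurability for all solutions below.\<close>

lemma borel_measurable_if_increments_dominated:
  fixes Y :: "real \<Rightarrow> 'b::euclidean_space" and m :: "real \<Rightarrow> real"
  assumes inc: "\<And>s t. s \<le> t \<Longrightarrow> norm (Y t - Y s) \<le> m t - m s"
  shows "Y \<in> borel_measurable borel"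
proof -
  have "(\<lambda>t. Y t \<bullet> i) \<in> borel_measurable borel" if i: "i \<in> Basis" for i
  proof -
    have le: "\<bar>Y t \<bullet> i - Y s \<bullet> i\<bar> \<le> m t - m s" if "s \<le> t" for s t
      using Basis_le_norm[OF i, of "Y t - Y s"] inc[OF that] by (simp add: inner_diff_left)
    have "mono (\<lambda>t. Y t \<bullet> i + m t)"
      unfolding mono_def
    proof (intro allI impI)
      fix s t :: real assume "s \<le> t"
      from le[OF this] show "Y s \<bullet> i + m s \<le> Y t \<bullet> i + m t" by linarith
    qed
    moreover have "mono m"
      unfolding mono_def
    proof (intro allI impI)
      fix s t :: real assume "s \<le> t"
      from le[OF this] show "m s \<le> m t" by linarith
    qed
    ultimately have "(\<lambda>t. (Y t \<bullet> i + m t) - m t) \<in> borel_measurable borel"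
      by (intro borel_measurable_diff borel_measurable_mono)
    then show ?thesis by simp
  qed
  then show ?thesis by (subst borel_measurable_euclidean_space) simp
qed

text \<open>The driving measures of an integral equation on \<open>[a,b]\<close>. Their \<open>\<sigma>\<close>-algebras and spaces may be
  larger than the Borel sets of \<open>[a,b]\<close>: Lebesgue measure, Borel measures restricted to another
  interval, and discrete measures on all subsets all qualify.\<close>

locale driver_family =
  fixes a b :: real and I :: "'i set" and \<rho> :: "'i \<Rightarrow> real measure"
  assumes ab: "a \<le> b" and finite_I: "finite I"
    and finite_driver: "\<And>i. i \<in> I \<Longrightarrow> finite_measure (\<rho> i)"
    and borel_driver: "\<And>i B. i \<in> I \<Longrightarrow> B \<in> sets borel \<Longrightarrow> B \<subseteq> {a..b} \<Longrightarrow> B \<in> sets (\<rho> i)"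
begin

definition mass :: "real set \<Rightarrow> real" where
  "mass S = (\<Sum>i\<in>I. measure (\<rho> i) S)"

definition driver_integral :: "('i \<Rightarrow> real \<Rightarrow> 'b::euclidean_space) \<Rightarrow> real set \<Rightarrow> 'b" where
  "driver_integral \<phi> S = (\<Sum>i\<in>I. LINT s:S|\<rho> i. \<phi> i s)"

definition admissible :: "real \<Rightarrow> ('i \<Rightarrow> real \<Rightarrow> 'b::euclidean_space) \<Rightarrow> bool" where
  "admissible C \<phi> \<longleftrightarrow> (\<forall>i\<in>I. (\<lambda>s. indicator {a..b} s *\<^sub>R \<phi> i s) \<in> borel_measurable (\<rho> i) \<and>
     (\<forall>s\<in>{a..b}. norm (\<phi> i s) \<le> C))"

abbreviation test_set :: "real set \<Rightarrow> bool" where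
  "test_set S \<equiv> S \<in> sets borel \<and> S \<subseteq> {a..b}"

lemma borel_imp_driver_measurable:
  assumes Y: "(Y :: real \<Rightarrow> 'b::euclidean_space) \<in> borel_measurable borel" and i: "i \<in> I"
  shows "(\<lambda>s. indicator {a..b} s *\<^sub>R Y s) \<in> borel_measurable (\<rho> i)"
proof (rule borel_measurableI)
  fix U :: "'b set" assume U: "open U"
  let ?Z = "\<lambda>s. indicator {a..b} s *\<^sub>R Y s"
  have Z: "?Z \<in> borel_measurable borel" using Y by measurable
  have sub: "B \<in> sets (\<rho> i)" if "B \<in> sets borel" "B \<subseteq> {a..b}" for B
    using borel_driver[OF i that] .
  have spc: "{a..b} \<subseteq> space (\<rho> i)" using sub[of "{a..b}"] sets.sets_into_space by auto
  show "?Z -` U \<inter> space (\<rho> i) \<in> sets (\<rho> i)"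
  proof (cases "0 \<in> U")
    case False
    have "?Z -` U \<in> sets borel" using measurable_sets[OF Z, of U] U by simp
    moreover have sZ: "?Z -` U \<subseteq> {a..b}"
    proof
      fix x assume x: "x \<in> ?Z -` U"
      show "x \<in> {a..b}" by (rule ccontr) (use x False in simp)
    qed
    ultimately have "?Z -` U \<in> sets (\<rho> i)" by (rule sub)
    moreover have "?Z -` U \<inter> space (\<rho> i) = ?Z -` U" using sZ spc by blast
    ultimately show ?thesis by simp
  next
    case True
    have "?Z -` (- U) \<in> sets borel" using measurable_sets[OF Z, of "- U"] U by simp
    moreover have "?Z -` (- U) \<subseteq> {a..b}"
    proof
      fix x assume x: "x \<in> ?Z -` (- U)"
      show "x \<in> {a..b}" by (rule ccontr) (use x True in simp)
    qed
    ultimately have "?Z -` (- U) \<in> sets (\<rho> i)" by (rule sub)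
    moreover have "?Z -` U \<inter> space (\<rho> i) = space (\<rho> i) - ?Z -` (- U)" by auto
    ultimately show ?thesis by simp
  qed
qed

lemma admissible_borel:
  assumes "(Y :: real \<Rightarrow> 'b::euclidean_space) \<in> borel_measurable borel" "\<And>s. s \<in> {a..b} \<Longrightarrow> norm (Y s) \<le> C"
  shows "admissible C (\<lambda>_. Y)"
  using assms borel_imp_driver_measurable by (auto simp: admissible_def)

lemma admissible_integrable:
  assumes "admissible C \<phi>" "test_set S" "i \<in> I"
  shows "set_integrable (\<rho> i) S (\<phi> i)"
  unfolding set_integrable_def
proof (rule finite_measure.integrable_const_bound[OF finite_driver])
  have S: "S \<in> sets (\<rho> i)" using borel_driver assms by blast
  have [measurable]: "(\<lambda>s. indicator {a..b} s *\<^sub>R \<phi> i s) \<in> borel_measurable (\<rho> i)" using assms by (simp add: admissible_def)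
  have "(\<lambda>s. indicator S s *\<^sub>R (indicator {a..b} s *\<^sub>R \<phi> i s)) \<in> borel_measurable (\<rho> i)"
    using S by measurable
  moreover have "(\<lambda>s. indicator S s *\<^sub>R (indicator {a..b} s *\<^sub>R \<phi> i s)) = (\<lambda>s. indicator S s *\<^sub>R \<phi> i s)"
    using assms(2) by (auto simp: indicator_def fun_eq_iff)
  ultimately show "(\<lambda>s. indicator S s *\<^sub>R \<phi> i s) \<in> borel_measurable (\<rho> i)" by simp
  have "norm (indicat_real S s *\<^sub>R \<phi> i s) \<le> max C 0" for s
  proof (cases "s \<in> S")
    case True
    then have "norm (\<phi> i s) \<le> C" using assms by (auto simp: admissible_def)
    then show ?thesis using True by simp
  qed simp
  then show "AE s in \<rho> i. norm (indicat_real S s *\<^sub>R \<phi> i s) \<le> max C 0" by simp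
qed (use assms in simp)

lemma mass_nonneg[simp]: "0 \<le> mass S" by (simp add: mass_def sum_nonneg)

lemma mass_empty[simp]: "mass {} = 0" by (simp add: mass_def)

lemma mass_Un: "test_set S \<Longrightarrow> test_set S' \<Longrightarrow> S \<inter> S' = {} \<Longrightarrow> mass (S \<union> S') = mass S + mass S'"
  unfolding mass_def sum.distrib[symmetric] using borel_driver finite_driver
  by (intro sum.cong refl) (simp add: finite_measure.finite_measure_Union)

lemma mass_mono: "test_set S \<Longrightarrow> S' \<subseteq> S \<Longrightarrow> S' \<in> sets borel \<Longrightarrow> mass S' \<le> mass S"
  unfolding mass_def using borel_driver finite_driver
  by (intro sum_mono finite_measure.finite_measure_mono) auto

lemma driver_integral_Un:
  assumes "admissible C \<phi>" "test_set S" "test_set S'" "S \<inter> S' = {}"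
  shows "driver_integral \<phi> (S \<union> S') = driver_integral \<phi> S + driver_integral \<phi> S'"
  unfolding driver_integral_def sum.distrib[symmetric]
  using assms by (intro sum.cong refl set_integral_Un admissible_integrable[OF assms(1)]) auto

lemma driver_integral_const:
  assumes "test_set S"
  shows "driver_integral (\<lambda>_ _. c :: real) S = c * mass S"
  unfolding driver_integral_def mass_def sum_distrib_left
proof (intro sum.cong refl)
  fix i assume "i \<in> I"
  then have "S \<inter> space (\<rho> i) = S" using borel_driver[of i S] assms sets.sets_into_space[of S "\<rho> i"] by auto
  then show "(LINT s:S|\<rho> i. c) = c * measure (\<rho> i) S" by (simp add: set_lebesgue_integral_def)
qed

lemma driver_integral_mono:
  assumes "admissible C \<phi>" "admissible C' \<psi>" "test_set S"
    and "\<And>i s. i \<in> I \<Longrightarrow> s \<in> S \<Longrightarrow> \<phi> i s \<le> (\<psi> i s :: real)"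
  shows "driver_integral \<phi> S \<le> driver_integral \<psi> S"
  unfolding driver_integral_def using assms
  by (intro sum_mono set_integral_mono admissible_integrable) auto

lemma driver_integral_norm_le:
  assumes "admissible C \<phi>" "admissible C' \<psi>" "test_set S"
    and "\<And>i s. i \<in> I \<Longrightarrow> s \<in> S \<Longrightarrow> norm (\<phi> i s) \<le> (\<psi> i s :: real)"
  shows "norm (driver_integral \<phi> S) \<le> driver_integral \<psi> S"
proof -
  have "norm (driver_integral \<phi> S) \<le> (\<Sum>i\<in>I. norm (LINT s:S|\<rho> i. \<phi> i s))"
    unfolding driver_integral_def by (rule norm_sum)
  also have "\<dots> \<le> driver_integral \<psi> S"
    unfolding driver_integral_def
  proof (intro sum_mono)
    fix i assume i: "i \<in> I"
    show "norm (LINT s:S|\<rho> i. \<phi> i s) \<le> (LINT s:S|\<rho> i. \<psi> i s)"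
      unfolding set_lebesgue_integral_def
    proof (rule Bochner_Integration.integral_norm_bound_integral)
      show "integrable (\<rho> i) (\<lambda>x. indicat_real S x *\<^sub>R \<phi> i x)" "integrable (\<rho> i) (\<lambda>x. indicat_real S x *\<^sub>R \<psi> i x)"
        using admissible_integrable[OF assms(1,3) i] admissible_integrable[OF assms(2,3) i] by (auto simp: set_integrable_def)
      show "norm (indicat_real S x *\<^sub>R \<phi> i x) \<le> indicat_real S x *\<^sub>R \<psi> i x" for x
        using assms(4)[OF i] by (cases "x \<in> S") auto
    qed
  qed
  finally show ?thesis .
qed

lemma admissible_const: "admissible \<bar>c\<bar> (\<lambda>_ _. c :: real)"
  by (intro admissible_borel) auto

lemma driver_integral_norm_le_mass:
  assumes "admissible C \<phi>" "test_set S"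
  shows "norm (driver_integral \<phi> S) \<le> C * mass S"
proof -
  have "norm (driver_integral \<phi> S) \<le> driver_integral (\<lambda>_ _. C) S"
    using assms by (intro driver_integral_norm_le[OF _ admissible_const]) (auto simp: admissible_def)
  then show ?thesis using driver_integral_const[OF assms(2)] by simp
qed

lemma admissible_diff:
  "admissible C \<phi> \<Longrightarrow> admissible C' \<psi> \<Longrightarrow> admissible (C + C') (\<lambda>i s. \<phi> i s - \<psi> i s)"
  unfolding admissible_def
proof (intro ballI conjI)
  fix i assume a: "\<forall>i\<in>I. (\<lambda>s. indicat_real {a..b} s *\<^sub>R \<phi> i s) \<in> borel_measurable (\<rho> i) \<and> (\<forall>s\<in>{a..b}. norm (\<phi> i s) \<le> C)"
    "\<forall>i\<in>I. (\<lambda>s. indicat_real {a..b} s *\<^sub>R \<psi> i s) \<in> borel_measurable (\<rho> i) \<and> (\<forall>s\<in>{a..b}. norm (\<psi> i s) \<le> C')" and i: "i \<in> I"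
  show "(\<lambda>s. indicat_real {a..b} s *\<^sub>R (\<phi> i s - \<psi> i s)) \<in> borel_measurable (\<rho> i)"
    unfolding scaleR_diff_right using a i by (intro borel_measurable_diff) auto
  show "norm (\<phi> i s - \<psi> i s) \<le> C + C'" if "s \<in> {a..b}" for s
    using a i that norm_triangle_ineq4[of "\<phi> i s" "\<psi> i s"] by fastforce
qed

lemma driver_integral_diff:
  assumes "admissible C \<phi>" "admissible C' \<psi>" "test_set S"
  shows "driver_integral (\<lambda>i s. \<phi> i s - \<psi> i s) S = driver_integral \<phi> S - driver_integral \<psi> S"
  unfolding driver_integral_def sum_subtractf[symmetric] using assms
  by (intro sum.cong refl) (simp add: set_integral_diff admissible_integrable)

lemma driver_integral_cmult:
  "driver_integral (\<lambda>i s. c * \<phi> i s :: real) S = c * driver_integral \<phi> S"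
  unfolding driver_integral_def sum_distrib_left by simp

lemma mass_left_open_tendsto_0:
  assumes t: "a < t" "t \<le> b"
  shows "((\<lambda>s. mass {s<..<t}) \<longlongrightarrow> 0) (at_left t)"
  unfolding mass_def
proof (rule tendsto_null_sum)
  fix i assume i: "i \<in> I"
  interpret finite_measure "\<rho> i" using finite_driver i by simp
  show "((\<lambda>s. measure (\<rho> i) {s<..<t}) \<longlongrightarrow> 0) (at_left t)"
  proof (rule tendsto_at_left_sequentially[OF t(1)])
    fix S :: "nat \<Rightarrow> real" assume S: "\<And>n. S n < t" "\<And>n. a < S n" "incseq S" "S \<longlonglongrightarrow> t"
    have "(\<lambda>n. measure (\<rho> i) {S n<..<t}) \<longlonglongrightarrow> measure (\<rho> i) (\<Inter>n. {S n<..<t})"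
    proof (rule Lim_measure_decseq)
      show "range (\<lambda>n. {S n<..<t}) \<subseteq> sets (\<rho> i)"
      proof (clarify)
        fix n show "{S n<..<t} \<in> sets (\<rho> i)" using S(2)[of n] t by (intro borel_driver[OF i]) auto
      qed
      show "decseq (\<lambda>n. {S n<..<t})" using S(3) by (force simp: decseq_def incseq_def intro: order.strict_trans1)
    qed simp
    moreover have "(\<Inter>n. {S n<..<t}) = {}"
    proof (rule ccontr)
      assume "(\<Inter>n. {S n<..<t}) \<noteq> {}"
      then obtain x where x: "\<forall>n. S n < x" "x < t" by force
      then have "t \<le> x" by (intro LIMSEQ_le_const2[OF S(4)]) (auto intro: less_imp_le)
      then show False using x by simp
    qed
    ultimately show "(\<lambda>n. measure (\<rho> i) {S n<..<t}) \<longlonglongrightarrow> 0" by simp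
  qed
qed

lemma driver_integral_left_limit:
  assumes adm: "admissible C \<phi>" and t: "a < t" "t \<le> b"
  shows "((\<lambda>s. driver_integral \<phi> {a..s}) \<longlongrightarrow> driver_integral \<phi> {a..<t}) (at_left t)"
proof (rule Lim_transform2)
  show "((\<lambda>s. driver_integral \<phi> {a..<t}) \<longlongrightarrow> driver_integral \<phi> {a..<t}) (at_left t)" by simp
  show "((\<lambda>s. driver_integral \<phi> {a..<t} - driver_integral \<phi> {a..s}) \<longlongrightarrow> 0) (at_left t)"
  proof (rule tendsto_norm_zero_cancel, rule tendsto_sandwich[of "\<lambda>_. 0" _ _ "\<lambda>s. C * mass {s<..<t}"])
    show "\<forall>\<^sub>F s in at_left t. norm (driver_integral \<phi> {a..<t} - driver_integral \<phi> {a..s}) \<le> C * mass {s<..<t}"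
      using eventually_at_left_real[OF t(1)]
    proof eventually_elim
      fix s assume s: "s \<in> {a<..<t}"
      have "{a..<t} = {a..s} \<union> {s<..<t}" using s by auto
      then have "driver_integral \<phi> {a..<t} = driver_integral \<phi> {a..s} + driver_integral \<phi> {s<..<t}"
        using driver_integral_Un[OF adm, of "{a..s}" "{s<..<t}"] s t by (simp add: subset_iff disjoint_iff)
      moreover have "norm (driver_integral \<phi> {s<..<t}) \<le> C * mass {s<..<t}"
        using s t by (intro driver_integral_norm_le_mass[OF adm]) auto
      ultimately show "norm (driver_integral \<phi> {a..<t} - driver_integral \<phi> {a..s}) \<le> C * mass {s<..<t}" by simp
    qed
    show "((\<lambda>s. C * mass {s<..<t}) \<longlongrightarrow> 0) (at_left t)"
      using tendsto_mult_right_zero[OF mass_left_open_tendsto_0[OF t]] .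
  qed auto
qed

text \<open>Extending functions of \<open>t \<in> [a,b]\<close> to the real line by their boundary values keeps them Borel and
  monotone.\<close>

definition clamp :: "real \<Rightarrow> real" where "clamp t = max a (min b t)"

lemma clamp_in: "clamp t \<in> {a..b}" "s \<le> t \<Longrightarrow> clamp s \<le> clamp t" "t \<in> {a..b} \<Longrightarrow> clamp t = t"
  using ab by (auto simp: clamp_def)

lemma test_clamp: "test_set {a..<clamp t}" "s \<le> t \<Longrightarrow> test_set {clamp s..<clamp t}"
  using clamp_in(1)[of t] clamp_in(1)[of s] by auto

lemma split_clamp:
  assumes "s \<le> t" shows "{a..<clamp t} = {a..<clamp s} \<union> {clamp s..<clamp t}"
  using clamp_in(1)[of s] clamp_in(2)[OF assms] by auto

lemma mass_clamp_diff:
  assumes "s \<le> t" shows "mass {clamp s..<clamp t} = mass {a..<clamp t} - mass {a..<clamp s}"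
proof -
  have "mass {a..<clamp t} = mass {a..<clamp s} + mass {clamp s..<clamp t}"
    unfolding split_clamp[OF assms] using test_clamp[of s] test_clamp(2)[OF assms] by (intro mass_Un) auto
  then show ?thesis by simp
qed

lemma driver_integral_clamp_increment:
  assumes "admissible C \<phi>" "s \<le> t"
  shows "norm (driver_integral \<phi> {a..<clamp t} - driver_integral \<phi> {a..<clamp s}) \<le> C * (mass {a..<clamp t} - mass {a..<clamp s})"
proof -
  have "driver_integral \<phi> {a..<clamp t} = driver_integral \<phi> {a..<clamp s} + driver_integral \<phi> {clamp s..<clamp t}"
    unfolding split_clamp[OF assms(2)] using test_clamp[of s] test_clamp(2)[OF assms(2)]
    by (intro driver_integral_Un[OF assms(1)]) auto
  then show ?thesis
    using driver_integral_norm_le_mass[OF assms(1) test_clamp(2)[OF assms(2)]] mass_clamp_diff[OF assms(2)] by simp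
qed

text \<open>If \<open>s\<close> belongs to the set \<open>U\<close> on the left, then \<open>[s,t)\<close> has mass at most \<open>d\<close>, and \<open>U\<close> is the union of such
  intervals. It is also an interval ending at \<open>t\<close>; when it does not contain its infimum, it is
  exhausted by an increasing sequence.\<close>

lemma mass_near_end_le:
  assumes d: "0 \<le> d"
  shows "mass {s\<in>{a..<clamp t}. mass {a..<clamp t} - mass {a..<s} \<le> d} \<le> d"
proof -
  define U where "U = {s\<in>{a..<clamp t}. mass {a..<clamp t} - mass {a..<s} \<le> d}"
  have cl: "s \<in> {a..<clamp t} \<Longrightarrow> clamp s = s" for s using clamp_in(1)[of t] by (intro clamp_in(3)) auto
  have tail: "mass {s..<clamp t} \<le> d" if "s \<in> U" for s
  proof -
    have sU: "s \<in> {a..<clamp t}" using that by (simp add: U_def)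
    have "clamp s = s" by (rule cl[OF sU])
    moreover have "s \<le> t" using sU unfolding clamp_def by (auto simp: less_max_iff_disj)
    ultimately show ?thesis using mass_clamp_diff[of s t] that by (simp add: U_def)
  qed
  have up: "s' \<in> U" if "s \<in> U" "s \<le> s'" "s' < clamp t" for s s'
  proof -
    have "mass {a..<s} \<le> mass {a..<s'}" using that test_clamp(1)[of t] by (intro mass_mono) (auto simp: U_def)
    then show ?thesis using that by (auto simp: U_def)
  qed
  show ?thesis
  proof (cases "U = {}")
    case True then show ?thesis using d unfolding U_def[symmetric] by simp
  next
    case False
    define u where "u = Inf U"
    have bdd: "bdd_below U" by (intro bdd_belowI[of _ a]) (auto simp: U_def)
    have u_le: "u \<le> s" if "s \<in> U" for s unfolding u_def using that bdd by (rule cInf_lower)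
    show ?thesis
    proof (cases "u \<in> U")
      case True
      have "U \<subseteq> {u..<clamp t}" using u_le by (auto simp: U_def)
      moreover have "{u..<clamp t} \<subseteq> U" using up[OF True] by (meson atLeastLessThan_iff subsetI)
      ultimately have "U = {u..<clamp t}" by (rule equalityI)
      then show ?thesis using tail[OF True] unfolding U_def by simp
    next
      case False
      have U_eq: "U = {u<..<clamp t}"
      proof
        show "U \<subseteq> {u<..<clamp t}"
        proof
          fix s assume s: "s \<in> U"
          then have "u \<noteq> s" using False by blast
          then have "u < s" using u_le[OF s] by simp
          then show "s \<in> {u<..<clamp t}" using s by (simp add: U_def)
        qed
        show "{u<..<clamp t} \<subseteq> U"
        proof
          fix s assume s: "s \<in> {u<..<clamp t}"
          then obtain s' where "s' \<in> U" "s' < s" using cInf_lessD[OF \<open>U \<noteq> {}\<close>, of s] by (auto simp: u_def)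
          then show "s \<in> U" using up s by auto
        qed
      qed
      have au: "a \<le> u" unfolding u_def using \<open>U \<noteq> {}\<close> by (intro cInf_greatest) (auto simp: U_def)
      define A where "A n = {u + 1 / real (Suc n)..<clamp t}" for n
      have AU: "A n \<subseteq> U" for n
      proof
        fix s assume "s \<in> A n"
        moreover have "0 < 1 / real (Suc n)" by simp
        ultimately show "s \<in> U" unfolding U_eq A_def by (auto intro: less_le_trans[of u "u + 1 / real (Suc n)"])
      qed
      have "incseq A"
      proof (rule incseq_SucI)
        fix n
        have "1 / real (Suc (Suc n)) \<le> 1 / real (Suc n)" by (intro divide_left_mono) auto
        then show "A n \<le> A (Suc n)" unfolding A_def by auto
      qed
      have UA: "(\<Union>n. A n) = U"
      proof
        show "(\<Union>n. A n) \<subseteq> U" using AU by auto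
        show "U \<subseteq> (\<Union>n. A n)"
        proof
          fix s assume s: "s \<in> U"
          then have "0 < s - u" by (simp add: U_eq)
          then obtain n where "inverse (real (Suc n)) < s - u" using reals_Archimedean by blast
          then have "s \<in> A n" using s by (auto simp: A_def U_eq inverse_eq_divide)
          then show "s \<in> (\<Union>n. A n)" by blast
        qed
      qed
      have Atest: "test_set (A n)" for n
      proof -
        have "U \<subseteq> {a..<clamp t}" by (auto simp: U_def)
        then have "A n \<subseteq> {a..b}" using AU[of n] test_clamp(1)[of t] by blast
        then show ?thesis by (simp add: A_def)
      qed
      have "(\<lambda>n. mass (A n)) \<longlonglongrightarrow> mass U"
        unfolding mass_def
      proof (intro tendsto_sum)
        fix i assume i: "i \<in> I"
        interpret finite_measure "\<rho> i" using finite_driver i by simp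
        have "range A \<subseteq> sets (\<rho> i)" using Atest borel_driver[OF i] by auto
        then show "(\<lambda>n. measure (\<rho> i) (A n)) \<longlonglongrightarrow> measure (\<rho> i) U"
          unfolding UA[symmetric] using \<open>incseq A\<close> by (intro Lim_measure_incseq) auto
      qed
      moreover have "mass (A n) \<le> d" for n
      proof (cases "A n = {}")
        case True then show ?thesis using d by simp
      next
        case False
        then have "u + 1 / real (Suc n) \<in> A n" by (auto simp: A_def)
        then show ?thesis using tail AU unfolding A_def by blast
      qed
      ultimately have "mass U \<le> d" by (intro LIMSEQ_le_const2) auto
      then show ?thesis by (simp add: U_def)
    qed
  qed
qed

lemma clamp_mass_mono: "s \<le> t \<Longrightarrow> mass {a..<clamp s} \<le> mass {a..<clamp t}"
  using mass_clamp_diff[of s t] mass_nonneg[of "{clamp s..<clamp t}"] by linarith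

text \<open>Write \<open>m(t)\<close> for the mass of \<open>[a,t)\<close> and put \<open>W = exp (k * m)\<close>. Where \<open>m(t) - m(s) \<le> d\<close>, the weight is
  at most \<open>W(t)\<close> and the mass is at most \<open>d\<close>; elsewhere the weight is at most
  \<open>exp (- k d) W(t)\<close>. Atoms do no harm, because the mass of \<open>[a,t)\<close> ignores the atom at \<open>t\<close>.\<close>

lemma exponential_weight:
  assumes L: "0 \<le> L"
  obtains W :: "real \<Rightarrow> real" and B where "W \<in> borel_measurable borel" "\<And>t. 1 \<le> W t" "\<And>t. W t \<le> B"
    "\<And>t. L * driver_integral (\<lambda>_. W) {a..<clamp t} \<le> W t / 2"
proof -
  define m where "m t = mass {a..<clamp t}" for t
  have m: "0 \<le> m t" "m t \<le> mass {a..b}" "mono m" for t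
    using clamp_in(1)[of t] by (auto simp: m_def mono_def clamp_mass_mono intro!: mass_mono)
  \<comment> \<open>\<open>d\<close> and \<open>k\<close> make each of the two contributions at most a quarter of \<open>W t\<close>.\<close>
  define d where "d = 1 / (4 * (L + 1))"
  have d: "d > 0" "L * d \<le> 1/4" using L by (auto simp: d_def field_simps)
  define k where "k = 4 * L * mass {a..b} / d"
  have k: "0 \<le> k" using L d by (simp add: k_def)
  have kd: "L * mass {a..b} * exp (- k * d) \<le> 1/4"
  proof -
    have "4 * (L * mass {a..b}) \<le> 1 + k * d" using d by (simp add: k_def)
    also have "\<dots> \<le> exp (k * d)" by (rule exp_ge_add_one_self)
    finally show ?thesis by (simp add: exp_minus field_simps)
  qed
  define W where "W t = exp (k * m t)" for t
  have Wm: "mono W" using m(3) k by (auto simp: W_def mono_def intro!: mult_left_mono)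
  then have W_borel: "W \<in> borel_measurable borel" by (rule borel_measurable_mono)
  have W1: "1 \<le> W t" for t using m(1) k by (simp add: W_def)
  have WB: "W t \<le> exp (k * mass {a..b})" for t using m(2) k by (auto simp: W_def intro!: mult_left_mono)
  have adW: "admissible (exp (k * mass {a..b})) (\<lambda>_. W)"
    using W1 WB by (intro admissible_borel W_borel) (auto intro: abs_leI order_trans[of _ "0::real"] simp: W_def)
  have "L * driver_integral (\<lambda>_. W) {a..<clamp t} \<le> W t / 2" for t
  proof -
    define U where "U = {s\<in>{a..<clamp t}. mass {a..<clamp t} - mass {a..<s} \<le> d}"
    have cl: "s \<in> {a..<clamp t} \<Longrightarrow> clamp s = s" for s using clamp_in(1)[of t] by (intro clamp_in(3)) auto
    have U_eq: "U = {s. m t - m s \<le> d} \<inter> {a..<clamp t}" using cl by (auto simp: U_def m_def)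
    have m_borel: "m \<in> borel_measurable borel" using m(3) by (rule borel_measurable_mono)
    have "{s\<in>space borel. m t - m s \<le> d} \<in> sets borel" using m_borel by measurable
    then have U: "test_set U" using test_clamp(1)[of t] unfolding U_eq by auto
    have V: "test_set ({a..<clamp t} - U)" using U test_clamp(1)[of t] by auto
    have W_le: "W s \<le> W t" if "s \<in> {a..<clamp t}" for s
      using that Wm ab by (auto simp: mono_def clamp_def split: if_splits)
    have "{a..<clamp t} = U \<union> ({a..<clamp t} - U)" by (auto simp: U_def)
    then have "driver_integral (\<lambda>_. W) {a..<clamp t} = driver_integral (\<lambda>_. W) U + driver_integral (\<lambda>_. W) ({a..<clamp t} - U)"
      using driver_integral_Un[OF adW U V] by simp
    moreover have "driver_integral (\<lambda>_. W) U \<le> W t * d"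
    proof -
      have "driver_integral (\<lambda>_. W) U \<le> driver_integral (\<lambda>_ _. W t) U"
        using W_le by (intro driver_integral_mono[OF adW admissible_const U]) (auto simp: U_def)
      also have "\<dots> = W t * mass U" using U by (rule driver_integral_const)
      also have "\<dots> \<le> W t * d" using mass_near_end_le[of d t] d W1[of t] by (intro mult_left_mono) (auto simp: U_def)
      finally show ?thesis .
    qed
    moreover have "driver_integral (\<lambda>_. W) ({a..<clamp t} - U) \<le> W t * exp (- k * d) * mass {a..b}"
    proof -
      have "driver_integral (\<lambda>_. W) ({a..<clamp t} - U) \<le> driver_integral (\<lambda>_ _. W t * exp (- k * d)) ({a..<clamp t} - U)"
      proof (intro driver_integral_mono[OF adW admissible_const V])
        fix s assume "s \<in> {a..<clamp t} - U"
        then have "m s \<le> m t - d" using cl[of s] by (auto simp: U_def m_def)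
        then have "k * m s \<le> k * (m t - d)" using k by (intro mult_left_mono)
        then show "W s \<le> W t * exp (- k * d)" by (simp add: W_def exp_add[symmetric] algebra_simps)
      qed
      also have "\<dots> = W t * exp (- k * d) * mass ({a..<clamp t} - U)" using V by (rule driver_integral_const)
      also have "\<dots> \<le> W t * exp (- k * d) * mass {a..b}"
        using V W1[of t] by (intro mult_left_mono mass_mono) auto
      finally show ?thesis .
    qed
    ultimately have "L * driver_integral (\<lambda>_. W) {a..<clamp t} \<le> L * (W t * d + W t * exp (- k * d) * mass {a..b})"
      using L by (intro mult_left_mono) auto
    also have "\<dots> = W t * (L * d + L * mass {a..b} * exp (- k * d))" by (simp add: algebra_simps)
    also have "\<dots> \<le> W t * (1/4 + 1/4)" using d kd W1[of t] by (intro mult_left_mono add_mono) auto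
    finally show ?thesis by simp
  qed
  then show ?thesis using that W_borel W1 WB by blast
qed

text \<open>If \<open>N\<close> is the supremum of \<open>D / W\<close> for the exponential weight \<open>W\<close>, then the hypothesis gives
  \<open>N \<le> A + N / 2\<close>. The order of the quantifiers records that \<open>K\<close> depends on the drivers and \<open>L\<close> only.\<close>

lemma gronwall:
  fixes L :: real
  assumes L: "0 \<le> L"
  shows "\<exists>K\<ge>0. \<forall>D A B. D \<in> borel_measurable borel \<longrightarrow> 0 \<le> A \<longrightarrow> (\<forall>t\<in>{a..b}. 0 \<le> D t \<and> D t \<le> B) \<longrightarrow>
     (\<forall>t\<in>{a..b}. D t \<le> A + L * driver_integral (\<lambda>_. D) {a..<t}) \<longrightarrow> (\<forall>t\<in>{a..b}. D t \<le> A * K)"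
proof -
  obtain W :: "real \<Rightarrow> real" and B where W: "W \<in> borel_measurable borel" "\<And>t. 1 \<le> W t" "\<And>t. W t \<le> B"
    "\<And>t. L * driver_integral (\<lambda>_. W) {a..<clamp t} \<le> W t / 2"
    using exponential_weight[OF L] by blast
  have adW: "admissible B (\<lambda>_. W)"
    using W(2,3) by (intro admissible_borel W) (auto intro!: abs_leI order_trans[OF _ order_trans[OF W(2) W(3)]] simp: order_trans[of _ 1])
  have "D t \<le> A * (2 * B)" if D: "D \<in> borel_measurable borel" "0 \<le> A" "\<forall>t\<in>{a..b}. 0 \<le> D t \<and> D t \<le> M"
    "\<forall>t\<in>{a..b}. D t \<le> A + L * driver_integral (\<lambda>_. D) {a..<t}" and t: "t \<in> {a..b}" for D A M t
  proof -
    define N where "N = (SUP t\<in>{a..b}. D t / W t)"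
    have bdd: "bdd_above ((\<lambda>t. D t / W t) ` {a..b})"
    proof (rule bdd_aboveI)
      fix x assume "x \<in> (\<lambda>t. D t / W t) ` {a..b}"
      then obtain t where t: "t \<in> {a..b}" "x = D t / W t" by blast
      have "D t / W t \<le> D t / 1" using D(3) t W(2)[of t] by (intro divide_left_mono) auto
      then show "x \<le> M" using D(3) t by fastforce
    qed
    have le: "D s \<le> N * W s" if "s \<in> {a..b}" for s
    proof -
      have "D s / W s \<le> N" unfolding N_def using that bdd by (intro cSUP_upper) auto
      then show ?thesis using W(2)[of s] by (simp add: divide_simps split: if_splits)
    qed
    have aab: "a \<in> {a..b}" using ab by simp
    have "0 \<le> D a" using bspec[OF D(3) aab] by simp
    then have "0 \<le> N * W a" using le[OF aab] by linarith
    then have N0: "0 \<le> N" using W(2)[of a] by (simp add: zero_le_mult_iff)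
    have adD: "admissible M (\<lambda>_. D)" using D by (intro admissible_borel) auto
    have "N \<le> A + N / 2"
      unfolding N_def
    proof (rule cSUP_least)
      fix s assume s: "s \<in> {a..b}"
      have test: "test_set {a..<s}" using s by auto
      have "driver_integral (\<lambda>_. D) {a..<s} \<le> driver_integral (\<lambda>_ s. N * W s) {a..<s}"
      proof (rule driver_integral_mono[OF adD _ test])
        show "admissible (N * B) (\<lambda>_ s. N * W s)"
        proof (rule admissible_borel)
          show "(\<lambda>s. N * W s) \<in> borel_measurable borel" using W(1) by measurable
          show "norm (N * W s) \<le> N * B" for s
            using N0 W(2)[of s] W(3)[of s] by (auto simp: abs_mult intro!: mult_left_mono)
        qed
      qed (use le s in auto)
      also have "\<dots> = N * driver_integral (\<lambda>_. W) {a..<s}" by (rule driver_integral_cmult)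
      finally have "L * driver_integral (\<lambda>_. D) {a..<s} \<le> L * (N * driver_integral (\<lambda>_. W) {a..<s})"
        using L by (intro mult_left_mono)
      also have "\<dots> = N * (L * driver_integral (\<lambda>_. W) {a..<s})" by simp
      also have "\<dots> \<le> N * (W s / 2)" using W(4)[of s] clamp_in(3)[OF s] N0 by (intro mult_left_mono) auto
      finally have "D s \<le> A + N / 2 * W s" using D(4) s by fastforce
      also have "\<dots> \<le> (A + N / 2) * W s" using D(2) W(2)[of s] by (simp add: algebra_simps mult_le_cancel_left1)
      finally show "D s / W s \<le> (A + (SUP t\<in>{a..b}. D t / W t) / 2)" using W(2)[of s] unfolding N_def
        by (simp add: divide_simps split: if_splits)
    qed (use ab in auto)
    then have "N \<le> 2 * A" by simp
    then have "D t \<le> 2 * A * W t" using le[OF t] W(2)[of t] by (meson mult_right_mono order_trans zero_le_one)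
    also have "\<dots> \<le> 2 * A * B" using D(2) W(3) by (intro mult_left_mono) auto
    finally show ?thesis by (simp add: algebra_simps)
  qed
  moreover have "0 \<le> 2 * B" using W(2)[of 0] W(3)[of 0] by linarith
  ultimately show ?thesis by (intro exI[of _ "2*B"]) blast
qed

text \<open>Picard iteration converges geometrically in the weighted sup norm. All iterates stay in the ball of
  radius \<open>R\<close>, since \<open>H\<close> is bounded by \<open>C\<close>; therefore a Lipschitz condition on that ball suffices.\<close>

lemma volterra_exists:
  fixes H :: "'i \<Rightarrow> real \<Rightarrow> 'b::euclidean_space \<Rightarrow> 'b"
  assumes meas: "\<And>i Y. i \<in> I \<Longrightarrow> Y \<in> borel_measurable borel \<Longrightarrow>
        (\<lambda>s. indicator {a..b} s *\<^sub>R H i s (Y s)) \<in> borel_measurable (\<rho> i)"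
    and bd: "\<And>i s y. i \<in> I \<Longrightarrow> s \<in> {a..b} \<Longrightarrow> norm (H i s y) \<le> C"
    and lip: "\<And>i s y z. i \<in> I \<Longrightarrow> s \<in> {a..b} \<Longrightarrow> norm y \<le> R \<Longrightarrow> norm z \<le> R \<Longrightarrow> norm (H i s y - H i s z) \<le> L * norm (y - z)"
    and R: "norm c + C * mass {a..b} \<le> R" and L: "0 \<le> L" and C: "0 \<le> C"
  obtains Y where "Y \<in> borel_measurable borel" "\<And>t. norm (Y t) \<le> R"
    "\<And>t. t \<in> {a..b} \<Longrightarrow> Y t = c + driver_integral (\<lambda>i s. H i s (Y s)) {a..<t}"
proof -
  \<comment> \<open>The Picard operator; clamping the end point lets it act on Borel functions on the whole line.\<close>
  define \<Phi> where "\<Phi> Y t = c + driver_integral (\<lambda>i s. H i s (Y s)) {a..<clamp t}" for Y t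
  have adm: "admissible C (\<lambda>i s. H i s (Y s))" if "Y \<in> borel_measurable borel" for Y
    using meas bd that by (auto simp: admissible_def)
  have \<Phi>_borel: "\<Phi> Y \<in> borel_measurable borel" if "Y \<in> borel_measurable borel" for Y
  proof (rule borel_measurable_if_increments_dominated)
    show "norm (\<Phi> Y t - \<Phi> Y s) \<le> C * mass {a..<clamp t} - C * mass {a..<clamp s}" if "s \<le> t" for s t
      using driver_integral_clamp_increment[OF adm[OF \<open>Y \<in> borel_measurable borel\<close>] that] by (simp add: \<Phi>_def algebra_simps)
  qed
  have \<Phi>_bd: "norm (\<Phi> Y t) \<le> R" if "Y \<in> borel_measurable borel" for Y t
  proof -
    have "norm (\<Phi> Y t) \<le> norm c + C * mass {a..<clamp t}"
      unfolding \<Phi>_def using driver_integral_norm_le_mass[OF adm[OF that] test_clamp(1)[of t]] by (intro norm_triangle_le) auto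
    also have "\<dots> \<le> norm c + C * mass {a..b}"
      using C clamp_in(1)[of t] by (intro add_left_mono mult_left_mono mass_mono) auto
    finally show ?thesis using R by simp
  qed
  have \<Phi>_lip: "norm (\<Phi> Y t - \<Phi> Z t) \<le> L * driver_integral (\<lambda>_ s. norm (Y s - Z s)) {a..<clamp t}"
    if Y: "Y \<in> borel_measurable borel" "\<And>t. norm (Y t) \<le> R" and Z: "Z \<in> borel_measurable borel" "\<And>t. norm (Z t) \<le> R" for Y Z t
  proof -
    have ad: "admissible (L * (R + R)) (\<lambda>_ s. L * norm (Y s - Z s))"
    proof (intro admissible_borel)
      show "(\<lambda>s. L * norm (Y s - Z s)) \<in> borel_measurable borel" using Y Z by measurable
      show "norm (L * norm (Y s - Z s)) \<le> L * (R + R)" for s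
        using L norm_triangle_ineq4[of "Y s" "Z s"] Y(2)[of s] Z(2)[of s] by (auto simp: abs_mult intro!: mult_left_mono)
    qed
    have "\<Phi> Y t - \<Phi> Z t = driver_integral (\<lambda>i s. H i s (Y s) - H i s (Z s)) {a..<clamp t}"
      using driver_integral_diff[OF adm[OF Y(1)] adm[OF Z(1)] test_clamp(1)[of t]] by (simp add: \<Phi>_def)
    also have "norm \<dots> \<le> driver_integral (\<lambda>_ s. L * norm (Y s - Z s)) {a..<clamp t}"
      using Y Z lip clamp_in(1)[of t]
      by (intro driver_integral_norm_le[OF admissible_diff[OF adm[OF Y(1)] adm[OF Z(1)]] ad test_clamp(1)]) auto
    finally show ?thesis by (simp add: driver_integral_cmult)
  qed
  obtain W :: "real \<Rightarrow> real" and B where W: "W \<in> borel_measurable borel" "\<And>t. 1 \<le> W t" "\<And>t. W t \<le> B"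
    "\<And>t. L * driver_integral (\<lambda>_. W) {a..<clamp t} \<le> W t / 2"
    using exponential_weight[OF L] by blast
  define y where "y n = (\<Phi> ^^ n) (\<lambda>_. c)" for n
  have y_Suc: "y (Suc n) = \<Phi> (y n)" for n by (simp add: y_def)
  have y_borel: "y n \<in> borel_measurable borel" for n
    by (induction n) (auto simp: y_Suc \<Phi>_borel, simp add: y_def)
  have c_R: "norm c \<le> R" using R C mult_nonneg_nonneg[OF C mass_nonneg[of "{a..b}"]] by linarith
  have y_bd: "norm (y n t) \<le> R" for n t
    by (cases n) (auto simp: y_Suc \<Phi>_bd y_borel, simp add: y_def c_R)
  have R0: "0 \<le> R" using c_R norm_ge_zero[of c] by linarith
  have contr: "norm (y (Suc n) t - y n t) \<le> 2 * R * (1/2)^n * W t" for n t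
  proof (induction n arbitrary: t)
    case 0
    have "norm (y (Suc 0) t - y 0 t) \<le> 2 * R" using norm_triangle_ineq4[of "y (Suc 0) t" "y 0 t"] y_bd[of "Suc 0" t] y_bd[of 0 t] by linarith
    also have "\<dots> \<le> 2 * R * W t" using R0 W(2)[of t] by (simp add: mult_le_cancel_left1)
    finally show ?case by simp
  next
    case (Suc n)
    have "norm (y (Suc (Suc n)) t - y (Suc n) t) \<le> L * driver_integral (\<lambda>_ s. norm (y (Suc n) s - y n s)) {a..<clamp t}"
      unfolding y_Suc[of "Suc n"] y_Suc[of n] using \<Phi>_lip[of "\<Phi> (y n)" "y n" t] y_borel y_bd \<Phi>_borel \<Phi>_bd by (simp add: y_Suc)
    also have "\<dots> \<le> L * driver_integral (\<lambda>_ s. 2 * R * (1/2)^n * W s) {a..<clamp t}"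
    proof (intro mult_left_mono L driver_integral_mono)
      show "admissible (2 * R) (\<lambda>_ s. norm (y (Suc n) s - y n s))"
      proof (rule admissible_borel)
        show "(\<lambda>s. norm (y (Suc n) s - y n s)) \<in> borel_measurable borel"
          using y_borel[of n] y_borel[of "Suc n"] by measurable
        show "norm (norm (y (Suc n) s - y n s)) \<le> 2 * R" for s
          using norm_triangle_ineq4[of "y (Suc n) s" "y n s"] y_bd[of "Suc n" s] y_bd[of n s] by simp
      qed
      show "admissible (2 * R * (1/2)^n * B) (\<lambda>_ s. 2 * R * (1/2)^n * W s)"
      proof (rule admissible_borel)
        show "(\<lambda>s. 2 * R * (1/2)^n * W s) \<in> borel_measurable borel" using W(1) by measurable
        show "norm (2 * R * (1/2)^n * W s) \<le> 2 * R * (1/2)^n * B" for s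
          using R0 W(2)[of s] W(3)[of s] by (auto simp: abs_mult intro!: mult_left_mono)
      qed
    qed (use Suc test_clamp(1)[of t] in auto)
    also have "\<dots> = 2 * R * (1/2)^n * (L * driver_integral (\<lambda>_. W) {a..<clamp t})"
      by (subst driver_integral_cmult) simp
    also have "\<dots> \<le> 2 * R * (1/2)^n * (W t / 2)" using R0 W(4)[of t] by (intro mult_left_mono) auto
    finally show ?case by simp
  qed
  have contrB: "norm (y (Suc n) t - y n t) \<le> 2 * R * B * (1/2)^n" for n t
  proof -
    have "2 * R * (1/2)^n * W t \<le> 2 * R * (1/2)^n * B" using R0 W(3)[of t] by (intro mult_left_mono) auto
    then show ?thesis using contr[of n t] by (simp add: mult_ac)
  qed
  have "uniform_limit UNIV (\<lambda>n t. \<Sum>k<n. y (Suc k) t - y k t) (\<lambda>t. \<Sum>k. y (Suc k) t - y k t) sequentially"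
    by (rule Weierstrass_m_test[OF contrB]) (auto intro!: summable_mult summable_geometric)
  moreover have "(\<Sum>k<n. y (Suc k) t - y k t) = y n t - c" for n t
    by (subst sum_lessThan_telescope) (simp add: y_def)
  ultimately have ul: "uniform_limit UNIV (\<lambda>n t. y n t - c) (\<lambda>t. \<Sum>k. y (Suc k) t - y k t) sequentially" by simp
  define Y where "Y t = c + (\<Sum>k. y (Suc k) t - y k t)" for t
  have ulY: "uniform_limit UNIV y Y sequentially"
    using ul unfolding uniform_limit_iff Y_def dist_norm by (simp add: algebra_simps)
  have lim: "(\<lambda>n. y n t) \<longlonglongrightarrow> Y t" for t using tendsto_uniform_limitI[OF ulY] by simp
  have Y_borel: "Y \<in> borel_measurable borel" by (rule borel_measurable_LIMSEQ_metric[of y]) (rule y_borel, rule lim)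
  have Y_bd: "norm (Y t) \<le> R" for t
    by (rule LIMSEQ_le_const2[OF tendsto_norm[OF lim[of t]]]) (simp add: y_bd)
  have "\<Phi> Y t = Y t" for t
  proof -
    have eps: "norm (\<Phi> Y t - Y t) \<le> e" if e: "e > 0" for e
    proof -
      \<comment> \<open>One error for the uniform limit itself, and \<open>L\<close> times the mass for passing it through the integral.\<close>
      define e' where "e' = e / (1 + L * mass {a..b})"
      have den: "0 < 1 + L * mass {a..b}" using L by (simp add: add_pos_nonneg)
      have e': "e' > 0" using e den by (simp add: e'_def)
      obtain n0 where n0: "\<And>n s. n \<ge> n0 \<Longrightarrow> dist (y n s) (Y s) < e'"
        using ulY e' unfolding uniform_limit_sequentially_iff by blast
      have small: "norm (Y s - y n0 s) \<le> e'" for s using n0[of n0 s] by (simp add: dist_norm norm_minus_commute)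
      have "norm (\<Phi> Y t - \<Phi> (y n0) t) \<le> L * driver_integral (\<lambda>_ s. norm (Y s - y n0 s)) {a..<clamp t}"
        by (intro \<Phi>_lip Y_borel Y_bd y_borel y_bd)
      also have "\<dots> \<le> L * driver_integral (\<lambda>_ _. e') {a..<clamp t}"
      proof (intro mult_left_mono L driver_integral_mono)
        show "admissible e' (\<lambda>_ s. norm (Y s - y n0 s))"
          using small y_borel Y_borel by (intro admissible_borel) auto
        show "admissible \<bar>e'\<bar> (\<lambda>_ _. e')" by (rule admissible_const)
      qed (use small test_clamp(1)[of t] in auto)
      also have "\<dots> = L * (e' * mass {a..<clamp t})" using test_clamp(1)[of t] by (simp add: driver_integral_const)
      also have "\<dots> \<le> L * (e' * mass {a..b})"
        using e' L clamp_in(1)[of t] by (intro mult_left_mono mass_mono) auto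
      finally have "norm (\<Phi> Y t - y (Suc n0) t) \<le> L * (e' * mass {a..b})" by (simp add: y_Suc)
      moreover have "norm (y (Suc n0) t - Y t) \<le> e'" using n0[of "Suc n0" t] by (simp add: dist_norm)
      moreover have "norm (\<Phi> Y t - Y t) \<le> norm (\<Phi> Y t - y (Suc n0) t) + norm (y (Suc n0) t - Y t)"
        using norm_triangle_ineq[of "\<Phi> Y t - y (Suc n0) t" "y (Suc n0) t - Y t"] by simp
      ultimately have "norm (\<Phi> Y t - Y t) \<le> e' * (1 + L * mass {a..b})" by (simp add: algebra_simps)
      also have "\<dots> = e" using den by (simp add: e'_def)
      finally show ?thesis .
    qed
    have "norm (\<Phi> Y t - Y t) \<le> 0" by (rule field_le_epsilon) (simp add: eps)
    then show ?thesis by simp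
  qed
  then have "Y t = c + driver_integral (\<lambda>i s. H i s (Y s)) {a..<t}" if "t \<in> {a..b}" for t
    using clamp_in(3)[OF that] unfolding \<Phi>_def by metis
  then show ?thesis using that Y_borel Y_bd by blast
qed

text \<open>The functions \<open>H\<close> and \<open>G\<close> stand for the integrands along \<open>Y\<close> and \<open>Z\<close>. Stating the Lipschitz bound for
  them, instead of for a field, lets the constant \<open>K\<close> be chosen before the equation.\<close>

lemma volterra_stable:
  fixes L :: real
  assumes L: "0 \<le> L"
  shows "\<exists>K\<ge>0. \<forall>H G Y Z C R. (Y :: real \<Rightarrow> 'b::euclidean_space) \<in> borel_measurable borel \<longrightarrow> Z \<in> borel_measurable borel \<longrightarrow>
     (\<forall>t\<in>{a..b}. norm (Y t) \<le> R \<and> norm (Z t) \<le> R) \<longrightarrow>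
     admissible C H \<longrightarrow> admissible C G \<longrightarrow>
     (\<forall>i\<in>I. \<forall>s\<in>{a..b}. norm (H i s - G i s) \<le> L * norm (Y s - Z s)) \<longrightarrow>
     (\<forall>t\<in>{a..b}. Y t = Y a + driver_integral H {a..<t}) \<longrightarrow>
     (\<forall>t\<in>{a..b}. Z t = Z a + driver_integral (G :: 'i \<Rightarrow> real \<Rightarrow> 'b) {a..<t}) \<longrightarrow>
     (\<forall>t\<in>{a..b}. norm (Y t - Z t) \<le> norm (Y a - Z a) * K)"
proof -
  obtain K where K0: "K \<ge> 0" and K: "\<forall>D A B. D \<in> borel_measurable borel \<longrightarrow> 0 \<le> A \<longrightarrow> (\<forall>t\<in>{a..b}. 0 \<le> D t \<and> D t \<le> B) \<longrightarrow>
     (\<forall>t\<in>{a..b}. D t \<le> A + L * driver_integral (\<lambda>_. D) {a..<t}) \<longrightarrow> (\<forall>t\<in>{a..b}. D t \<le> A * K)"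
    using gronwall[OF L] by (elim exE conjE) (rule that)
  show ?thesis
  proof (intro exI[of _ K] conjI K0 allI impI)
    fix H G Y Z and C R :: real
    assume Y: "(Y :: real \<Rightarrow> 'b) \<in> borel_measurable borel" and Z: "Z \<in> borel_measurable borel"
      and R: "\<forall>t\<in>{a..b}. norm (Y t) \<le> R \<and> norm (Z t) \<le> R"
      and adH: "admissible C H" and adG: "admissible C G"
      and lip: "\<forall>i\<in>I. \<forall>s\<in>{a..b}. norm (H i s - G i s) \<le> L * norm (Y s - Z s)"
      and eY: "\<forall>t\<in>{a..b}. Y t = Y a + driver_integral H {a..<t}"
      and eZ: "\<forall>t\<in>{a..b}. Z t = Z a + driver_integral G {a..<t}"
    show "\<forall>t\<in>{a..b}. norm (Y t - Z t) \<le> norm (Y a - Z a) * K"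
    proof (rule K[THEN spec, THEN spec, THEN spec, THEN mp, THEN mp, THEN mp, THEN mp])
      show D: "(\<lambda>t. norm (Y t - Z t)) \<in> borel_measurable borel" using Y Z by measurable
      have DR: "norm (Y t - Z t) \<le> R + R" if "t \<in> {a..b}" for t
        using R that norm_triangle_ineq4[of "Y t" "Z t"] by fastforce
      then show "\<forall>t\<in>{a..b}. 0 \<le> norm (Y t - Z t) \<and> norm (Y t - Z t) \<le> R + R" by simp
      show "\<forall>t\<in>{a..b}. norm (Y t - Z t) \<le> norm (Y a - Z a) + L * driver_integral (\<lambda>_ s. norm (Y s - Z s)) {a..<t}"
      proof
        fix t assume t: "t \<in> {a..b}"
        have test: "test_set {a..<t}" using t by auto
        have "Y t - Z t = (Y a - Z a) + driver_integral (\<lambda>i s. H i s - G i s) {a..<t}"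
          unfolding driver_integral_diff[OF adH adG test] using bspec[OF eY t] bspec[OF eZ t] by (simp add: algebra_simps)
        moreover have "norm (driver_integral (\<lambda>i s. H i s - G i s) {a..<t}) \<le> driver_integral (\<lambda>_ s. L * norm (Y s - Z s)) {a..<t}"
        proof (rule driver_integral_norm_le[OF admissible_diff[OF adH adG] _ test])
          show "admissible (L * (R + R)) (\<lambda>_ s. L * norm (Y s - Z s))"
            using D DR L by (intro admissible_borel) (auto simp: abs_mult intro!: mult_left_mono)
        qed (use lip t in auto)
        ultimately show "norm (Y t - Z t) \<le> norm (Y a - Z a) + L * driver_integral (\<lambda>_ s. norm (Y s - Z s)) {a..<t}"
          by (simp add: driver_integral_cmult norm_triangle_le)
      qed
    qed simp
  qed
qed

end

section \<open>Controlled differential equations in fast time\<close>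

lemma abs_continuous_on_imp_continuous_on:
  fixes z :: "real \<Rightarrow> 'b::real_normed_vector"
  assumes "abs_continuous_on {p..q} z"
  shows "continuous_on {p..q} z"
  unfolding continuous_on_iff
proof (intro ballI allI impI)
  fix s e :: real assume s: "s \<in> {p..q}" and e: "0 < e"
  obtain d where d: "d > 0" "\<forall>a b n. (\<forall>i<n. a i \<le> b i \<and> {a i..b i} \<subseteq> {p..q}) \<and>
        (\<forall>i<n. \<forall>k<n. i \<noteq> k \<longrightarrow> {a i<..<b i} \<inter> {a k<..<b k} = {}) \<and>
        (\<Sum>i<(n::nat). b i - a i) < d \<longrightarrow> (\<Sum>i<n. norm (z (b i) - z (a i))) < e"
    using assms[unfolded abs_continuous_on_def, THEN spec, THEN mp, OF e] by (elim exE conjE) (rule that)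
  have "norm (z v - z u) < e" if "u \<in> {p..q}" "v \<in> {p..q}" "u \<le> v" "v - u < d" for u v
    using d(2)[THEN spec[of _ "\<lambda>_. u"], THEN spec[of _ "\<lambda>_. v"], THEN spec[of _ 1]] that by auto
  note small = this
  show "\<exists>d>0. \<forall>x'\<in>{p..q}. dist x' s < d \<longrightarrow> dist (z x') (z s) < e"
  proof (intro exI[of _ d] conjI ballI impI d(1))
    fix x' assume x': "x' \<in> {p..q}" "dist x' s < d"
    show "dist (z x') (z s) < e"
    proof (cases "x' \<le> s")
      case True
      then have "norm (z s - z x') < e" using small[OF x'(1) s] x'(2) by (simp add: dist_real_def)
      then show ?thesis by (simp add: dist_norm norm_minus_commute)
    next
      case False
      then show ?thesis using small[OF s x'(1)] x'(2) by (simp add: dist_real_def dist_norm)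
    qed
  qed
qed

text \<open>Caratheodory solutions of \<open>z' = \<Sum>\<^sub>j w\<^sup>j(s) G\<^sub>j(s,z)\<close> on the fast time interval.\<close>

definition is_arc :: "(real \<Rightarrow> real ^ 'm) \<Rightarrow> ('m::finite \<Rightarrow> real \<Rightarrow> 'b \<Rightarrow> 'b) \<Rightarrow> (real \<Rightarrow> 'b::euclidean_space) \<Rightarrow> bool" where
  "is_arc w G z \<longleftrightarrow> abs_continuous_on {0..1} z \<and>
     (AE s in lebesgue_on {0..1}. (z has_vector_derivative (\<Sum>j\<in>UNIV. (w s $ j) *\<^sub>R G j s (z s))) (at s within {0..1}))"

lemma norm1_nonneg[simp]: "0 \<le> norm1 v" by (simp add: norm1_def sum_nonneg)

lemma borel_measurable_norm1:
  fixes w :: "'a \<Rightarrow> real ^ 'm"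
  assumes "w \<in> borel_measurable M" shows "(\<lambda>s. norm1 (w s)) \<in> borel_measurable M"
proof -
  have "(\<lambda>s. w s $ j) \<in> borel_measurable M" for j
    using borel_measurable_inner[OF assms borel_measurable_const[of "axis j 1"]] by (simp add: inner_axis)
  then show ?thesis unfolding norm1_def by measurable
qed

lemma measurable_vec_nth:
  fixes w :: "'a \<Rightarrow> real ^ 'm"
  assumes "w \<in> borel_measurable M" shows "(\<lambda>s. w s $ j) \<in> borel_measurable M"
  using borel_measurable_inner[OF assms borel_measurable_const[of "axis j 1"]] by (simp add: inner_axis)

lemma norm_sum_control_le:
  fixes w :: "real ^ 'm"
  assumes "\<And>j. norm (G j) \<le> C"
  shows "norm (\<Sum>j\<in>UNIV. (w $ j) *\<^sub>R G j) \<le> norm1 w * C"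
proof -
  have "norm (\<Sum>j\<in>UNIV. (w $ j) *\<^sub>R G j) \<le> (\<Sum>j\<in>UNIV. \<bar>w $ j\<bar> * C)"
    using assms by (intro sum_norm_le) (auto intro: mult_left_mono)
  then show ?thesis by (simp add: norm1_def sum_distrib_right)
qed

lemma borel_subset_in_lebesgue_on:
  assumes "B \<in> sets borel" "B \<subseteq> S" "S \<in> sets lebesgue"
  shows "B \<in> sets (lebesgue_on S)"
proof -
  have "B \<in> sets lebesgue" using assms(1) by simp
  then show ?thesis using assms by (subst sets_restrict_space_iff) auto
qed

interpretation unit_time: driver_family 0 1 "{()}" "\<lambda>_. lebesgue_on {0..1}"
proof (rule driver_family.intro)
  show "finite_measure (lebesgue_on {0..1::real})" for i :: unit by (rule finite_measure_lebesgue_on) simp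
  show "B \<in> sets (lebesgue_on {0..1})" if "i \<in> {()}" "B \<in> sets borel" "B \<subseteq> {0..1}" for B :: "real set" and i :: unit
    by (rule borel_subset_in_lebesgue_on[OF that(2,3)]) simp
qed simp_all

lemma unit_time_mass: "unit_time.mass {0..1} = 1"
  unfolding unit_time.mass_def by (simp add: measure_restrict_space)

lemma unit_time_integral:
  fixes \<phi> :: "unit \<Rightarrow> real \<Rightarrow> 'c::euclidean_space"
  assumes meas: "\<phi> () \<in> borel_measurable (lebesgue_on {0..1})" and t: "t \<in> {0..1}"
  shows "unit_time.driver_integral \<phi> {0..<t} = (LINT s|lebesgue_on {0..t}. \<phi> () s)"
proof -
  have m: "(\<lambda>s. indicator {0..1} s *\<^sub>R \<phi> () s) \<in> borel_measurable lebesgue"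
    using meas borel_measurable_restrict_space_iff[of "{0..1}" lebesgue "\<phi> ()"] by simp
  have m2: "(\<lambda>s. indicator S s *\<^sub>R \<phi> () s) \<in> borel_measurable lebesgue" if S: "S \<in> sets borel" "S \<subseteq> {0..1}" for S
  proof -
    have "(\<lambda>s. indicator S s *\<^sub>R (indicator {0..1} s *\<^sub>R \<phi> () s)) \<in> borel_measurable lebesgue"
      using S by (intro borel_measurable_scaleR m borel_measurable_indicator) auto
    moreover have "(\<lambda>s. indicator S s *\<^sub>R (indicator {0..1} s *\<^sub>R \<phi> () s)) = (\<lambda>s. indicator S s *\<^sub>R \<phi> () s)"
      using S by (auto simp: indicator_def fun_eq_iff)
    ultimately show ?thesis by simp
  qed
  have "unit_time.driver_integral \<phi> {0..<t} = (LINT s|lebesgue. indicator {0..1} s *\<^sub>R (indicator {0..<t} s *\<^sub>R \<phi> () s))"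
    unfolding unit_time.driver_integral_def set_lebesgue_integral_def by (simp add: integral_restrict_space)
  also have "\<dots> = (LINT s|lebesgue. indicator {0..t} s *\<^sub>R \<phi> () s)"
  proof (rule integral_cong_AE)
    have "(\<lambda>s. indicator {0..1} s *\<^sub>R (indicator {0..<t} s *\<^sub>R \<phi> () s)) = (\<lambda>s. indicator {0..<t} s *\<^sub>R \<phi> () s)"
      using t by (auto simp: indicator_def fun_eq_iff)
    then show "(\<lambda>s. indicator {0..1} s *\<^sub>R (indicator {0..<t} s *\<^sub>R \<phi> () s)) \<in> borel_measurable lebesgue"
      using m2[of "{0..<t}"] t by (simp add: subset_iff)
    show "(\<lambda>s. indicator {0..t} s *\<^sub>R \<phi> () s) \<in> borel_measurable lebesgue" using m2[of "{0..t}"] t by auto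
    show "AE s in lebesgue. indicator {0..1} s *\<^sub>R (indicator {0..<t} s *\<^sub>R \<phi> () s) = indicator {0..t} s *\<^sub>R \<phi> () s"
      using t by (intro AE_I'[of "{t}"]) (auto simp: indicator_def)
  qed
  also have "\<dots> = (LINT s|lebesgue_on {0..t}. \<phi> () s)" by (simp add: integral_restrict_space)
  finally show ?thesis .
qed

lemma continuous_clamp_borel:
  fixes z :: "real \<Rightarrow> 'b::euclidean_space"
  assumes "continuous_on {0..1} z"
  shows "(\<lambda>t. z (max 0 (min 1 t))) \<in> borel_measurable borel"
proof (rule borel_measurable_continuous_onI)
  show "continuous_on UNIV (\<lambda>t. z (max 0 (min 1 t)))"
    by (rule continuous_on_compose2[OF assms]) (auto intro!: continuous_intros)
qed

text \<open>A control \<open>w\<close> with essential bound \<open>Cw\<close> and fields \<open>G\<^sub>j\<close> bounded by \<open>Cg\<close>, depending measurably on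
  time along every Borel function.\<close>

locale fast_control =
  fixes w :: "real \<Rightarrow> real ^ 'm" and G :: "'m::finite \<Rightarrow> real \<Rightarrow> 'b::euclidean_space \<Rightarrow> 'b" and Cw Cg :: real
  assumes w_meas: "w \<in> borel_measurable (lebesgue_on {0..1})"
    and w_bd: "AE s in lebesgue_on {0..1}. norm1 (w s) \<le> Cw" and Cw: "0 \<le> Cw"
    and G_bd: "\<And>j s y. s \<in> {0..1} \<Longrightarrow> norm (G j s y) \<le> Cg" and Cg: "0 \<le> Cg"
    and G_meas: "\<And>j Y. Y \<in> borel_measurable borel \<Longrightarrow> (\<lambda>s. G j s (Y s)) \<in> borel_measurable (lebesgue_on {0..1})"
begin

text \<open>Essential boundedness leaves a null set where \<open>w\<close> is large. Replacing \<open>w\<close> by 0 there changes neither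
  the equation nor its integrals and makes the velocities bounded everywhere.\<close>

definition truncated :: "real \<Rightarrow> real ^ 'm" where "truncated s = (if norm1 (w s) \<le> Cw then w s else 0)"

lemma truncated_bound: "norm1 (truncated s) \<le> Cw" "norm1 (truncated s) \<le> norm1 (w s)"
  using Cw by (auto simp: truncated_def) (simp_all add: norm1_def sum_nonneg)

lemma truncated_measurable: "truncated \<in> borel_measurable (lebesgue_on {0..1})"
  unfolding truncated_def using w_meas borel_measurable_norm1[OF w_meas] by measurable

lemma truncated_AE: "AE s in lebesgue_on {0..1}. truncated s = w s"
  using w_bd by eventually_elim (simp add: truncated_def)

definition velocity :: "(real \<Rightarrow> 'b) \<Rightarrow> real \<Rightarrow> 'b" where
  "velocity z s = (\<Sum>j\<in>UNIV. (truncated s $ j) *\<^sub>R G j s (z s))"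

lemma velocity_measurable: "Y \<in> borel_measurable borel \<Longrightarrow> velocity Y \<in> borel_measurable (lebesgue_on {0..1})"
  unfolding velocity_def using G_meas measurable_vec_nth[OF truncated_measurable]
  by (intro borel_measurable_sum borel_measurable_scaleR) auto

lemma velocity_bound: "s \<in> {0..1} \<Longrightarrow> norm (velocity z s) \<le> norm1 (truncated s) * Cg"
  unfolding velocity_def by (rule norm_sum_control_le) (rule G_bd)

lemma velocity_bound_uniform: "s \<in> {0..1} \<Longrightarrow> norm (velocity z s) \<le> Cw * Cg"
  using velocity_bound[of s z] mult_right_mono[OF truncated_bound(1)[of s] Cg] by linarith

lemma velocity_cong: "s \<in> {0..1} \<Longrightarrow> z s = z' s \<Longrightarrow> velocity z s = velocity z' s"
  by (simp add: velocity_def)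

lemma truncated_integral: "(LINT s|lebesgue_on {0..1}. norm1 (truncated s)) = (LINT s|lebesgue_on {0..1}. norm1 (w s))"
  using truncated_AE by (intro integral_cong_AE borel_measurable_norm1 truncated_measurable w_meas) auto

lemma arc_clamp:
  assumes "is_arc w G z"
  defines "zc \<equiv> \<lambda>t. z (max 0 (min 1 t))"
  shows "zc \<in> borel_measurable borel" "t \<in> {0..1} \<Longrightarrow> zc t = z t"
  using assms(1) unfolding zc_def is_arc_def
  by (auto intro!: continuous_clamp_borel abs_continuous_on_imp_continuous_on)

lemma velocity_arc_measurable: "is_arc w G z \<Longrightarrow> velocity z \<in> borel_measurable (lebesgue_on {0..1})"
proof -
  assume z: "is_arc w G z"
  have "velocity (\<lambda>t. z (max 0 (min 1 t))) \<in> borel_measurable (lebesgue_on {0..1})"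
    by (rule velocity_measurable[OF arc_clamp(1)[OF z]])
  then show ?thesis
    by (rule measurable_cong[THEN iffD1, rotated]) (auto intro: velocity_cong)
qed

lemma arc_integral_eq:
  assumes z: "is_arc w G z" and t: "t \<in> {0..1}"
  shows "z t = z 0 + (LINT u|lebesgue_on {0..t}. velocity z u)"
proof (rule abs_continuous_fundamental_theorem[OF _ velocity_arc_measurable[OF z] velocity_bound_uniform _ t])
  show "abs_continuous_on {0..1} z" using z by (simp add: is_arc_def)
  have "AE s in lebesgue_on {0..1}. (z has_vector_derivative (\<Sum>j\<in>UNIV. (w s $ j) *\<^sub>R G j s (z s))) (at s within {0..1})"
    using z by (simp add: is_arc_def)
  then show "AE s in lebesgue_on {0..1}. (z has_vector_derivative velocity z s) (at s within {0..1})"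
    using truncated_AE by eventually_elim (simp add: velocity_def)
qed

lemma arc_volterra:
  assumes z: "is_arc w G z" and t: "t \<in> {0..1}"
  shows "z t = z 0 + unit_time.driver_integral (\<lambda>_. velocity z) {0..<t}"
  using arc_integral_eq[OF z t] unit_time_integral[of "\<lambda>_. velocity z", OF velocity_arc_measurable[OF z] t] by simp

lemma admissible_velocity: "is_arc w G z \<Longrightarrow> unit_time.admissible (Cw * Cg) (\<lambda>_. velocity z)"
  unfolding unit_time.admissible_def using velocity_arc_measurable[of z] velocity_bound_uniform
  by (auto intro!: borel_measurable_scaleR borel_measurable_indicator)

lemma arc_growth:
  assumes z: "is_arc w G z" and t: "t \<in> {0..1}"
  shows "norm (z t - z 0) \<le> Cw * Cg"
proof -
  have "norm (unit_time.driver_integral (\<lambda>_. velocity z) {0..<t}) \<le> Cw * Cg * unit_time.mass {0..<t}"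
    using t by (intro unit_time.driver_integral_norm_le_mass[OF admissible_velocity[OF z]]) auto
  also have "\<dots> \<le> Cw * Cg * unit_time.mass {0..1}"
    using Cw Cg t by (intro mult_left_mono unit_time.mass_mono) auto
  finally show ?thesis using arc_volterra[OF z t] by (simp add: unit_time_mass)
qed

lemma admissible_norm1: "0 \<le> c \<Longrightarrow> unit_time.admissible (c * Cw) (\<lambda>_ s. c * norm1 (truncated s))"
  unfolding unit_time.admissible_def using truncated_bound(1)
  by (auto intro!: borel_measurable_scaleR borel_measurable_indicator borel_measurable_times borel_measurable_norm1 truncated_measurable mult_left_mono simp: abs_mult)

lemma integral_norm1:
  "unit_time.driver_integral (\<lambda>_ s. c * norm1 (truncated s)) {0..<1} = c * (LINT s|lebesgue_on {0..1}. norm1 (w s))"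
proof -
  have "unit_time.driver_integral (\<lambda>_ s. c * norm1 (truncated s)) {0..<1} = (LINT s|lebesgue_on {0..1}. c * norm1 (truncated s))"
    by (rule unit_time_integral) (auto intro!: borel_measurable_times borel_measurable_norm1 truncated_measurable)
  then show ?thesis using truncated_integral by simp
qed

lemma arc_jump_le:
  assumes z: "is_arc w G z"
  shows "norm (z 1 - z 0) \<le> Cg * (LINT s|lebesgue_on {0..1}. norm1 (w s))"
proof -
  have "norm (unit_time.driver_integral (\<lambda>_. velocity z) {0..<1}) \<le> unit_time.driver_integral (\<lambda>_ s. Cg * norm1 (truncated s)) {0..<1}"
    using velocity_bound[of _ z] by (intro unit_time.driver_integral_norm_le[OF admissible_velocity[OF z] admissible_norm1[OF Cg]]) (auto simp: mult.commute)
  then show ?thesis using arc_volterra[OF z, of 1] integral_norm1 by simp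
qed

lemma velocity_lipschitz:
  assumes lip: "\<And>j s y y'. s \<in> {0..1} \<Longrightarrow> norm y \<le> R \<Longrightarrow> norm y' \<le> R \<Longrightarrow> norm (G j s y - G j s y') \<le> L * norm (y - y')"
    and s: "s \<in> {0..1}" and b: "norm (z s) \<le> R" "norm (z' s) \<le> R"
  shows "norm (velocity z s - velocity z' s) \<le> norm1 (truncated s) * (L * norm (z s - z' s))"
proof -
  have "velocity z s - velocity z' s = (\<Sum>j\<in>UNIV. (truncated s $ j) *\<^sub>R (G j s (z s) - G j s (z' s)))"
    by (simp add: velocity_def sum_subtractf scaleR_diff_right)
  also have "norm \<dots> \<le> norm1 (truncated s) * (L * norm (z s - z' s))"
    by (rule norm_sum_control_le) (rule lip[OF s b])
  finally show ?thesis .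
qed

text \<open>The displacement over the unit interval depends on the start with a constant proportional to the
  total effort \<open>\<integral> \<parallel>w\<parallel>\<close>, which is what makes the jump maps summable.\<close>

lemma arc_jump_diff_le:
  assumes z: "is_arc w G z" "is_arc w G z'"
    and lip: "\<And>j s y y'. s \<in> {0..1} \<Longrightarrow> norm y \<le> R \<Longrightarrow> norm y' \<le> R \<Longrightarrow> norm (G j s y - G j s y') \<le> L * norm (y - y')"
    and b: "\<And>s. s \<in> {0..1} \<Longrightarrow> norm (z s) \<le> R" "\<And>s. s \<in> {0..1} \<Longrightarrow> norm (z' s) \<le> R"
    and d: "\<And>s. s \<in> {0..1} \<Longrightarrow> norm (z s - z' s) \<le> B" and L: "0 \<le> L"
  shows "norm ((z 1 - z 0) - (z' 1 - z' 0)) \<le> L * B * (LINT s|lebesgue_on {0..1}. norm1 (w s))"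
proof -
  have B: "0 \<le> B" using order_trans[OF norm_ge_zero d[of 0]] by simp
  have "(z 1 - z 0) - (z' 1 - z' 0) = unit_time.driver_integral (\<lambda>_ s. velocity z s - velocity z' s) {0..<1}"
    using arc_volterra[OF z(1), of 1] arc_volterra[OF z(2), of 1]
    by (subst unit_time.driver_integral_diff[OF admissible_velocity[OF z(1)] admissible_velocity[OF z(2)]]) auto
  also have "norm \<dots> \<le> unit_time.driver_integral (\<lambda>_ s. (L * B) * norm1 (truncated s)) {0..<1}"
  proof (rule unit_time.driver_integral_norm_le[OF unit_time.admissible_diff[OF admissible_velocity[OF z(1)] admissible_velocity[OF z(2)]] admissible_norm1])
    fix s :: real assume "s \<in> {0..<1}"
    then have s: "s \<in> {0..1}" by auto
    have "norm (velocity z s - velocity z' s) \<le> norm1 (truncated s) * (L * norm (z s - z' s))"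
      by (rule velocity_lipschitz[where R=R and L=L]) (use s b lip in auto)
    also have "\<dots> \<le> norm1 (truncated s) * (L * B)" using d[OF s] L by (intro mult_left_mono) auto
    finally show "norm (velocity z s - velocity z' s) \<le> (L * B) * norm1 (truncated s)" by (simp add: mult.commute)
  qed (use L B in auto)
  also have "\<dots> = L * B * (LINT s|lebesgue_on {0..1}. norm1 (w s))" by (rule integral_norm1)
  finally show ?thesis .
qed

lemma arc_exists:
  assumes lip: "\<And>j s y y'. s \<in> {0..1} \<Longrightarrow> norm y \<le> R \<Longrightarrow> norm y' \<le> R \<Longrightarrow> norm (G j s y - G j s y') \<le> L * norm (y - y')"
    and L: "0 \<le> L" and R: "norm c + Cw * Cg \<le> R"
  obtains z where "is_arc w G z" "z 0 = c"
proof -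
  obtain Y where Y: "Y \<in> borel_measurable borel" "\<And>t. norm (Y t) \<le> R"
    "\<And>t. t \<in> {0..1} \<Longrightarrow> Y t = c + unit_time.driver_integral (\<lambda>_ s. \<Sum>j\<in>UNIV. (truncated s $ j) *\<^sub>R G j s (Y s)) {0..<t}"
  proof (rule unit_time.volterra_exists[where c=c and H="\<lambda>_ s y. \<Sum>j\<in>UNIV. (truncated s $ j) *\<^sub>R G j s y" and C="Cw * Cg" and L="Cw * L" and R=R])
    fix Y :: "real \<Rightarrow> 'b" assume "Y \<in> borel_measurable borel"
    then have "velocity Y \<in> borel_measurable (lebesgue_on {0..1})" by (rule velocity_measurable)
    then have "(\<lambda>s. indicat_real {0..1} s *\<^sub>R velocity Y s) \<in> borel_measurable (lebesgue_on {0..1})"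
      by (intro borel_measurable_scaleR borel_measurable_indicator) auto
    then show "(\<lambda>s. indicat_real {0..1} s *\<^sub>R (\<Sum>j\<in>UNIV. (truncated s $ j) *\<^sub>R G j s (Y s))) \<in> borel_measurable (lebesgue_on {0..1})"
      by (simp add: velocity_def)
  next
    fix s y assume "s \<in> {0..1::real}"
    then show "norm (\<Sum>j\<in>UNIV. (truncated s $ j) *\<^sub>R G j s y) \<le> Cw * Cg" using velocity_bound_uniform[of s "\<lambda>_. y"] by (simp add: velocity_def)
  next
    fix s and y y' :: 'b assume s: "s \<in> {0..1::real}" and b: "norm y \<le> R" "norm y' \<le> R"
    have "norm (velocity (\<lambda>_. y) s - velocity (\<lambda>_. y') s) \<le> norm1 (truncated s) * (L * norm (y - y'))"
      by (rule velocity_lipschitz[where R=R and L=L]) (use b s in \<open>auto intro: lip\<close>)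
    also have "\<dots> \<le> Cw * (L * norm (y - y'))" using truncated_bound(1) L by (intro mult_right_mono) auto
    finally show "norm ((\<Sum>j\<in>UNIV. (truncated s $ j) *\<^sub>R G j s y) - (\<Sum>j\<in>UNIV. (truncated s $ j) *\<^sub>R G j s y')) \<le> Cw * L * norm (y - y')"
      by (simp add: velocity_def)
  qed (use R Cw Cg L in \<open>auto simp: unit_time_mass\<close>)
  have eq: "Y t = c + (LINT u|lebesgue_on {0..t}. velocity Y u)" if t: "t \<in> {0..1}" for t
    using Y(3)[OF t] unit_time_integral[of "\<lambda>_. velocity Y", OF velocity_measurable[OF Y(1)] t] unfolding velocity_def[abs_def] by simp
  have Y0: "Y 0 = c" using Y(3)[of 0] by (simp add: unit_time.driver_integral_def set_lebesgue_integral_def)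
  have "abs_continuous_on {0..1} Y"
  proof (rule Lipschitz_imp_abs_continuous_on[where B="Cw * Cg"])
    fix s t :: real assume st: "s \<in> {0..1}" "t \<in> {0..1}" "s \<le> t"
    have "norm ((LINT u|lebesgue_on {0..t}. velocity Y u) - (LINT u|lebesgue_on {0..s}. velocity Y u)) \<le> Cw * Cg * (t - s)"
      by (rule norm_indefinite_integral_increment[OF velocity_measurable[OF Y(1)] velocity_bound_uniform]) (use st in auto)
    then show "norm (Y t - Y s) \<le> Cw * Cg * (t - s)" using eq[OF st(1)] eq[OF st(2)] by simp
  qed (use Cw Cg in auto)
  moreover have "AE s in lebesgue_on {0..1}. ((\<lambda>t. LINT u|lebesgue_on {0..t}. velocity Y u) has_vector_derivative velocity Y s) (at s within {0..1})"
    by (rule indefinite_integral_derivative_ae[OF velocity_measurable[OF Y(1)] velocity_bound_uniform])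
  then have "AE s in lebesgue_on {0..1}. (Y has_vector_derivative (\<Sum>j\<in>UNIV. (w s $ j) *\<^sub>R G j s (Y s))) (at s within {0..1})"
    using truncated_AE AE_space
  proof eventually_elim
    case (elim s)
    then have s: "s \<in> {0..1}" by simp
    have "((\<lambda>t. c + (LINT u|lebesgue_on {0..t}. velocity Y u)) has_vector_derivative velocity Y s) (at s within {0..1})"
      using elim(1) by (auto intro!: derivative_eq_intros)
    then have "(Y has_vector_derivative velocity Y s) (at s within {0..1})"
      by (rule has_vector_derivative_transform[OF s, rotated]) (use eq in auto)
    then show ?case using elim(2) by (simp add: velocity_def)
  qed
  ultimately have "is_arc w G Y" by (simp add: is_arc_def)
  then show ?thesis using that Y0 by blast
qed

end

text \<open>One constant serves all controls with the same essential bound and all fields with the same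
  Lipschitz constant; it is applied to infinitely many jump times simultaneously.\<close>

lemma arcs_stable:
  fixes L Cw :: real
  assumes L: "0 \<le> L" "0 \<le> Cw"
  shows "\<exists>K\<ge>0. \<forall>w (G :: 'm::finite \<Rightarrow> real \<Rightarrow> 'b::euclidean_space \<Rightarrow> 'b) Cg z z' R. fast_control w G Cw Cg \<longrightarrow>
     is_arc w G z \<longrightarrow> is_arc w G z' \<longrightarrow>
     (\<forall>s\<in>{0..1}. norm (z s) \<le> R \<and> norm (z' s) \<le> R) \<longrightarrow>
     (\<forall>j s y y'. s \<in> {0..1} \<longrightarrow> norm y \<le> R \<longrightarrow> norm y' \<le> R \<longrightarrow> norm (G j s y - G j s y') \<le> L * norm (y - y')) \<longrightarrow>
     (\<forall>s\<in>{0..1}. norm (z s - z' s) \<le> norm (z 0 - z' 0) * K)"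
proof -
  have CL: "0 \<le> Cw * L" using L by simp
  obtain K where K0: "K \<ge> 0" and K: "\<forall>H G Y Z C R. (Y :: real \<Rightarrow> 'b) \<in> borel_measurable borel \<longrightarrow> Z \<in> borel_measurable borel \<longrightarrow>
     (\<forall>t\<in>{0..1}. norm (Y t) \<le> R \<and> norm (Z t) \<le> R) \<longrightarrow>
     unit_time.admissible C H \<longrightarrow> unit_time.admissible C G \<longrightarrow>
     (\<forall>i\<in>{()}. \<forall>s\<in>{0..1}. norm (H i s - G i s) \<le> Cw * L * norm (Y s - Z s)) \<longrightarrow>
     (\<forall>t\<in>{0..1}. Y t = Y 0 + unit_time.driver_integral H {0..<t}) \<longrightarrow>
     (\<forall>t\<in>{0..1}. Z t = Z 0 + unit_time.driver_integral G {0..<t}) \<longrightarrow>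
     (\<forall>t\<in>{0..1}. norm (Y t - Z t) \<le> norm (Y 0 - Z 0) * K)"
    using unit_time.volterra_stable[OF CL] by (elim exE conjE) (rule that)
  show ?thesis
  proof (intro exI[of _ K] conjI K0 allI impI)
    fix w and G :: "'m \<Rightarrow> real \<Rightarrow> 'b \<Rightarrow> 'b" and Cg z z' R
    assume fc: "fast_control w G Cw Cg" and z: "is_arc w G z" "is_arc w G z'"
      and b: "\<forall>s\<in>{0..1}. norm (z s) \<le> R \<and> norm (z' s) \<le> R"
      and lip: "\<forall>j s y y'. s \<in> {0..1} \<longrightarrow> norm y \<le> R \<longrightarrow> norm y' \<le> R \<longrightarrow> norm (G j s y - G j s y') \<le> L * norm (y - y')"
    interpret fast_control w G Cw Cg by (rule fc)
    let ?Y = "\<lambda>t. z (max 0 (min 1 t))" and ?Z = "\<lambda>t. z' (max 0 (min 1 t))"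
    have "\<forall>t\<in>{0..1}. norm (?Y t - ?Z t) \<le> norm (?Y 0 - ?Z 0) * K"
    proof (rule K[THEN spec[of _ "\<lambda>_. velocity z"], THEN spec[of _ "\<lambda>_. velocity z'"], THEN spec, THEN spec, THEN spec[of _ "Cw * Cg"], THEN spec[of _ R],
          THEN mp, THEN mp, THEN mp, THEN mp, THEN mp, THEN mp, THEN mp, THEN mp])
      show "?Y \<in> borel_measurable borel" "?Z \<in> borel_measurable borel" using arc_clamp(1) z by auto
      show "\<forall>t\<in>{0..1}. norm (?Y t) \<le> R \<and> norm (?Z t) \<le> R" using b by auto
      show "unit_time.admissible (Cw * Cg) (\<lambda>_. velocity z)" "unit_time.admissible (Cw * Cg) (\<lambda>_. velocity z')"
        using z by (auto intro: admissible_velocity)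
      show "\<forall>i\<in>{()}. \<forall>s\<in>{0..1}. norm (velocity z s - velocity z' s) \<le> Cw * L * norm (?Y s - ?Z s)"
      proof (intro ballI)
        fix s :: real assume s: "s \<in> {0..1}"
        have "norm (velocity z s - velocity z' s) \<le> norm1 (truncated s) * (L * norm (z s - z' s))"
          by (rule velocity_lipschitz[where R=R, OF _ s]) (use lip b s in auto)
        also have "\<dots> \<le> Cw * (L * norm (z s - z' s))" using truncated_bound(1) L by (intro mult_right_mono) auto
        finally show "norm (velocity z s - velocity z' s) \<le> Cw * L * norm (?Y s - ?Z s)" using s by simp
      qed
      show "\<forall>t\<in>{0..1}. ?Y t = ?Y 0 + unit_time.driver_integral (\<lambda>_. velocity z) {0..<t}"
      proof
        fix t :: real assume t: "t \<in> {0..1}"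
        then show "?Y t = ?Y 0 + unit_time.driver_integral (\<lambda>_. velocity z) {0..<t}" using arc_volterra[OF z(1) t] by simp
      qed
      show "\<forall>t\<in>{0..1}. ?Z t = ?Z 0 + unit_time.driver_integral (\<lambda>_. velocity z') {0..<t}"
      proof
        fix t :: real assume t: "t \<in> {0..1}"
        then show "?Z t = ?Z 0 + unit_time.driver_integral (\<lambda>_. velocity z') {0..<t}" using arc_volterra[OF z(2) t] by simp
      qed
    qed
    then show "\<forall>s\<in>{0..1}. norm (z s - z' s) \<le> norm (z 0 - z' 0) * K" by simp
  qed
qed

section \<open>Delay slots and smooth fields\<close>

text \<open>The tuple with the current value in the slot of delay 0 and the other slots taken from \<open>w\<close>. It
  separates the unknown from the data already determined in earlier blocks.\<close>

definition slot_insert :: "('k::finite \<Rightarrow> nat) \<Rightarrow> 'b \<Rightarrow> 'b ^ 'k \<Rightarrow> 'b ^ 'k" where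
  "slot_insert \<kappa> y w = (\<chi> i. if \<kappa> i = 0 then y else w $ i)"

lemma slot_insert_measurable:
  fixes Y :: "'a \<Rightarrow> 'b::euclidean_space" and \<kappa> :: "'k::finite \<Rightarrow> nat"
  assumes Y: "Y \<in> borel_measurable M" and W: "\<And>i. \<kappa> i \<noteq> 0 \<Longrightarrow> (\<lambda>s. W s $ i) \<in> borel_measurable M"
  shows "(\<lambda>s. slot_insert \<kappa> (Y s) (W s)) \<in> borel_measurable M"
proof -
  have "(\<lambda>s. slot_insert \<kappa> (Y s) (W s) \<bullet> b) \<in> borel_measurable M" if "b \<in> Basis" for b
  proof -
    obtain i u where b: "b = axis i u" using \<open>b \<in> Basis\<close> by (auto simp: Basis_vec_def)
    have "(\<lambda>s. (slot_insert \<kappa> (Y s) (W s) $ i) \<bullet> u) \<in> borel_measurable M"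
      using Y W[of i] by (cases "\<kappa> i = 0") (auto simp: slot_insert_def)
    then show ?thesis by (simp add: b inner_axis)
  qed
  then show ?thesis by (subst borel_measurable_euclidean_space) simp
qed

lemma slot_insert_lipschitz:
  fixes y z :: "'b::euclidean_space" and \<kappa> :: "'k::finite \<Rightarrow> nat"
  assumes "inj \<kappa>"
  shows "norm (slot_insert \<kappa> y w - slot_insert \<kappa> z w) \<le> norm (y - z)"
proof -
  have "norm (slot_insert \<kappa> y w - slot_insert \<kappa> z w) \<le> (\<Sum>i\<in>UNIV. norm ((slot_insert \<kappa> y w - slot_insert \<kappa> z w) $ i))"
    unfolding norm_vec_def by (rule L2_set_le_sum) simp
  also have "\<dots> = (\<Sum>i\<in>{i. \<kappa> i = 0}. norm (y - z))"
    by (rule sum.mono_neutral_cong_right) (auto simp: slot_insert_def)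
  also have "\<dots> = real (card {i. \<kappa> i = 0}) * norm (y - z)" by simp
  also have "\<dots> \<le> 1 * norm (y - z)"
  proof (intro mult_right_mono)
    have "card {i. \<kappa> i = 0} \<le> card {0::nat}"
      using assms by (intro card_inj_on_le[of \<kappa>]) (auto intro: inj_on_subset)
    then show "real (card {i. \<kappa> i = 0}) \<le> 1" by simp
  qed simp
  finally show ?thesis by simp
qed

lemma slot_insert_bounded:
  fixes y :: "'b::euclidean_space" and \<kappa> :: "'k::finite \<Rightarrow> nat"
  assumes "norm y \<le> B" "\<And>i. \<kappa> i \<noteq> 0 \<Longrightarrow> norm (w $ i) \<le> B"
  shows "norm (slot_insert \<kappa> y w) \<le> real CARD('k) * B"
proof -
  have "norm (slot_insert \<kappa> y w) \<le> (\<Sum>i\<in>UNIV. norm (slot_insert \<kappa> y w $ i))"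
    unfolding norm_vec_def by (rule L2_set_le_sum) simp
  also have "\<dots> \<le> (\<Sum>i\<in>(UNIV::'k set). B)" using assms by (intro sum_mono) (auto simp: slot_insert_def)
  finally show ?thesis by simp
qed

lemma slot_insert_cong:
  "(\<And>i. \<kappa> i \<noteq> 0 \<Longrightarrow> w $ i = w' $ i) \<Longrightarrow> slot_insert \<kappa> y w = slot_insert \<kappa> y w'"
  by (simp add: slot_insert_def vec_eq_iff)

lemma C1_map_continuous: "C1_map f \<Longrightarrow> continuous_on UNIV f"
  unfolding C1_map_def continuous_on_eq_continuous_within by (auto intro: has_derivative_continuous)

text \<open>The derivative is bounded on the compact convex set \<open>[p,q] \<times> cball 0 R\<close>.\<close>

lemma C1_map_lipschitz_on_bounded:
  fixes f :: "real \<times> 'c::euclidean_space \<Rightarrow> 'b::euclidean_space"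
  assumes "C1_map f"
  shows "\<exists>L\<ge>0. \<forall>t\<in>{p..q}. \<forall>u v. norm u \<le> R \<longrightarrow> norm v \<le> R \<longrightarrow> norm (f (t,u) - f (t,v)) \<le> L * norm (u - v)"
proof -
  obtain f' where f': "\<And>z. (f has_derivative blinfun_apply (f' z)) (at z)" and cont: "continuous_on UNIV f'"
    using assms unfolding C1_map_def by blast
  define S where "S = {p..q} \<times> (cball 0 R :: 'c set)"
  have S: "compact S" "convex S" unfolding S_def by (auto intro!: compact_Times convex_Times)
  have "compact (f' ` S)" using S(1) cont by (intro compact_continuous_image) (auto intro: continuous_on_subset)
  then obtain L where L: "\<And>z. z \<in> S \<Longrightarrow> norm (f' z) \<le> L" using compact_imp_bounded bounded_iff by (metis imageI)
  show ?thesis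
  proof (intro exI[of _ "max L 0"] conjI ballI allI impI)
    fix t and u v :: 'c assume t: "t \<in> {p..q}" "norm u \<le> R" "norm v \<le> R"
    have "norm (f (t,u) - f (t,v)) \<le> max L 0 * norm ((t,u) - (t,v))"
    proof (rule differentiable_bound[OF S(2)])
      show "(f has_derivative blinfun_apply (f' x)) (at x within S)" for x
        using f' by (rule has_derivative_at_withinI)
      show "onorm (blinfun_apply (f' x)) \<le> max L 0" if "x \<in> S" for x
        using L[OF that] by (simp add: norm_blinfun.rep_eq[symmetric])
    qed (use t in \<open>auto simp: S_def\<close>)
    then show "norm (f (t,u) - f (t,v)) \<le> max L 0 * norm (u - v)" by (simp add: norm_Pair)
  qed simp
qed

section \<open>Functions of bounded variation\<close>

lemma bounded_variation_onI:
  fixes x :: "real \<Rightarrow> 'b::real_normed_vector" and V :: "real \<Rightarrow> real"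
  assumes "\<And>s t. s \<in> {p..q} \<Longrightarrow> t \<in> {p..q} \<Longrightarrow> s \<le> t \<Longrightarrow> norm (x t - x s) \<le> V t - V s"
  shows "bounded_variation_on {p..q} x"
  unfolding bounded_variation_on_def
proof (intro exI allI impI)
  fix P :: "nat \<Rightarrow> real" and n assume P: "(\<forall>i\<le>n. P i \<in> {p..q}) \<and> (\<forall>i<n. P i \<le> P (Suc i))"
  have Vm: "V s \<le> V t" if "s \<in> {p..q}" "t \<in> {p..q}" "s \<le> t" for s t
    using assms[OF that] norm_ge_zero[of "x t - x s"] by linarith
  have "(\<Sum>i<n. norm (x (P (Suc i)) - x (P i))) \<le> (\<Sum>i<n. V (P (Suc i)) - V (P i))"
    using P by (intro sum_mono assms) auto
  also have "\<dots> = V (P n) - V (P 0)" by (rule sum_lessThan_telescope)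
  also have "\<dots> \<le> V q - V p"
  proof -
    have "P n \<in> {p..q}" "P 0 \<in> {p..q}" using P by auto
    then have "V (P n) \<le> V q" "V p \<le> V (P 0)" by (auto intro!: Vm)
    then show ?thesis by simp
  qed
  finally show "(\<Sum>i<n. norm (x (P (Suc i)) - x (P i))) \<le> V q - V p" .
qed

lemma bounded_variation_on_add:
  assumes "bounded_variation_on S x" "bounded_variation_on S y"
  shows "bounded_variation_on S (\<lambda>t. x t + y t)"
proof -
  obtain C where C: "\<forall>p n. (\<forall>i\<le>n. p i \<in> S) \<and> (\<forall>i<n. p i \<le> p (Suc i)) \<longrightarrow> (\<Sum>i<(n::nat). norm (x (p (Suc i)) - x (p i))) \<le> C"
    using assms(1) unfolding bounded_variation_on_def by (elim exE) (rule that)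
  obtain D where D: "\<forall>p n. (\<forall>i\<le>n. p i \<in> S) \<and> (\<forall>i<n. p i \<le> p (Suc i)) \<longrightarrow> (\<Sum>i<(n::nat). norm (y (p (Suc i)) - y (p i))) \<le> D"
    using assms(2) unfolding bounded_variation_on_def by (elim exE) (rule that)
  show ?thesis
    unfolding bounded_variation_on_def
  proof (intro exI[of _ "C + D"] allI impI)
    fix P :: "nat \<Rightarrow> real" and n assume P: "(\<forall>i\<le>n. P i \<in> S) \<and> (\<forall>i<n. P i \<le> P (Suc i))"
    have "(\<Sum>i<n. norm (x (P (Suc i)) + y (P (Suc i)) - (x (P i) + y (P i)))) \<le>
      (\<Sum>i<n. norm (x (P (Suc i)) - x (P i)) + norm (y (P (Suc i)) - y (P i)))"
      by (intro sum_mono norm_diff_triangle_ineq)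
    also have "\<dots> \<le> C + D"
      unfolding sum.distrib using C[THEN spec[of _ P], THEN spec[of _ n], THEN mp, OF P] D[THEN spec[of _ P], THEN spec[of _ n], THEN mp, OF P]
      by (rule add_mono)
    finally show "(\<Sum>i<n. norm (x (P (Suc i)) + y (P (Suc i)) - (x (P i) + y (P i)))) \<le> C + D" .
  qed
qed

lemma bounded_variation_on_cong:
  assumes "bounded_variation_on S x" "\<And>t. t \<in> S \<Longrightarrow> y t = x t"
  shows "bounded_variation_on S y"
proof -
  obtain C where C: "\<forall>p n. (\<forall>i\<le>n. p i \<in> S) \<and> (\<forall>i<n. p i \<le> p (Suc i)) \<longrightarrow> (\<Sum>i<(n::nat). norm (x (p (Suc i)) - x (p i))) \<le> C"
    using assms(1) unfolding bounded_variation_on_def by (elim exE) (rule that)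
  show ?thesis
    unfolding bounded_variation_on_def
  proof (intro exI[of _ C] allI impI)
    fix P :: "nat \<Rightarrow> real" and n assume P: "(\<forall>i\<le>n. P i \<in> S) \<and> (\<forall>i<n. P i \<le> P (Suc i))"
    have "(\<Sum>i<n. norm (y (P (Suc i)) - y (P i))) = (\<Sum>i<n. norm (x (P (Suc i)) - x (P i)))"
      using P assms(2) by (intro sum.cong refl) auto
    then show "(\<Sum>i<n. norm (y (P (Suc i)) - y (P i))) \<le> C"
      using C[THEN spec[of _ P], THEN spec[of _ n], THEN mp, OF P] by simp
  qed
qed

lemma bounded_variation_on_modify_point:
  fixes x y :: "real \<Rightarrow> 'b::real_normed_vector"
  assumes x: "bounded_variation_on {p..q} x" and eq: "\<And>t. t \<in> {p..q} \<Longrightarrow> t \<noteq> c \<Longrightarrow> y t = x t"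
  shows "bounded_variation_on {p..q} y"
proof -
  define d where "d = y c - x c"
  have "bounded_variation_on {p..q} (\<lambda>t. if t = c then d else 0)"
    by (rule bounded_variation_onI[where V="\<lambda>t. (if c \<le> t then norm d else 0) + (if c < t then norm d else 0)"]) auto
  from bounded_variation_on_add[OF x this] show ?thesis
    by (rule bounded_variation_on_cong) (use eq in \<open>auto simp: d_def\<close>)
qed

text \<open>Splitting every increment at \<open>c\<close> by means of \<open>min\<close> and \<open>max\<close> turns a partition of \<open>[p,q]\<close> into one of
  each part, without inserting \<open>c\<close> as a new point.\<close>

lemma bounded_variation_on_concat:
  fixes x :: "real \<Rightarrow> 'b::real_normed_vector"
  assumes "bounded_variation_on {p..c} x" "bounded_variation_on {c..q} x" and c: "p \<le> c" "c \<le> q"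
  shows "bounded_variation_on {p..q} x"
proof -
  obtain C where C: "\<forall>P n. (\<forall>i\<le>n. P i \<in> {p..c}) \<and> (\<forall>i<n. P i \<le> P (Suc i)) \<longrightarrow> (\<Sum>i<(n::nat). norm (x (P (Suc i)) - x (P i))) \<le> C"
    using assms(1) unfolding bounded_variation_on_def by (elim exE) (rule that)
  obtain D where D: "\<forall>P n. (\<forall>i\<le>n. P i \<in> {c..q}) \<and> (\<forall>i<n. P i \<le> P (Suc i)) \<longrightarrow> (\<Sum>i<(n::nat). norm (x (P (Suc i)) - x (P i))) \<le> D"
    using assms(2) unfolding bounded_variation_on_def by (elim exE) (rule that)
  show ?thesis
    unfolding bounded_variation_on_def
  proof (intro exI[of _ "C + D"] allI impI)
    fix P :: "nat \<Rightarrow> real" and n assume P: "(\<forall>i\<le>n. P i \<in> {p..q}) \<and> (\<forall>i<n. P i \<le> P (Suc i))"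
    let ?l = "\<lambda>i. min (P i) c" and ?r = "\<lambda>i. max (P i) c"
    have "(\<Sum>i<n. norm (x (P (Suc i)) - x (P i))) \<le>
      (\<Sum>i<n. norm (x (?l (Suc i)) - x (?l i)) + norm (x (?r (Suc i)) - x (?r i)))"
    proof (intro sum_mono)
      fix i assume "i \<in> {..<n}"
      then have "P i \<le> P (Suc i)" using P by auto
      then consider "P (Suc i) \<le> c" | "c \<le> P i" | "P i < c" "c < P (Suc i)" by linarith
      then show "norm (x (P (Suc i)) - x (P i)) \<le> norm (x (?l (Suc i)) - x (?l i)) + norm (x (?r (Suc i)) - x (?r i))"
      proof cases
        case 3
        then show ?thesis using norm_triangle_ineq[of "x c - x (P i)" "x (P (Suc i)) - x c"] by (simp add: min_def max_def)
      qed (use \<open>P i \<le> P (Suc i)\<close> in \<open>auto simp: min_def max_def\<close>)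
    qed
    also have "\<dots> \<le> C + D"
      unfolding sum.distrib
    proof (rule add_mono)
      show "(\<Sum>i<n. norm (x (?l (Suc i)) - x (?l i))) \<le> C"
        by (rule C[THEN spec[of _ ?l], THEN spec[of _ n], THEN mp]) (use P c in \<open>auto simp: min_def\<close>)
      show "(\<Sum>i<n. norm (x (?r (Suc i)) - x (?r i))) \<le> D"
        by (rule D[THEN spec[of _ ?r], THEN spec[of _ n], THEN mp]) (use P c in \<open>auto simp: max_def\<close>)
    qed
    finally show "(\<Sum>i<n. norm (x (P (Suc i)) - x (P i))) \<le> C + D" .
  qed
qed

text \<open>\<open>V\<close> is the variation function; appending the points \<open>s\<close> and \<open>t\<close> to a chain in \<open>[p,s]\<close> shows that it
  grows by at least the increment of \<open>x\<close>.\<close>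

lemma bounded_variation_on_dominated:
  fixes x :: "real \<Rightarrow> 'b::real_normed_vector"
  assumes "bounded_variation_on {p..q} x"
  obtains V :: "real \<Rightarrow> real" where "\<And>s t. s \<in> {p..q} \<Longrightarrow> t \<in> {p..q} \<Longrightarrow> s \<le> t \<Longrightarrow> norm (x t - x s) \<le> V t - V s"
proof -
  obtain C where C: "\<forall>P n. (\<forall>i\<le>n. P i \<in> {p..q}) \<and> (\<forall>i<n. P i \<le> P (Suc i)) \<longrightarrow> (\<Sum>i<(n::nat). norm (x (P (Suc i)) - x (P i))) \<le> C"
    using assms unfolding bounded_variation_on_def by (elim exE) (rule that)
  define chain where "chain t P n \<longleftrightarrow> (\<forall>i\<le>n. P i \<in> {p..t}) \<and> (\<forall>i<n. P i \<le> P (Suc i))" for t :: real and P and n :: nat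
  define S where "S t = {(\<Sum>i<n. norm (x (P (Suc i)) - x (P i))) | P n. chain t P n}" for t
  define V where "V t = Sup (S t)" for t
  have bdd: "bdd_above (S t)" if t: "t \<in> {p..q}" for t
  proof (rule bdd_aboveI)
    fix y assume "y \<in> S t"
    then obtain P n where P: "chain t P n" and y: "y = (\<Sum>i<n. norm (x (P (Suc i)) - x (P i)))" by (auto simp: S_def)
    have "(\<forall>i\<le>n. P i \<in> {p..q}) \<and> (\<forall>i<n. P i \<le> P (Suc i))" using P t by (auto simp: chain_def)
    from C[THEN spec[of _ P], THEN spec[of _ n], THEN mp, OF this] show "y \<le> C" by (simp add: y)
  qed
  have "norm (x t - x s) \<le> V t - V s" if st: "s \<in> {p..q}" "t \<in> {p..q}" "s \<le> t" for s t
  proof -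
    have "V s \<le> V t - norm (x t - x s)"
      unfolding V_def[of s]
    proof (rule cSup_least)
      have "chain s (\<lambda>_. p) 0" using st by (simp add: chain_def)
      then show "S s \<noteq> {}" by (auto simp: S_def)
      fix y assume "y \<in> S s"
      then obtain P n where P: "chain s P n" and y: "y = (\<Sum>i<n. norm (x (P (Suc i)) - x (P i)))" by (auto simp: S_def)
      \<comment> \<open>The chain \<open>P\<close> followed by \<open>s\<close> and \<open>t\<close>.\<close>
      define Q where "Q i = (if i \<le> n then P i else if i = Suc n then s else t)" for i
      have Pn: "P n \<le> s" using P by (auto simp: chain_def)
      have "chain t Q (Suc (Suc n))"
        using P Pn st by (auto simp: chain_def Q_def le_Suc_eq less_Suc_eq)
      then have "(\<Sum>i<Suc (Suc n). norm (x (Q (Suc i)) - x (Q i))) \<in> S t" unfolding S_def by blast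
      then have "(\<Sum>i<Suc (Suc n). norm (x (Q (Suc i)) - x (Q i))) \<le> V t"
        unfolding V_def using bdd[OF st(2)] by (rule cSup_upper)
      moreover have "(\<Sum>i<n. norm (x (Q (Suc i)) - x (Q i))) = y"
        unfolding y by (intro sum.cong refl) (auto simp: Q_def)
      moreover have "Q (Suc n) = s" "Q (Suc (Suc n)) = t" by (auto simp: Q_def)
      moreover have "(\<Sum>i<Suc (Suc n). norm (x (Q (Suc i)) - x (Q i))) =
        (\<Sum>i<n. norm (x (Q (Suc i)) - x (Q i))) + norm (x (Q (Suc n)) - x (Q n)) + norm (x (Q (Suc (Suc n))) - x (Q (Suc n)))"
        by simp
      ultimately have "y + norm (x s - x (Q n)) + norm (x t - x s) \<le> V t" by simp
      then show "y \<le> V t - norm (x t - x s)" using norm_ge_zero[of "x s - x (Q n)"] by linarith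
    qed
    then show ?thesis by simp
  qed
  then show ?thesis using that by blast
qed

lemma bounded_variation_on_bounded:
  fixes x :: "real \<Rightarrow> 'b::real_normed_vector"
  assumes "bounded_variation_on {p..q} x"
  shows "\<exists>B. \<forall>t\<in>{p..q}. norm (x t) \<le> B"
proof -
  obtain V :: "real \<Rightarrow> real" where V: "\<And>s t. s \<in> {p..q} \<Longrightarrow> t \<in> {p..q} \<Longrightarrow> s \<le> t \<Longrightarrow> norm (x t - x s) \<le> V t - V s"
    using bounded_variation_on_dominated[OF assms] by blast
  show ?thesis
  proof (intro exI[of _ "norm (x p) + (V q - V p)"] ballI)
    fix t assume t: "t \<in> {p..q}"
    then have p: "p \<in> {p..q}" "q \<in> {p..q}" by auto
    have "norm (x t - x p) \<le> V t - V p" using t by (intro V p) auto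
    moreover have "norm (x q - x t) \<le> V q - V t" using V[OF t p(2)] t by simp
    then have "0 \<le> V q - V t" by (rule order_trans[OF norm_ge_zero])
    ultimately show "norm (x t) \<le> norm (x p) + (V q - V p)"
      using norm_triangle_ineq[of "x p" "x t - x p"] by simp
  qed
qed

lemma bounded_variation_on_borel:
  fixes x :: "real \<Rightarrow> 'b::euclidean_space"
  assumes "bounded_variation_on {p..q} x" "p \<le> q"
  shows "(\<lambda>t. if t \<in> {p..q} then x t else 0) \<in> borel_measurable borel"
proof -
  obtain V :: "real \<Rightarrow> real" where V: "\<And>s t. s \<in> {p..q} \<Longrightarrow> t \<in> {p..q} \<Longrightarrow> s \<le> t \<Longrightarrow> norm (x t - x s) \<le> V t - V s"
    using bounded_variation_on_dominated[OF assms(1)] by blast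
  have "(\<lambda>t. x (max p (min q t))) \<in> borel_measurable borel"
    by (rule borel_measurable_if_increments_dominated[where m="\<lambda>t. V (max p (min q t))"], rule V) (use assms(2) in auto)
  then have "(\<lambda>t. if t \<in> {p..q} then x (max p (min q t)) else 0) \<in> borel_measurable borel"
    by (intro measurable_If_set) auto
  moreover have "(\<lambda>t. if t \<in> {p..q} then x (max p (min q t)) else 0) = (\<lambda>t. if t \<in> {p..q} then x t else 0)"
    by (auto simp: fun_eq_iff)
  ultimately show ?thesis by simp
qed

section \<open>One delay block\<close>

text \<open>The measures that drive a block: time, the positive and negative parts of the components of the
  atomless measure, and the discrete measure of jumps.\<close>

datatype 'm driver = Time | Pos 'm | Neg 'm | Jumps

lemma UNIV_driver: "(UNIV :: 'm driver set) = {Time, Jumps} \<union> (range Pos \<union> range Neg)"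
proof -
  have "d \<in> {Time, Jumps} \<union> (range Pos \<union> range Neg)" for d :: "'m driver" by (cases d) auto
  then show ?thesis by blast
qed

lemma finite_UNIV_driver: "finite (UNIV :: 'm::finite driver set)"
  unfolding UNIV_driver by simp

lemma sum_UNIV_driver:
  fixes \<phi> :: "'m::finite driver \<Rightarrow> 'c::comm_monoid_add"
  shows "(\<Sum>i\<in>UNIV. \<phi> i) = \<phi> Time + (\<Sum>j\<in>UNIV. \<phi> (Pos j) + \<phi> (Neg j)) + \<phi> Jumps"
proof -
  have "(\<Sum>i\<in>UNIV. \<phi> i) = (\<Sum>i\<in>{Time, Jumps}. \<phi> i) + (\<Sum>i\<in>range Pos \<union> range Neg. \<phi> i)"
    unfolding UNIV_driver by (rule sum.union_disjoint) auto
  also have "(\<Sum>i\<in>range Pos \<union> range Neg. \<phi> i) = (\<Sum>i\<in>range Pos. \<phi> i) + (\<Sum>i\<in>range Neg. \<phi> i)"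
    by (rule sum.union_disjoint) auto
  also have "(\<Sum>i\<in>range Pos. \<phi> i) = (\<Sum>j\<in>UNIV. \<phi> (Pos j))"
    by (subst sum.reindex) (auto simp: inj_def)
  also have "(\<Sum>i\<in>range Neg. \<phi> i) = (\<Sum>j\<in>UNIV. \<phi> (Neg j))"
    by (subst sum.reindex) (auto simp: inj_def)
  finally show ?thesis by (simp add: sum.distrib add_ac)
qed

text \<open>The right-hand side of the block equation without its initial value; \<open>u\<close> are the jumps.\<close>

definition block_rhs :: "real \<Rightarrow> ('m::finite \<Rightarrow> real measure) \<Rightarrow> ('m \<Rightarrow> real measure) \<Rightarrow>
    (real \<Rightarrow> 'b \<Rightarrow> 'b) \<Rightarrow> ('m \<Rightarrow> real \<Rightarrow> 'b \<Rightarrow> 'b) \<Rightarrow> (real \<Rightarrow> 'b) \<Rightarrow> (real \<Rightarrow> 'b) \<Rightarrow> real \<Rightarrow> 'b::euclidean_space" where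
  "block_rhs a pos neg F G x u t = (LINT s:{a..t}|lebesgue. F s (x s))
     + (\<Sum>j\<in>UNIV. (LINT s:{a..t}|pos j. G j s (x s)) - (LINT s:{a..t}|neg j. G j s (x s)))
     + (\<Sum>\<^sub>\<infinity>r\<in>{a<..t}. u r)"

text \<open>One block \<open>[a,b]\<close> with drift \<open>F\<close>, fields \<open>G\<close>, and jumps \<open>J t\<close> applied to the left limit at \<open>t\<close>. Jumps occur
  strictly inside the block, and up to constant factors \<open>atom_mass\<close> bounds both their size and
  their Lipschitz constants.\<close>

locale jump_block =
  fixes a b :: real and pos neg :: "'m::finite \<Rightarrow> real measure"
    and F :: "real \<Rightarrow> 'b::euclidean_space \<Rightarrow> 'b" and G :: "'m \<Rightarrow> real \<Rightarrow> 'b \<Rightarrow> 'b"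
    and J :: "real \<Rightarrow> 'b \<Rightarrow> 'b" and atom_mass :: "real \<Rightarrow> real" and C :: real
  assumes a_less_b: "a < b"
    and pn_finite: "\<And>j. finite_measure (pos j)" "\<And>j. finite_measure (neg j)"
    and pn_sets: "\<And>j B. B \<in> sets borel \<Longrightarrow> B \<subseteq> {a..b} \<Longrightarrow> B \<in> sets (pos j)"
      "\<And>j B. B \<in> sets borel \<Longrightarrow> B \<subseteq> {a..b} \<Longrightarrow> B \<in> sets (neg j)"
    and pn_atomless: "\<And>j t. emeasure (pos j) {t} = 0" "\<And>j t. emeasure (neg j) {t} = 0"
    and F_meas: "\<And>Y. Y \<in> borel_measurable borel \<Longrightarrow> (\<lambda>s. indicator {a..b} s *\<^sub>R F s (Y s)) \<in> borel_measurable borel"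
    and G_meas: "\<And>j Y. Y \<in> borel_measurable borel \<Longrightarrow> (\<lambda>s. indicator {a..b} s *\<^sub>R G j s (Y s)) \<in> borel_measurable borel"
    and C: "0 \<le> C"
    and F_bd: "\<And>s y. s \<in> {a..b} \<Longrightarrow> norm (F s y) \<le> C" and G_bd: "\<And>j s y. s \<in> {a..b} \<Longrightarrow> norm (G j s y) \<le> C"
    and F_lip: "\<And>R. \<exists>L\<ge>0. \<forall>s\<in>{a..b}. \<forall>y z. norm y \<le> R \<longrightarrow> norm z \<le> R \<longrightarrow> norm (F s y - F s z) \<le> L * norm (y - z)"
    and G_lip: "\<And>R. \<exists>L\<ge>0. \<forall>j. \<forall>s\<in>{a..b}. \<forall>y z. norm y \<le> R \<longrightarrow> norm z \<le> R \<longrightarrow> norm (G j s y - G j s z) \<le> L * norm (y - z)"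
    and atom_mass_nonneg: "\<And>s. 0 \<le> atom_mass s" and atom_mass_summable: "atom_mass summable_on {a<..<b}"
    and J_bd: "\<And>s y. s \<in> {a<..<b} \<Longrightarrow> norm (J s y) \<le> C * atom_mass s"
    and J_lip: "\<And>R. \<exists>L\<ge>0. \<forall>s\<in>{a<..<b}. \<forall>y z. norm y \<le> R \<longrightarrow> norm z \<le> R \<longrightarrow> norm (J s y - J s z) \<le> L * atom_mass s * norm (y - z)"
begin

text \<open>Jumps are integrals against a discrete measure on all subsets of the real line, so that no
  measurability of the jump maps in \<open>t\<close> is required.\<close>

definition driver_measure :: "'m driver \<Rightarrow> real measure" where
  "driver_measure i = (case i of Time \<Rightarrow> lebesgue_on {a..b} | Pos j \<Rightarrow> pos j | Neg j \<Rightarrow> neg j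
     | Jumps \<Rightarrow> density (count_space UNIV) (\<lambda>s. ennreal (if s \<in> {a<..<b} then atom_mass s else 0)))"

text \<open>The integrands along \<open>x\<close> with jumps \<open>u\<close>. A jump is divided by its mass, since the discrete driver
  multiplies it by that mass again.\<close>

definition driver_field :: "(real \<Rightarrow> 'b) \<Rightarrow> (real \<Rightarrow> 'b) \<Rightarrow> 'm driver \<Rightarrow> real \<Rightarrow> 'b" where
  "driver_field x u i s = (case i of Time \<Rightarrow> F s (x s) | Pos j \<Rightarrow> G j s (x s) | Neg j \<Rightarrow> - G j s (x s)
     | Jumps \<Rightarrow> if s \<in> {a<..<b} then u s /\<^sub>R atom_mass s else 0)"

lemma driver_measure_simps[simp]: "driver_measure Time = lebesgue_on {a..b}" "driver_measure (Pos j) = pos j" "driver_measure (Neg j) = neg j"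
  "driver_measure Jumps = density (count_space UNIV) (\<lambda>s. ennreal (if s \<in> {a<..<b} then atom_mass s else 0))"
  by (simp_all add: driver_measure_def)

lemma driver_field_simps[simp]: "driver_field x u Time s = F s (x s)" "driver_field x u (Pos j) s = G j s (x s)" "driver_field x u (Neg j) s = - G j s (x s)"
  "driver_field x u Jumps s = (if s \<in> {a<..<b} then u s /\<^sub>R atom_mass s else 0)"
  by (simp_all add: driver_field_def)

lemma atom_mass_abs_summable: "S \<subseteq> {a<..<b} \<Longrightarrow> Infinite_Set_Sum.abs_summable_on atom_mass S"
proof -
  assume S: "S \<subseteq> {a<..<b}"
  have "atom_mass summable_on S" using atom_mass_summable S by (rule summable_on_subset_banach)
  then have "Infinite_Sum.abs_summable_on atom_mass S" using atom_mass_nonneg by simp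
  then show "Infinite_Set_Sum.abs_summable_on atom_mass S" by (rule iffD1[OF abs_summable_equivalent])
qed

lemma finite_jumps: "finite_measure (driver_measure Jumps)"
proof (rule finite_measureI)
  have "(\<integral>\<^sup>+ s. ennreal (if s \<in> {a<..<b} then atom_mass s else 0) \<partial>count_space UNIV) = (\<integral>\<^sup>+ s. ennreal (atom_mass s) * indicator {a<..<b} s \<partial>count_space UNIV)"
    by (intro nn_integral_cong) (auto simp: indicator_def)
  also have "\<dots> = (\<integral>\<^sup>+ s. ennreal (atom_mass s) \<partial>count_space {a<..<b})"
    by (subst nn_integral_count_space_indicator) auto
  also have "\<dots> < \<infinity>"
  proof -
    have "integrable (count_space {a<..<b}) atom_mass" using atom_mass_abs_summable[of "{a<..<b}"] by (simp add: abs_summable_on_def)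
    then have "(\<integral>\<^sup>+ s. ennreal (norm (atom_mass s)) \<partial>count_space {a<..<b}) < \<infinity>" by (simp add: integrable_iff_bounded)
    then show ?thesis using atom_mass_nonneg by simp
  qed
  finally show "emeasure (driver_measure Jumps) (space (driver_measure Jumps)) \<noteq> \<infinity>" by (simp add: emeasure_density)
qed

sublocale driver_family a b UNIV driver_measure
proof (rule driver_family.intro)
  show "a \<le> b" using a_less_b by simp
  show "finite (UNIV :: 'm driver set)" by (rule finite_UNIV_driver)
  show "finite_measure (driver_measure i)" for i
  proof (cases i)
    case Time then show ?thesis by (simp add: finite_measure_lebesgue_on)
  next
    case Jumps then show ?thesis using finite_jumps by simp
  qed (simp_all add: pn_finite)
  show "B \<in> sets (driver_measure i)" if "B \<in> sets borel" "B \<subseteq> {a..b}" for B i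
  proof (cases i)
    case Time then show ?thesis using that by (simp add: borel_subset_in_lebesgue_on)
  qed (use that in \<open>simp_all add: pn_sets\<close>)
qed

lemma jumps_integral:
  assumes u: "\<And>s. s \<in> {a<..<b} \<Longrightarrow> norm (u s) \<le> C * atom_mass s"
  shows "(LINT s:S|driver_measure Jumps. driver_field x u Jumps s) = (\<Sum>\<^sub>\<infinity>s\<in>S \<inter> {a<..<b}. u s)"
    and "u summable_on S \<inter> {a<..<b}"
proof -
  have as: "Infinite_Set_Sum.abs_summable_on u (S \<inter> {a<..<b})"
  proof (rule abs_summable_on_comparison_test')
    show "Infinite_Set_Sum.abs_summable_on (\<lambda>s. C * atom_mass s) (S \<inter> {a<..<b})"
      using atom_mass_abs_summable[of "S \<inter> {a<..<b}"] by (intro abs_summable_on_cmult_right) auto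
  qed (use u in auto)
  have cancel: "atom_mass s *\<^sub>R (u s /\<^sub>R atom_mass s) = u s" if "s \<in> {a<..<b}" for s
    using u[OF that] by (cases "atom_mass s = 0") auto
  have "(LINT s:S|driver_measure Jumps. driver_field x u Jumps s) =
      (LINT s|count_space UNIV. (if s \<in> {a<..<b} then atom_mass s else 0) *\<^sub>R (indicator S s *\<^sub>R driver_field x u Jumps s))"
    unfolding set_lebesgue_integral_def driver_measure_simps
    by (rule integral_density) (auto simp: atom_mass_nonneg)
  also have "\<dots> = (LINT s:S \<inter> {a<..<b}|count_space UNIV. u s)"
    unfolding set_lebesgue_integral_def
  proof (intro Bochner_Integration.integral_cong refl)
    fix s
    show "(if s \<in> {a<..<b} then atom_mass s else 0) *\<^sub>R (indicat_real S s *\<^sub>R driver_field x u Jumps s) = indicat_real (S \<inter> {a<..<b}) s *\<^sub>R u s"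
    proof (cases "s \<in> {a<..<b}")
      case True
      have f: "driver_field x u Jumps s = u s /\<^sub>R atom_mass s" using True by simp
      have i: "indicat_real (S \<inter> {a<..<b}) s = indicat_real S s" using True by (auto simp: indicator_def)
      have "atom_mass s *\<^sub>R (indicat_real S s *\<^sub>R (u s /\<^sub>R atom_mass s)) = indicat_real S s *\<^sub>R (atom_mass s *\<^sub>R (u s /\<^sub>R atom_mass s))"
        by (rule scaleR_left_commute)
      then show ?thesis unfolding f i cancel[OF True] by (simp only: True if_True)
    next
      case False
      have i: "indicat_real (S \<inter> {a<..<b}) s = 0" using False by (auto simp: indicator_def)
      show ?thesis unfolding i by (simp only: False if_False scaleR_zero_left)
    qed
  qed
  also have "\<dots> = infsetsum u (S \<inter> {a<..<b})" by (simp add: infsetsum_altdef)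
  also have "\<dots> = (\<Sum>\<^sub>\<infinity>s\<in>S \<inter> {a<..<b}. u s)" using as by (rule infsetsum_infsum)
  finally show "(LINT s:S|driver_measure Jumps. driver_field x u Jumps s) = (\<Sum>\<^sub>\<infinity>s\<in>S \<inter> {a<..<b}. u s)" .
  show "u summable_on S \<inter> {a<..<b}"
    using as abs_summable_summable abs_summable_equivalent by blast
qed

abbreviation rhs :: "(real \<Rightarrow> 'b) \<Rightarrow> (real \<Rightarrow> 'b) \<Rightarrow> real \<Rightarrow> 'b" where
  "rhs \<equiv> block_rhs a pos neg F G"

lemma rhs_eq:
  assumes u: "\<And>s. s \<in> {a<..<b} \<Longrightarrow> norm (u s) \<le> C * atom_mass s" and t: "a < t" "t < b"
  shows "driver_integral (driver_field x u) {a..t} = rhs x u t" "u summable_on {a<..t}"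
proof -
  have S: "{a..t} \<inter> {a<..<b} = {a<..t}" using t by auto
  have "(LINT s:{a..t}|lebesgue_on {a..b}. F s (x s)) = (LINT s|lebesgue. indicator {a..b} s *\<^sub>R (indicator {a..t} s *\<^sub>R F s (x s)))"
    unfolding set_lebesgue_integral_def by (simp add: integral_restrict_space)
  also have "\<dots> = (LINT s:{a..t}|lebesgue. F s (x s))"
    unfolding set_lebesgue_integral_def using t by (intro Bochner_Integration.integral_cong refl) (auto simp: indicator_def)
  finally have T: "(LINT s:{a..t}|lebesgue_on {a..b}. F s (x s)) = (LINT s:{a..t}|lebesgue. F s (x s))" .
  have N: "(LINT s:{a..t}|neg j. - G j s (x s)) = - (LINT s:{a..t}|neg j. G j s (x s))" for j
    unfolding set_lebesgue_integral_def by simp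
  have "(LINT s:{a..t}|driver_measure Jumps. driver_field x u Jumps s) = (\<Sum>\<^sub>\<infinity>r\<in>{a<..t}. u r)"
    using jumps_integral(1)[where S="{a..t}" and u=u and x=x, OF u] unfolding S .
  moreover have "driver_field x u Time = (\<lambda>s. F s (x s))" "\<And>j. driver_field x u (Pos j) = (\<lambda>s. G j s (x s))"
    "\<And>j. driver_field x u (Neg j) = (\<lambda>s. - G j s (x s))" by (simp_all add: fun_eq_iff)
  ultimately show "driver_integral (driver_field x u) {a..t} = rhs x u t"
    unfolding driver_integral_def sum_UNIV_driver block_rhs_def by (simp only: T N driver_measure_simps(1-3) add_uminus_conv_diff)
  show "u summable_on {a<..t}" using jumps_integral(2)[OF u, of "{a..t}"] S by simp
qed

lemma driver_field_admissible:
  assumes x: "x \<in> borel_measurable borel" and u: "\<And>s. s \<in> {a<..<b} \<Longrightarrow> norm (u s) \<le> C * atom_mass s"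
  shows "admissible C (driver_field x u)"
  unfolding admissible_def
proof (intro ballI conjI)
  fix i :: "'m driver"
  have 1: "(\<lambda>s. indicat_real {a..b} s *\<^sub>R Z s) \<in> borel_measurable (driver_measure i)"
    if "(\<lambda>s. indicat_real {a..b} s *\<^sub>R Z s) \<in> borel_measurable borel" for Z :: "real \<Rightarrow> 'b"
  proof -
    have "(\<lambda>s. indicat_real {a..b} s *\<^sub>R (indicat_real {a..b} s *\<^sub>R Z s)) \<in> borel_measurable (driver_measure i)"
      using that by (rule borel_imp_driver_measurable) simp
    moreover have "(\<lambda>s. indicat_real {a..b} s *\<^sub>R (indicat_real {a..b} s *\<^sub>R Z s)) = (\<lambda>s. indicat_real {a..b} s *\<^sub>R Z s)"
      by (auto simp: indicator_def fun_eq_iff)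
    ultimately show ?thesis by simp
  qed
  show "(\<lambda>s. indicat_real {a..b} s *\<^sub>R driver_field x u i s) \<in> borel_measurable (driver_measure i)"
  proof (cases i)
    case Time
    then show ?thesis using 1[OF F_meas[OF x]] by simp
  next
    case (Pos j)
    then show ?thesis using 1[OF G_meas[OF x, of j]] by simp
  next
    case (Neg j)
    then show ?thesis using borel_measurable_uminus[OF 1[OF G_meas[OF x, of j]]] by simp
  next
    case Jumps
    then show ?thesis by simp
  qed
  fix s assume s: "s \<in> {a..b}"
  show "norm (driver_field x u i s) \<le> C"
  proof (cases i)
    case Jumps
    have "norm (u s /\<^sub>R atom_mass s) \<le> C" if "s \<in> {a<..<b}"
    proof (cases "atom_mass s = 0")
      case False
      then have "0 < atom_mass s" using atom_mass_nonneg[of s] by simp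
      then show ?thesis using u[OF that] by (simp add: divide_simps mult.commute)
    qed (use C in simp)
    then show ?thesis using Jumps C by simp
  qed (use s F_bd G_bd in simp_all)
qed

lemma null_countable:
  assumes "countable N" "N \<subseteq> {a..b}" "i \<noteq> Jumps"
  shows "N \<in> null_sets (driver_measure i)"
proof -
  have "{t} \<in> null_sets (driver_measure i)" if t: "t \<in> {a..b}" for t
  proof
    show "{t} \<in> sets (driver_measure i)" using t by (intro borel_driver) auto
    show "emeasure (driver_measure i) {t} = 0"
      using assms(3) t pn_atomless by (cases i) (auto simp: emeasure_restrict_space)
  qed
  then have "(\<Union>t\<in>N. {t}) \<in> null_sets (driver_measure i)" using assms by (intro null_sets_UN') auto
  then show ?thesis by simp
qed

text \<open>The drivers other than the jumps have no atoms, so changing \<open>x\<close> at countably many points, in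
  particular passing to its left-continuous version, is invisible to them.\<close>

lemma driver_integral_transfer:
  assumes x: "x \<in> borel_measurable borel" and y: "y \<in> borel_measurable borel"
    and u: "\<And>s. s \<in> {a<..<b} \<Longrightarrow> norm (u s) \<le> C * atom_mass s"
    and N: "countable N" and eq: "\<And>t. t \<in> {a..b} - N \<Longrightarrow> x t = y t" and S: "test_set S"
  shows "driver_integral (driver_field x u) S = driver_integral (driver_field y u) S"
  unfolding driver_integral_def
proof (rule sum.cong[OF refl])
  fix i :: "'m driver"
  show "(LINT s:S|driver_measure i. driver_field x u i s) = (LINT s:S|driver_measure i. driver_field y u i s)"
  proof (cases "i = Jumps")
    case True
    then show ?thesis by simp
  next
    case False
    have null: "N \<inter> {a..b} \<in> null_sets (driver_measure i)" using N False by (intro null_countable) auto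
    show ?thesis
      unfolding set_lebesgue_integral_def
    proof (rule integral_cong_AE)
      show "(\<lambda>s. indicat_real S s *\<^sub>R driver_field x u i s) \<in> borel_measurable (driver_measure i)"
        using admissible_integrable[OF driver_field_admissible[OF x u] S, of i] by (simp add: set_integrable_def borel_measurable_integrable)
      show "(\<lambda>s. indicat_real S s *\<^sub>R driver_field y u i s) \<in> borel_measurable (driver_measure i)"
        using admissible_integrable[OF driver_field_admissible[OF y u] S, of i] by (simp add: set_integrable_def borel_measurable_integrable)
      have *: "driver_field x u i s = driver_field y u i s" if "s \<in> {a..b}" "s \<notin> N" for s
        using eq[of s] that False by (cases i) auto
      show "AE s in driver_measure i. indicat_real S s *\<^sub>R driver_field x u i s = indicat_real S s *\<^sub>R driver_field y u i s"
      proof (intro AE_I'[OF null] subsetI)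
        fix s assume "s \<in> {s \<in> space (driver_measure i). indicat_real S s *\<^sub>R driver_field x u i s \<noteq> indicat_real S s *\<^sub>R driver_field y u i s}"
        then have "s \<in> S" "driver_field x u i s \<noteq> driver_field y u i s" by (auto simp: indicator_def)
        then show "s \<in> N \<inter> {a..b}" using * S by blast
      qed
    qed
  qed
qed

lemma driver_integral_point:
  assumes t: "t \<in> {a..b}" and 0: "t \<in> {a<..<b} \<Longrightarrow> atom_mass t = 0"
    and x: "x \<in> borel_measurable borel" and u: "\<And>s. s \<in> {a<..<b} \<Longrightarrow> norm (u s) \<le> C * atom_mass s"
  shows "driver_integral (driver_field x u) {t} = 0"
  unfolding driver_integral_def
proof (intro sum.neutral ballI)
  fix i :: "'m driver"
  show "(LINT s:{t}|driver_measure i. driver_field x u i s) = 0"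
  proof (cases "i = Jumps")
    case True
    have "driver_field x u Jumps t = 0" using 0 by auto
    then have "(\<lambda>s. indicat_real {t} s *\<^sub>R driver_field x u Jumps s) = (\<lambda>s. 0)" by (auto simp: indicator_def fun_eq_iff)
    then show ?thesis using True unfolding set_lebesgue_integral_def by (simp only: Bochner_Integration.integral_zero)
  next
    case False
    then have "{t} \<in> null_sets (driver_measure i)" using t by (intro null_countable) auto
    then have "AE s in driver_measure i. indicat_real {t} s *\<^sub>R driver_field x u i s = 0"
      by (rule AE_I') (auto simp: indicator_def)
    then show ?thesis unfolding set_lebesgue_integral_def by (rule integral_eq_zero_AE)
  qed
qed

lemma atom_mass_support_countable: "countable {s\<in>{a<..<b}. atom_mass s \<noteq> 0}"
proof -
  have "Infinite_Sum.abs_summable_on atom_mass {a<..<b}"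
    by (rule iffD2[OF abs_summable_equivalent atom_mass_abs_summable]) simp
  from abs_summable_countable[OF this] show ?thesis by simp
qed

lemma closed_split: "s \<le> t \<Longrightarrow> {a..clamp t} = {a..clamp s} \<union> {clamp s<..clamp t}"
  using clamp_in(1)[of s] clamp_in(2)[of s t] by auto

lemma closed_increment:
  assumes ad: "admissible C \<phi>" and st: "s \<le> t"
  shows "norm (driver_integral \<phi> {a..clamp t} - driver_integral \<phi> {a..clamp s}) \<le> C * mass {a..clamp t} - C * mass {a..clamp s}"
proof -
  have T: "test_set {a..clamp s}" "test_set {clamp s<..clamp t}" using clamp_in(1)[of s] clamp_in(1)[of t] by auto
  have D: "{a..clamp s} \<inter> {clamp s<..clamp t} = {}" by auto
  have "driver_integral \<phi> {a..clamp t} = driver_integral \<phi> {a..clamp s} + driver_integral \<phi> {clamp s<..clamp t}"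
    unfolding closed_split[OF st] by (rule driver_integral_Un[OF ad T D])
  moreover have "mass {a..clamp t} = mass {a..clamp s} + mass {clamp s<..clamp t}"
    unfolding closed_split[OF st] by (rule mass_Un[OF T D])
  ultimately show ?thesis using driver_integral_norm_le_mass[OF ad T(2)] by (simp add: algebra_simps)
qed

lemma closed_eq_open_plus_point:
  assumes ad: "admissible C \<phi>" and t: "t \<in> {a..b}"
  shows "driver_integral \<phi> {a..t} = driver_integral \<phi> {a..<t} + driver_integral \<phi> {t}"
proof -
  have "{a..t} = {a..<t} \<union> {t}" using t by auto
  moreover have "test_set {a..<t}" "test_set {t}" "{a..<t} \<inter> {t} = {}" using t by auto
  ultimately show ?thesis using driver_integral_Un[OF ad, of "{a..<t}" "{t}"] by metis
qed

lemma driver_field_lipschitz: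
  "\<exists>L\<ge>0. \<forall>y z u u' s i. s \<in> {a..b} \<longrightarrow> norm (y s) \<le> R \<longrightarrow> norm (z s) \<le> R \<longrightarrow> 
     (s \<in> {a<..<b} \<longrightarrow> u s = J s (y s) \<and> u' s = J s (z s)) \<longrightarrow>
     norm (driver_field y u i s - driver_field z u' i s) \<le> L * norm (y s - z s)"
proof -
  obtain L1 where L1: "L1 \<ge> 0" "\<forall>s\<in>{a..b}. \<forall>y z. norm y \<le> R \<longrightarrow> norm z \<le> R \<longrightarrow> norm (F s y - F s z) \<le> L1 * norm (y - z)"
    using F_lip[of R] by (elim exE conjE) (rule that)
  obtain L2 where L2: "L2 \<ge> 0" "\<forall>j. \<forall>s\<in>{a..b}. \<forall>y z. norm y \<le> R \<longrightarrow> norm z \<le> R \<longrightarrow> norm (G j s y - G j s z) \<le> L2 * norm (y - z)"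
    using G_lip[of R] by (elim exE conjE) (rule that)
  obtain L3 where L3: "L3 \<ge> 0" "\<forall>s\<in>{a<..<b}. \<forall>y z. norm y \<le> R \<longrightarrow> norm z \<le> R \<longrightarrow> norm (J s y - J s z) \<le> L3 * atom_mass s * norm (y - z)"
    using J_lip[of R] by (elim exE conjE) (rule that)
  show ?thesis
  proof (intro exI[of _ "L1 + L2 + L3"] conjI allI impI)
    show "0 \<le> L1 + L2 + L3" using L1 L2 L3 by simp
    fix y z u u' :: "real \<Rightarrow> 'b" and s and i :: "'m driver"
    assume s: "s \<in> {a..b}" "norm (y s) \<le> R" "norm (z s) \<le> R"
      and u: "s \<in> {a<..<b} \<longrightarrow> u s = J s (y s) \<and> u' s = J s (z s)"
    have "norm (driver_field y u i s - driver_field z u' i s) \<le> L1 * norm (y s - z s) \<or> norm (driver_field y u i s - driver_field z u' i s) \<le> L2 * norm (y s - z s)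
       \<or> norm (driver_field y u i s - driver_field z u' i s) \<le> L3 * norm (y s - z s)"
    proof (cases i)
      case Time
      then show ?thesis using L1(2)[rule_format, OF s] by simp
    next
      case (Pos j)
      then show ?thesis using L2(2)[rule_format, OF s] by simp
    next
      case (Neg j)
      then show ?thesis using L2(2)[rule_format, OF s, of j] by (simp add: norm_minus_commute)
    next
      case Jumps
      show ?thesis
      proof (cases "s \<in> {a<..<b} \<and> atom_mass s \<noteq> 0")
        case True
        then have m: "0 < atom_mass s" using atom_mass_nonneg[of s] by simp
        have "norm (J s (y s) - J s (z s)) \<le> L3 * atom_mass s * norm (y s - z s)" using L3(2) True s by blast
        moreover have "driver_field y u i s - driver_field z u' i s = (J s (y s) - J s (z s)) /\<^sub>R atom_mass s"
          using Jumps True u by (simp add: scaleR_diff_right)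
        ultimately have "norm (driver_field y u i s - driver_field z u' i s) \<le> L3 * norm (y s - z s)"
          using m by (simp add: divide_simps mult_ac)
        then show ?thesis by simp
      next
        case False
        then have "driver_field y u i s - driver_field z u' i s = 0" using Jumps by auto
        then show ?thesis using L1(1) by simp
      qed
    qed
    moreover have "L1 * norm (y s - z s) \<le> (L1 + L2 + L3) * norm (y s - z s)"
      "L2 * norm (y s - z s) \<le> (L1 + L2 + L3) * norm (y s - z s)" "L3 * norm (y s - z s) \<le> (L1 + L2 + L3) * norm (y s - z s)"
      using L1 L2 L3 by (intro mult_right_mono; simp)+
    ultimately show "norm (driver_field y u i s - driver_field z u' i s) \<le> (L1 + L2 + L3) * norm (y s - z s)" by linarith
  qed
qed

text \<open>Solve the Volterra equation for the left-continuous version \<open>Y\<close> and let \<open>X\<close> be the same expression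
  over closed intervals. The formula is stated for every Borel \<open>x\<close> that agrees with \<open>X\<close> inside the
  block, because gluing prescribes the value at the left end independently.\<close>

lemma block_exists:
  obtains X Y :: "real \<Rightarrow> 'b" and V :: "real \<Rightarrow> real" and B where
    "X \<in> borel_measurable borel" "\<And>t. norm (X t) \<le> B" "\<And>t. norm (Y t) \<le> B"
    "\<And>x t. x \<in> borel_measurable borel \<Longrightarrow> (\<And>s. s \<in> {a<..<b} \<Longrightarrow> x s = X s) \<Longrightarrow> t \<in> {a<..<b} \<Longrightarrow>
        (\<lambda>r. J r (Y r)) summable_on {a<..t} \<and> x t = c + rhs x (\<lambda>r. J r (Y r)) t"
    "\<And>t. t \<in> {a<..b} \<Longrightarrow> (X \<longlongrightarrow> Y t) (at_left t)"
    "\<And>s t. s \<le> t \<Longrightarrow> norm (X t - X s) \<le> V t - V s"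
proof -
  define R where "R = norm c + C * mass {a..b}"
  obtain L where L: "L \<ge> 0" "\<forall>y z u u' s i. s \<in> {a..b} \<longrightarrow> norm (y s) \<le> R \<longrightarrow> norm (z s) \<le> R \<longrightarrow> 
     (s \<in> {a<..<b} \<longrightarrow> u s = J s (y s) \<and> u' s = J s (z s)) \<longrightarrow>
     norm (driver_field y u i s - driver_field z u' i s) \<le> L * norm (y s - z s)"
    using driver_field_lipschitz[of R] by (elim exE conjE) (rule that)
  let ?H = "\<lambda>i s y. driver_field (\<lambda>_. y) (\<lambda>_. J s y) i s"
  have H_eq: "?H i s (Y s) = driver_field Y (\<lambda>s. J s (Y s)) i s" for i s Y by (cases i) auto
  have adm: "admissible C (driver_field Y (\<lambda>s. J s (Y s)))" if "Y \<in> borel_measurable borel" for Y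
    using that J_bd by (rule driver_field_admissible)
  obtain Y where Y: "Y \<in> borel_measurable borel" "\<And>t. norm (Y t) \<le> R"
    "\<And>t. t \<in> {a..b} \<Longrightarrow> Y t = c + driver_integral (\<lambda>i s. ?H i s (Y s)) {a..<t}"
  proof (rule volterra_exists[where c=c and H="?H" and C=C and L=L and R=R])
    fix i :: "'m driver" and Y :: "real \<Rightarrow> 'b" assume "Y \<in> borel_measurable borel"
    then show "(\<lambda>s. indicat_real {a..b} s *\<^sub>R ?H i s (Y s)) \<in> borel_measurable (driver_measure i)"
      unfolding H_eq using adm[of Y] by (simp add: admissible_def)
  next
    fix i :: "'m driver" and s y assume s: "s \<in> {a..b}"
    have "admissible C (driver_field (\<lambda>_. y) (\<lambda>s. J s y))" using adm[of "\<lambda>_. y"] by simp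
    then have "norm (driver_field (\<lambda>_. y) (\<lambda>s. J s y) i s) \<le> C" using s by (simp add: admissible_def)
    then show "norm (?H i s y) \<le> C" by (cases i) auto
  next
    fix i :: "'m driver" and s and y z :: 'b assume s: "s \<in> {a..b}" and R: "norm y \<le> R" "norm z \<le> R"
    show "norm (?H i s y - ?H i s z) \<le> L * norm (y - z)"
      using L(2)[THEN spec[of _ "\<lambda>_. y"], THEN spec[of _ "\<lambda>_. z"], THEN spec[of _ "\<lambda>_. J s y"], THEN spec[of _ "\<lambda>_. J s z"], THEN spec[of _ s], THEN spec[of _ i]]
        s R by simp
  qed (use L C in \<open>auto simp: R_def\<close>)
  define u where "u s = J s (Y s)" for s
  have u: "norm (u s) \<le> C * atom_mass s" if "s \<in> {a<..<b}" for s using J_bd[OF that] by (simp add: u_def)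
  have ad: "admissible C (driver_field Y u)" using adm[OF Y(1)] by (simp add: u_def[abs_def])
  have Yeq: "Y t = c + driver_integral (driver_field Y u) {a..<t}" if "t \<in> {a..b}" for t
    using Y(3)[OF that] unfolding H_eq u_def[abs_def] .
  define X where "X t = c + driver_integral (driver_field Y u) {a..clamp t}" for t
  define V where "V t = C * mass {a..clamp t}" for t
  have inc: "norm (X t - X s) \<le> V t - V s" if "s \<le> t" for s t
    using closed_increment[OF ad that] by (simp add: X_def V_def)
  have X_borel: "X \<in> borel_measurable borel" using inc by (rule borel_measurable_if_increments_dominated)
  have X_bd: "norm (X t) \<le> R" for t
  proof -
    have T: "test_set {a..clamp t}" using clamp_in(1)[of t] by auto
    have "norm (X t) \<le> norm c + C * mass {a..clamp t}"
      unfolding X_def using driver_integral_norm_le_mass[OF ad T] by (intro norm_triangle_le) auto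
    also have "\<dots> \<le> R" unfolding R_def using C T by (intro add_left_mono mult_left_mono mass_mono) auto
    finally show ?thesis .
  qed
  \<comment> \<open>Closing the interval at \<open>t\<close> adds the mass of \<open>{t}\<close>, and only jump times carry mass.\<close>
  define N where "N = {s\<in>{a<..<b}. atom_mass s \<noteq> 0}"
  have XY: "X t = Y t" if "t \<in> {a..b} - N" for t
  proof -
    have t: "t \<in> {a..b}" using that by simp
    have "driver_integral (driver_field Y u) {t} = 0" using that by (intro driver_integral_point t Y(1) u) (auto simp: N_def)
    then show ?thesis using closed_eq_open_plus_point[OF ad t] Yeq[OF t] clamp_in(3)[OF t] by (simp add: X_def)
  qed
  show ?thesis
  proof (rule that[of X R Y V])
    fix x t assume x: "x \<in> borel_measurable borel" and xX: "\<And>s. s \<in> {a<..<b} \<Longrightarrow> x s = X s" and t: "t \<in> {a<..<b}"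
    have "driver_integral (driver_field x u) {a..t} = driver_integral (driver_field Y u) {a..t}"
    proof (rule driver_integral_transfer[OF x Y(1) u])
      show "countable (N \<union> {a,b})" using atom_mass_support_countable by (simp add: N_def)
      show "x s = Y s" if "s \<in> {a..b} - (N \<union> {a,b})" for s using xX[of s] XY[of s] that by auto
    qed (use t in auto)
    then have "x t = c + driver_integral (driver_field x u) {a..t}" using xX[OF t] clamp_in(3)[of t] t by (simp add: X_def)
    moreover have "driver_integral (driver_field x u) {a..t} = rhs x u t" using t by (intro rhs_eq(1) u) auto
    moreover have "u summable_on {a<..t}" using t by (intro rhs_eq(2) u) auto
    ultimately show "(\<lambda>r. J r (Y r)) summable_on {a<..t} \<and> x t = c + rhs x (\<lambda>r. J r (Y r)) t" by (simp add: u_def[abs_def])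
  next
    fix t assume t: "t \<in> {a<..b}"
    have "((\<lambda>s. c + driver_integral (driver_field Y u) {a..s}) \<longlongrightarrow> c + driver_integral (driver_field Y u) {a..<t}) (at_left t)"
      using t by (intro tendsto_add tendsto_const driver_integral_left_limit[OF ad]) auto
    then have "((\<lambda>s. c + driver_integral (driver_field Y u) {a..s}) \<longlongrightarrow> Y t) (at_left t)" using Yeq[of t] t by simp
    moreover have "\<forall>\<^sub>F s in at_left t. X s = c + driver_integral (driver_field Y u) {a..s}"
      using eventually_at_left_real[of a t] t by (auto elim!: eventually_mono simp: X_def clamp_in(3))
    ultimately show "(X \<longlongrightarrow> Y t) (at_left t)" by (simp add: tendsto_cong)
  qed (use X_borel X_bd Y(2) inc in auto)
qed

text \<open>Conversely, left limits of a solution \<open>x\<close> exist and define a function \<open>Y\<close> that satisfies the Volterra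
  equation; here the jumps are expressed through \<open>left_lim x\<close>, which equals \<open>Y\<close> only after convergence is known.\<close>

lemma block_solution_left_version:
  assumes x: "x \<in> borel_measurable borel"
    and eq: "\<And>t. t \<in> {a<..<b} \<Longrightarrow> x t = c + rhs x (\<lambda>r. J r (left_lim x r)) t"
  obtains Y u where "Y \<in> borel_measurable borel" "\<And>t. t \<in> {a<..b} \<Longrightarrow> (x \<longlongrightarrow> Y t) (at_left t)"
    "\<And>t. norm (Y t) \<le> norm c + C * mass {a..b}" "\<And>t. t \<in> {a..b} \<Longrightarrow> Y t = c + driver_integral (driver_field Y u) {a..<t}"
    "\<And>t. t \<in> {a<..<b} \<Longrightarrow> x t = c + driver_integral (driver_field Y u) {a..t}" "\<And>s. s \<in> {a<..<b} \<Longrightarrow> u s = J s (Y s)"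
    "admissible C (driver_field Y u)"
proof -
  define u where "u r = J r (left_lim x r)" for r
  have u: "norm (u s) \<le> C * atom_mass s" if "s \<in> {a<..<b}" for s using J_bd[OF that] by (simp add: u_def)
  have ad: "admissible C (driver_field x u)" using x u by (rule driver_field_admissible)
  have xeq: "x t = c + driver_integral (driver_field x u) {a..t}" if "t \<in> {a<..<b}" for t
    using eq[OF that] rhs_eq(1)[OF u, of t x] that by (simp add: u_def[abs_def])
  define Y where "Y t = c + driver_integral (driver_field x u) {a..<clamp t}" for t
  have Y_borel: "Y \<in> borel_measurable borel"
    by (rule borel_measurable_if_increments_dominated[where m="\<lambda>t. C * mass {a..<clamp t}"])
      (use driver_integral_clamp_increment[OF ad] in \<open>simp add: Y_def right_diff_distrib\<close>)
  have lim: "(x \<longlongrightarrow> Y t) (at_left t)" if t: "t \<in> {a<..b}" for t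
  proof -
    have "((\<lambda>s. c + driver_integral (driver_field x u) {a..s}) \<longlongrightarrow> c + driver_integral (driver_field x u) {a..<t}) (at_left t)"
      using t by (intro tendsto_add tendsto_const driver_integral_left_limit[OF ad]) auto
    moreover have "Y t = c + driver_integral (driver_field x u) {a..<t}" using t clamp_in(3)[of t] by (simp add: Y_def)
    moreover have "\<forall>\<^sub>F s in at_left t. x s = c + driver_integral (driver_field x u) {a..s}"
      using eventually_at_left_real[of a t] t by (auto elim!: eventually_mono intro!: xeq)
    ultimately show ?thesis by (simp add: tendsto_cong)
  qed
  have uJ: "u s = J s (Y s)" if s: "s \<in> {a<..<b}" for s
  proof -
    have "left_lim x s = Y s" unfolding left_lim_def using lim[of s] s by (intro tendsto_Lim) auto
    then show ?thesis by (simp add: u_def)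
  qed
  define N where "N = {s\<in>{a<..<b}. atom_mass s \<noteq> 0} \<union> {a,b}"
  have N: "countable N" using atom_mass_support_countable by (simp add: N_def)
  have xY: "x t = Y t" if "t \<in> {a..b} - N" for t
  proof -
    have t: "t \<in> {a..b}" "t \<in> {a<..<b}" using that by (auto simp: N_def)
    have "driver_integral (driver_field x u) {t} = 0" using that by (intro driver_integral_point t x u) (auto simp: N_def)
    then show ?thesis using closed_eq_open_plus_point[OF ad t(1)] xeq[OF t(2)] clamp_in(3)[OF t(1)] by (simp add: Y_def)
  qed
  have tr: "driver_integral (driver_field x u) S = driver_integral (driver_field Y u) S" if "test_set S" for S
    by (rule driver_integral_transfer[OF x Y_borel u N xY that])
  show ?thesis
  proof (rule that[of Y u])
    show "norm (Y t) \<le> norm c + C * mass {a..b}" for t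
    proof -
      have "norm (Y t) \<le> norm c + C * mass {a..<clamp t}"
        unfolding Y_def using driver_integral_norm_le_mass[OF ad test_clamp(1)[of t]] by (intro norm_triangle_le) auto
      also have "\<dots> \<le> norm c + C * mass {a..b}"
        using C clamp_in(1)[of t] by (intro add_left_mono mult_left_mono mass_mono) auto
      finally show ?thesis .
    qed
    show "Y t = c + driver_integral (driver_field Y u) {a..<t}" if "t \<in> {a..b}" for t
    proof -
      have "test_set {a..<t}" using that by auto
      then show ?thesis using tr[of "{a..<t}"] clamp_in(3)[OF that] by (simp add: Y_def)
    qed
    show "x t = c + driver_integral (driver_field Y u) {a..t}" if "t \<in> {a<..<b}" for t
    proof -
      have "test_set {a..t}" using that by auto
      then show ?thesis using tr[of "{a..t}"] xeq[OF that] by simp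
    qed
    show "admissible C (driver_field Y u)" using Y_borel u by (rule driver_field_admissible)
  qed (use Y_borel lim uJ in auto)
qed

text \<open>The left versions of two solutions satisfy the same Volterra equation with the same initial value,
  so they coincide, and each solution is recovered from its left version.\<close>

lemma block_unique:
  assumes x: "x \<in> borel_measurable borel" "\<And>t. t \<in> {a<..<b} \<Longrightarrow> x t = c + rhs x (\<lambda>r. J r (left_lim x r)) t"
    and x': "x' \<in> borel_measurable borel" "\<And>t. t \<in> {a<..<b} \<Longrightarrow> x' t = c + rhs x' (\<lambda>r. J r (left_lim x' r)) t"
  shows "\<And>t. t \<in> {a<..<b} \<Longrightarrow> x' t = x t" "\<And>t. t \<in> {a<..b} \<Longrightarrow> left_lim x' t = left_lim x t"
proof -
  define R where "R = norm c + C * mass {a..b}"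
  obtain Y u where Y: "Y \<in> borel_measurable borel" "\<And>t. t \<in> {a<..b} \<Longrightarrow> (x \<longlongrightarrow> Y t) (at_left t)"
    "\<And>t. norm (Y t) \<le> R" "\<And>t. t \<in> {a..b} \<Longrightarrow> Y t = c + driver_integral (driver_field Y u) {a..<t}"
    "\<And>t. t \<in> {a<..<b} \<Longrightarrow> x t = c + driver_integral (driver_field Y u) {a..t}" "\<And>s. s \<in> {a<..<b} \<Longrightarrow> u s = J s (Y s)"
    "admissible C (driver_field Y u)"
    by (rule block_solution_left_version[OF x, folded R_def]) (assumption | (rule that; assumption))+
  obtain Y' u' where Y': "Y' \<in> borel_measurable borel" "\<And>t. t \<in> {a<..b} \<Longrightarrow> (x' \<longlongrightarrow> Y' t) (at_left t)"
    "\<And>t. norm (Y' t) \<le> R" "\<And>t. t \<in> {a..b} \<Longrightarrow> Y' t = c + driver_integral (driver_field Y' u') {a..<t}"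
    "\<And>t. t \<in> {a<..<b} \<Longrightarrow> x' t = c + driver_integral (driver_field Y' u') {a..t}" "\<And>s. s \<in> {a<..<b} \<Longrightarrow> u' s = J s (Y' s)"
    "admissible C (driver_field Y' u')"
    by (rule block_solution_left_version[OF x', folded R_def]) (assumption | (rule that; assumption))+
  obtain L where L: "L \<ge> 0" "\<forall>y z u u' s i. s \<in> {a..b} \<longrightarrow> norm (y s) \<le> R \<longrightarrow> norm (z s) \<le> R \<longrightarrow> 
     (s \<in> {a<..<b} \<longrightarrow> u s = J s (y s) \<and> u' s = J s (z s)) \<longrightarrow>
     norm (driver_field y u i s - driver_field z u' i s) \<le> L * norm (y s - z s)"
    using driver_field_lipschitz[of R] by (elim exE conjE) (rule that)
  obtain K where K0: "K \<ge> 0" and K: "\<forall>H G Y Z C R. (Y :: real \<Rightarrow> 'b) \<in> borel_measurable borel \<longrightarrow> Z \<in> borel_measurable borel \<longrightarrow>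
     (\<forall>t\<in>{a..b}. norm (Y t) \<le> R \<and> norm (Z t) \<le> R) \<longrightarrow>
     admissible C H \<longrightarrow> admissible C G \<longrightarrow>
     (\<forall>i\<in>UNIV. \<forall>s\<in>{a..b}. norm (H i s - G i s) \<le> L * norm (Y s - Z s)) \<longrightarrow>
     (\<forall>t\<in>{a..b}. Y t = Y a + driver_integral H {a..<t}) \<longrightarrow>
     (\<forall>t\<in>{a..b}. Z t = Z a + driver_integral G {a..<t}) \<longrightarrow>
     (\<forall>t\<in>{a..b}. norm (Y t - Z t) \<le> norm (Y a - Z a) * K)"
    using volterra_stable[OF L(1)] by (elim exE conjE) (rule that)
  have Ya: "Y a = c" using Y(4)[of a] a_less_b by (simp add: driver_integral_def set_lebesgue_integral_def)
  have Ya': "Y' a = c" using Y'(4)[of a] a_less_b by (simp add: driver_integral_def set_lebesgue_integral_def)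
  have "\<forall>t\<in>{a..b}. norm (Y t - Y' t) \<le> norm (Y a - Y' a) * K"
  proof (rule K[THEN spec[of _ "driver_field Y u"], THEN spec[of _ "driver_field Y' u'"], THEN spec[of _ Y], THEN spec[of _ Y'], THEN spec[of _ C], THEN spec[of _ R],
          THEN mp, THEN mp, THEN mp, THEN mp, THEN mp, THEN mp, THEN mp, THEN mp])
    show "\<forall>t\<in>{a..b}. norm (Y t) \<le> R \<and> norm (Y' t) \<le> R" using Y(3) Y'(3) by simp
    show "\<forall>i\<in>UNIV. \<forall>s\<in>{a..b}. norm (driver_field Y u i s - driver_field Y' u' i s) \<le> L * norm (Y s - Y' s)"
      using L(2) Y(3,6) Y'(3,6) by simp
    show "\<forall>t\<in>{a..b}. Y t = Y a + driver_integral (driver_field Y u) {a..<t}" unfolding Ya by (intro ballI Y(4))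
    show "\<forall>t\<in>{a..b}. Y' t = Y' a + driver_integral (driver_field Y' u') {a..<t}" unfolding Ya' by (intro ballI Y'(4))
  qed (fact Y(1,7) Y'(1,7))+
  then have YY: "Y' t = Y t" if "t \<in> {a..b}" for t using that by (simp add: Ya Ya')
  have fl: "driver_field Y u i s = driver_field Y' u' i s" if "s \<in> {a..b}" for i s
    using YY[OF that] Y(6)[of s] Y'(6)[of s] by (cases i) auto
  show "x' t = x t" if t: "t \<in> {a<..<b}" for t
  proof -
    have "driver_integral (driver_field Y u) {a..t} = driver_integral (driver_field Y' u') {a..t}"
      unfolding driver_integral_def set_lebesgue_integral_def
      using t fl by (intro sum.cong refl Bochner_Integration.integral_cong) (auto simp: indicator_def)
    then show ?thesis using Y(5)[OF t] Y'(5)[OF t] by simp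
  qed
  show "left_lim x' t = left_lim x t" if t: "t \<in> {a<..b}" for t
  proof -
    have "left_lim x t = Y t" "left_lim x' t = Y' t" unfolding left_lim_def using Y(2)[OF t] Y'(2)[OF t] by (auto intro: tendsto_Lim)
    then show ?thesis using YY[of t] t by simp
  qed
qed

end

section \<open>Left limits, shifts and gluing\<close>

lemma left_lim_cong:
  assumes "p < t" "\<And>s. p < s \<Longrightarrow> s < t \<Longrightarrow> x s = y s"
  shows "left_lim x t = left_lim y t"
proof -
  have "\<forall>\<^sub>F s in at_left t. x s = y s"
    using eventually_at_left_real[OF assms(1)] by eventually_elim (use assms(2) in auto)
  then have "(x \<longlongrightarrow> l) (at_left t) \<longleftrightarrow> (y \<longlongrightarrow> l) (at_left t)" for l by (rule tendsto_cong)
  then show ?thesis by (simp add: left_lim_def t2_space_class.Lim_def)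
qed

lemma left_lim_eqI: "(x \<longlongrightarrow> l) (at_left (t::real)) \<Longrightarrow> left_lim x t = l"
  unfolding left_lim_def by (rule tendsto_Lim) simp_all

lemma infsum_shift:
  fixes u :: "real \<Rightarrow> 'b::real_normed_vector"
  assumes "\<And>r. r \<in> {0<..t - a} \<Longrightarrow> \<phi> r = u (r + a)"
  shows "\<phi> summable_on {0<..t - a} \<longleftrightarrow> u summable_on {a<..t}"
    and "(\<Sum>\<^sub>\<infinity>r\<in>{0<..t - a}. \<phi> r) = (\<Sum>\<^sub>\<infinity>r\<in>{a<..t}. u r)"
proof -
  have im: "(\<lambda>r. r + a) ` {0<..t - a} = {a<..t}"
  proof
    show "{a<..t} \<subseteq> (\<lambda>r. r + a) ` {0<..t - a}"
    proof
      fix s assume "s \<in> {a<..t}"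
      then show "s \<in> (\<lambda>r. r + a) ` {0<..t - a}" by (intro image_eqI[of _ _ "s - a"]) auto
    qed
  qed auto
  have inj: "inj_on (\<lambda>r. r + a) {0<..t - a}" by (simp add: inj_on_def)
  have "u summable_on {a<..t} \<longleftrightarrow> (u \<circ> (\<lambda>r. r + a)) summable_on {0<..t - a}"
    unfolding im[symmetric] by (rule summable_on_reindex[OF inj])
  also have "\<dots> \<longleftrightarrow> \<phi> summable_on {0<..t - a}" using assms by (intro summable_on_cong) auto
  finally show "\<phi> summable_on {0<..t - a} \<longleftrightarrow> u summable_on {a<..t}" by simp
  have "(\<Sum>\<^sub>\<infinity>r\<in>{a<..t}. u r) = infsum (u \<circ> (\<lambda>r. r + a)) {0<..t - a}"
    unfolding im[symmetric] by (rule infsum_reindex[OF inj])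
  also have "\<dots> = (\<Sum>\<^sub>\<infinity>r\<in>{0<..t - a}. \<phi> r)" using assms by (intro infsum_cong) auto
  finally show "(\<Sum>\<^sub>\<infinity>r\<in>{0<..t - a}. \<phi> r) = (\<Sum>\<^sub>\<infinity>r\<in>{a<..t}. u r)" by simp
qed

definition glue :: "real \<Rightarrow> (real \<Rightarrow> 'b) \<Rightarrow> 'b \<Rightarrow> (real \<Rightarrow> 'b) \<Rightarrow> real \<Rightarrow> 'b" where
  "glue a x c X t = (if t < a then x t else if t = a then c else X t)"

lemma glue_simps[simp]: "t < a \<Longrightarrow> glue a x c X t = x t" "glue a x c X a = c" "a < t \<Longrightarrow> glue a x c X t = X t"
  by (auto simp: glue_def)

lemma glue_borel:
  fixes x :: "real \<Rightarrow> 'b::euclidean_space"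
  assumes "x \<in> borel_measurable borel" "X \<in> borel_measurable borel"
  shows "glue a x c X \<in> borel_measurable borel"
  unfolding glue_def[abs_def] using assms by measurable

lemma glue_bounded_variation:
  fixes x :: "real \<Rightarrow> 'b::euclidean_space"
  assumes x: "bounded_variation_on {p..a} x" and X: "\<And>s t. s \<le> t \<Longrightarrow> norm (X t - X s) \<le> V t - (V s :: real)"
    and ab: "p \<le> a" "a \<le> b"
  shows "bounded_variation_on {p..b} (glue a x c X)"
proof (rule bounded_variation_on_concat[OF _ _ ab])
  show "bounded_variation_on {p..a} (glue a x c X)"
    using x by (rule bounded_variation_on_modify_point[where c=a]) (auto simp: glue_def)
  have "bounded_variation_on {a..b} X" by (rule bounded_variation_onI[where V=V]) (rule X)
  then show "bounded_variation_on {a..b} (glue a x c X)"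
    by (rule bounded_variation_on_modify_point[where c=a]) (auto simp: glue_def)
qed

lemma block_tuple_slot_insert: "block_tuple \<kappa> z l = slot_insert \<kappa> (z l) (block_tuple \<kappa> z l)"
  by (simp add: vec_eq_iff block_tuple_def slot_insert_def)

lemma delay_tuple_slot_insert: "delay_tuple \<kappa> h x t = slot_insert \<kappa> (x t) (delay_tuple \<kappa> h x t)"
  by (simp add: vec_eq_iff delay_tuple_def slot_insert_def)

lemma borel_measurable_lebesgue_on_borel:
  fixes Y :: "real \<Rightarrow> 'b::euclidean_space"
  assumes "Y \<in> borel_measurable borel"
  shows "Y \<in> borel_measurable (lebesgue_on S)"
  using assms by (intro measurable_restrict_space1 measurable_completion) simp

section \<open>The data of an impulse control\<close>

locale impulse_setting =
  fixes N M :: nat and h :: real and K :: "(real ^ 'm) set" and \<kappa> :: "'k::finite \<Rightarrow> nat"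
    and f :: "real \<times> ((real ^ 'n) ^ 'k) \<Rightarrow> real ^ 'n"
    and g :: "'m \<Rightarrow> real \<times> ((real ^ 'n) ^ 'k) \<Rightarrow> real ^ 'n"
    and \<xi>0 :: "real \<Rightarrow> real ^ 'n" and x0 :: "real ^ 'n"
    and \<mu> :: "real set \<Rightarrow> real ^ 'm" and \<nu> :: "real measure"
    and \<omega> :: "real \<Rightarrow> int \<Rightarrow> real \<Rightarrow> real ^ 'm"
  assumes N1: "N \<ge> 1" and h: "h > 0" and \<kappa>: "bij_betw \<kappa> UNIV {0..M}"
    and f_C1: "C1_map f" and f_bd: "bounded (range f)"
    and g_C1: "\<And>j. C1_map (g j)" and g_bd: "\<And>j. bounded (range (g j))"
    and \<xi>0_cont: "continuous_on {- (real M * h)..0} \<xi>0"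
    and control: "impulse_control N h K \<mu> \<nu> \<omega>"
begin

abbreviation T :: real where "T \<equiv> real N * h"

definition block_start :: "int \<Rightarrow> real" where "block_start l = of_int (l - 1) * h"

definition jump_mass :: "int \<Rightarrow> real \<Rightarrow> real" where
  "jump_mass l r = (LINT s|lebesgue_on {0..1}. norm1 (\<omega> r l s))"

definition pos :: "'m \<Rightarrow> real measure" where "pos j = jordan_pos T (component (vec_cont_part \<mu>) j)"
definition neg :: "'m \<Rightarrow> real measure" where "neg j = jordan_neg T (component (vec_cont_part \<mu>) j)"

lemma block_start_simps: "block_start 1 = 0" "block_start (l + 1) = block_start l + h" "of_int l * h = block_start l + h"
  by (simp_all add: block_start_def algebra_simps)

lemma block_start_bounds: "l \<in> {1..int N} \<Longrightarrow> 0 \<le> block_start l \<and> block_start l + h \<le> T"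
proof -
  assume l: "l \<in> {1..int N}"
  then have "real_of_int l * h \<le> real N * h" using h by (intro mult_right_mono) auto
  moreover have "0 \<le> real_of_int (l - 1) * h" using l h by simp
  ultimately show ?thesis by (simp add: block_start_def algebra_simps)
qed

lemmas control' = control[unfolded impulse_control_def]

lemma \<mu>_vec: "\<mu> \<in> vec_measures T"
  using control'[THEN conjunct1] by (simp add: cone_measures_def)

lemma \<nu>_pos: "sets \<nu> = sets (borel_on T)" "finite_measure \<nu>"
  using control'[THEN conjunct2, THEN conjunct1] by (auto simp: Vc_def pos_measures_def)

lemma \<omega>_meas: "r \<in> {0..h} \<Longrightarrow> l \<in> {1..int N} \<Longrightarrow> \<omega> r l \<in> borel_measurable (lebesgue_on {0..1})"
  using control'[THEN conjunct2, THEN conjunct2, THEN conjunct1] by blast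

lemma \<omega>_const: "r \<in> {0..h} \<Longrightarrow> AE s in lebesgue_on {0..1}. (\<Sum>l\<in>{1..int N}. norm1 (\<omega> r l s)) = (\<Sum>l\<in>{1..int N}. jump_mass l r)"
  unfolding jump_mass_def
  using control'[THEN conjunct2, THEN conjunct2, THEN conjunct2, THEN conjunct2, THEN conjunct1] by blast

lemma jump_mass_interior: "r \<in> {0<..<h} \<Longrightarrow> l \<in> {1..int N} \<Longrightarrow> jump_mass l r = measure \<nu> {r + block_start l}"
  unfolding jump_mass_def block_start_def
  using control'[THEN conjunct2, THEN conjunct2, THEN conjunct2, THEN conjunct2, THEN conjunct2, THEN conjunct1] by blast

lemma jump_mass_nonneg: "0 \<le> jump_mass l r"
  unfolding jump_mass_def by (rule Bochner_Integration.integral_nonneg) simp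

text \<open>For \<open>r\<close> in the interior the constant value of \<open>\<Sum>\<^sub>l \<parallel>\<omega>\<^sup>r\<^sub>l(s)\<parallel>\<close> is a sum of masses of atoms of \<open>\<nu>\<close>, hence at
  most \<open>N\<close> times its total mass; the two values \<open>r = 0\<close> and \<open>r = h\<close> contribute their own constants.\<close>

lemma ex_control_bound: "\<exists>c\<ge>0. \<forall>r\<in>{0..h}. \<forall>l\<in>{1..int N}. AE s in lebesgue_on {0..1}. norm1 (\<omega> r l s) \<le> c"
proof -
  define tot where "tot r = (\<Sum>l\<in>{1..int N}. jump_mass l r)" for r
  define c where "c = max (real N * measure \<nu> (space \<nu>)) (max (tot 0) (tot h))"
  have tot: "tot r \<le> c" if "r \<in> {0..h}" for r
  proof (cases "r \<in> {0<..<h}")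
    case True
    have "tot r \<le> (\<Sum>l\<in>{1..int N}. measure \<nu> (space \<nu>))"
      unfolding tot_def
    proof (rule sum_mono)
      fix l assume "l \<in> {1..int N}"
      then show "jump_mass l r \<le> measure \<nu> (space \<nu>)"
        using jump_mass_interior[OF True] finite_measure.bounded_measure[OF \<nu>_pos(2)] by simp
    qed
    then show ?thesis by (simp add: c_def)
  next
    case False
    then have "r = 0 \<or> r = h" using that by auto
    then show ?thesis by (auto simp: c_def)
  qed
  show ?thesis
  proof (intro exI[of _ c] conjI ballI)
    show "0 \<le> c" by (simp add: c_def le_max_iff_disj)
    fix r l assume r: "r \<in> {0..h}" and l: "l \<in> {1..int N}"
    show "AE s in lebesgue_on {0..1}. norm1 (\<omega> r l s) \<le> c"
      using \<omega>_const[OF r]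
    proof eventually_elim
      case (elim s)
      have "norm1 (\<omega> r l s) \<le> (\<Sum>l\<in>{1..int N}. norm1 (\<omega> r l s))" using l by (intro member_le_sum) auto
      then show ?case using elim tot[OF r] by (simp add: tot_def)
    qed
  qed
qed

definition control_bound :: real where
  "control_bound = (SOME c. c \<ge> 0 \<and> (\<forall>r\<in>{0..h}. \<forall>l\<in>{1..int N}. AE s in lebesgue_on {0..1}. norm1 (\<omega> r l s) \<le> c))"

lemma control_bound: "0 \<le> control_bound" "\<And>r l. r \<in> {0..h} \<Longrightarrow> l \<in> {1..int N} \<Longrightarrow> AE s in lebesgue_on {0..1}. norm1 (\<omega> r l s) \<le> control_bound"
  using someI_ex[OF ex_control_bound] unfolding control_bound_def by auto

lemma ex_field_bound: "\<exists>c\<ge>0. \<forall>z. norm (f z) \<le> c \<and> (\<forall>j. norm (g j z) \<le> c)"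
proof -
  obtain cf where cf: "\<And>z. norm (f z) \<le> cf" using f_bd by (auto simp: bounded_iff)
  have "\<forall>j. \<exists>c. \<forall>z. norm (g j z) \<le> c" using g_bd by (auto simp: bounded_iff)
  then obtain cg where cg: "\<And>j z. norm (g j z) \<le> cg j" by metis
  have cg0: "0 \<le> cg j" for j using order_trans[OF norm_ge_zero cg] .
  have cf0: "0 \<le> cf" using order_trans[OF norm_ge_zero cf] .
  have "norm (g j z) \<le> cf + (\<Sum>j\<in>UNIV. cg j)" for j z
    using cg[of j z] member_le_sum[of j UNIV cg] cg0 cf0 by simp
  moreover have "norm (f z) \<le> cf + (\<Sum>j\<in>UNIV. cg j)" for z using cf[of z] cg0 by (simp add: sum_nonneg add_increasing2)
  ultimately show ?thesis using cf0 cg0 by (intro exI[of _ "cf + (\<Sum>j\<in>UNIV. cg j)"]) (auto simp: sum_nonneg)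
qed

definition field_bound :: real where
  "field_bound = (SOME c. c \<ge> 0 \<and> (\<forall>z. norm (f z) \<le> c \<and> (\<forall>j. norm (g j z) \<le> c)))"

lemma field_bound: "0 \<le> field_bound" "norm (f z) \<le> field_bound" "norm (g j z) \<le> field_bound"
proof -
  have "field_bound \<ge> 0 \<and> (\<forall>z. norm (f z) \<le> field_bound \<and> (\<forall>j. norm (g j z) \<le> field_bound))"
    unfolding field_bound_def by (rule someI_ex[OF ex_field_bound])
  then show "0 \<le> field_bound" "norm (f z) \<le> field_bound" "norm (g j z) \<le> field_bound" by blast+
qed

text \<open>Inside a block the jump masses are the masses of distinct atoms of the finite measure \<open>\<nu>\<close>.\<close>

lemma jump_mass_summable:
  assumes l: "l \<in> {1..int N}"
  shows "jump_mass l summable_on {0<..<h}"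
proof (rule nonneg_bdd_above_summable_on)
  interpret finite_measure \<nu> by (rule \<nu>_pos(2))
  show "bdd_above (sum (jump_mass l) ` {F. F \<subseteq> {0<..<h} \<and> finite F})"
  proof (rule bdd_aboveI)
    fix y assume "y \<in> sum (jump_mass l) ` {F. F \<subseteq> {0<..<h} \<and> finite F}"
    then obtain F where F: "F \<subseteq> {0<..<h}" "finite F" and y: "y = sum (jump_mass l) F" by auto
    have sing: "{r + block_start l} \<in> sets \<nu>" if "r \<in> F" for r
    proof -
      have "r + block_start l \<in> {0..T}" using F that block_start_bounds[OF l] by (force simp: subset_iff)
      then show ?thesis unfolding \<nu>_pos(1) by (auto simp: sets_restrict_space_iff)
    qed
    have "y = (\<Sum>r\<in>F. measure \<nu> {r + block_start l})"
      unfolding y using F l by (intro sum.cong refl jump_mass_interior) auto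
    also have "\<dots> = measure \<nu> (\<Union>r\<in>F. {r + block_start l})"
      using F(2) sing by (intro finite_measure_finite_Union[symmetric]) (auto simp: disjoint_family_on_def)
    also have "\<dots> \<le> measure \<nu> (space \<nu>)" by (rule bounded_measure)
    finally show "y \<le> measure \<nu> (space \<nu>)" .
  qed
qed (simp add: jump_mass_nonneg)

definition atom_mass :: "int \<Rightarrow> real \<Rightarrow> real" where
  "atom_mass l t = (if t \<in> {block_start l<..<block_start l + h} then jump_mass l (t - block_start l) else 0)"

lemma atom_mass_props:
  "0 \<le> atom_mass l t" "l \<in> {1..int N} \<Longrightarrow> atom_mass l summable_on {block_start l<..<block_start l + h}"
proof -
  show "0 \<le> atom_mass l t" by (simp add: atom_mass_def jump_mass_nonneg)
  assume l: "l \<in> {1..int N}"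
  have im: "(\<lambda>t. t - block_start l) ` {block_start l<..<block_start l + h} = {0<..<h}"
  proof
    show "{0<..<h} \<subseteq> (\<lambda>t. t - block_start l) ` {block_start l<..<block_start l + h}"
    proof
      fix s assume "s \<in> {0<..<h}"
      then show "s \<in> (\<lambda>t. t - block_start l) ` {block_start l<..<block_start l + h}" by (intro image_eqI[of _ _ "s + block_start l"]) auto
    qed
  qed auto
  have inj: "inj_on (\<lambda>t. t - block_start l) {block_start l<..<block_start l + h}" by (simp add: inj_on_def)
  have "(jump_mass l \<circ> (\<lambda>t. t - block_start l)) summable_on {block_start l<..<block_start l + h}"
    using jump_mass_summable[OF l] summable_on_reindex[OF inj, of "jump_mass l"] unfolding im by simp
  then show "atom_mass l summable_on {block_start l<..<block_start l + h}"
    by (rule summable_on_cong[THEN iffD1, rotated]) (simp add: atom_mass_def)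
qed

definition arc_field :: "(real \<Rightarrow> int \<Rightarrow> real \<Rightarrow> real ^ 'n) \<Rightarrow> int \<Rightarrow> real \<Rightarrow> 'm \<Rightarrow> real \<Rightarrow> real ^ 'n \<Rightarrow> real ^ 'n" where
  "arc_field \<zeta> l r j s y = g j (r + block_start l, slot_insert \<kappa> y (block_tuple \<kappa> (\<lambda>i. \<zeta> r i s) l))"

text \<open>What a block needs to know about the arcs of earlier blocks. The index range
  contains every index \<open>i - k\<close> with \<open>1 \<le> i \<le> l\<close> and \<open>1 \<le> k \<le> M\<close>, so it serves all blocks up to \<open>l\<close>.\<close>

definition good_history :: "(real \<Rightarrow> int \<Rightarrow> real \<Rightarrow> real ^ 'n) \<Rightarrow> int \<Rightarrow> bool" where
  "good_history \<zeta> l \<longleftrightarrow> (\<forall>r\<in>{0..h}. \<forall>i\<in>{1 - int M..<l}. \<zeta> r i \<in> borel_measurable (lebesgue_on {0..1})) \<and>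
     (\<exists>B. \<forall>r\<in>{0..h}. \<forall>i\<in>{1 - int M..<l}. \<forall>s\<in>{0..1}. norm (\<zeta> r i s) \<le> B)"

lemma slot_index: "1 \<le> l \<Longrightarrow> \<kappa> i \<noteq> 0 \<Longrightarrow> l - int (\<kappa> i) \<in> {1 - int M..<l}"
proof -
  assume "1 \<le> l" "\<kappa> i \<noteq> 0"
  moreover have "\<kappa> i \<in> {0..M}" using bij_betwE[OF \<kappa>] by blast
  ultimately show ?thesis by auto
qed

lemma inj_\<kappa>: "inj \<kappa>" using \<kappa> by (simp add: bij_betw_def)

lemma arc_field_cong:
  assumes "1 \<le> l" "\<And>i. i \<in> {1 - int M..<l} \<Longrightarrow> \<zeta> r i s = \<zeta>' r i s"
  shows "arc_field \<zeta> l r j s y = arc_field \<zeta>' l r j s y"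
proof -
  have "slot_insert \<kappa> y (block_tuple \<kappa> (\<lambda>i. \<zeta> r i s) l) = slot_insert \<kappa> y (block_tuple \<kappa> (\<lambda>i. \<zeta>' r i s) l)"
    using slot_index[OF assms(1)] assms(2) by (intro slot_insert_cong) (simp add: block_tuple_def)
  then show ?thesis by (simp add: arc_field_def)
qed

lemma is_arc_cong:
  assumes "1 \<le> l" "\<And>i s. i \<in> {1 - int M..<l} \<Longrightarrow> s \<in> {0..1} \<Longrightarrow> \<zeta> r i s = \<zeta>' r i s"
  shows "is_arc (\<omega> r l) (arc_field \<zeta> l r) z \<longleftrightarrow> is_arc (\<omega> r l) (arc_field \<zeta>' l r) z"
proof -
  have "arc_field \<zeta> l r j s y = arc_field \<zeta>' l r j s y" if "s \<in> {0..1}" for j s y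
    using assms that by (intro arc_field_cong) auto
  then show ?thesis unfolding is_arc_def
    by (intro conj_cong refl AE_cong) simp
qed

lemma is_arc_block:
  "is_arc (\<omega> r l) (arc_field \<zeta> l r) (\<zeta> r l) \<longleftrightarrow> abs_continuous_on {0..1} (\<zeta> r l) \<and>
    (AE s in lebesgue_on {0..1}. (\<zeta> r l has_vector_derivative
       (\<Sum>j\<in>UNIV. (\<omega> r l s $ j) *\<^sub>R g j (r + of_int (l - 1) * h, block_tuple \<kappa> (\<lambda>i. \<zeta> r i s) l))) (at s within {0..1}))"
  unfolding is_arc_def arc_field_def block_start_def using block_tuple_slot_insert[of \<kappa> "\<lambda>i. \<zeta> r i _" l, symmetric] by simp

lemma fast_control_block:
  assumes l: "l \<in> {1..int N}" and r: "r \<in> {0..h}" and gh: "good_history \<zeta> l"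
  shows "fast_control (\<omega> r l) (arc_field \<zeta> l r) control_bound field_bound"
proof
  show "\<omega> r l \<in> borel_measurable (lebesgue_on {0..1})" using r l by (rule \<omega>_meas)
  show "AE s in lebesgue_on {0..1}. norm1 (\<omega> r l s) \<le> control_bound" "0 \<le> control_bound" using control_bound r l by auto
  show "norm (arc_field \<zeta> l r j s y) \<le> field_bound" for j s y by (simp add: arc_field_def field_bound)
  show "0 \<le> field_bound" by (rule field_bound)
  fix j and Y :: "real \<Rightarrow> real ^ 'n" assume Y: "Y \<in> borel_measurable borel"
  have "(\<lambda>s. slot_insert \<kappa> (Y s) (block_tuple \<kappa> (\<lambda>i. \<zeta> r i s) l)) \<in> borel_measurable (lebesgue_on {0..1})"
  proof (rule slot_insert_measurable)
    show "Y \<in> borel_measurable (lebesgue_on {0..1})" using Y by (rule borel_measurable_lebesgue_on_borel)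
    show "(\<lambda>s. block_tuple \<kappa> (\<lambda>i. \<zeta> r i s) l $ i) \<in> borel_measurable (lebesgue_on {0..1})" if "\<kappa> i \<noteq> 0" for i
      using gh r slot_index[OF _ that, of l] l by (simp add: good_history_def block_tuple_def)
  qed
  then have "(\<lambda>s. (r + block_start l, slot_insert \<kappa> (Y s) (block_tuple \<kappa> (\<lambda>i. \<zeta> r i s) l))) \<in> borel_measurable (lebesgue_on {0..1})"
    by (intro borel_measurable_Pair borel_measurable_const)
  from measurable_compose[OF this borel_measurable_continuous_onI[OF C1_map_continuous[OF g_C1]]]
  show "(\<lambda>s. arc_field \<zeta> l r j s (Y s)) \<in> borel_measurable (lebesgue_on {0..1})"
    unfolding arc_field_def .
qed

lemma g_lipschitz_bounded: "\<exists>L\<ge>0. \<forall>j. \<forall>t\<in>{0..T}. \<forall>u v. norm u \<le> R \<longrightarrow> norm v \<le> R \<longrightarrow> norm (g j (t,u) - g j (t,v)) \<le> L * norm (u - v)"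
proof -
  have "\<forall>j. \<exists>L\<ge>0. \<forall>t\<in>{0..T}. \<forall>u v. norm u \<le> R \<longrightarrow> norm v \<le> R \<longrightarrow> norm (g j (t,u) - g j (t,v)) \<le> L * norm (u - v)"
    using C1_map_lipschitz_on_bounded[OF g_C1] by blast
  then obtain L where L: "\<And>j. L j \<ge> 0" "\<And>j t u v. t \<in> {0..T} \<Longrightarrow> norm u \<le> R \<Longrightarrow> norm v \<le> R \<Longrightarrow> norm (g j (t,u) - g j (t,v)) \<le> L j * norm (u - v)"
    by metis
  show ?thesis
  proof (intro exI[of _ "\<Sum>j\<in>UNIV. L j"] conjI allI ballI impI)
    show "0 \<le> (\<Sum>j\<in>UNIV. L j)" using L(1) by (simp add: sum_nonneg)
    fix j t and u v :: "(real ^ 'n) ^ 'k" assume t: "t \<in> {0..T}" "norm u \<le> R" "norm v \<le> R"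
    have "L j \<le> (\<Sum>j\<in>UNIV. L j)" using L(1) by (intro member_le_sum) auto
    then show "norm (g j (t,u) - g j (t,v)) \<le> (\<Sum>j\<in>UNIV. L j) * norm (u - v)"
      using L(2)[OF t, of j] mult_right_mono[of "L j" "\<Sum>j\<in>UNIV. L j" "norm (u - v)"] by simp
  qed
qed

lemma slot_insert_radius:
  fixes y :: "real ^ 'n"
  assumes "norm y \<le> R" "\<And>i. \<kappa> i \<noteq> 0 \<Longrightarrow> norm (w $ i) \<le> B"
  shows "norm (slot_insert \<kappa> y w) \<le> real CARD('k) * max R B"
  by (rule slot_insert_bounded) (use assms in \<open>auto simp: le_max_iff_disj\<close>)

lemma arc_field_lipschitz:
  assumes l: "l \<in> {1..int N}" and gh: "good_history \<zeta> l"
  shows "\<exists>L\<ge>0. \<forall>r\<in>{0..h}. \<forall>j s y y'. s \<in> {0..1} \<longrightarrow> norm y \<le> R \<longrightarrow> norm y' \<le> R \<longrightarrow>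
    norm (arc_field \<zeta> l r j s y - arc_field \<zeta> l r j s y') \<le> L * norm (y - y')"
proof -
  obtain B where B: "\<And>r i s. r \<in> {0..h} \<Longrightarrow> i \<in> {1 - int M..<l} \<Longrightarrow> s \<in> {0..1} \<Longrightarrow> norm (\<zeta> r i s) \<le> B"
    using gh unfolding good_history_def by blast
  obtain L where L: "L \<ge> 0" "\<forall>j. \<forall>t\<in>{0..T}. \<forall>u v. norm u \<le> real CARD('k) * max R B \<longrightarrow> norm v \<le> real CARD('k) * max R B \<longrightarrow> norm (g j (t,u) - g j (t,v)) \<le> L * norm (u - v)"
    using g_lipschitz_bounded by blast
  show ?thesis
  proof (intro exI[of _ L] conjI L(1) ballI allI impI)
    fix r s :: real and j and y y' :: "real ^ 'n" assume r: "r \<in> {0..h}" and s: "s \<in> {0..1}" and y: "norm y \<le> R" "norm y' \<le> R"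
    let ?w = "block_tuple \<kappa> (\<lambda>i. \<zeta> r i s) l"
    have w: "norm (?w $ i) \<le> B" if "\<kappa> i \<noteq> 0" for i
      using B[OF r slot_index[OF _ that] s] l by (simp add: block_tuple_def)
    have t: "r + block_start l \<in> {0..T}" using r block_start_bounds[OF l] by auto
    have "norm (arc_field \<zeta> l r j s y - arc_field \<zeta> l r j s y') \<le> L * norm (slot_insert \<kappa> y ?w - slot_insert \<kappa> y' ?w)"
      unfolding arc_field_def using L(2) t slot_insert_radius[OF y(1) w] slot_insert_radius[OF y(2) w] by blast
    also have "\<dots> \<le> L * norm (y - y')" using L(1) by (intro mult_left_mono slot_insert_lipschitz inj_\<kappa>)
    finally show "norm (arc_field \<zeta> l r j s y - arc_field \<zeta> l r j s y') \<le> L * norm (y - y')" .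
  qed
qed

lemma arc_ex:
  assumes l: "l \<in> {1..int N}" and r: "r \<in> {0..h}" and gh: "good_history \<zeta> l"
  shows "\<exists>z. is_arc (\<omega> r l) (arc_field \<zeta> l r) z \<and> z 0 = y"
proof -
  interpret fast_control "\<omega> r l" "arc_field \<zeta> l r" control_bound field_bound by (rule fast_control_block[OF assms])
  obtain L where L: "L \<ge> 0" "\<forall>r\<in>{0..h}. \<forall>j s y' y''. s \<in> {0..1} \<longrightarrow> norm y' \<le> norm y + control_bound * field_bound \<longrightarrow> norm y'' \<le> norm y + control_bound * field_bound \<longrightarrow>
    norm (arc_field \<zeta> l r j s y' - arc_field \<zeta> l r j s y'') \<le> L * norm (y' - y'')"
    using arc_field_lipschitz[OF l gh] by blast
  obtain z where "is_arc (\<omega> r l) (arc_field \<zeta> l r) z" "z 0 = y"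
    by (rule arc_exists[of "norm y + control_bound * field_bound" L y]) (use L r in auto)
  then show ?thesis by blast
qed

text \<open>The constant is uniform in \<open>r\<close>, since the arcs started in a ball remain in a larger ball whose radius
  depends on the uniform bounds only.\<close>

lemma flow_lipschitz:
  assumes l: "l \<in> {1..int N}" and gh: "good_history \<zeta> l"
  shows "\<exists>L\<ge>0. \<forall>r\<in>{0..h}. \<forall>z z'. is_arc (\<omega> r l) (arc_field \<zeta> l r) z \<longrightarrow> is_arc (\<omega> r l) (arc_field \<zeta> l r) z' \<longrightarrow>
     norm (z 0) \<le> R \<longrightarrow> norm (z' 0) \<le> R \<longrightarrow>
     (\<forall>s\<in>{0..1}. norm (z s - z' s) \<le> L * norm (z 0 - z' 0)) \<and>
     norm ((z 1 - z 0) - (z' 1 - z' 0)) \<le> L * jump_mass l r * norm (z 0 - z' 0)"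
proof -
  let ?R = "R + control_bound * field_bound"
  obtain L where L: "L \<ge> 0" "\<forall>r\<in>{0..h}. \<forall>j s y' y''. s \<in> {0..1} \<longrightarrow> norm y' \<le> ?R \<longrightarrow> norm y'' \<le> ?R \<longrightarrow>
    norm (arc_field \<zeta> l r j s y' - arc_field \<zeta> l r j s y'') \<le> L * norm (y' - y'')"
    using arc_field_lipschitz[OF l gh] by blast
  obtain K where K: "K \<ge> 0" "\<forall>w (G :: 'm \<Rightarrow> real \<Rightarrow> real ^ 'n \<Rightarrow> real ^ 'n) Cg z z' R. fast_control w G control_bound Cg \<longrightarrow>
     is_arc w G z \<longrightarrow> is_arc w G z' \<longrightarrow>
     (\<forall>s\<in>{0..1}. norm (z s) \<le> R \<and> norm (z' s) \<le> R) \<longrightarrow>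
     (\<forall>j s y y'. s \<in> {0..1} \<longrightarrow> norm y \<le> R \<longrightarrow> norm y' \<le> R \<longrightarrow> norm (G j s y - G j s y') \<le> L * norm (y - y')) \<longrightarrow>
     (\<forall>s\<in>{0..1}. norm (z s - z' s) \<le> norm (z 0 - z' 0) * K)"
    using arcs_stable[OF L(1) control_bound(1)] by (elim exE conjE) (rule that)
  show ?thesis
    \<comment> \<open>\<open>K\<close> bounds the distance of two arcs, and \<open>L * K\<close> that of their displacements per unit of jump mass.\<close>
  proof (intro exI[of _ "max K (L * K)"] conjI[of "0 \<le> max K (L * K)"] ballI allI impI)
    show "0 \<le> max K (L * K)" using K(1) by (simp add: le_max_iff_disj)
    fix r z z' assume r: "r \<in> {0..h}" and z: "is_arc (\<omega> r l) (arc_field \<zeta> l r) z" "is_arc (\<omega> r l) (arc_field \<zeta> l r) z'"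
      and R: "norm (z 0) \<le> R" "norm (z' 0) \<le> R"
    interpret fast_control "\<omega> r l" "arc_field \<zeta> l r" control_bound field_bound by (rule fast_control_block[OF l r gh])
    have b: "norm (z s) \<le> ?R" "norm (z' s) \<le> ?R" if "s \<in> {0..1}" for s
      using arc_growth[OF z(1) that] arc_growth[OF z(2) that] R norm_triangle_ineq[of "z s - z 0" "z 0"] norm_triangle_ineq[of "z' s - z' 0" "z' 0"] by auto
    have d: "\<forall>s\<in>{0..1}. norm (z s - z' s) \<le> norm (z 0 - z' 0) * K"
    proof (rule K(2)[THEN spec[of _ "\<omega> r l"], THEN spec[of _ "arc_field \<zeta> l r"], THEN spec[of _ field_bound], THEN spec[of _ z], THEN spec[of _ z'], THEN spec[of _ ?R],
          THEN mp, THEN mp, THEN mp, THEN mp, THEN mp])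
      show "fast_control (\<omega> r l) (arc_field \<zeta> l r) control_bound field_bound" by (rule fast_control_block[OF l r gh])
      show "\<forall>s\<in>{0..1}. norm (z s) \<le> ?R \<and> norm (z' s) \<le> ?R" using b by simp
      show "\<forall>j s y y'. s \<in> {0..1} \<longrightarrow> norm y \<le> ?R \<longrightarrow> norm y' \<le> ?R \<longrightarrow> norm (arc_field \<zeta> l r j s y - arc_field \<zeta> l r j s y') \<le> L * norm (y - y')"
        using L(2) r by blast
    qed (fact z)+
    have "norm ((z 1 - z 0) - (z' 1 - z' 0)) \<le> L * (norm (z 0 - z' 0) * K) * (LINT s|lebesgue_on {0..1}. norm1 (\<omega> r l s))"
      by (rule arc_jump_diff_le[OF z, where R="?R"]) (use L r b d in auto)
    then have "norm ((z 1 - z 0) - (z' 1 - z' 0)) \<le> (L * K) * (jump_mass l r * norm (z 0 - z' 0))" by (simp add: jump_mass_def mult_ac)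
    also have "\<dots> \<le> max K (L * K) * (jump_mass l r * norm (z 0 - z' 0))"
      using jump_mass_nonneg by (intro mult_right_mono) auto
    finally have 2: "norm ((z 1 - z 0) - (z' 1 - z' 0)) \<le> max K (L * K) * jump_mass l r * norm (z 0 - z' 0)" by (simp add: mult_ac)
    have 1: "norm (z s - z' s) \<le> max K (L * K) * norm (z 0 - z' 0)" if "s \<in> {0..1}" for s
    proof -
      have "norm (z s - z' s) \<le> K * norm (z 0 - z' 0)" using d that by (simp add: mult.commute)
      also have "\<dots> \<le> max K (L * K) * norm (z 0 - z' 0)" by (intro mult_right_mono) auto
      finally show ?thesis .
    qed
    show "(\<forall>s\<in>{0..1}. norm (z s - z' s) \<le> max K (L * K) * norm (z 0 - z' 0)) \<and>
       norm ((z 1 - z 0) - (z' 1 - z' 0)) \<le> max K (L * K) * jump_mass l r * norm (z 0 - z' 0)"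
      using 1 2 by simp
  qed
qed

lemma arc_unique:
  assumes l: "l \<in> {1..int N}" and r: "r \<in> {0..h}" and gh: "good_history \<zeta> l"
    and z: "is_arc (\<omega> r l) (arc_field \<zeta> l r) z" "is_arc (\<omega> r l) (arc_field \<zeta> l r) z'" "z 0 = z' 0" and s: "s \<in> {0..1}"
  shows "z s = z' s"
proof -
  have "norm (z s - z' s) \<le> 0"
  proof -
    obtain L where L: "\<forall>r\<in>{0..h}. \<forall>z z''. is_arc (\<omega> r l) (arc_field \<zeta> l r) z \<longrightarrow> is_arc (\<omega> r l) (arc_field \<zeta> l r) z'' \<longrightarrow>
     norm (z 0) \<le> norm (z' 0) \<longrightarrow> norm (z'' 0) \<le> norm (z' 0) \<longrightarrow>
     (\<forall>s\<in>{0..1}. norm (z s - z'' s) \<le> L * norm (z 0 - z'' 0)) \<and>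
     norm ((z 1 - z 0) - (z'' 1 - z'' 0)) \<le> L * jump_mass l r * norm (z 0 - z'' 0)"
      using flow_lipschitz[OF l gh, of "norm (z' 0)"] by (elim exE conjE) (rule that)
    from L[THEN bspec, OF r, THEN spec[of _ z], THEN spec[of _ z'], THEN mp, OF z(1), THEN mp, OF z(2), THEN mp, THEN mp, THEN conjunct1, THEN bspec, OF _ _ s]
    show ?thesis using z(3) by simp
  qed
  then show ?thesis by simp
qed

definition arc_from :: "(real \<Rightarrow> int \<Rightarrow> real \<Rightarrow> real ^ 'n) \<Rightarrow> int \<Rightarrow> real \<Rightarrow> real ^ 'n \<Rightarrow> real \<Rightarrow> real ^ 'n" where
  "arc_from \<zeta> l r y = (SOME z. is_arc (\<omega> r l) (arc_field \<zeta> l r) z \<and> z 0 = y)"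

lemma arc_from:
  assumes "l \<in> {1..int N}" "r \<in> {0..h}" "good_history \<zeta> l"
  shows "is_arc (\<omega> r l) (arc_field \<zeta> l r) (arc_from \<zeta> l r y)" "arc_from \<zeta> l r y 0 = y"
  using someI_ex[OF arc_ex[OF assms, of y]] unfolding arc_from_def by auto

definition jump_map :: "(real \<Rightarrow> int \<Rightarrow> real \<Rightarrow> real ^ 'n) \<Rightarrow> int \<Rightarrow> real \<Rightarrow> real ^ 'n \<Rightarrow> real ^ 'n" where
  "jump_map \<zeta> l t y = arc_from \<zeta> l (t - block_start l) y 1 - y"

text \<open>The field \<open>\<phi>\<close> as a function of time and current state, with delayed values read off the known
  function \<open>x\<close>.\<close>

definition slow_field :: "(real \<times> ((real ^ 'n) ^ 'k) \<Rightarrow> real ^ 'n) \<Rightarrow> (real \<Rightarrow> real ^ 'n) \<Rightarrow> real \<Rightarrow> real ^ 'n \<Rightarrow> real ^ 'n" where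
  "slow_field \<phi> x t y = \<phi> (t, slot_insert \<kappa> y (delay_tuple \<kappa> h x t))"

lemma slow_field_meas:
  assumes \<phi>: "continuous_on UNIV \<phi>" and x: "x \<in> borel_measurable borel" and Y: "Y \<in> borel_measurable borel"
  shows "(\<lambda>s. indicator {a..b} s *\<^sub>R slow_field \<phi> x s (Y s)) \<in> borel_measurable borel"
proof -
  have "(\<lambda>s. slot_insert \<kappa> (Y s) (delay_tuple \<kappa> h x s)) \<in> borel_measurable borel"
  proof (rule slot_insert_measurable[OF Y])
    show "(\<lambda>s. delay_tuple \<kappa> h x s $ i) \<in> borel_measurable borel" for i
      unfolding delay_tuple_def using x by simp
  qed
  then have "(\<lambda>s. (s, slot_insert \<kappa> (Y s) (delay_tuple \<kappa> h x s))) \<in> borel_measurable borel"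
    by (intro borel_measurable_Pair) auto
  from measurable_compose[OF this borel_measurable_continuous_onI[OF \<phi>]]
  have "(\<lambda>s. slow_field \<phi> x s (Y s)) \<in> borel_measurable borel" unfolding slow_field_def .
  then show ?thesis by measurable
qed

lemma delay_index:
  assumes l: "l \<in> {1..int N}" and t: "t \<in> {block_start l..block_start l + h}" and i: "\<kappa> i \<noteq> 0"
  shows "t - real (\<kappa> i) * h \<in> {- (real M * h)..block_start l}" "t < block_start l + h \<Longrightarrow> t - real (\<kappa> i) * h < block_start l"
proof -
  have k: "1 \<le> \<kappa> i" "\<kappa> i \<le> M" using i bij_betwE[OF \<kappa>] by auto
  have "1 * h \<le> real (\<kappa> i) * h" by (rule mult_right_mono) (use k h in auto)
  moreover have "real (\<kappa> i) * h \<le> real M * h" by (rule mult_right_mono) (use k h in auto)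
  moreover have "block_start l \<le> t" "t \<le> block_start l + h" "0 \<le> block_start l" using t block_start_bounds[OF l] by auto
  ultimately show "t - real (\<kappa> i) * h \<in> {- (real M * h)..block_start l}" "t < block_start l + h \<Longrightarrow> t - real (\<kappa> i) * h < block_start l"
    unfolding atLeastAtMost_iff by linarith+
qed

lemma slow_field_lipschitz:
  assumes l: "l \<in> {1..int N}" and B: "\<And>t. t \<in> {- (real M * h)..block_start l} \<Longrightarrow> norm (x t) \<le> B"
    and L: "0 \<le> L" "\<forall>t\<in>{0..T}. \<forall>u v. norm u \<le> real CARD('k) * max R B \<longrightarrow> norm v \<le> real CARD('k) * max R B \<longrightarrow> norm (\<phi> (t,u) - \<phi> (t,v)) \<le> L * norm (u - v)"
    and s: "s \<in> {block_start l..block_start l + h}" and y: "norm y \<le> R" "norm z \<le> R"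
  shows "norm (slow_field \<phi> x s y - slow_field \<phi> x s z) \<le> L * norm (y - z)"
proof -
  let ?w = "delay_tuple \<kappa> h x s"
  have w: "norm (?w $ i) \<le> B" if "\<kappa> i \<noteq> 0" for i
    using B[OF delay_index(1)[OF l s that]] by (simp add: delay_tuple_def)
  have t: "s \<in> {0..T}" using s block_start_bounds[OF l] by auto
  have "norm (slow_field \<phi> x s y - slow_field \<phi> x s z) \<le> L * norm (slot_insert \<kappa> y ?w - slot_insert \<kappa> z ?w)"
    unfolding slow_field_def using L(2) t slot_insert_radius[OF y(1) w] slot_insert_radius[OF y(2) w] by blast
  also have "\<dots> \<le> L * norm (y - z)" using L(1) by (intro mult_left_mono slot_insert_lipschitz inj_\<kappa>)
  finally show ?thesis .
qed

text \<open>On block \<open>l\<close> only values of \<open>x\<close> up to the block start and arcs of lower index enter the fields and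
  the jump maps.\<close>

lemma jump_block_state:
  assumes l: "l \<in> {1..int N}" and x: "x \<in> borel_measurable borel" and B: "\<And>t. t \<in> {- (real M * h)..block_start l} \<Longrightarrow> norm (x t) \<le> B"
    and gh: "good_history \<zeta> l"
  shows "jump_block (block_start l) (block_start l + h) pos neg (slow_field f x) (\<lambda>j. slow_field (g j) x) (jump_map \<zeta> l) (atom_mass l) field_bound"
proof (rule jump_block.intro)
  show "block_start l < block_start l + h" using h by simp
  show "finite_measure (pos j)" for j
    unfolding pos_def using jordan_cont_part(1)[OF \<mu>_vec] by blast
  show "finite_measure (neg j)" for j
    unfolding neg_def using jordan_cont_part(1)[OF \<mu>_vec] by blast
  show "emeasure (pos j) {t} = 0" for j t
    unfolding pos_def using jordan_cont_part(3)[OF \<mu>_vec] by blast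
  show "emeasure (neg j) {t} = 0" for j t
    unfolding neg_def using jordan_cont_part(3)[OF \<mu>_vec] by blast
  have sets: "sets (pos j) = sets (borel_on T)" "sets (neg j) = sets (borel_on T)" for j
    unfolding pos_def neg_def using jordan_cont_part(2)[OF \<mu>_vec] by blast+
  have sub: "B \<in> sets (borel_on T)" if "B \<in> sets borel" "B \<subseteq> {block_start l..block_start l + h}" for B
  proof -
    have "B \<subseteq> {0..T}" using that block_start_bounds[OF l] by force
    then show ?thesis using that(1) by (simp add: sets_restrict_space_iff)
  qed
  show "S \<in> sets (pos j)" if "S \<in> sets borel" "S \<subseteq> {block_start l..block_start l + h}" for j S
    unfolding sets by (rule sub[OF that])
  show "S \<in> sets (neg j)" if "S \<in> sets borel" "S \<subseteq> {block_start l..block_start l + h}" for j S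
    unfolding sets by (rule sub[OF that])
  fix Y :: "real \<Rightarrow> real ^ 'n" assume Y: "Y \<in> borel_measurable borel"
  show "(\<lambda>s. indicat_real {block_start l..block_start l + h} s *\<^sub>R slow_field f x s (Y s)) \<in> borel_measurable borel"
    using C1_map_continuous[OF f_C1] x Y by (rule slow_field_meas)
  show "(\<lambda>s. indicat_real {block_start l..block_start l + h} s *\<^sub>R slow_field (g j) x s (Y s)) \<in> borel_measurable borel" for j
    using C1_map_continuous[OF g_C1] x Y by (rule slow_field_meas)
next
  show "0 \<le> field_bound" by (rule field_bound)
  show "norm (slow_field f x s y) \<le> field_bound" for s y by (simp add: slow_field_def field_bound)
  show "norm (slow_field (g j) x s y) \<le> field_bound" for j s y by (simp add: slow_field_def field_bound)
  fix R
  obtain L where L: "L \<ge> 0" "\<forall>t\<in>{0..T}. \<forall>u v. norm u \<le> real CARD('k) * max R B \<longrightarrow> norm v \<le> real CARD('k) * max R B \<longrightarrow> norm (f (t,u) - f (t,v)) \<le> L * norm (u - v)"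
    using C1_map_lipschitz_on_bounded[OF f_C1] by blast
  show "\<exists>L\<ge>0. \<forall>s\<in>{block_start l..block_start l + h}. \<forall>y z. norm y \<le> R \<longrightarrow> norm z \<le> R \<longrightarrow> norm (slow_field f x s y - slow_field f x s z) \<le> L * norm (y - z)"
  proof (intro exI[of _ L] conjI L(1) ballI allI impI)
    fix s and y z :: "real ^ 'n" assume s: "s \<in> {block_start l..block_start l + h}" "norm y \<le> R" "norm z \<le> R"
    show "norm (slow_field f x s y - slow_field f x s z) \<le> L * norm (y - z)"
      by (rule slow_field_lipschitz[OF l B L s])
  qed
  obtain L' where L': "L' \<ge> 0" "\<forall>j. \<forall>t\<in>{0..T}. \<forall>u v. norm u \<le> real CARD('k) * max R B \<longrightarrow> norm v \<le> real CARD('k) * max R B \<longrightarrow> norm (g j (t,u) - g j (t,v)) \<le> L' * norm (u - v)"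
    using g_lipschitz_bounded by blast
  show "\<exists>L\<ge>0. \<forall>j. \<forall>s\<in>{block_start l..block_start l + h}. \<forall>y z. norm y \<le> R \<longrightarrow> norm z \<le> R \<longrightarrow> norm (slow_field (g j) x s y - slow_field (g j) x s z) \<le> L * norm (y - z)"
  proof (intro exI[of _ L'] conjI L'(1) allI ballI impI)
    fix j s and y z :: "real ^ 'n" assume s: "s \<in> {block_start l..block_start l + h}" "norm y \<le> R" "norm z \<le> R"
    show "norm (slow_field (g j) x s y - slow_field (g j) x s z) \<le> L' * norm (y - z)"
      by (rule slow_field_lipschitz[OF l B L'(1) L'(2)[THEN spec] s])
  qed
next
  show "0 \<le> atom_mass l s" for s by (rule atom_mass_props(1))
  show "atom_mass l summable_on {block_start l<..<block_start l + h}" by (rule atom_mass_props(2)[OF l])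
  show "norm (jump_map \<zeta> l s y) \<le> field_bound * atom_mass l s" if "s \<in> {block_start l<..<block_start l + h}" for s y
  proof -
    have r: "s - block_start l \<in> {0..h}" using that by auto
    interpret fast_control "\<omega> (s - block_start l) l" "arc_field \<zeta> l (s - block_start l)" control_bound field_bound by (rule fast_control_block[OF l r gh])
    show ?thesis using arc_jump_le[OF arc_from(1)[OF l r gh, of y]] that
      by (simp add: jump_map_def arc_from(2)[OF l r gh] atom_mass_def jump_mass_def)
  qed
  fix R
  obtain L where L: "L \<ge> 0" "\<forall>r\<in>{0..h}. \<forall>z z'. is_arc (\<omega> r l) (arc_field \<zeta> l r) z \<longrightarrow> is_arc (\<omega> r l) (arc_field \<zeta> l r) z' \<longrightarrow>
     norm (z 0) \<le> R \<longrightarrow> norm (z' 0) \<le> R \<longrightarrow>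
     (\<forall>s\<in>{0..1}. norm (z s - z' s) \<le> L * norm (z 0 - z' 0)) \<and>
     norm ((z 1 - z 0) - (z' 1 - z' 0)) \<le> L * jump_mass l r * norm (z 0 - z' 0)"
    using flow_lipschitz[OF l gh, of R] by (elim exE conjE) (rule that)
  show "\<exists>L\<ge>0. \<forall>s\<in>{block_start l<..<block_start l + h}. \<forall>y z. norm y \<le> R \<longrightarrow> norm z \<le> R \<longrightarrow> norm (jump_map \<zeta> l s y - jump_map \<zeta> l s z) \<le> L * atom_mass l s * norm (y - z)"
  proof (intro exI[of _ L] conjI L(1) ballI allI impI)
    fix s and y z :: "real ^ 'n" assume s: "s \<in> {block_start l<..<block_start l + h}" and y: "norm y \<le> R" "norm z \<le> R"
    have r: "s - block_start l \<in> {0..h}" using s by auto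
    have "norm ((arc_from \<zeta> l (s - block_start l) y 1 - y) - (arc_from \<zeta> l (s - block_start l) z 1 - z)) \<le> L * jump_mass l (s - block_start l) * norm (y - z)"
      using L(2)[THEN bspec, OF r, THEN spec, THEN spec, THEN mp, THEN mp, THEN mp, THEN mp, THEN conjunct2,
        OF arc_from(1)[OF l r gh, of y] arc_from(1)[OF l r gh, of z]] y by (simp add: arc_from(2)[OF l r gh])
    then show "norm (jump_map \<zeta> l s y - jump_map \<zeta> l s z) \<le> L * atom_mass l s * norm (y - z)" using s by (simp add: jump_map_def atom_mass_def)
  qed
qed

end

section \<open>The state component\<close>

lemma block_rhs_cong:
  fixes x x' :: "real \<Rightarrow> 'b::euclidean_space"
  assumes "\<And>s. s \<in> {a..t} \<Longrightarrow> x s = x' s"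
  shows "block_rhs a pos neg F G x u t = block_rhs a pos neg F G x' u t"
proof -
  have "(LINT s:{a..t}|\<rho>. \<phi> s (x s)) = (LINT s:{a..t}|\<rho>. \<phi> s (x' s))" for \<rho> :: "real measure" and \<phi> :: "real \<Rightarrow> 'b \<Rightarrow> 'b"
    unfolding set_lebesgue_integral_def using assms
    by (intro Bochner_Integration.integral_cong refl) (auto simp: indicator_def)
  then show ?thesis unfolding block_rhs_def by simp
qed

context impulse_setting
begin

definition state_eq :: "(real \<Rightarrow> real ^ 'n) \<Rightarrow> (real \<Rightarrow> int \<Rightarrow> real \<Rightarrow> real ^ 'n) \<Rightarrow> int \<Rightarrow> real \<Rightarrow> bool" where
  "state_eq x \<zeta> l t \<longleftrightarrow>
     (\<lambda>r. \<zeta> r l 1 - left_lim x (r + block_start l)) summable_on {0<..t - block_start l} \<and>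
     x t = \<zeta> 0 l 1
       + (LINT t'|lebesgue_on {block_start l..t}. f (t', delay_tuple \<kappa> h x t'))
       + (\<Sum>j\<in>UNIV. signed_integral T (component (vec_cont_part \<mu>) j) {block_start l..t} (\<lambda>t'. g j (t', delay_tuple \<kappa> h x t')))
       + (\<Sum>\<^sub>\<infinity>r\<in>{0<..t - block_start l}. \<zeta> r l 1 - left_lim x (r + block_start l))"

definition state_block :: "(real \<Rightarrow> real ^ 'n) \<Rightarrow> (real \<Rightarrow> int \<Rightarrow> real \<Rightarrow> real ^ 'n) \<Rightarrow> int \<Rightarrow> bool" where
  "state_block x \<zeta> l \<longleftrightarrow>
     (\<forall>r\<in>{0..h}. is_arc (\<omega> r l) (arc_field \<zeta> l r) (\<zeta> r l) \<and>
        \<zeta> r l 0 = (if r = 0 then \<zeta> h (l - 1) 1 else left_lim x (r + block_start l))) \<and>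
     (\<forall>t\<in>{block_start l<..<block_start l + h}. state_eq x \<zeta> l t)"

abbreviation state_rhs :: "(real \<Rightarrow> real ^ 'n) \<Rightarrow> int \<Rightarrow> (real \<Rightarrow> real ^ 'n) \<Rightarrow> (real \<Rightarrow> real ^ 'n) \<Rightarrow> real \<Rightarrow> real ^ 'n" where
  "state_rhs w l \<equiv> block_rhs (block_start l) pos neg (slow_field f w) (\<lambda>j. slow_field (g j) w)"

text \<open>The equation of the definition is the block equation, with jump times counted from the origin and
  delayed values taken from any \<open>w\<close> that agrees with \<open>x\<close> before the block.\<close>

lemma state_eq_iff:
  assumes l: "l \<in> {1..int N}" and t: "t \<in> {block_start l<..<block_start l + h}"
    and w: "\<And>s. s \<in> {- (real M * h)..<block_start l} \<Longrightarrow> w s = x s"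
    and u: "\<And>r. r \<in> {0<..<h} \<Longrightarrow> \<zeta> r l 1 - left_lim x (r + block_start l) = u (r + block_start l)"
  shows "state_eq x \<zeta> l t \<longleftrightarrow> u summable_on {block_start l<..t} \<and> x t = \<zeta> 0 l 1 + state_rhs w l x u t"
proof -
  have u': "\<zeta> r l 1 - left_lim x (r + block_start l) = u (r + block_start l)" if "r \<in> {0<..t - block_start l}" for r using u[of r] that t by auto
  have field_eq: "slow_field \<phi> w s (x s) = \<phi> (s, delay_tuple \<kappa> h x s)" if s: "s \<in> {block_start l..t}" for \<phi> :: "real \<times> ((real ^ 'n) ^ 'k) \<Rightarrow> real ^ 'n" and s
  proof -
    have s': "s \<in> {block_start l..block_start l + h}" "s < block_start l + h" using s t by auto
    have "slot_insert \<kappa> (x s) (delay_tuple \<kappa> h w s) = slot_insert \<kappa> (x s) (delay_tuple \<kappa> h x s)"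
    proof (rule slot_insert_cong)
      fix i assume "\<kappa> i \<noteq> 0"
      then show "delay_tuple \<kappa> h w s $ i = delay_tuple \<kappa> h x s $ i"
        unfolding delay_tuple_def using delay_index[OF l s'(1)] s'(2) by (auto intro: w)
    qed
    then show ?thesis unfolding slow_field_def using delay_tuple_slot_insert[of \<kappa> h x s] by simp
  qed
  have int: "(LINT s:{block_start l..t}|\<rho>. slow_field \<phi> w s (x s)) = (LINT s:{block_start l..t}|\<rho>. \<phi> (s, delay_tuple \<kappa> h x s))"
    for \<phi> :: "real \<times> ((real ^ 'n) ^ 'k) \<Rightarrow> real ^ 'n" and \<rho> :: "real measure"
    unfolding set_lebesgue_integral_def using field_eq
    by (intro Bochner_Integration.integral_cong refl) (auto simp: indicator_def)
  have "(LINT s:{block_start l..t}|lebesgue. f (s, delay_tuple \<kappa> h x s)) = (LINT t'|lebesgue_on {block_start l..t}. f (t', delay_tuple \<kappa> h x t'))"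
    unfolding set_lebesgue_integral_def by (simp add: integral_restrict_space)
  moreover have "(\<lambda>r. \<zeta> r l 1 - left_lim x (r + block_start l)) summable_on {0<..t - block_start l} \<longleftrightarrow> u summable_on {block_start l<..t}"
    by (rule infsum_shift(1)) (rule u')
  moreover have "(\<Sum>\<^sub>\<infinity>r\<in>{0<..t - block_start l}. \<zeta> r l 1 - left_lim x (r + block_start l)) = (\<Sum>\<^sub>\<infinity>r\<in>{block_start l<..t}. u r)"
    by (rule infsum_shift(2)) (rule u')
  ultimately show ?thesis
    unfolding state_eq_def block_rhs_def int signed_integral_def pos_def neg_def
    by (simp add: add.assoc)
qed

lemma state_block_cong:
  assumes l: "l \<in> {1..int N}" and b: "state_block x \<zeta> l"
    and x: "\<And>t. t < block_start l + h \<Longrightarrow> x' t = x t" and \<zeta>: "\<And>i r. i \<le> l \<Longrightarrow> \<zeta>' r i = \<zeta> r i"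
  shows "state_block x' \<zeta>' l"
proof -
  have ll: "left_lim x' (r + block_start l) = left_lim x (r + block_start l)" if "r \<le> h" for r
    using x that by (intro left_lim_cong[of "r + block_start l - 1"]) auto
  have arc: "is_arc (\<omega> r l) (arc_field \<zeta>' l r) z \<longleftrightarrow> is_arc (\<omega> r l) (arc_field \<zeta> l r) z" for r z
    using l \<zeta> by (intro is_arc_cong) auto
  have "state_eq x' \<zeta>' l t" if t: "t \<in> {block_start l<..<block_start l + h}" for t
  proof -
    define u where "u s = \<zeta> (s - block_start l) l 1 - left_lim x s" for s
    have "state_eq x \<zeta> l t" using b t by (simp add: state_block_def)
    then have "u summable_on {block_start l<..t} \<and> x t = \<zeta> 0 l 1 + state_rhs x l x u t"
      by (subst (asm) state_eq_iff[OF l t, where w=x and u=u]) (auto simp: u_def)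
    moreover have "state_rhs x l x u t = state_rhs x l x' u t"
      using x t by (intro block_rhs_cong) auto
    ultimately show ?thesis
      using t x by (subst state_eq_iff[OF l t, where w=x and u=u]) (auto simp: u_def \<zeta> ll)
  qed
  then show ?thesis using b unfolding state_block_def by (simp add: arc \<zeta> ll)
qed

text \<open>The prescribed arcs of index at most 0. The value at \<open>r = h\<close>, \<open>s = 1\<close> of the arc with index 0 is the
  initial state, from which the first block starts.\<close>

definition history :: "real \<Rightarrow> int \<Rightarrow> real \<Rightarrow> real ^ 'n" where
  "history r i s = (if i = 0 then (if r = h \<and> s = 1 then x0 else \<xi>0 (r - h)) else \<xi>0 (r - (1 - of_int i) * h))"

lemma \<xi>0_bounded: "\<exists>B. \<forall>t\<in>{- (real M * h)..0}. norm (\<xi>0 t) \<le> B"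
  using compact_imp_bounded[OF compact_continuous_image[OF \<xi>0_cont compact_Icc]] by (auto simp: bounded_iff)

lemma good_history_base:
  assumes "\<And>r i s. r \<in> {0..h} \<Longrightarrow> s \<in> {0..1} \<Longrightarrow> i \<in> {1 - int M..0} \<Longrightarrow> \<zeta> r i s = history r i s"
  shows "good_history \<zeta> 1"
  unfolding good_history_def
proof (intro conjI ballI)
  fix r i assume r: "r \<in> {0..h}" and i: "i \<in> {1 - int M..<1}"
  have "history r i \<in> borel_measurable (lebesgue_on {0..1})"
  proof (rule borel_measurable_lebesgue_on_borel)
    show "history r i \<in> borel_measurable borel"
      unfolding history_def[abs_def] by (cases "i = 0"; cases "r = h") auto
  qed
  then show "\<zeta> r i \<in> borel_measurable (lebesgue_on {0..1})"
    by (rule measurable_cong[THEN iffD1, rotated]) (use assms r i in auto)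
next
  obtain B where B: "\<And>t. t \<in> {- (real M * h)..0} \<Longrightarrow> norm (\<xi>0 t) \<le> B" using \<xi>0_bounded by blast
  show "\<exists>B. \<forall>r\<in>{0..h}. \<forall>i\<in>{1 - int M..<1}. \<forall>s\<in>{0..1}. norm (\<zeta> r i s) \<le> B"
  proof (intro exI[of _ "max B (norm x0)"] ballI)
    fix r i and s :: real assume r: "r \<in> {0..h}" and i: "i \<in> {1 - int M..<1}" and s: "s \<in> {0..1}"
    have "r - (1 - of_int i) * h \<in> {- (real M * h)..0}"
    proof -
      have "1 * h \<le> (1 - real_of_int i) * h" by (rule mult_right_mono) (use i h in auto)
      moreover have "(1 - real_of_int i) * h \<le> real M * h" by (rule mult_right_mono) (use i h in auto)
      ultimately show ?thesis using r unfolding atLeastAtMost_iff by linarith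
    qed
    from B[OF this] have "norm (history r i s) \<le> max B (norm x0)"
      by (cases "i = 0") (auto simp: history_def le_max_iff_disj)
    then show "norm (\<zeta> r i s) \<le> max B (norm x0)" using assms[OF r s, of i] i by simp
  qed
qed

lemma good_history_extend:
  assumes gh: "good_history \<zeta> l" and l: "l \<in> {1..int N}"
    and arc: "\<And>r. r \<in> {0..h} \<Longrightarrow> is_arc (\<omega> r l) (arc_field \<zeta> l r) (\<zeta> r l)"
    and B: "\<And>r. r \<in> {0..h} \<Longrightarrow> norm (\<zeta> r l 0) \<le> B"
  shows "good_history \<zeta> (l + 1)"
proof -
  obtain B' where B': "\<And>r i s. r \<in> {0..h} \<Longrightarrow> i \<in> {1 - int M..<l} \<Longrightarrow> s \<in> {0..1} \<Longrightarrow> norm (\<zeta> r i s) \<le> B'"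
    using gh unfolding good_history_def by blast
  show ?thesis
    unfolding good_history_def
  proof (intro conjI ballI)
    fix r i assume r: "r \<in> {0..h}" and i: "i \<in> {1 - int M..<l + 1}"
    show "\<zeta> r i \<in> borel_measurable (lebesgue_on {0..1})"
    proof (cases "i = l")
      case True
      have "continuous_on {0..1} (\<zeta> r l)" using arc[OF r] by (auto simp: is_arc_def intro: abs_continuous_on_imp_continuous_on)
      then show ?thesis unfolding True by (rule continuous_imp_measurable_on_sets_lebesgue) simp
    next
      case False
      then show ?thesis using gh r i by (auto simp: good_history_def)
    qed
  next
    show "\<exists>B. \<forall>r\<in>{0..h}. \<forall>i\<in>{1 - int M..<l + 1}. \<forall>s\<in>{0..1}. norm (\<zeta> r i s) \<le> B"
    proof (intro exI[of _ "max B' (B + control_bound * field_bound)"] ballI)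
      fix r i and s :: real assume r: "r \<in> {0..h}" and i: "i \<in> {1 - int M..<l + 1}" and s: "s \<in> {0..1}"
      show "norm (\<zeta> r i s) \<le> max B' (B + control_bound * field_bound)"
      proof (cases "i = l")
        case True
        interpret fast_control "\<omega> r l" "arc_field \<zeta> l r" control_bound field_bound by (rule fast_control_block[OF l r gh])
        show ?thesis using arc_growth[OF arc[OF r] s] B[OF r] norm_triangle_ineq[of "\<zeta> r l s - \<zeta> r l 0" "\<zeta> r l 0"]
          unfolding True by simp
      next
        case False
        then have "i \<in> {1 - int M..<l}" using i by auto
        from B'[OF r this s] show ?thesis by simp
      qed
    qed
  qed
qed

text \<open>A solution on the first \<open>L\<close> blocks. The function is kept Borel and bounded on the whole line;
  the value at the end of the last solved block is provisional and is overwritten by the next step.\<close>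

definition state_solved :: "nat \<Rightarrow> (real \<Rightarrow> real ^ 'n) \<Rightarrow> (real \<Rightarrow> int \<Rightarrow> real \<Rightarrow> real ^ 'n) \<Rightarrow> bool" where
  "state_solved L x \<zeta> \<longleftrightarrow> x \<in> borel_measurable borel \<and> (\<exists>B. \<forall>t. norm (x t) \<le> B) \<and>
     (\<forall>t\<in>{- (real M * h)..<0}. x t = \<xi>0 t) \<and> x 0 = x0 \<and>
     (\<forall>i\<le>0. \<forall>r. \<zeta> r i = history r i) \<and> good_history \<zeta> (int L + 1) \<and>
     (\<forall>l\<in>{1..int L}. state_block x \<zeta> l) \<and> (\<forall>l\<in>{2..int L}. x (block_start l) = \<zeta> 0 l 1) \<and>
     bounded_variation_on {0..real L * h} x"

lemma bounded_variation_on_singleton: "bounded_variation_on {p..p} (x :: real \<Rightarrow> 'b::real_normed_vector)"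
  by (rule bounded_variation_onI[where V="\<lambda>_. 0"]) auto

lemma history_borel: "(\<lambda>t. if t \<in> {- (real M * h)..<0} then \<xi>0 t else 0) \<in> borel_measurable borel"
proof -
  have "continuous_on {- (real M * h)..<0} \<xi>0" using \<xi>0_cont by (rule continuous_on_subset) auto
  then have "(\<lambda>t. indicator {- (real M * h)..<0} t *\<^sub>R \<xi>0 t) \<in> borel_measurable borel"
    by (rule borel_measurable_continuous_on_indicator[rotated]) simp
  moreover have "(\<lambda>t. indicator {- (real M * h)..<0} t *\<^sub>R \<xi>0 t) = (\<lambda>t. if t \<in> {- (real M * h)..<0} then \<xi>0 t else 0)"
    by (auto simp: indicator_def)
  ultimately show ?thesis by simp
qed

lemma state_solved_0: "\<exists>x \<zeta>. state_solved 0 x \<zeta>"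
proof -
  define x where "x = glue 0 (\<lambda>t. if t \<in> {- (real M * h)..<0} then \<xi>0 t else 0) x0 (\<lambda>_. 0)"
  obtain B where B: "\<And>t. t \<in> {- (real M * h)..0} \<Longrightarrow> norm (\<xi>0 t) \<le> B" using \<xi>0_bounded by blast
  have B0: "0 \<le> B" using B[of 0] h order_trans[OF norm_ge_zero[of "\<xi>0 0"]] by simp
  have "norm (x t) \<le> max B (norm x0)" for t
    using B[of t] B0 by (auto simp: x_def glue_def le_max_iff_disj)
  moreover have "x \<in> borel_measurable borel" unfolding x_def by (rule glue_borel[OF history_borel]) simp
  moreover have "x t = \<xi>0 t" if "t \<in> {- (real M * h)..<0}" for t using that by (simp add: x_def glue_def)
  moreover have "x 0 = x0" by (simp add: x_def)
  moreover have "good_history history 1" by (rule good_history_base) simp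
  ultimately have "state_solved 0 x history"
    unfolding state_solved_def using bounded_variation_on_singleton[of 0 x] by auto
  then show ?thesis by blast
qed

text \<open>The next block starts from the end of the arc \<open>\<zeta>\<^sup>0\<^sub>l\<close>, whose own start is the end of \<open>\<zeta>\<^sup>h\<^sub>l\<^sub>-\<^sub>1\<close>. Its
  interior arcs start from the left limits of the new piece. For \<open>L = 0\<close> the value at time 0 remains
  the initial state, although the first block begins at \<open>\<zeta>\<^sup>0\<^sub>1(1)\<close>.\<close>

lemma state_solved_Suc:
  assumes S: "state_solved L x \<zeta>" and L: "L < N"
  shows "\<exists>x \<zeta>. state_solved (Suc L) x \<zeta>"
proof -
  define l where "l = int L + 1"
  have l: "l \<in> {1..int N}" using L by (simp add: l_def)
  have start_l: "block_start l = real L * h" by (simp add: block_start_def l_def)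
  obtain B where B: "\<And>t. norm (x t) \<le> B" using S by (auto simp: state_solved_def)
  have xb: "x \<in> borel_measurable borel" and gh: "good_history \<zeta> l" using S by (auto simp: state_solved_def l_def)
  interpret jb: jump_block "block_start l" "block_start l + h" pos neg "slow_field f x" "\<lambda>j. slow_field (g j) x" "jump_map \<zeta> l" "atom_mass l" field_bound
    by (rule jump_block_state[OF l xb B gh])
  define c where "c = arc_from \<zeta> l 0 (\<zeta> h (l - 1) 1) 1"
  obtain X Y V BX where X: "X \<in> borel_measurable borel" "\<And>t. norm (X t) \<le> BX" "\<And>t. norm (Y t) \<le> BX"
    "\<And>x' t. x' \<in> borel_measurable borel \<Longrightarrow> (\<And>s. s \<in> {block_start l<..<block_start l + h} \<Longrightarrow> x' s = X s) \<Longrightarrow> t \<in> {block_start l<..<block_start l + h} \<Longrightarrow>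
        (\<lambda>r. jump_map \<zeta> l r (Y r)) summable_on {block_start l<..t} \<and> x' t = c + state_rhs x l x' (\<lambda>r. jump_map \<zeta> l r (Y r)) t"
    "\<And>t. t \<in> {block_start l<..block_start l + h} \<Longrightarrow> (X \<longlongrightarrow> Y t) (at_left t)"
    "\<And>s t. s \<le> t \<Longrightarrow> norm (X t - X s) \<le> V t - V s"
  proof (rule jb.block_exists[of c], goal_cases)
    case (1 X Y V B)
    show ?case by (rule 1(1)) (fact 1)+
  qed
  define xa where "xa = (if L = 0 then x0 else c)"
  define x' where "x' = glue (block_start l) x xa X"
  define \<zeta>' where "\<zeta>' r i = (if i = l then arc_from \<zeta> l r (if r = 0 then \<zeta> h (l - 1) 1 else Y (r + block_start l)) else \<zeta> r i)" for r i
  have x'_borel: "x' \<in> borel_measurable borel" unfolding x'_def by (rule glue_borel[OF xb X(1)])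
  have ll: "left_lim x' (r + block_start l) = Y (r + block_start l)" if "r \<in> {0<..h}" for r
  proof -
    have "left_lim x' (r + block_start l) = left_lim X (r + block_start l)" using that by (intro left_lim_cong[of "block_start l"]) (auto simp: x'_def)
    also have "\<dots> = Y (r + block_start l)" using that by (intro left_lim_eqI X(5)) auto
    finally show ?thesis .
  qed
  have arc_cong: "is_arc (\<omega> r l) (arc_field \<zeta>' l r) z \<longleftrightarrow> is_arc (\<omega> r l) (arc_field \<zeta> l r) z" for r z
    using l by (intro is_arc_cong) (auto simp: \<zeta>'_def)
  have start: "\<zeta>' r l 0 = (if r = 0 then \<zeta>' h (l - 1) 1 else left_lim x' (r + block_start l))" if "r \<in> {0..h}" for r
    using arc_from(2)[OF l that gh] ll[of r] that by (auto simp: \<zeta>'_def)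
  have arcs: "is_arc (\<omega> r l) (arc_field \<zeta>' l r) (\<zeta>' r l)" if "r \<in> {0..h}" for r
    unfolding arc_cong using arc_from(1)[OF l that gh] by (simp add: \<zeta>'_def)
  have new: "state_block x' \<zeta>' l"
    unfolding state_block_def
  proof (intro conjI ballI)
    fix t assume t: "t \<in> {block_start l<..<block_start l + h}"
    have "(\<lambda>r. jump_map \<zeta> l r (Y r)) summable_on {block_start l<..t} \<and> x' t = c + state_rhs x l x' (\<lambda>r. jump_map \<zeta> l r (Y r)) t"
      using t by (intro X(4) x'_borel) (auto simp: x'_def)
    moreover have "\<zeta>' r l 1 - left_lim x' (r + block_start l) = jump_map \<zeta> l (r + block_start l) (Y (r + block_start l))" if "r \<in> {0<..<h}" for r
      using ll[of r] that by (simp add: \<zeta>'_def jump_map_def)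
    moreover have "\<zeta>' 0 l 1 = c" by (simp add: \<zeta>'_def c_def)
    ultimately show "state_eq x' \<zeta>' l t"
      by (subst state_eq_iff[OF l t, where w=x and u="\<lambda>r. jump_map \<zeta> l r (Y r)"]) (auto simp: x'_def)
  qed (use arcs start in auto)
  have old: "state_block x' \<zeta>' i" if i: "i \<in> {1..int L}" for i
  proof (rule state_block_cong)
    show "i \<in> {1..int N}" using i L by auto
    show "state_block x \<zeta> i" using S i by (auto simp: state_solved_def)
    fix t assume t: "t < block_start i + h"
    have "block_start i + h \<le> block_start l"
    proof -
      have "real_of_int i * h \<le> real L * h" by (rule mult_right_mono) (use i h in auto)
      then show ?thesis unfolding block_start_simps(3) start_l .
    qed
    then show "x' t = x t" using t by (simp add: x'_def)
  next
    fix k r assume "k \<le> i"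
    then show "\<zeta>' r k = \<zeta> r k" using i by (auto simp: \<zeta>'_def l_def)
  qed
  have gh': "good_history \<zeta>' (int (Suc L) + 1)"
  proof -
    have "good_history \<zeta>' l" using gh unfolding good_history_def by (auto simp: \<zeta>'_def)
    then have "good_history \<zeta>' (l + 1)"
    proof (rule good_history_extend[OF _ l arcs])
      show "norm (\<zeta>' r l 0) \<le> max BX (norm (\<zeta> h (l - 1) 1))" if "r \<in> {0..h}" for r
        using arc_from(2)[OF l that gh] X(3) by (auto simp: \<zeta>'_def le_max_iff_disj)
    qed
    then show ?thesis by (simp add: l_def)
  qed
  have pts: "x' (block_start i) = \<zeta>' 0 i 1" if i: "i \<in> {2..int (Suc L)}" for i
  proof (cases "i = l")
    case True
    then show ?thesis using i by (auto simp: x'_def xa_def \<zeta>'_def c_def l_def)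
  next
    case False
    then have i': "i \<in> {2..int L}" using i by (auto simp: l_def)
    have "real_of_int (i - 1) * h < real L * h" using i' h by (intro mult_strict_right_mono) auto
    then have "block_start i < block_start l" by (simp add: start_l) (simp add: block_start_def)
    then show ?thesis using S i' False by (simp add: x'_def \<zeta>'_def state_solved_def)
  qed
  have bv: "bounded_variation_on {0..real (Suc L) * h} x'"
    unfolding x'_def
  proof (rule glue_bounded_variation)
    show "bounded_variation_on {0..block_start l} x" using S by (simp add: state_solved_def start_l)
    show "norm (X t - X s) \<le> V t - V s" if "s \<le> t" for s t by (rule X(6)[OF that])
    show "0 \<le> block_start l" "block_start l \<le> real (Suc L) * h" using h by (auto simp: start_l algebra_simps)
  qed
  have bnd: "norm (x' t) \<le> max (max B BX) (norm xa)" for t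
    using B[of t] X(2)[of t] by (auto simp: x'_def glue_def le_max_iff_disj)
  have start_0: "0 \<le> block_start l" using block_start_bounds[OF l] by simp
  have x'0: "x' 0 = x0"
  proof (cases "L = 0")
    case True
    then show ?thesis by (simp add: x'_def xa_def start_l glue_def)
  next
    case False
    then have "0 < block_start l" using h by (simp add: start_l)
    then show ?thesis using S by (simp add: x'_def state_solved_def)
  qed
  have hist: "x' t = \<xi>0 t" if "t \<in> {- (real M * h)..<0}" for t
    using that start_0 S by (auto simp: x'_def state_solved_def)
  have "state_solved (Suc L) x' \<zeta>'"
    unfolding state_solved_def
  proof (intro conjI ballI allI impI)
    show "\<exists>B. \<forall>t. norm (x' t) \<le> B" using bnd by blast
    show "\<zeta>' r i = history r i" if "i \<le> 0" for i r using that S by (auto simp: \<zeta>'_def state_solved_def l_def)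
    show "state_block x' \<zeta>' i" if "i \<in> {1..int (Suc L)}" for i
      using that new old[of i] by (cases "i = l") (auto simp: l_def)
  qed (use x'_borel hist x'0 gh' pts bv in auto)
  then show ?thesis by blast
qed

lemma state_solved_exists: "L \<le> N \<Longrightarrow> \<exists>x \<zeta>. state_solved L x \<zeta>"
proof (induction L)
  case 0
  show ?case by (rule state_solved_0)
next
  case (Suc L)
  then show ?case using state_solved_Suc[of L] by auto
qed

definition state_solution :: "(real \<Rightarrow> real ^ 'n) \<Rightarrow> (real \<Rightarrow> int \<Rightarrow> real \<Rightarrow> real ^ 'n) \<Rightarrow> bool" where
  "state_solution x \<zeta> \<longleftrightarrow> bounded_variation_on {0..T} x \<and> (\<forall>t\<in>{- (real M * h)..<0}. x t = \<xi>0 t) \<and> x 0 = x0 \<and>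
     (\<forall>r\<in>{0..h}. \<forall>s\<in>{0..1}. \<forall>i. i = 0 \<or> i \<in> {1 - int M..0} \<longrightarrow> \<zeta> r i s = history r i s) \<and>
     (\<forall>l\<in>{1..int N}. state_block x \<zeta> l) \<and> (\<forall>l\<in>{2..int N}. x (block_start l) = \<zeta> 0 l 1)"

text \<open>A solution may be arbitrary outside \<open>[-Mh,T]\<close>; the cut-off is Borel and bounded on the whole line.\<close>

definition cut_off :: "(real \<Rightarrow> real ^ 'n) \<Rightarrow> real \<Rightarrow> real ^ 'n" where
  "cut_off x t = (if t \<in> {- (real M * h)..<0} then \<xi>0 t else if t \<in> {0..T} then x t else 0)"

text \<open>Measurability comes from bounded variation on \<open>[0,T]\<close> and continuity of the history.\<close>

lemma cut_off_props:
  assumes S: "state_solution x \<zeta>"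
  shows "cut_off x \<in> borel_measurable borel" "\<exists>B. \<forall>t. norm (cut_off x t) \<le> B"
    "t \<in> {- (real M * h)..T} \<Longrightarrow> cut_off x t = x t" "t \<in> {0<..T} \<Longrightarrow> left_lim (cut_off x) t = left_lim x t"
proof -
  have T0: "0 \<le> T" using h by simp
  have bv: "bounded_variation_on {0..T} x" using S by (simp add: state_solution_def)
  have "cut_off x = (\<lambda>t. (if t \<in> {- (real M * h)..<0} then \<xi>0 t else 0) + (if t \<in> {0..T} then x t else 0))"
    by (auto simp: cut_off_def fun_eq_iff)
  then show "cut_off x \<in> borel_measurable borel"
    using borel_measurable_add[OF history_borel bounded_variation_on_borel[OF bv T0]] by simp
  obtain B where B: "\<And>t. t \<in> {- (real M * h)..0} \<Longrightarrow> norm (\<xi>0 t) \<le> B" using \<xi>0_bounded by blast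
  obtain B' where B': "\<And>t. t \<in> {0..T} \<Longrightarrow> norm (x t) \<le> B'" using bounded_variation_on_bounded[OF bv] by blast
  have "norm (cut_off x t) \<le> max 0 (max B B')" for t using B[of t] B'[of t] by (auto simp: cut_off_def le_max_iff_disj)
  then show "\<exists>B. \<forall>t. norm (cut_off x t) \<le> B" by blast
  show "cut_off x t = x t" if "t \<in> {- (real M * h)..T}"
  proof -
    have "\<forall>t\<in>{- (real M * h)..<0}. x t = \<xi>0 t" using S by (simp add: state_solution_def)
    then show ?thesis using that by (auto simp: cut_off_def)
  qed
  show "left_lim (cut_off x) t = left_lim x t" if "t \<in> {0<..T}"
    using that by (intro left_lim_cong[of 0]) (auto simp: cut_off_def)
qed

text \<open>Since arcs are determined by their start, the jumps of any solution are values of the jump map at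
  its left limits. The map may be built from the arcs \<open>\<zeta>b\<close> of another solution that agrees on earlier
  blocks, so that two solutions satisfy literally the same block equation.\<close>

lemma state_solution_block_rhs:
  assumes S: "state_solution x \<zeta>" and l: "l \<in> {1..int N}" and gh: "good_history \<zeta>b l"
    and \<zeta>: "\<And>r i s. r \<in> {0..h} \<Longrightarrow> s \<in> {0..1} \<Longrightarrow> i \<in> {1 - int M..<l} \<Longrightarrow> \<zeta> r i s = \<zeta>b r i s"
    and xb: "\<And>t. t \<in> {- (real M * h)..<block_start l} \<Longrightarrow> xb t = x t"
    and t: "t \<in> {block_start l<..<block_start l + h}"
  shows "cut_off x t = \<zeta> 0 l 1 + state_rhs xb l (cut_off x) (\<lambda>r. jump_map \<zeta>b l r (left_lim (cut_off x) r)) t"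
proof -
  let ?u = "\<lambda>r. jump_map \<zeta>b l r (left_lim (cut_off x) r)"
  have b: "state_block x \<zeta> l" using S l by (simp add: state_solution_def)
  have lb: "0 \<le> block_start l" "block_start l + h \<le> T" using block_start_bounds[OF l] by auto
  have u: "\<zeta> r l 1 - left_lim x (r + block_start l) = ?u (r + block_start l)" if r: "r \<in> {0<..<h}" for r
  proof -
    have r': "r \<in> {0..h}" using r by auto
    have ll: "left_lim (cut_off x) (r + block_start l) = left_lim x (r + block_start l)" using r lb by (intro cut_off_props(4)[OF S]) auto
    have "is_arc (\<omega> r l) (arc_field \<zeta> l r) (\<zeta> r l)" using b r' by (simp add: state_block_def)
    then have arc: "is_arc (\<omega> r l) (arc_field \<zeta>b l r) (\<zeta> r l)"
      by (rule is_arc_cong[THEN iffD1, rotated 2]) (use l \<zeta>[OF r'] in auto)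
    have "\<zeta> r l 0 = left_lim x (r + block_start l)" using b r r' by (auto simp: state_block_def)
    then have start: "\<zeta> r l 0 = arc_from \<zeta>b l r (left_lim x (r + block_start l)) 0" unfolding arc_from(2)[OF l r' gh] .
    have "\<zeta> r l 1 = arc_from \<zeta>b l r (left_lim x (r + block_start l)) 1"
      by (rule arc_unique[OF l r' gh arc arc_from(1)[OF l r' gh] start]) simp
    then show ?thesis by (simp add: jump_map_def ll)
  qed
  have "state_eq x \<zeta> l t" using b t by (simp add: state_block_def)
  then have "x t = \<zeta> 0 l 1 + state_rhs xb l x ?u t"
    by (subst (asm) state_eq_iff[OF l t, where w=xb and u="?u"]) (use xb u in auto)
  moreover have "state_rhs xb l x ?u t = state_rhs xb l (cut_off x) ?u t"
    using t lb h by (intro block_rhs_cong cut_off_props(3)[OF S, symmetric]) (auto intro: order_trans[of _ 0])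
  moreover have "cut_off x t = x t" using t lb h by (intro cut_off_props(3)[OF S]) (auto intro: order_trans[of _ 0])
  ultimately show ?thesis by simp
qed

lemma block_start_Suc: "block_start (int L + 1) = real L * h" by (simp add: block_start_def)

text \<open>Induction over the blocks. On the next block both solutions start from the same value; the block
  equation determines them, hence their left limits, and these determine the arcs.\<close>

lemma state_solution_unique:
  assumes S: "state_solution x \<zeta>" and S': "state_solution x' \<zeta>'" and L: "L \<le> N"
  shows "(\<forall>t\<in>{- (real M * h)..<real L * h}. x' t = x t) \<and>
     (\<forall>r\<in>{0..h}. \<forall>s\<in>{0..1}. \<forall>i. i = 0 \<or> i \<in> {1 - int M..int L} \<longrightarrow> \<zeta>' r i s = \<zeta> r i s) \<and> good_history \<zeta> (int L + 1)"
  using L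
proof (induction L)
  case 0
  have "good_history \<zeta> 1" using S by (intro good_history_base) (auto simp: state_solution_def)
  then show ?case using S S' by (auto simp: state_solution_def)
next
  case (Suc L)
  define l where "l = int L + 1"
  have l: "l \<in> {1..int N}" using Suc by (simp add: l_def)
  have start_l: "block_start l = real L * h" by (simp add: l_def block_start_Suc)
  have lb: "0 \<le> block_start l" "block_start l + h \<le> T" using block_start_bounds[OF l] by auto
  have IH: "\<And>t. t \<in> {- (real M * h)..<block_start l} \<Longrightarrow> x' t = x t"
    "\<And>r s i. r \<in> {0..h} \<Longrightarrow> s \<in> {0..1} \<Longrightarrow> i = 0 \<or> i \<in> {1 - int M..<l} \<Longrightarrow> \<zeta>' r i s = \<zeta> r i s"
    "good_history \<zeta> l"
    using Suc.IH Suc.prems unfolding l_def block_start_Suc by auto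
  have b: "state_block x \<zeta> l" "state_block x' \<zeta>' l" using S S' l by (auto simp: state_solution_def)
  have arc': "is_arc (\<omega> r l) (arc_field \<zeta> l r) (\<zeta>' r l)" if r: "r \<in> {0..h}" for r
  proof -
    have "is_arc (\<omega> r l) (arc_field \<zeta>' l r) (\<zeta>' r l)" using b(2) r by (simp add: state_block_def)
    then show ?thesis by (rule is_arc_cong[THEN iffD1, rotated 2]) (use l IH(2)[OF r] in auto)
  qed
  have arc: "is_arc (\<omega> r l) (arc_field \<zeta> l r) (\<zeta> r l)" if r: "r \<in> {0..h}" for r
    using b(1) r by (simp add: state_block_def)
  have h0: "0 \<in> {0..h}" "h \<in> {0..h}" using h by auto
  have "\<zeta>' h (l - 1) 1 = \<zeta> h (l - 1) 1" using h0 by (intro IH(2)) (auto simp: l_def)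
  then have start0: "\<zeta>' 0 l 0 = \<zeta> 0 l 0" using b h0 by (simp add: state_block_def)
  have c: "\<zeta>' 0 l 1 = \<zeta> 0 l 1" by (rule arc_unique[OF l h0(1) IH(3) arc'[OF h0(1)] arc[OF h0(1)] start0]) simp
  obtain B where B: "\<And>t. norm (cut_off x t) \<le> B" using cut_off_props(2)[OF S] by blast
  interpret jb: jump_block "block_start l" "block_start l + h" pos neg "slow_field f (cut_off x)" "\<lambda>j. slow_field (g j) (cut_off x)" "jump_map \<zeta> l" "atom_mass l" field_bound
    by (rule jump_block_state[OF l cut_off_props(1)[OF S] B IH(3)])
  have cx: "cut_off x t = x t" if "t \<in> {- (real M * h)..<block_start l}" for t
    using that lb h by (intro cut_off_props(3)[OF S]) auto
  have e: "cut_off x t = \<zeta> 0 l 1 + state_rhs (cut_off x) l (cut_off x) (\<lambda>r. jump_map \<zeta> l r (left_lim (cut_off x) r)) t"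
    if "t \<in> {block_start l<..<block_start l + h}" for t
    by (rule state_solution_block_rhs[OF S l IH(3)]) (use that cx in auto)
  have e': "cut_off x' t = \<zeta> 0 l 1 + state_rhs (cut_off x) l (cut_off x') (\<lambda>r. jump_map \<zeta> l r (left_lim (cut_off x') r)) t"
    if "t \<in> {block_start l<..<block_start l + h}" for t
    unfolding c[symmetric] by (rule state_solution_block_rhs[OF S' l IH(3)]) (use that cx IH in auto)
  have U1: "cut_off x' t = cut_off x t" if "t \<in> {block_start l<..<block_start l + h}" for t
    by (rule jb.block_unique(1)[OF cut_off_props(1)[OF S] e cut_off_props(1)[OF S'] e']) (use that in auto)
  have U2: "left_lim (cut_off x') t = left_lim (cut_off x) t" if "t \<in> {block_start l<..block_start l + h}" for t
    by (rule jb.block_unique(2)[OF cut_off_props(1)[OF S] e cut_off_props(1)[OF S'] e']) (use that in auto)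
  have ll: "left_lim x' (r + block_start l) = left_lim x (r + block_start l)" if "r \<in> {0<..h}" for r
  proof -
    have "left_lim (cut_off x') (r + block_start l) = left_lim (cut_off x) (r + block_start l)" using that by (intro U2) auto
    then show ?thesis using cut_off_props(4)[OF S, of "r + block_start l"] cut_off_props(4)[OF S', of "r + block_start l"] that lb by auto
  qed
  have \<zeta>: "\<zeta>' r l s = \<zeta> r l s" if r: "r \<in> {0..h}" and s: "s \<in> {0..1}" for r s
  proof (rule arc_unique[OF l r IH(3) arc'[OF r] arc[OF r] _ s])
    show "\<zeta>' r l 0 = \<zeta> r l 0"
    proof (cases "r = 0")
      case True
      then show ?thesis using start0 by simp
    next
      case False
      then show ?thesis using b r ll[of r] by (auto simp: state_block_def)
    qed
  qed
  have open_eq: "x' t = x t" if t: "t \<in> {block_start l<..<block_start l + h}" for t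
  proof -
    have "t \<in> {- (real M * h)..T}" using t lb h by (auto intro: order_trans[of _ 0])
    then show ?thesis using U1[OF t] cut_off_props(3)[OF S] cut_off_props(3)[OF S'] by simp
  qed
  have point_eq: "x' (block_start l) = x (block_start l)"
  proof (cases "L = 0")
    case True
    then show ?thesis using S S' by (simp add: start_l state_solution_def)
  next
    case False
    then have "l \<in> {2..int N}" using l by (auto simp: l_def)
    then show ?thesis using S S' c by (simp add: state_solution_def)
  qed
  have gh: "good_history \<zeta> (l + 1)"
  proof -
    obtain Y u where Y: "\<And>t. t \<in> {block_start l<..block_start l + h} \<Longrightarrow> (cut_off x \<longlongrightarrow> Y t) (at_left t)"
      "\<And>t. norm (Y t) \<le> norm (\<zeta> 0 l 1) + field_bound * jb.mass {block_start l..block_start l + h}"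
      using jb.block_solution_left_version[OF cut_off_props(1)[OF S] e] by metis
    show ?thesis
    proof (rule good_history_extend[OF IH(3) l arc])
      fix r assume r: "r \<in> {0..h}"
      show "norm (\<zeta> r l 0) \<le> max (norm (\<zeta> 0 l 0)) (norm (\<zeta> 0 l 1) + field_bound * jb.mass {block_start l..block_start l + h})"
      proof (cases "r = 0")
        case False
        then have "r + block_start l \<in> {block_start l<..block_start l + h}" "r + block_start l \<in> {0<..T}" using r lb by auto
        then have "left_lim x (r + block_start l) = Y (r + block_start l)" using left_lim_eqI[OF Y(1)] cut_off_props(4)[OF S] by metis
        then show ?thesis using b(1) r False Y(2)[of "r + block_start l"] by (auto simp: state_block_def le_max_iff_disj)
      qed simp
    qed
  qed
  have "x' t = x t" if "t \<in> {- (real M * h)..<real (Suc L) * h}" for t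
  proof -
    have "t < block_start l + h" using that by (simp add: start_l algebra_simps)
    then consider "t < block_start l" | "t = block_start l" | "t \<in> {block_start l<..<block_start l + h}" unfolding greaterThanLessThan_iff by linarith
    then show ?thesis using IH(1)[of t] point_eq open_eq[of t] that by cases auto
  qed
  moreover have "\<zeta>' r i s = \<zeta> r i s" if "r \<in> {0..h}" "s \<in> {0..1}" "i = 0 \<or> i \<in> {1 - int M..int (Suc L)}" for r s i
    using IH(2)[OF that(1,2), of i] \<zeta>[OF that(1,2)] that(3) by (cases "i = l") (auto simp: l_def)
  moreover have "good_history \<zeta> (int (Suc L) + 1)" using gh by (simp add: l_def)
  ultimately show ?case by blast
qed

end

section \<open>The variation component\<close>

lemma integral_lebesgue_on_point: "(LINT s|lebesgue_on {p::real}. (\<phi> s :: 'b::euclidean_space)) = 0"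
proof -
  have "(LINT s|lebesgue_on {p}. \<phi> s) = (LINT s|lebesgue. indicator {p} s *\<^sub>R \<phi> s)"
    by (subst integral_restrict_space) auto
  also have "\<dots> = 0"
  proof (rule integral_eq_zero_AE)
    show "AE s in lebesgue. indicator {p} s *\<^sub>R \<phi> s = 0"
      by (rule AE_I'[of "{p}"]) (auto simp: indicator_def)
  qed
  finally show ?thesis .
qed

context impulse_setting
begin

definition nu_cont :: "real measure" where "nu_cont = pos_cont_part \<nu>"

text \<open>The atoms of \<open>\<nu>\<close> form a countable Borel set, so the density defining the atomless part is measurable.\<close>

lemma nu_cont_props: "finite_measure nu_cont" "sets nu_cont = sets (borel_on T)" "emeasure nu_cont {t} = 0"
proof -
  interpret finite_measure \<nu> by (rule \<nu>_pos(2))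
  define N where "N = {t. measure \<nu> {t} \<noteq> 0}"
  have N: "countable N" unfolding N_def by (rule countable_support)
  have spc: "space \<nu> = {0..T}" using sets_eq_imp_space_eq[OF \<nu>_pos(1)] by (simp add: space_restrict_space)
  have sing: "{t} \<in> sets \<nu>" if "t \<in> {0..T}" for t using that unfolding \<nu>_pos(1) by (auto simp: sets_restrict_space_iff)
  have "N \<subseteq> {0..T}"
  proof
    fix t assume "t \<in> N"
    then have "{t} \<in> sets \<nu>" unfolding N_def using measure_notin_sets by blast
    then show "t \<in> {0..T}" using sets.sets_into_space spc by blast
  qed
  then have "(\<Union>t\<in>N. {t}) \<in> sets \<nu>" using N sing by (intro sets.countable_UN') auto
  then have Ns: "space \<nu> - N \<in> sets \<nu>" by auto
  have "{t. emeasure \<nu> {t} = 0} \<inter> space \<nu> = space \<nu> - N" by (auto simp: N_def emeasure_eq_measure)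
  then have m[measurable]: "(indicator {t. emeasure \<nu> {t} = 0} :: real \<Rightarrow> ennreal) \<in> borel_measurable \<nu>"
    using Ns by (subst borel_measurable_indicator_iff) simp
  show "sets nu_cont = sets (borel_on T)" unfolding nu_cont_def pos_cont_part_def using \<nu>_pos(1) by simp
  have em: "emeasure nu_cont B = (\<integral>\<^sup>+x. indicator {t. emeasure \<nu> {t} = 0} x * indicator B x \<partial>\<nu>)" if "B \<in> sets \<nu>" for B
    unfolding nu_cont_def pos_cont_part_def by (rule emeasure_density[OF m that])
  show "finite_measure nu_cont"
  proof (rule finite_measureI)
    have "space nu_cont = space \<nu>" by (simp add: nu_cont_def pos_cont_part_def)
    then have "emeasure nu_cont (space nu_cont) = (\<integral>\<^sup>+x. indicator {t. emeasure \<nu> {t} = 0} x * indicator (space \<nu>) x \<partial>\<nu>)" by (simp add: em)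
    also have "\<dots> \<le> (\<integral>\<^sup>+x. indicator (space \<nu>) x \<partial>\<nu>)" by (intro nn_integral_mono) (auto simp: indicator_def)
    also have "\<dots> = emeasure \<nu> (space \<nu>)" by simp
    finally show "emeasure nu_cont (space nu_cont) \<noteq> \<infinity>" using emeasure_finite[of "space \<nu>"] by (auto simp: top_unique)
  qed
  show "emeasure nu_cont {t} = 0"
  proof (cases "t \<in> {0..T}")
    case True
    have "emeasure nu_cont {t} = (\<integral>\<^sup>+x. indicator {t. emeasure \<nu> {t} = 0} t * indicator {t} x \<partial>\<nu>)"
      unfolding em[OF sing[OF True]] by (intro nn_integral_cong) (auto simp: indicator_def)
    also have "\<dots> = indicator {t. emeasure \<nu> {t} = 0} t * emeasure \<nu> {t}"
      by (rule nn_integral_cmult_indicator[OF sing[OF True]])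
    also have "\<dots> = 0" by (simp add: indicator_def)
    finally show ?thesis .
  next
    case False
    then have "{t} \<notin> sets nu_cont" using spc sets.sets_into_space[of "{t}" \<nu>] by (auto simp: nu_cont_def pos_cont_part_def)
    then show ?thesis by (rule emeasure_notin_sets)
  qed
qed

definition variation_eq :: "(real \<Rightarrow> real) \<Rightarrow> (real \<Rightarrow> int \<Rightarrow> real \<Rightarrow> real) \<Rightarrow> int \<Rightarrow> real \<Rightarrow> bool" where
  "variation_eq v \<theta> l t \<longleftrightarrow>
     (\<lambda>r. \<theta> r l 1 - left_lim v (r + block_start l)) summable_on {0<..t - block_start l} \<and>
     v t = \<theta> 0 l 1 + measure nu_cont {block_start l..t} + (\<Sum>\<^sub>\<infinity>r\<in>{0<..t - block_start l}. \<theta> r l 1 - left_lim v (r + block_start l))"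

text \<open>The two clauses of the definition that concern one arc \<open>\<theta>\<^sup>r\<^sub>l\<close>.\<close>

definition variation_arc :: "(real \<Rightarrow> real) \<Rightarrow> (real \<Rightarrow> int \<Rightarrow> real \<Rightarrow> real) \<Rightarrow> int \<Rightarrow> real \<Rightarrow> bool" where
  "variation_arc v \<theta> l r \<longleftrightarrow> (\<forall>s\<in>{0..1}. \<theta> r l s = \<theta> r l 0 + (LINT s'|lebesgue_on {0..s}. norm1 (\<omega> r l s'))) \<and>
     \<theta> r l 0 = (if r = 0 then \<theta> h (l - 1) 1 else left_lim v (r + block_start l))"

definition variation_block :: "(real \<Rightarrow> real) \<Rightarrow> (real \<Rightarrow> int \<Rightarrow> real \<Rightarrow> real) \<Rightarrow> int \<Rightarrow> bool" where
  "variation_block v \<theta> l \<longleftrightarrow> (\<forall>r\<in>{0..h}. variation_arc v \<theta> l r) \<and> (\<forall>t\<in>{block_start l<..<block_start l + h}. variation_eq v \<theta> l t)"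

lemma variation_arc_jump: "variation_arc v \<theta> l r \<Longrightarrow> \<theta> r l 1 = \<theta> r l 0 + jump_mass l r"
  unfolding variation_arc_def jump_mass_def by (elim conjE bspec) simp

lemma variation_arc_start: "variation_arc v \<theta> l r \<Longrightarrow> \<theta> r l 0 = (if r = 0 then \<theta> h (l - 1) 1 else left_lim v (r + block_start l))"
  unfolding variation_arc_def by (rule conjunct2)

abbreviation variation_rhs :: "int \<Rightarrow> (real \<Rightarrow> real) \<Rightarrow> (real \<Rightarrow> real) \<Rightarrow> real \<Rightarrow> real" where
  "variation_rhs l \<equiv> block_rhs (block_start l) (\<lambda>_::unit. nu_cont) (\<lambda>_. null_measure (borel_on T)) (\<lambda>_ _. 0) (\<lambda>_ _ _. 1)"

lemma variation_eq_iff: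
  assumes l: "l \<in> {1..int N}" and t: "t \<in> {block_start l<..<block_start l + h}" and arc: "\<And>r. r \<in> {0<..<h} \<Longrightarrow> variation_arc v \<theta> l r"
  shows "variation_eq v \<theta> l t \<longleftrightarrow> v t = \<theta> 0 l 1 + variation_rhs l v (atom_mass l) t"
proof -
  have u: "\<theta> r l 1 - left_lim v (r + block_start l) = atom_mass l (r + block_start l)" if "r \<in> {0<..t - block_start l}" for r
  proof -
    have "r \<in> {0<..<h}" using that t by auto
    then show ?thesis using variation_arc_jump[OF arc, of r] variation_arc_start[OF arc, of r] by (simp add: atom_mass_def)
  qed
  have s1: "(\<lambda>r. \<theta> r l 1 - left_lim v (r + block_start l)) summable_on {0<..t - block_start l} \<longleftrightarrow> atom_mass l summable_on {block_start l<..t}"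
    by (rule infsum_shift(1)) (rule u)
  have s2: "(\<Sum>\<^sub>\<infinity>r\<in>{0<..t - block_start l}. \<theta> r l 1 - left_lim v (r + block_start l)) = (\<Sum>\<^sub>\<infinity>r\<in>{block_start l<..t}. atom_mass l r)"
    by (rule infsum_shift(2)) (rule u)
  have "atom_mass l summable_on {block_start l<..t}"
    by (rule summable_on_subset_banach[OF atom_mass_props(2)[OF l]]) (use t in auto)
  moreover have "(LINT s:{block_start l..t}|nu_cont. 1) = measure nu_cont {block_start l..t}"
  proof -
    have "{block_start l..t} \<in> sets nu_cont" unfolding nu_cont_props(2) using t block_start_bounds[OF l] by (auto simp: sets_restrict_space_iff)
    then have "{block_start l..t} \<inter> space nu_cont = {block_start l..t}" using sets.sets_into_space by blast
    then show ?thesis by (simp add: set_lebesgue_integral_def)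
  qed
  moreover have "(LINT s:{block_start l..t}|null_measure (borel_on T). 1) = (0::real)"
    by (simp add: set_lebesgue_integral_def)
  ultimately show ?thesis unfolding variation_eq_def s1 s2 block_rhs_def by (simp add: set_lebesgue_integral_def add.assoc)
qed

text \<open>The equation for \<open>v\<close> is a block equation with a single unit field driven by \<open>\<nu>\<^sup>c\<close> and with jumps
  that do not depend on the state.\<close>

lemma jump_block_variation:
  assumes l: "l \<in> {1..int N}"
  shows "jump_block (block_start l) (block_start l + h) (\<lambda>_::unit. nu_cont) (\<lambda>_. null_measure (borel_on T)) (\<lambda>_ _. 0) (\<lambda>_ _ _. 1 :: real) (\<lambda>t _. atom_mass l t) (atom_mass l) 1"
proof (rule jump_block.intro)
  show "block_start l < block_start l + h" using h by simp
  show "finite_measure nu_cont" by (rule nu_cont_props)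
  show "finite_measure (null_measure (borel_on T))" by (rule finite_measureI) simp
  have sub: "B \<in> sets (borel_on T)" if "B \<in> sets borel" "B \<subseteq> {block_start l..block_start l + h}" for B
  proof -
    have "B \<subseteq> {0..T}" using that block_start_bounds[OF l] by force
    then show ?thesis using that(1) by (simp add: sets_restrict_space_iff)
  qed
  show "B \<in> sets nu_cont" if "B \<in> sets borel" "B \<subseteq> {block_start l..block_start l + h}" for B unfolding nu_cont_props(2) by (rule sub[OF that])
  show "B \<in> sets (null_measure (borel_on T))" if "B \<in> sets borel" "B \<subseteq> {block_start l..block_start l + h}" for B using sub[OF that] by simp
  show "emeasure nu_cont {t} = 0" for t by (rule nu_cont_props)
  show "\<exists>L\<ge>0. \<forall>s\<in>{block_start l..block_start l + h}. \<forall>y z::real. norm y \<le> R \<longrightarrow> norm z \<le> R \<longrightarrow> norm (0 - (0::real)) \<le> L * norm (y - z)" for R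
    by (intro exI[of _ 0]) simp
  show "\<exists>L\<ge>0. \<forall>j::unit. \<forall>s\<in>{block_start l..block_start l + h}. \<forall>y z::real. norm y \<le> R \<longrightarrow> norm z \<le> R \<longrightarrow> norm (1 - (1::real)) \<le> L * norm (y - z)" for R
    by (intro exI[of _ 0]) simp
  show "\<exists>L\<ge>0. \<forall>s\<in>{block_start l<..<block_start l + h}. \<forall>y z::real. norm y \<le> R \<longrightarrow> norm z \<le> R \<longrightarrow> norm (atom_mass l s - atom_mass l s) \<le> L * atom_mass l s * norm (y - z)" for R
    by (intro exI[of _ 0]) simp
  show "0 \<le> atom_mass l s" for s by (rule atom_mass_props(1))
  show "atom_mass l summable_on {block_start l<..<block_start l + h}" by (rule atom_mass_props(2)[OF l])
  show "norm (atom_mass l s) \<le> 1 * atom_mass l s" for s using atom_mass_props(1)[of l s] by simp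
qed simp_all

definition variation_solved :: "nat \<Rightarrow> (real \<Rightarrow> real) \<Rightarrow> (real \<Rightarrow> int \<Rightarrow> real \<Rightarrow> real) \<Rightarrow> bool" where
  "variation_solved L v \<theta> \<longleftrightarrow> v \<in> borel_measurable borel \<and> v 0 = 0 \<and> (\<forall>r s. \<theta> r 0 s = 0) \<and>
     (\<forall>l\<in>{1..int L}. variation_block v \<theta> l) \<and> (\<forall>l\<in>{2..int L}. v (block_start l) = \<theta> 0 l 1) \<and>
     bounded_variation_on {0..real L * h} v"

lemma variation_block_cong:
  assumes l: "l \<in> {1..int N}" and b: "variation_block v \<theta> l"
    and v: "\<And>t. t < block_start l + h \<Longrightarrow> v' t = v t" and \<theta>: "\<And>i r. i \<in> {l - 1, l} \<Longrightarrow> \<theta>' r i = \<theta> r i"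
  shows "variation_block v' \<theta>' l"
proof -
  have ll: "left_lim v' (r + block_start l) = left_lim v (r + block_start l)" if "r \<le> h" for r
    using v that by (intro left_lim_cong[of "r + block_start l - 1"]) auto
  have arc: "variation_arc v' \<theta>' l r" if "r \<in> {0..h}" for r
  proof -
    have va: "variation_arc v \<theta> l r" using b that by (simp add: variation_block_def)
    have e: "\<theta>' r l = \<theta> r l" "\<theta>' h (l - 1) = \<theta> h (l - 1)" "left_lim v' (r + block_start l) = left_lim v (r + block_start l)"
      using that by (auto intro: \<theta> ll)
    show ?thesis using va unfolding variation_arc_def e .
  qed
  have "variation_eq v' \<theta>' l t" if t: "t \<in> {block_start l<..<block_start l + h}" for t
  proof -
    have "variation_eq v \<theta> l t" using b t by (simp add: variation_block_def)
    then have "v t = \<theta> 0 l 1 + variation_rhs l v (atom_mass l) t"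
      by (subst (asm) variation_eq_iff[OF l t]) (use b in \<open>auto simp: variation_block_def\<close>)
    moreover have "variation_rhs l v (atom_mass l) t = variation_rhs l v' (atom_mass l) t" using v t by (intro block_rhs_cong) auto
    ultimately show ?thesis using t v \<theta> by (subst variation_eq_iff[OF l t]) (auto intro: arc)
  qed
  then show ?thesis using arc by (simp add: variation_block_def)
qed

lemma variation_solved_Suc:
  assumes S: "variation_solved L v \<theta>" and L: "L < N"
  shows "\<exists>v \<theta>. variation_solved (Suc L) v \<theta>"
proof -
  define l where "l = int L + 1"
  have l: "l \<in> {1..int N}" using L by (simp add: l_def)
  have start_l: "block_start l = real L * h" by (simp add: l_def block_start_Suc)
  interpret jb: jump_block "block_start l" "block_start l + h" "\<lambda>_::unit. nu_cont" "\<lambda>_. null_measure (borel_on T)" "\<lambda>_ _. 0" "\<lambda>_ _ _. 1 :: real" "\<lambda>t _. atom_mass l t" "atom_mass l" 1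
    by (rule jump_block_variation[OF l])
  define c where "c = \<theta> h (l - 1) 1 + jump_mass l 0"
  obtain X Y V BX where X: "X \<in> borel_measurable borel" "\<And>t. norm (X t) \<le> BX" "\<And>t. norm (Y t) \<le> BX"
    "\<And>x' t. x' \<in> borel_measurable borel \<Longrightarrow> (\<And>s. s \<in> {block_start l<..<block_start l + h} \<Longrightarrow> x' s = X s) \<Longrightarrow> t \<in> {block_start l<..<block_start l + h} \<Longrightarrow>
        (\<lambda>r. atom_mass l r) summable_on {block_start l<..t} \<and> x' t = c + variation_rhs l x' (\<lambda>r. atom_mass l r) t"
    "\<And>t. t \<in> {block_start l<..block_start l + h} \<Longrightarrow> (X \<longlongrightarrow> Y t) (at_left t)"
    "\<And>s t. s \<le> t \<Longrightarrow> norm (X t - X s) \<le> V t - V s"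
  proof (rule jb.block_exists[of c], goal_cases)
    case (1 X Y V B)
    show ?case by (rule 1(1)) (fact 1)+
  qed
  define va where "va = (if L = 0 then 0 else c)"
  define v' where "v' = glue (block_start l) v va X"
  define \<theta>' where "\<theta>' r i = (if i = l then (\<lambda>s. (if r = 0 then \<theta> h (l - 1) 1 else Y (r + block_start l)) + (LINT s'|lebesgue_on {0..s}. norm1 (\<omega> r l s'))) else \<theta> r i)" for r i
  have v'_borel: "v' \<in> borel_measurable borel" unfolding v'_def using S X(1) by (intro glue_borel) (auto simp: variation_solved_def)
  have ll: "left_lim v' (r + block_start l) = Y (r + block_start l)" if "r \<in> {0<..h}" for r
  proof -
    have "left_lim v' (r + block_start l) = left_lim X (r + block_start l)" using that by (intro left_lim_cong[of "block_start l"]) (auto simp: v'_def)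
    also have "\<dots> = Y (r + block_start l)" using that by (intro left_lim_eqI X(5)) auto
    finally show ?thesis .
  qed
  have start: "\<theta>' r l 0 = (if r = 0 then \<theta> h (l - 1) 1 else Y (r + block_start l))" for r
    by (simp add: \<theta>'_def integral_lebesgue_on_point)
  have arcs: "variation_arc v' \<theta>' l r" if "r \<in> {0..h}" for r
    unfolding variation_arc_def start using that ll[of r] by (auto simp: \<theta>'_def)
  have new: "variation_block v' \<theta>' l"
    unfolding variation_block_def
  proof (intro conjI ballI arcs)
    fix t assume t: "t \<in> {block_start l<..<block_start l + h}"
    have "v' t = c + variation_rhs l v' (atom_mass l) t"
      using X(4)[OF v'_borel _ t] by (simp add: v'_def)
    moreover have "\<theta>' 0 l 1 = c" by (simp add: \<theta>'_def c_def jump_mass_def)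
    ultimately show "variation_eq v' \<theta>' l t" by (subst variation_eq_iff[OF l t]) (auto intro: arcs)
  qed
  have old: "variation_block v' \<theta>' i" if i: "i \<in> {1..int L}" for i
  proof (rule variation_block_cong)
    show "i \<in> {1..int N}" using i L by auto
    show "variation_block v \<theta> i" using S i by (auto simp: variation_solved_def)
    fix t assume t: "t < block_start i + h"
    have "block_start i + h \<le> block_start l"
    proof -
      have "real_of_int i * h \<le> real L * h" by (rule mult_right_mono) (use i h in auto)
      then show ?thesis unfolding block_start_simps(3) start_l .
    qed
    then show "v' t = v t" using t by (simp add: v'_def)
  next
    fix k r assume "k \<in> {i - 1, i}"
    then show "\<theta>' r k = \<theta> r k" using i by (auto simp: \<theta>'_def l_def)
  qed
  have pts: "v' (block_start i) = \<theta>' 0 i 1" if i: "i \<in> {2..int (Suc L)}" for i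
  proof (cases "i = l")
    case True
    then show ?thesis using i by (auto simp: v'_def va_def \<theta>'_def c_def l_def jump_mass_def)
  next
    case False
    then have i': "i \<in> {2..int L}" using i by (auto simp: l_def)
    have "real_of_int (i - 1) * h < real L * h" using i' h by (intro mult_strict_right_mono) auto
    then have "block_start i < block_start l" by (simp add: start_l) (simp add: block_start_def)
    then show ?thesis using S i' False by (simp add: v'_def \<theta>'_def variation_solved_def)
  qed
  have bv: "bounded_variation_on {0..real (Suc L) * h} v'"
    unfolding v'_def
  proof (rule glue_bounded_variation)
    show "bounded_variation_on {0..block_start l} v" using S by (simp add: variation_solved_def start_l)
    show "norm (X t - X s) \<le> V t - V s" if "s \<le> t" for s t by (rule X(6)[OF that])
    show "0 \<le> block_start l" "block_start l \<le> real (Suc L) * h" using h by (auto simp: start_l algebra_simps)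
  qed
  have v'0: "v' 0 = 0"
  proof (cases "L = 0")
    case True
    then show ?thesis by (simp add: v'_def va_def start_l glue_def)
  next
    case False
    then have "0 < block_start l" using h by (simp add: start_l)
    then show ?thesis using S by (simp add: v'_def variation_solved_def)
  qed
  have "variation_solved (Suc L) v' \<theta>'"
    unfolding variation_solved_def
  proof (intro conjI ballI allI)
    show "\<theta>' r 0 s = 0" for r s using S by (auto simp: \<theta>'_def variation_solved_def l_def)
    show "variation_block v' \<theta>' i" if "i \<in> {1..int (Suc L)}" for i
      using that new old[of i] by (cases "i = l") (auto simp: l_def)
  qed (use v'_borel v'0 pts bv in auto)
  then show ?thesis by blast
qed

lemma variation_solved_exists: "L \<le> N \<Longrightarrow> \<exists>v \<theta>. variation_solved L v \<theta>"
proof (induction L)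
  case 0
  have "variation_solved 0 (\<lambda>_. 0) (\<lambda>_ _ _. 0)" using bounded_variation_on_singleton[of 0 "\<lambda>_. 0 :: real"] by (simp add: variation_solved_def)
  then show ?case by blast
next
  case (Suc L)
  then show ?case using variation_solved_Suc[of L] by auto
qed

definition variation_solution :: "(real \<Rightarrow> real) \<Rightarrow> (real \<Rightarrow> int \<Rightarrow> real \<Rightarrow> real) \<Rightarrow> bool" where
  "variation_solution v \<theta> \<longleftrightarrow> bounded_variation_on {0..T} v \<and> v 0 = 0 \<and> (\<forall>r\<in>{0..h}. \<forall>s\<in>{0..1}. \<theta> r 0 s = 0) \<and>
     (\<forall>l\<in>{1..int N}. variation_block v \<theta> l) \<and> (\<forall>l\<in>{2..int N}. v (block_start l) = \<theta> 0 l 1)"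

text \<open>The only information handed from one block to the next is the end value of \<open>\<theta>\<^sup>h\<^sub>l\<close>.\<close>

lemma variation_solution_unique:
  assumes S: "variation_solution v \<theta>" and S': "variation_solution v' \<theta>'" and L: "L \<le> N"
  shows "(\<forall>t\<in>{0..<real L * h}. v' t = v t) \<and> \<theta>' h (int L) 1 = \<theta> h (int L) 1"
  using L
proof (induction L)
  case 0
  then show ?case using S S' h by (simp add: variation_solution_def)
next
  case (Suc L)
  define l where "l = int L + 1"
  have l: "l \<in> {1..int N}" using Suc by (simp add: l_def)
  have start_l: "block_start l = real L * h" by (simp add: l_def block_start_Suc)
  have lb: "0 \<le> block_start l" "block_start l + h \<le> T" using block_start_bounds[OF l] by auto
  have IH: "\<And>t. t \<in> {0..<block_start l} \<Longrightarrow> v' t = v t" "\<theta>' h (l - 1) 1 = \<theta> h (l - 1) 1"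
    using Suc.IH Suc.prems unfolding l_def block_start_Suc by auto
  have b: "variation_block v \<theta> l" "variation_block v' \<theta>' l" using S S' l by (auto simp: variation_solution_def)
  have arc: "variation_arc v \<theta> l r" "variation_arc v' \<theta>' l r" if "r \<in> {0..h}" for r using b that by (auto simp: variation_block_def)
  have h0: "0 \<in> {0..h}" "h \<in> {0..h}" using h by auto
  have c: "\<theta>' 0 l 1 = \<theta> 0 l 1"
    using variation_arc_jump[OF arc(1)[OF h0(1)]] variation_arc_jump[OF arc(2)[OF h0(1)]] variation_arc_start[OF arc(1)[OF h0(1)]] variation_arc_start[OF arc(2)[OF h0(1)]] IH(2) by simp
  define w where "w v t = (if t \<in> {0..T} then v t else 0)" for v :: "real \<Rightarrow> real" and t
  have T0: "0 \<le> T" using h by simp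
  have wb: "w v \<in> borel_measurable borel" "w v' \<in> borel_measurable borel"
    unfolding w_def[abs_def] by (rule bounded_variation_on_borel[OF _ T0], use S S' in \<open>simp add: variation_solution_def\<close>)+
  have wl: "left_lim (w v) t = left_lim v t" if "t \<in> {0<..T}" for v t
    using that by (intro left_lim_cong[of 0]) (auto simp: w_def)
  have we: "w v t = v t" if "t \<in> {block_start l..<block_start l + h}" for v t using that lb by (auto simp: w_def)
  interpret jb: jump_block "block_start l" "block_start l + h" "\<lambda>_::unit. nu_cont" "\<lambda>_. null_measure (borel_on T)" "\<lambda>_ _. 0" "\<lambda>_ _ _. 1 :: real" "\<lambda>t _. atom_mass l t" "atom_mass l" 1
    by (rule jump_block_variation[OF l])
  have e: "w u t = \<theta> 0 l 1 + variation_rhs l (w u) (\<lambda>r. atom_mass l r) t"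
    if t: "t \<in> {block_start l<..<block_start l + h}" and u: "(u = v \<and> \<phi> = \<theta>) \<or> (u = v' \<and> \<phi> = \<theta>')" for t u \<phi>
  proof -
    have "variation_block u \<phi> l" using u b by auto
    then have "variation_eq u \<phi> l t" "\<And>r. r \<in> {0<..<h} \<Longrightarrow> variation_arc u \<phi> l r" using t by (auto simp: variation_block_def)
    then have "u t = \<phi> 0 l 1 + variation_rhs l u (atom_mass l) t" using variation_eq_iff[OF l t] by blast
    moreover have "variation_rhs l u (atom_mass l) t = variation_rhs l (w u) (atom_mass l) t" using t by (intro block_rhs_cong we[symmetric]) auto
    moreover have "\<phi> 0 l 1 = \<theta> 0 l 1" using u c by auto
    ultimately show ?thesis using we[of t u] t by simp
  qed
  have e1: "w v t = \<theta> 0 l 1 + variation_rhs l (w v) (\<lambda>r. atom_mass l r) t" if "t \<in> {block_start l<..<block_start l + h}" for t using e[OF that] by blast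
  have e2: "w v' t = \<theta> 0 l 1 + variation_rhs l (w v') (\<lambda>r. atom_mass l r) t" if "t \<in> {block_start l<..<block_start l + h}" for t using e[OF that] by blast
  have U1: "w v' t = w v t" if "t \<in> {block_start l<..<block_start l + h}" for t
    by (rule jb.block_unique(1)[OF wb(1) e1 wb(2) e2]) (use that in auto)
  have U2: "left_lim (w v') t = left_lim (w v) t" if "t \<in> {block_start l<..block_start l + h}" for t
    by (rule jb.block_unique(2)[OF wb(1) e1 wb(2) e2]) (use that in auto)
  have open_eq: "v' t = v t" if "t \<in> {block_start l<..<block_start l + h}" for t using U1[OF that] we[of t v] we[of t v'] that by simp
  have "left_lim v' (h + block_start l) = left_lim v (h + block_start l)"
    using U2[of "h + block_start l"] wl[of "h + block_start l" v] wl[of "h + block_start l" v'] lb h by simp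
  then have "\<theta>' h l 1 = \<theta> h l 1"
    using variation_arc_jump[OF arc(1)[OF h0(2)]] variation_arc_jump[OF arc(2)[OF h0(2)]] variation_arc_start[OF arc(1)[OF h0(2)]] variation_arc_start[OF arc(2)[OF h0(2)]] h by simp
  moreover have point_eq: "v' (block_start l) = v (block_start l)"
  proof (cases "L = 0")
    case True
    then show ?thesis using S S' by (simp add: start_l variation_solution_def)
  next
    case False
    then have "l \<in> {2..int N}" using l by (auto simp: l_def)
    then show ?thesis using S S' c by (simp add: variation_solution_def)
  qed
  moreover have "v' t = v t" if "t \<in> {0..<real (Suc L) * h}" for t
  proof -
    have "t < block_start l + h" using that by (simp add: start_l algebra_simps)
    then consider "t < block_start l" | "t = block_start l" | "t \<in> {block_start l<..<block_start l + h}" unfolding greaterThanLessThan_iff by linarith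
    then show ?thesis using IH(1)[of t] point_eq open_eq[of t] that by cases auto
  qed
  ultimately show ?case by (simp add: l_def add.commute)
qed

section \<open>Existence and uniqueness of the impulse solution\<close>

text \<open>The prescribed arcs of the definition are indexed by natural numbers \<open>a\<close> for the block \<open>-a\<close>.\<close>

lemma history_iff:
  "(\<zeta> r 0 s = (if r = h \<and> s = 1 then x0 else \<xi>0 (r - h)) \<and>
    (\<forall>a::nat. 1 \<le> a \<and> a < M \<longrightarrow> \<zeta> r (- int a) s = \<xi>0 (r - (real a + 1) * h))) \<longleftrightarrow>
   (\<forall>i. i = 0 \<or> i \<in> {1 - int M..0} \<longrightarrow> \<zeta> r i s = history r i s)" (is "?A \<longleftrightarrow> ?B")
proof
  assume A: ?A
  show ?B
  proof (intro allI impI)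
    fix i assume i: "i = 0 \<or> i \<in> {1 - int M..0}"
    show "\<zeta> r i s = history r i s"
    proof (cases "i = 0")
      case False
      have "1 \<le> nat (- i) \<and> nat (- i) < M" using i False by auto
      then have "\<zeta> r (- int (nat (- i))) s = \<xi>0 (r - (real (nat (- i)) + 1) * h)" using A by blast
      moreover have "int (nat (- i)) = - i" "real (nat (- i)) = - of_int i" using i by auto
      ultimately show ?thesis using False by (simp add: history_def)
    qed (use A in \<open>simp add: history_def\<close>)
  qed
next
  assume B: ?B
  have "\<zeta> r (- int a) s = \<xi>0 (r - (real a + 1) * h)" if "1 \<le> a \<and> a < M" for a :: nat
  proof -
    have "- int a \<in> {1 - int M..0}" using that by auto
    then show ?thesis using B that by (simp add: history_def add.commute)
  qed
  moreover have "\<zeta> r 0 s = history r 0 s" using B by blast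
  ultimately show ?A by (simp add: history_def)
qed

lemma attached_arcs_iff:
  "attached_arcs N M h \<kappa> g \<xi>0 x0 \<omega> x v \<zeta> \<theta> \<longleftrightarrow>
     (\<forall>r\<in>{0..h}. \<forall>s\<in>{0..1}. \<theta> r 0 s = 0 \<and> (\<forall>i. i = 0 \<or> i \<in> {1 - int M..0} \<longrightarrow> \<zeta> r i s = history r i s)) \<and>
     (\<forall>l\<in>{1..int N}. \<forall>r\<in>{0..h}. (is_arc (\<omega> r l) (arc_field \<zeta> l r) (\<zeta> r l) \<and>
        \<zeta> r l 0 = (if r = 0 then \<zeta> h (l - 1) 1 else left_lim x (r + block_start l))) \<and> variation_arc v \<theta> l r)"
  unfolding attached_arcs_def is_arc_block variation_arc_def block_start_def history_iff by (simp add: conj_assoc)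

lemma impulse_solution_unfold:
  "impulse_solution N M h \<kappa> f g \<xi>0 x0 \<mu> \<nu> \<omega> x v \<longleftrightarrow>
     bounded_variation_on {0..T} x \<and>
     (bounded_variation_on {- (real M * h)..0} \<xi>0 \<longrightarrow> bounded_variation_on {- (real M * h)..T} x) \<and>
     bounded_variation_on {0..T} v \<and> (\<forall>t\<in>{- (real M * h)..<0}. x t = \<xi>0 t) \<and> x 0 = x0 \<and> v 0 = 0 \<and>
     (\<exists>\<zeta> \<theta>. attached_arcs N M h \<kappa> g \<xi>0 x0 \<omega> x v \<zeta> \<theta> \<and>
        (\<forall>l\<in>{2..int N}. x (block_start l) = \<zeta> 0 l 1 \<and> v (block_start l) = \<theta> 0 l 1) \<and>
        x T = \<zeta> h (int N) 1 \<and> v T = \<theta> h (int N) 1 \<and>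
        (\<forall>l\<in>{1..int N}. \<forall>t\<in>{block_start l<..<block_start l + h}. state_eq x \<zeta> l t \<and> variation_eq v \<theta> l t))"
  unfolding impulse_solution_def state_eq_def variation_eq_def nu_cont_def block_start_def[symmetric] conj_assoc
  unfolding block_start_simps(3) by (rule refl)

lemma impulse_solution_iff:
  "impulse_solution N M h \<kappa> f g \<xi>0 x0 \<mu> \<nu> \<omega> x v \<longleftrightarrow>
     (bounded_variation_on {- (real M * h)..0} \<xi>0 \<longrightarrow> bounded_variation_on {- (real M * h)..T} x) \<and>
     (\<exists>\<zeta> \<theta>. state_solution x \<zeta> \<and> variation_solution v \<theta> \<and> x T = \<zeta> h (int N) 1 \<and> v T = \<theta> h (int N) 1)"
proof
  assume L: "impulse_solution N M h \<kappa> f g \<xi>0 x0 \<mu> \<nu> \<omega> x v"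
  then obtain \<zeta> \<theta> where A: "attached_arcs N M h \<kappa> g \<xi>0 x0 \<omega> x v \<zeta> \<theta>"
    and P: "\<forall>l\<in>{2..int N}. x (block_start l) = \<zeta> 0 l 1 \<and> v (block_start l) = \<theta> 0 l 1"
    and E: "x T = \<zeta> h (int N) 1" "v T = \<theta> h (int N) 1"
    and Q: "\<forall>l\<in>{1..int N}. \<forall>t\<in>{block_start l<..<block_start l + h}. state_eq x \<zeta> l t \<and> variation_eq v \<theta> l t"
    unfolding impulse_solution_unfold by (elim conjE exE) (rule that)
  have bv: "bounded_variation_on {0..T} x" "bounded_variation_on {0..T} v" "\<forall>t\<in>{- (real M * h)..<0}. x t = \<xi>0 t" "x 0 = x0" "v 0 = 0"
    using L[unfolded impulse_solution_unfold] by blast+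
  note A1 = A[unfolded attached_arcs_iff, THEN conjunct1] and A2 = A[unfolded attached_arcs_iff, THEN conjunct2]
  have "state_block x \<zeta> l" if "l \<in> {1..int N}" for l
    unfolding state_block_def using bspec[OF A2 that] bspec[OF Q that] by blast
  moreover have "variation_block v \<theta> l" if "l \<in> {1..int N}" for l
    unfolding variation_block_def using bspec[OF A2 that] bspec[OF Q that] by blast
  ultimately have "state_solution x \<zeta>" "variation_solution v \<theta>"
    unfolding state_solution_def variation_solution_def using bv A1 P by blast+
  then show "(bounded_variation_on {- (real M * h)..0} \<xi>0 \<longrightarrow> bounded_variation_on {- (real M * h)..T} x) \<and>
     (\<exists>\<zeta> \<theta>. state_solution x \<zeta> \<and> variation_solution v \<theta> \<and> x T = \<zeta> h (int N) 1 \<and> v T = \<theta> h (int N) 1)"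
    using L[unfolded impulse_solution_unfold] E by blast
next
  assume R: "(bounded_variation_on {- (real M * h)..0} \<xi>0 \<longrightarrow> bounded_variation_on {- (real M * h)..T} x) \<and>
     (\<exists>\<zeta> \<theta>. state_solution x \<zeta> \<and> variation_solution v \<theta> \<and> x T = \<zeta> h (int N) 1 \<and> v T = \<theta> h (int N) 1)"
  then obtain \<zeta> \<theta> where S: "state_solution x \<zeta>" "variation_solution v \<theta>" and E: "x T = \<zeta> h (int N) 1" "v T = \<theta> h (int N) 1"
    by blast
  have arcs: "attached_arcs N M h \<kappa> g \<xi>0 x0 \<omega> x v \<zeta> \<theta>"
    unfolding attached_arcs_iff using S unfolding state_solution_def variation_solution_def state_block_def variation_block_def by blast
  have points: "\<forall>l\<in>{2..int N}. x (block_start l) = \<zeta> 0 l 1 \<and> v (block_start l) = \<theta> 0 l 1"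
    using S unfolding state_solution_def variation_solution_def by blast
  have eqs: "\<forall>l\<in>{1..int N}. \<forall>t\<in>{block_start l<..<block_start l + h}. state_eq x \<zeta> l t \<and> variation_eq v \<theta> l t"
    using S unfolding state_solution_def variation_solution_def state_block_def variation_block_def by blast
  have bv: "bounded_variation_on {0..T} x" "bounded_variation_on {0..T} v" "\<forall>t\<in>{- (real M * h)..<0}. x t = \<xi>0 t" "x 0 = x0" "v 0 = 0"
    using S unfolding state_solution_def variation_solution_def by blast+
  show "impulse_solution N M h \<kappa> f g \<xi>0 x0 \<mu> \<nu> \<omega> x v"
    unfolding impulse_solution_unfold
    by (intro conjI exI[of _ \<zeta>] exI[of _ \<theta>] bv conjunct1[OF R] arcs points E eqs)
qed

text \<open>The final values at \<open>T\<close> come from the arcs with \<open>r = h\<close> of the last block. They influence no earlier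
  value, so they are written in at the end.\<close>

theorem existence_uniqueness:
  "\<exists>x v. impulse_solution N M h \<kappa> f g \<xi>0 x0 \<mu> \<nu> \<omega> x v \<and>
     (\<forall>x' v'. impulse_solution N M h \<kappa> f g \<xi>0 x0 \<mu> \<nu> \<omega> x' v' \<longrightarrow>
        (\<forall>t\<in>{- (real M * h)..T}. x' t = x t) \<and> (\<forall>t\<in>{0..T}. v' t = v t))"
proof -
  obtain x1 \<zeta> where x1: "state_solved N x1 \<zeta>" using state_solved_exists by blast
  obtain v1 \<theta> where v1: "variation_solved N v1 \<theta>" using variation_solved_exists by blast
  have T0: "0 < T" using N1 h by simp
  \<comment> \<open>Changing one value keeps the variation bounded; the other conditions concern times before \<open>T\<close>.\<close>
  define x where "x = x1(T := \<zeta> h (int N) 1)"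
  define v where "v = v1(T := \<theta> h (int N) 1)"
  have before: "t < T" if "l \<in> {1..int N}" "t < block_start l + h" for l t using block_start_bounds[OF that(1)] that by simp
  have start_T: "block_start l < T" if "l \<in> {1..int N}" for l using block_start_bounds[OF that] h by simp
  have xb: "state_block x \<zeta> l" if l: "l \<in> {1..int N}" for l
  proof (rule state_block_cong[OF l])
    show "state_block x1 \<zeta> l" using x1 l by (simp add: state_solved_def)
    show "x t = x1 t" if "t < block_start l + h" for t using before[OF l that] by (simp add: x_def)
  qed simp
  have vb: "variation_block v \<theta> l" if l: "l \<in> {1..int N}" for l
  proof (rule variation_block_cong[OF l])
    show "variation_block v1 \<theta> l" using v1 l by (simp add: variation_solved_def)
    show "v t = v1 t" if "t < block_start l + h" for t using before[OF l that] by (simp add: v_def)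
  qed simp
  have xbv: "bounded_variation_on {0..T} x"
  proof (rule bounded_variation_on_modify_point[where c=T])
    show "bounded_variation_on {0..T} x1" using x1 by (simp add: state_solved_def)
  qed (simp add: x_def)
  have vbv: "bounded_variation_on {0..T} v"
  proof (rule bounded_variation_on_modify_point[where c=T])
    show "bounded_variation_on {0..T} v1" using v1 by (simp add: variation_solved_def)
  qed (simp add: v_def)
  have xh: "x t = \<xi>0 t" if "t \<in> {- (real M * h)..<0}" for t using x1 that T0 by (simp add: x_def state_solved_def)
  have xs: "state_solution x \<zeta>"
    unfolding state_solution_def
  proof (intro conjI ballI allI impI)
    show "x 0 = x0" using x1 N1 h by (simp add: x_def state_solved_def)
    show "\<zeta> r i s = history r i s" if "i = 0 \<or> i \<in> {1 - int M..0}" for r i s using x1 that by (auto simp: state_solved_def)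
    show "x (block_start l) = \<zeta> 0 l 1" if "l \<in> {2..int N}" for l using x1 that start_T[of l] by (auto simp: x_def state_solved_def)
  qed (use xbv xh xb in auto)
  have vs: "variation_solution v \<theta>"
    unfolding variation_solution_def
  proof (intro conjI ballI)
    show "v 0 = 0" using v1 N1 h by (simp add: v_def variation_solved_def)
    show "v (block_start l) = \<theta> 0 l 1" if "l \<in> {2..int N}" for l using v1 that start_T[of l] by (auto simp: v_def variation_solved_def)
    show "\<theta> r 0 s = 0" for r s using v1 by (simp add: variation_solved_def)
  qed (use vbv vb in auto)
  have "bounded_variation_on {- (real M * h)..T} x" if "bounded_variation_on {- (real M * h)..0} \<xi>0"
  proof (rule bounded_variation_on_concat[OF _ xbv])
    show "bounded_variation_on {- (real M * h)..0} x"
      by (rule bounded_variation_on_modify_point[OF that, of 0]) (simp add: xh)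
  qed (use h T0 in auto)
  then have solves: "impulse_solution N M h \<kappa> f g \<xi>0 x0 \<mu> \<nu> \<omega> x v"
    unfolding impulse_solution_iff using xs vs by (auto simp: x_def v_def)
  have "(\<forall>t\<in>{- (real M * h)..T}. x' t = x t) \<and> (\<forall>t\<in>{0..T}. v' t = v t)"
    if s': "impulse_solution N M h \<kappa> f g \<xi>0 x0 \<mu> \<nu> \<omega> x' v'" for x' v'
  proof -
    obtain \<zeta>' \<theta>' where xs': "state_solution x' \<zeta>'" and vs': "variation_solution v' \<theta>'" and xT: "x' T = \<zeta>' h (int N) 1" and vT: "v' T = \<theta>' h (int N) 1"
      using s' unfolding impulse_solution_iff by blast
    have UX: "\<And>t. t \<in> {- (real M * h)..<T} \<Longrightarrow> x' t = x t" "\<zeta>' h (int N) 1 = \<zeta> h (int N) 1"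
      using state_solution_unique[OF xs xs' order_refl] h N1 by auto
    have UV: "\<And>t. t \<in> {0..<T} \<Longrightarrow> v' t = v t" "\<theta>' h (int N) 1 = \<theta> h (int N) 1"
      using variation_solution_unique[OF vs vs' order_refl] by auto
    have "x' t = x t" if "t \<in> {- (real M * h)..T}" for t
      using that UX(1)[of t] UX(2) xT by (cases "t = T") (auto simp: x_def)
    moreover have "v' t = v t" if "t \<in> {0..T}" for t
      using that UV(1)[of t] UV(2) vT by (cases "t = T") (auto simp: v_def)
    ultimately show ?thesis by blast
  qed
  then show ?thesis using solves by blast
qed

end

theorem proposition2p4:
  fixes N M :: nat and h :: real
    and K :: "(real ^ 'm) set"
    and \<kappa> :: "'k::finite \<Rightarrow> nat"
    and f :: "real \<times> ((real ^ 'n) ^ 'k) \<Rightarrow> real ^ 'n"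
    and g :: "'m \<Rightarrow> real \<times> ((real ^ 'n) ^ 'k) \<Rightarrow> real ^ 'n"
    and \<xi>0 :: "real \<Rightarrow> real ^ 'n" and x0 :: "real ^ 'n"
    and \<mu> :: "real set \<Rightarrow> real ^ 'm" and \<nu> :: "real measure"
    and \<omega> :: "real \<Rightarrow> int \<Rightarrow> real \<Rightarrow> real ^ 'm"
  assumes "N \<ge> 1" and "N \<ge> M" and "h > 0"
    and "closed K" and "cone K"
    and "bij_betw \<kappa> UNIV {0..M}"
    and "C1_map f" and "bounded (range f)"
    and "\<And>j. C1_map (g j)" and "\<And>j. bounded (range (g j))"
    and "continuous_on {- (real M * h)..0} \<xi>0"
    and "impulse_control N h K \<mu> \<nu> \<omega>"
  shows "\<exists>x v. impulse_solution N M h \<kappa> f g \<xi>0 x0 \<mu> \<nu> \<omega> x v \<and>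
           (\<forall>x' v'. impulse_solution N M h \<kappa> f g \<xi>0 x0 \<mu> \<nu> \<omega> x' v' \<longrightarrow>
              (\<forall>t\<in>{- (real M * h)..real N * h}. x' t = x t) \<and>
              (\<forall>t\<in>{0..real N * h}. v' t = v t))"
proof -
  interpret impulse_setting N M h K \<kappa> f g \<xi>0 x0 \<mu> \<nu> \<omega>
    by (rule impulse_setting.intro) (fact assms)+
  show ?thesis by (rule existence_uniqueness)
qed

end
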